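(* Strong solutions $w$ on $[0,T]$ of the Corrected Smagorinsky Model $$w_t-\frac{C_s^4\delta^2}{\mu^{2}}\Delta w_t+w\cdot\nabla w-\nu\Delta w+\nabla q-\nabla\cdot\big((C_s\delta)^2|\nabla w|\nabla w\big)=f(x),\qquad \nabla\cdot w=0\ \text{ in }\Omega,\qquad w=0\ \text{ on }\partial\Omega,$$ satisfying $\nabla w\in L^3(0,T;L^3(\Omega))$ are unique: if $w_1,w_2$ are two strong solutions on $[0,T]$ with the same body force $f$ and the same initial value, and $\nabla w_1,\nabla w_2\in L^3(0,T;L^3(\Omega))$, then $w_1=w_2$.
   Context: $\Omega\subset\mathbb{R}^d$ ($d=2$ or $3$) is a regular bounded flow domain. $\nu>0$ is the kinematic viscosity, $C_s,\delta,\mu>0$ are constants, and $f=f(x)$ is a prescribed body force for which the pairings $(f,v)$ make sense. $\|\cdot\|$ and $(\cdot,\cdot)$ are the $L^2(\Omega)$ norm and inner product. $|\nabla w|$ is the Euclidean (Frobenius) norm of the velocity gradient. Spaces: $X=\{v\in L^3(\Omega):\nabla v\in L^3(\Omega),\ v=0\text{ on }\partial\Omega\}$ (vector fields), $Q=\{q\in L^2(\Omega):\int_\Omega q\,dx=0\}$. Weak form of the model: $(w,p)\in(X,Q)$ satisfies $$(w_t,v)+\tfrac{C_s^4}{\mu^2}\delta^2(\nabla w_t,\nabla v)+(w\cdot\nabla w,v)+\nu(\nabla w,\nabla v)-(p,\nabla\cdot v)+\big((C_s\delta)^2|\nabla w|\nabla w,\nabla v\big)=(f,v)\quad\forall v\in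 X,$$ $$(q,\nabla\cdot w)=0\quad\forall q\in Q .$$ Strong solution: $w$ is a strong solution with initial value $w_0\in H^1(\Omega)$, $w_0=0$ on $\partial\Omega$, on $[0,T]$ if (1) $w\in L^\infty(0,T;H^1(\Omega))\cap L^2(0,T;W^{1,3}(\Omega))\cap L^2(0,T;L^6(\Omega))$; (2) $w(\cdot,t)\to w_0$ in $L^2(\Omega)$ as $t\to0$; (3) $w$ satisfies the weak form above for all $v\in L^\infty(0,T;H^1(\Omega))\cap L^2(0,T;W^{1,3}(\Omega))\cap L^2(0,T;L^6(\Omega))$ (vanishing on $\partial\Omega$). *)

theory Defs
  imports "HOL-Analysis.Analysis"
begin

section \<open>Test functions and weak derivatives\<close>

definition dir_deriv :: "'a \<Rightarrow> ('a::euclidean_space \<Rightarrow> 'b::real_normed_vector) \<Rightarrow> 'a \<Rightarrow> 'b" where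
  "dir_deriv b f = (\<lambda>x. frechet_derivative f (at x) b)"

text \<open>If every iterated directional derivative is differentiable, then every partial derivative
  of every order is continuous, so this is $C^\infty$ on the whole space.\<close>

definition smooth :: "('a::euclidean_space \<Rightarrow> 'b::real_normed_vector) \<Rightarrow> bool" where
  "smooth f \<longleftrightarrow> (\<forall>bs. (fold dir_deriv bs f) differentiable_on UNIV)"

definition test_function :: "'a::euclidean_space set \<Rightarrow> ('a \<Rightarrow> 'b::real_normed_vector) \<Rightarrow> bool" where
  "test_function U \<psi> \<longleftrightarrow> smooth \<psi> \<and> compact (closure {x. \<psi> x \<noteq> 0}) \<and> closure {x. \<psi> x \<noteq> 0} \<subseteq> U"

definition locally_integrable :: "'a::euclidean_space set \<Rightarrow> ('a \<Rightarrow> 'b::euclidean_space) \<Rightarrow> bool" where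
  "locally_integrable U u \<longleftrightarrow> (\<forall>K. compact K \<and> K \<subseteq> U \<longrightarrow> set_integrable lborel K u)"

definition has_weak_deriv ::
  "'a::euclidean_space set \<Rightarrow> 'a \<Rightarrow> ('a \<Rightarrow> 'b::euclidean_space) \<Rightarrow> ('a \<Rightarrow> 'b) \<Rightarrow> bool" where
  "has_weak_deriv U b u g \<longleftrightarrow>
     locally_integrable U u \<and> locally_integrable U g \<and>
     (\<forall>\<psi>::'a \<Rightarrow> real. test_function U \<psi> \<longrightarrow>
        (LINT x:U|lborel. dir_deriv b \<psi> x *\<^sub>R u x) = - (LINT x:U|lborel. \<psi> x *\<^sub>R g x))"

text \<open>Gradients are matrix fields with entries $G_{ij} = \partial_j u_i$, as for
  \<open>matrix (frechet_derivative u (at x))\<close>.  With the library norm and inner product on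
  \<open>real ^ 'd ^ 'd\<close>, \<open>norm (G x)\<close> is the Frobenius norm and \<open>G x \<bullet> H x\<close> the Frobenius product.
  Weak gradients are unique only up to null sets, hence a relation.\<close>

definition has_weak_gradient ::
  "(real ^ 'd) set \<Rightarrow> (real ^ 'd \<Rightarrow> real ^ 'd) \<Rightarrow> (real ^ 'd \<Rightarrow> real ^ 'd ^ 'd) \<Rightarrow> bool" where
  "has_weak_gradient \<Omega> u G \<longleftrightarrow> (\<forall>j. has_weak_deriv \<Omega> (axis j 1) u (\<lambda>x. column j (G x)))"


section \<open>Lebesgue, Sobolev and Bochner spaces\<close>

definition in_Lp :: "real \<Rightarrow> 'a::euclidean_space set \<Rightarrow> ('a \<Rightarrow> 'b::euclidean_space) \<Rightarrow> bool" where
  "in_Lp p A f \<longleftrightarrow>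
     set_borel_measurable lborel A f \<and> set_integrable lborel A (\<lambda>x. norm (f x) powr p)"

text \<open>The norm is meaningful only under \<^const>\<open>in_Lp\<close>, which accompanies all its uses below.\<close>

definition Lp_norm :: "real \<Rightarrow> 'a::euclidean_space set \<Rightarrow> ('a \<Rightarrow> 'b::euclidean_space) \<Rightarrow> real" where
  "Lp_norm p A f = (LINT x:A|lborel. norm (f x) powr p) powr (1 / p)"

definition L2_inner ::
  "'a::euclidean_space set \<Rightarrow> ('a \<Rightarrow> 'b::euclidean_space) \<Rightarrow> ('a \<Rightarrow> 'b) \<Rightarrow> real" where
  "L2_inner A f g = (LINT x:A|lborel. f x \<bullet> g x)"

text \<open>\<open>W0 p \<Omega> u G\<close>: $u$ lies in $W^{1,p}(\Omega)$, has weak gradient $G$, and vanishes on the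
  boundary, i.e. is a $W^{1,p}$-limit of vector fields in $C_c^\infty(\Omega)$.\<close>

definition W0 ::
  "real \<Rightarrow> (real ^ 'd) set \<Rightarrow> (real ^ 'd \<Rightarrow> real ^ 'd) \<Rightarrow> (real ^ 'd \<Rightarrow> real ^ 'd ^ 'd) \<Rightarrow> bool" where
  "W0 p \<Omega> u G \<longleftrightarrow>
     in_Lp p \<Omega> u \<and> in_Lp p \<Omega> G \<and> has_weak_gradient \<Omega> u G \<and>
     (\<exists>\<Phi>::nat \<Rightarrow> real ^ 'd \<Rightarrow> real ^ 'd.
        (\<forall>n. test_function \<Omega> (\<Phi> n)) \<and>
        (\<lambda>n. Lp_norm p \<Omega> (\<lambda>x. \<Phi> n x - u x)) \<longlonglongrightarrow> 0 \<and>
        (\<lambda>n. Lp_norm p \<Omega> (\<lambda>x. matrix (frechet_derivative (\<Phi> n) (at x)) - G x)) \<longlonglongrightarrow> 0)"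

text \<open>The space $X$ of velocities (with $G = \nabla v$) and the space $Q$ of pressures.\<close>

abbreviation velocity_space ::
  "(real ^ 'd) set \<Rightarrow> (real ^ 'd \<Rightarrow> real ^ 'd) \<Rightarrow> (real ^ 'd \<Rightarrow> real ^ 'd ^ 'd) \<Rightarrow> bool" where
  "velocity_space \<equiv> W0 3"

definition pressure_space :: "(real ^ 'd) set \<Rightarrow> (real ^ 'd \<Rightarrow> real) set" where
  "pressure_space \<Omega> = {q. in_Lp 2 \<Omega> q \<and> (LINT x:\<Omega>|lborel. q x) = 0}"

text \<open>The Bochner spaces $L^r(I;L^q(\Omega))$ and $L^\infty(I;L^q(\Omega))$ for finite $q$.  As
  $L^q(\Omega)$ is separable, the strongly measurable functions into it are exactly those
  represented by jointly measurable functions of $(t,x)$.\<close>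

definition bochner_measurable ::
  "real set \<Rightarrow> 'a::euclidean_space set \<Rightarrow> real \<Rightarrow> (real \<Rightarrow> 'a \<Rightarrow> 'b::euclidean_space) \<Rightarrow> bool" where
  "bochner_measurable I \<Omega> q u \<longleftrightarrow>
     set_borel_measurable lborel (I \<times> \<Omega>) (\<lambda>(t, x). u t x) \<and>
     (AE t\<in>I in lborel. in_Lp q \<Omega> (u t))"

definition in_Lr_Lq ::
  "real \<Rightarrow> real \<Rightarrow> real set \<Rightarrow> 'a::euclidean_space set \<Rightarrow> (real \<Rightarrow> 'a \<Rightarrow> 'b::euclidean_space) \<Rightarrow> bool" where
  "in_Lr_Lq r q I \<Omega> u \<longleftrightarrow>
     bochner_measurable I \<Omega> q u \<and> in_Lp r I (\<lambda>t. Lp_norm q \<Omega> (u t))"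

definition in_Linf_Lq ::
  "real \<Rightarrow> real set \<Rightarrow> 'a::euclidean_space set \<Rightarrow> (real \<Rightarrow> 'a \<Rightarrow> 'b::euclidean_space) \<Rightarrow> bool" where
  "in_Linf_Lq q I \<Omega> u \<longleftrightarrow>
     bochner_measurable I \<Omega> q u \<and> (\<exists>C. AE t\<in>I in lborel. Lp_norm q \<Omega> (u t) \<le> C)"

definition has_spatial_gradient ::
  "real set \<Rightarrow> (real ^ 'd) set \<Rightarrow> (real \<Rightarrow> real ^ 'd \<Rightarrow> real ^ 'd)
     \<Rightarrow> (real \<Rightarrow> real ^ 'd \<Rightarrow> real ^ 'd ^ 'd) \<Rightarrow> bool" where
  "has_spatial_gradient I \<Omega> u G \<longleftrightarrow> (AE t\<in>I in lborel. has_weak_gradient \<Omega> (u t) (G t))"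

text \<open>$u \in L^\infty(0,T;H^1) \cap L^2(0,T;W^{1,3}) \cap L^2(0,T;L^6)$, vanishing on the boundary,
  with spatial gradient $G$.\<close>

definition velocity_class ::
  "real \<Rightarrow> (real ^ 'd) set \<Rightarrow> (real \<Rightarrow> real ^ 'd \<Rightarrow> real ^ 'd)
     \<Rightarrow> (real \<Rightarrow> real ^ 'd \<Rightarrow> real ^ 'd ^ 'd) \<Rightarrow> bool" where
  "velocity_class T \<Omega> u G \<longleftrightarrow>
     has_spatial_gradient {0<..<T} \<Omega> u G \<and>
     in_Linf_Lq 2 {0<..<T} \<Omega> u \<and> in_Linf_Lq 2 {0<..<T} \<Omega> G \<and>
     in_Lr_Lq 2 3 {0<..<T} \<Omega> u \<and> in_Lr_Lq 2 3 {0<..<T} \<Omega> G \<and>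
     in_Lr_Lq 2 6 {0<..<T} \<Omega> u \<and>
     (AE t\<in>{0<..<T} in lborel. velocity_space \<Omega> (u t) (G t))"

text \<open>The pairings of $w_t$ and $\nabla w_t$ with test functions are $L^2$ inner products, so
  $w_t$ is a function, with values in $H^1(\Omega)$: the distributional derivative of $w$ on
  $(0,T) \times \Omega$, in $L^1_{loc}(0,T;H^1(\Omega))$.\<close>

definition has_time_deriv ::
  "real \<Rightarrow> (real ^ 'd) set \<Rightarrow> (real \<Rightarrow> real ^ 'd \<Rightarrow> real ^ 'd) \<Rightarrow> (real \<Rightarrow> real ^ 'd \<Rightarrow> real ^ 'd)
     \<Rightarrow> (real \<Rightarrow> real ^ 'd \<Rightarrow> real ^ 'd ^ 'd) \<Rightarrow> bool" where
  "has_time_deriv T \<Omega> w wt Gt \<longleftrightarrow>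
     has_weak_deriv ({0<..<T} \<times> \<Omega>) (1, 0) (\<lambda>(t, x). w t x) (\<lambda>(t, x). wt t x) \<and>
     has_spatial_gradient {0<..<T} \<Omega> wt Gt \<and>
     (\<forall>a b. 0 < a \<and> a < b \<and> b < T \<longrightarrow> in_Lr_Lq 1 2 {a..b} \<Omega> wt \<and> in_Lr_Lq 1 2 {a..b} \<Omega> Gt)"


section \<open>The flow domain and the model\<close>

text \<open>Near each boundary point, \<open>\<Omega>\<close> is the part of space above a Lipschitz graph over the
  hyperplane orthogonal to \<open>n\<close>.\<close>

definition lipschitz_boundary :: "'a::euclidean_space set \<Rightarrow> bool" where
  "lipschitz_boundary \<Omega> \<longleftrightarrow>
     (\<forall>x\<in>frontier \<Omega>. \<exists>r>0. \<exists>n L. \<exists>\<gamma>::'a \<Rightarrow> real.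
        norm n = 1 \<and> L-lipschitz_on {z. z \<bullet> n = 0} \<gamma> \<and>
        \<Omega> \<inter> ball x r =
          {y \<in> ball x r. \<gamma> (y - x - ((y - x) \<bullet> n) *\<^sub>R n) < (y - x) \<bullet> n})"

definition flow_domain :: "'a::euclidean_space set \<Rightarrow> bool" where
  "flow_domain \<Omega> \<longleftrightarrow>
     open \<Omega> \<and> connected \<Omega> \<and> bounded \<Omega> \<and> \<Omega> \<noteq> {} \<and> lipschitz_boundary \<Omega>"

definition body_force :: "(real ^ 'd) set \<Rightarrow> (real ^ 'd \<Rightarrow> real ^ 'd) \<Rightarrow> bool" where
  "body_force \<Omega> f \<longleftrightarrow>
     (\<forall>v H. velocity_space \<Omega> v H \<longrightarrow> set_integrable lborel \<Omega> (\<lambda>x. f x \<bullet> v x))"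

text \<open>The momentum equation at a fixed time; \<open>G\<close>, \<open>wt\<close>, \<open>Gt\<close>, \<open>H\<close> stand for
  $\nabla w$, $w_t$, $\nabla w_t$, $\nabla v$.\<close>

definition weak_momentum ::
  "real \<Rightarrow> real \<Rightarrow> real \<Rightarrow> real \<Rightarrow> (real ^ 'd) set \<Rightarrow> (real ^ 'd \<Rightarrow> real ^ 'd)
     \<Rightarrow> (real ^ 'd \<Rightarrow> real ^ 'd) \<Rightarrow> (real ^ 'd \<Rightarrow> real ^ 'd ^ 'd)
     \<Rightarrow> (real ^ 'd \<Rightarrow> real ^ 'd) \<Rightarrow> (real ^ 'd \<Rightarrow> real ^ 'd ^ 'd)
     \<Rightarrow> (real ^ 'd \<Rightarrow> real)
     \<Rightarrow> (real ^ 'd \<Rightarrow> real ^ 'd) \<Rightarrow> (real ^ 'd \<Rightarrow> real ^ 'd ^ 'd) \<Rightarrow> bool" where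
  "weak_momentum \<nu> Cs \<delta> \<mu> \<Omega> f w G wt Gt p v H \<longleftrightarrow>
     L2_inner \<Omega> wt v
     + Cs ^ 4 / \<mu>\<^sup>2 * \<delta>\<^sup>2 * L2_inner \<Omega> Gt H
     + L2_inner \<Omega> (\<lambda>x. G x *v w x) v
     + \<nu> * L2_inner \<Omega> G H
     - L2_inner \<Omega> p (\<lambda>x. trace (H x))
     + L2_inner \<Omega> (\<lambda>x. ((Cs * \<delta>)\<^sup>2 * norm (G x)) *\<^sub>R G x) H
     = L2_inner \<Omega> f v"

definition weak_incompressible ::
  "(real ^ 'd) set \<Rightarrow> (real ^ 'd \<Rightarrow> real ^ 'd ^ 'd) \<Rightarrow> bool" where
  "weak_incompressible \<Omega> G \<longleftrightarrow>
     (\<forall>q\<in>pressure_space \<Omega>. L2_inner \<Omega> q (\<lambda>x. trace (G x)) = 0)"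

text \<open>A solution is determined only up to null sets of times, so its initial value is attained
  as an essential limit; for a representative continuous at \<open>0\<close> this is the ordinary limit.
  Test functions depend on time, hence the exceptional null set may depend on \<open>v\<close>.\<close>

definition strong_solution ::
  "real \<Rightarrow> real \<Rightarrow> real \<Rightarrow> real \<Rightarrow> (real ^ 'd) set \<Rightarrow> real \<Rightarrow> (real ^ 'd \<Rightarrow> real ^ 'd)
     \<Rightarrow> (real ^ 'd \<Rightarrow> real ^ 'd) \<Rightarrow> (real \<Rightarrow> real ^ 'd \<Rightarrow> real ^ 'd) \<Rightarrow> bool" where
  "strong_solution \<nu> Cs \<delta> \<mu> \<Omega> T f w0 w \<longleftrightarrow>
     (\<exists>G0. W0 2 \<Omega> w0 G0) \<and>
     (\<forall>\<epsilon>>0. \<exists>\<eta>>0. AE t\<in>{0<..<\<eta>} in lborel. Lp_norm 2 \<Omega> (\<lambda>x. w t x - w0 x) < \<epsilon>) \<and>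
     (\<exists>G wt Gt. \<exists>p::real \<Rightarrow> real ^ 'd \<Rightarrow> real.
        velocity_class T \<Omega> w G \<and>
        has_time_deriv T \<Omega> w wt Gt \<and>
        (AE t\<in>{0<..<T} in lborel. p t \<in> pressure_space \<Omega>) \<and>
        (AE t\<in>{0<..<T} in lborel. weak_incompressible \<Omega> (G t)) \<and>
        (\<forall>v H. velocity_class T \<Omega> v H \<longrightarrow>
           (AE t\<in>{0<..<T} in lborel.
              weak_momentum \<nu> Cs \<delta> \<mu> \<Omega> f (w t) (G t) (wt t) (Gt t) (p t) (v t) (H t))))"

end

theory Submission
  imports Defs "HOL-Computational_Algebra.Polynomial"
begin

text \<open>Let $\phi = w_1 - w_2$ and $\kappa = C_s^4 \delta^2 / \mu^2$.  Because of the correction term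
  $-\kappa\, \Delta w_t$, testing the difference of the two momentum equations with $\phi$ controls the energy
  $E = \|\phi\|^2 + \kappa \|\nabla\phi\|^2$, which contains the gradient.  This makes the convective terms
  harmless: Hoelder's inequality and the Ladyzhenskaya inequality
  $\|\phi\|_3 \<le> 4 (\|\phi\|^2 + \|\nabla\phi\|^2)^{1/2}$ bound them by $\alpha E$ with
  $\alpha$ proportional to $\|w_1\|_6 + \|\nabla w_2\|_3$, which is integrable in time.  The viscous and the
  Smagorinsky terms only dissipate, and the pressures drop out as $\nabla \cdot \phi = 0$ (\<open>difference_energy_bound\<close>).  If $E$
  were differentiable and $E(0) = 0$ were known, the lemma of Gronwall would end the proof.  Both points
  need an argument.

  Regularity in time.  The time derivative is a distributional one.  Testing it with bumps that approximate
  indicators of rational boxes shows that, outside one null set of times, the pair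
  $u = (\phi, \sqrt\kappa\, \nabla\phi)$ is an integral of $z = u_t$ (\<open>space_time_FTC\<close>).  The
  increment of $E = \|u\|^2$ over $[s, t]$ then differs from $2 \int_s^t (z, u)$ by at most
  $(\int_s^t \|z\|)^2$, and errors of quadratic order vanish under refinement (\<open>energy_inequality\<close>).

  Initial energy.  The initial condition yields $\|\phi(t)\| \rightarrow 0$ but nothing about
  $\nabla\phi(t)$.  The equations are therefore tested with the difference $\phi(t_0)$ frozen at a small time
  $t_0$.  Since $u(s)$ tends to zero weakly as $s \rightarrow 0$ (\<open>weakly_vanishing_start\<close>), $E(t_0)$ is bounded by
  the integral over $(0, t_0)$ of an integrable function plus a constant times $t_0 \|\nabla\phi(t_0)\|_3^3$
  (\<open>energy_endpoint\<close>).  Here $\nabla w_1, \nabla w_2 \<in> L^3(0,T;L^3)$ enters: the cubes of these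
  norms are integrable, so the last term is small for suitable $t_0$ arbitrarily close to $0$
  (\<open>vanishing_times\<close>).  Smallness of $E$ at such times replaces $E(0) = 0$ in the lemma of
  Gronwall (\<open>integral_Gronwall_zero\<close>).\<close>

section \<open>Smooth functions and box bumps\<close>

text \<open>Smoothness speaks about all iterated directional derivatives, so it is the largest property
  that implies differentiability and is inherited by directional derivatives.  It is therefore
  proved by exhibiting a set of differentiable functions invariant under \<^term>\<open>dir_deriv\<close>.\<close>

lemma smooth_coinduct:
  assumes "f \<in> S" "\<And>g. g \<in> S \<Longrightarrow> g differentiable_on UNIV" "\<And>g b. g \<in> S \<Longrightarrow> dir_deriv b g \<in> S"
  shows "smooth f"
proof -
  have "fold dir_deriv bs f \<in> S" for bs
    using assms(1,3) by (induction bs arbitrary: f) auto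
  then show ?thesis using assms(2) unfolding smooth_def by blast
qed

lemma smooth_dir_deriv: "smooth f \<Longrightarrow> smooth (dir_deriv b f)"
  unfolding smooth_def by (metis fold_simps(2))

lemma smooth_differentiable_on: "smooth f \<Longrightarrow> f differentiable_on UNIV"
  unfolding smooth_def by (metis fold_simps(1))

lemma smooth_has_derivative:
  "smooth f \<Longrightarrow> (f has_derivative frechet_derivative f (at x)) (at x)"
  using smooth_differentiable_on differentiable_on_def frechet_derivative_works by (metis UNIV_I)

lemma smooth_step:
  assumes "f differentiable_on UNIV" "\<And>b. smooth (dir_deriv b f)"
  shows "smooth f"
proof (rule smooth_coinduct[where S="insert f {g. smooth g}"])
qed (use assms smooth_differentiable_on smooth_dir_deriv in auto)

lemma smooth_continuous_on: "smooth f \<Longrightarrow> continuous_on A f"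
  using smooth_differentiable_on differentiable_imp_continuous_on continuous_on_subset
  by (metis subset_UNIV)

lemma dir_derivI: "(f has_derivative f') (at x) \<Longrightarrow> dir_deriv b f x = f' b"
  unfolding dir_deriv_def using frechet_derivative_at by metis

lemma dir_deriv_outside_closed:
  assumes K: "closed K" and out: "\<And>y. y \<notin> K \<Longrightarrow> f y = 0" and x: "x \<notin> K"
  shows "dir_deriv b f x = 0"
proof -
  have "(f has_derivative (\<lambda>h. 0)) (at x)"
    by (rule has_derivative_transform_within_open[where f="\<lambda>x. 0" and s="- K"]) (use K out x in \<open>auto simp: open_Compl\<close>)
  then show ?thesis by (rule dir_derivI)
qed

lemma smooth_const: "smooth (\<lambda>x::'a::euclidean_space. c::'b::real_normed_vector)"
proof (rule smooth_coinduct[where S="{\<lambda>x. c, \<lambda>x. 0}"])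
  fix g :: "'a \<Rightarrow> 'b" and b assume "g \<in> {\<lambda>x. c, \<lambda>x. 0}"
  then have "dir_deriv b g = (\<lambda>x. 0)"
    unfolding dir_deriv_def by auto
  then show "dir_deriv b g \<in> {\<lambda>x. c, \<lambda>x. 0}" by simp
qed auto

lemma smooth_linear_image:
  fixes f :: "'a::euclidean_space \<Rightarrow> 'b::real_normed_vector"
  assumes "bounded_linear L" "smooth f"
  shows "smooth (\<lambda>x. L (f x))" "dir_deriv b (\<lambda>x. L (f x)) x = L (dir_deriv b f x)"
proof -
  have d: "((\<lambda>x. L (f x)) has_derivative (\<lambda>h. L (frechet_derivative f (at x) h))) (at x)"
    if "smooth f" for f :: "'a \<Rightarrow> 'b" and x
    using bounded_linear.has_derivative[OF assms(1) smooth_has_derivative[OF that]] .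
  have e: "dir_deriv b (\<lambda>x. L (f x)) = (\<lambda>x. L (dir_deriv b f x))" if "smooth f" for f :: "'a \<Rightarrow> 'b" and b
    using dir_derivI[OF d[OF that]] by (auto simp: dir_deriv_def)
  show "smooth (\<lambda>x. L (f x))"
  proof (rule smooth_coinduct[where S="(\<lambda>(f::'a \<Rightarrow> 'b) x. L (f x)) ` {g. smooth g}"])
    fix g b assume "g \<in> (\<lambda>(f::'a \<Rightarrow> 'b) x. L (f x)) ` {g. smooth g}"
    then obtain g0 where g0: "smooth g0" "g = (\<lambda>x. L (g0 x))" by auto
    show "g differentiable_on UNIV"
      using d[OF g0(1)] unfolding g0(2) differentiable_on_def by (auto intro!: differentiableI)
    show "dir_deriv b g \<in> (\<lambda>(f::'a \<Rightarrow> 'b) x. L (f x)) ` {g. smooth g}"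
      using e[OF g0(1)] smooth_dir_deriv[OF g0(1)] unfolding g0(2) by blast
  qed (use assms in auto)
  show "dir_deriv b (\<lambda>x. L (f x)) x = L (dir_deriv b f x)" using e[OF assms(2)] by metis
qed

lemma smooth_compose_linear:
  fixes f :: "'a::euclidean_space \<Rightarrow> 'b::real_normed_vector" and L :: "'c::euclidean_space \<Rightarrow> 'a"
  assumes "bounded_linear L" "smooth f"
  shows "smooth (\<lambda>x. f (L x))" "dir_deriv b (\<lambda>x. f (L x)) x = dir_deriv (L b) f (L x)"
proof -
  have d: "((\<lambda>x. f (L x)) has_derivative (\<lambda>h. frechet_derivative f (at (L x)) (L h))) (at x)"
    if "smooth f" for f :: "'a \<Rightarrow> 'b" and x
    using has_derivative_compose[OF bounded_linear_imp_has_derivative[OF assms(1)] smooth_has_derivative[OF that]] .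
  have e: "dir_deriv b (\<lambda>x. f (L x)) = (\<lambda>x. dir_deriv (L b) f (L x))" if "smooth f" for f :: "'a \<Rightarrow> 'b" and b
    using dir_derivI[OF d[OF that]] by (auto simp: dir_deriv_def)
  show "smooth (\<lambda>x. f (L x))"
  proof (rule smooth_coinduct[where S="(\<lambda>(f::'a \<Rightarrow> 'b) x. f (L x)) ` {g. smooth g}"])
    fix g b assume "g \<in> (\<lambda>(f::'a \<Rightarrow> 'b) x. f (L x)) ` {g. smooth g}"
    then obtain g0 where g0: "smooth g0" "g = (\<lambda>x. g0 (L x))" by auto
    show "g differentiable_on UNIV"
      using d[OF g0(1)] unfolding g0(2) differentiable_on_def by (auto intro!: differentiableI)
    show "dir_deriv b g \<in> (\<lambda>(f::'a \<Rightarrow> 'b) x. f (L x)) ` {g. smooth g}"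
      using e[OF g0(1)] smooth_dir_deriv[OF g0(1)] unfolding g0(2) by blast
  qed (use assms in auto)
  show "dir_deriv b (\<lambda>x. f (L x)) x = dir_deriv (L b) f (L x)" using e[OF assms(2)] by metis
qed

lemma smooth_diff:
  fixes f g :: "'a::euclidean_space \<Rightarrow> 'b::real_normed_vector"
  assumes "smooth f" "smooth g"
  shows "smooth (\<lambda>x. f x - g x)" "dir_deriv b (\<lambda>x. f x - g x) x = dir_deriv b f x - dir_deriv b g x"
proof -
  have d: "((\<lambda>x. f x - g x) has_derivative (\<lambda>h. frechet_derivative f (at x) h - frechet_derivative g (at x) h)) (at x)"
    if "smooth f" "smooth g" for f g :: "'a \<Rightarrow> 'b" and x
    using has_derivative_diff[OF that[THEN smooth_has_derivative]] .
  have e: "dir_deriv b (\<lambda>x. f x - g x) = (\<lambda>x. dir_deriv b f x - dir_deriv b g x)" if "smooth f" "smooth g" for f g :: "'a \<Rightarrow> 'b" and b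
    using dir_derivI[OF d[OF that]] by (auto simp: dir_deriv_def)
  let ?S = "(\<lambda>(f,g) x. f x - g x) ` ({g. smooth g} \<times> {g::'a \<Rightarrow> 'b. smooth g})"
  show "smooth (\<lambda>x. f x - g x)"
  proof (rule smooth_coinduct[where S="?S"])
    fix h b assume "h \<in> ?S"
    then obtain f g where g0: "smooth f" "smooth g" "h = (\<lambda>x. f x - g x)" by auto
    show "h differentiable_on UNIV"
      using d[OF g0(1,2)] unfolding g0(3) differentiable_on_def by (auto intro!: differentiableI)
    show "dir_deriv b h \<in> ?S"
      using e[OF g0(1,2)] g0(1,2)[THEN smooth_dir_deriv, of b] unfolding g0(3) by auto
  qed (use assms in auto)
  show "dir_deriv b (\<lambda>x. f x - g x) x = dir_deriv b f x - dir_deriv b g x" using e[OF assms] by metis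
qed

lemma dir_deriv_mult:
  fixes f g :: "'a::euclidean_space \<Rightarrow> real"
  assumes "smooth f" "smooth g"
  shows "((\<lambda>x. f x * g x) has_derivative
     (\<lambda>h. f x * frechet_derivative g (at x) h + frechet_derivative f (at x) h * g x)) (at x)"
    and "dir_deriv b (\<lambda>x. f x * g x) x = f x * dir_deriv b g x + dir_deriv b f x * g x"
proof -
  show d: "((\<lambda>x. f x * g x) has_derivative
     (\<lambda>h. f x * frechet_derivative g (at x) h + frechet_derivative f (at x) h * g x)) (at x)"
    using has_derivative_mult[OF assms[THEN smooth_has_derivative]] .
  show "dir_deriv b (\<lambda>x. f x * g x) x = f x * dir_deriv b g x + dir_deriv b f x * g x"
    using dir_derivI[OF d] by (auto simp: dir_deriv_def)
qed

text \<open>The iterated derivatives of a product are sums of products of iterated derivatives, so the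
  invariant set consists of all finite sums of products of smooth functions; such a sum is encoded
  by the list of its pairs of factors.\<close>

lemma smooth_mult:
  fixes f g :: "'a::euclidean_space \<Rightarrow> real"
  assumes "smooth f" "smooth g"
  shows "smooth (\<lambda>x. f x * g x)"
proof -
  define ev :: "(('a \<Rightarrow> real) \<times> ('a \<Rightarrow> real)) list \<Rightarrow> 'a \<Rightarrow> real"
    where "ev ps = (\<lambda>x. \<Sum>(f,g)\<leftarrow>ps. f x * g x)" for ps
  define ok :: "(('a \<Rightarrow> real) \<times> ('a \<Rightarrow> real)) list \<Rightarrow> bool"
    where "ok ps \<longleftrightarrow> (\<forall>(f,g)\<in>set ps. smooth f \<and> smooth g)" for ps
  define D where "D b ps = concat (map (\<lambda>(f,g). [(f, dir_deriv b g), (dir_deriv b f, g)]) ps)"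
    for b :: 'a and ps :: "(('a \<Rightarrow> real) \<times> ('a \<Rightarrow> real)) list"
  have okD: "ok (D b ps)" if "ok ps" for b ps
    using that unfolding ok_def D_def by (auto intro: smooth_dir_deriv)
  have der: "(ev ps has_derivative (\<lambda>b. ev (D b ps) x)) (at x)" if "ok ps" for ps x
    using that
  proof (induction ps)
    case Nil
    then show ?case unfolding ev_def D_def by simp
  next
    case (Cons p ps)
    obtain f g where p: "p = (f, g)" by force
    have ok: "smooth f" "smooth g" "ok ps" using Cons.prems unfolding ok_def p by auto
    have 1: "ev (p # ps) = (\<lambda>x. f x * g x + ev ps x)"
      unfolding ev_def p by auto
    have 2: "(\<lambda>b. ev (D b (p#ps)) x) = (\<lambda>b. (f x * frechet_derivative g (at x) b + frechet_derivative f (at x) b * g x) + ev (D b ps) x)"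
      unfolding ev_def D_def p by (auto simp: dir_deriv_def)
    show ?case unfolding 1 2
      by (intro has_derivative_add dir_deriv_mult ok Cons.IH)
  qed
  show ?thesis
  proof (rule smooth_coinduct[where S="ev ` Collect ok"])
    have "(\<lambda>x. f x * g x) = ev [(f,g)]" unfolding ev_def by auto
    then show "(\<lambda>x. f x * g x) \<in> ev ` Collect ok" using assms unfolding ok_def by auto
    fix h b assume "h \<in> ev ` Collect ok"
    then obtain ps where ps: "ok ps" "h = ev ps" by auto
    show "h differentiable_on UNIV"
      using der[OF ps(1)] unfolding ps(2) differentiable_on_def by (auto intro!: differentiableI)
    have "dir_deriv b h = ev (D b ps)"
      using dir_derivI[OF der[OF ps(1)]] unfolding ps(2) by auto
    then show "dir_deriv b h \<in> ev ` Collect ok" using okD[OF ps(1)] by auto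
  qed
qed

lemma smooth_prod:
  fixes f :: "'i \<Rightarrow> 'a::euclidean_space \<Rightarrow> real"
  assumes "finite I" "\<And>i. i \<in> I \<Longrightarrow> smooth (f i)"
  shows "smooth (\<lambda>x. \<Prod>i\<in>I. f i x)"
  using assms
proof (induction I)
  case empty
  then show ?case using smooth_const by simp
next
  case (insert a A)
  have "(\<lambda>x. \<Prod>i\<in>insert a A. f i x) = (\<lambda>x. f a x * (\<Prod>i\<in>A. f i x))"
    using insert by auto
  then show ?case using smooth_mult[of "f a" "\<lambda>x. \<Prod>i\<in>A. f i x"] insert by simp
qed

text \<open>For \<open>p = 1\<close> this is the standard flat function $e^{-1/x}$, extended by $0$ to the negative axis.
  With polynomials in $1/x$ as factors, the family is closed under differentiation, which proves
  all its members smooth at once.\<close>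

definition flat :: "real poly \<Rightarrow> real \<Rightarrow> real" where
  "flat p x = (if x > 0 then poly p (1 / x) * exp (- (1 / x)) else 0)"

lemma poly_exp_tendsto: "((\<lambda>y. poly p y * exp (- y)) \<longlongrightarrow> 0) (at_top :: real filter)"
proof -
  have "((\<lambda>y. \<Sum>i\<le>degree p. coeff p i * (y ^ i / exp y)) \<longlongrightarrow> (\<Sum>i\<le>degree p. coeff p i * 0)) (at_top :: real filter)"
    by (intro tendsto_sum tendsto_mult tendsto_const tendsto_power_div_exp_0)
  moreover have "(\<lambda>y. \<Sum>i\<le>degree p. coeff p i * (y ^ i / exp y)) = (\<lambda>y. poly p y * exp (- y))"
    by (auto simp: poly_altdef sum_distrib_right exp_minus divide_inverse mult.assoc intro!: sum.cong ext)
  ultimately show ?thesis by simp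
qed

lemma flat_has_derivative:
  "(flat p has_real_derivative flat ([:0,0,1:] * (p - pderiv p)) x) (at x)"
proof (cases x "0::real" rule: linorder_cases)
  case less
  have "((\<lambda>x. 0) has_real_derivative 0) (at x)" by simp
  then have "(flat p has_real_derivative 0) (at x)"
    by (rule has_field_derivative_transform_within_open[where S="{..<0}"]) (use less in \<open>auto simp: flat_def\<close>)
  then show ?thesis using less by (simp add: flat_def)
next
  case greater
  have "((\<lambda>x. poly p (1 / x) * exp (- (1 / x))) has_real_derivative
      flat ([:0,0,1:] * (p - pderiv p)) x) (at x)"
    using greater
    by (auto intro!: derivative_eq_intros simp: flat_def field_simps power2_eq_square)
  then show ?thesis
    by (rule has_field_derivative_transform_within_open[where S="{0<..}"]) (use greater in \<open>auto simp: flat_def\<close>)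
next
  case equal
  have "((\<lambda>h. flat p h / h) \<longlongrightarrow> 0) (at 0)"
  proof (rule filterlim_split_at)
    have "\<forall>\<^sub>F h in at_left (0::real). flat p h / h = 0"
      by (auto simp: flat_def eventually_at_filter)
    then show "((\<lambda>h. flat p h / h) \<longlongrightarrow> 0) (at_left 0)"
      by (rule tendsto_eventually)
    \<comment> \<open>the substitution \<open>y = 1 / x\<close> turns the difference quotient at \<open>0\<close> into a polynomial times \<open>exp (- y)\<close>\<close>
    have "((\<lambda>y. poly ([:0,1:] * p) y * exp (- y)) \<longlongrightarrow> 0) (at_top :: real filter)"
      by (rule poly_exp_tendsto)
    then have "((\<lambda>x. poly ([:0,1:] * p) (inverse x) * exp (- (inverse x))) \<longlongrightarrow> 0) (at_right (0::real))"
      by (rule filterlim_compose[OF _ filterlim_inverse_at_top_right])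
    moreover have "\<forall>\<^sub>F x in at_right (0::real). poly ([:0,1:] * p) (inverse x) * exp (- (inverse x)) = flat p x / x"
      by (auto simp: flat_def eventually_at_filter field_simps)
    ultimately show "((\<lambda>h. flat p h / h) \<longlongrightarrow> 0) (at_right 0)"
      using tendsto_cong by fast
  qed
  then show ?thesis using equal by (auto simp: DERIV_def flat_def)
qed

lemma smooth_flat: "smooth (flat p)"
proof (rule smooth_coinduct[where S="range flat"])
  fix g b assume "g \<in> range flat"
  then obtain q where q: "g = flat q" by auto
  show "g differentiable_on UNIV"
    using flat_has_derivative[of q] unfolding q differentiable_on_def
    by (metis has_field_derivative_imp_has_derivative differentiableI)
  have "dir_deriv b g x = flat (smult b ([:0,0,1:] * (q - pderiv q))) x" for x
    using dir_derivI[OF flat_has_derivative[of q x, THEN has_field_derivative_imp_has_derivative]]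
    unfolding q by (auto simp: flat_def algebra_simps)
  then show "dir_deriv b g \<in> range flat" by auto
qed auto

text \<open>The slopes at both ends steepen with \<open>n\<close>, so these bumps, all supported in \<open>{c..d}\<close>, converge to
  the indicator of \<open>{c<..<d}\<close>.\<close>

definition bump :: "nat \<Rightarrow> real \<Rightarrow> real \<Rightarrow> real \<Rightarrow> real" where
  "bump n c d x = flat 1 (real (Suc n) * (x - c)) * flat 1 (real (Suc n) * (d - x))"

lemma flat_affine_smooth: "smooth (\<lambda>x. flat p (a * (x - c)))"
proof -
  have tr: "smooth (\<lambda>x. f (x - c))" if "smooth f" for f :: "real \<Rightarrow> real" and c
  proof (rule smooth_coinduct[where S="(\<lambda>f x. f (x - c)) ` {g::real \<Rightarrow> real. smooth g}"])
    fix g b assume "g \<in> (\<lambda>f x. f (x - c)) ` {g::real \<Rightarrow> real. smooth g}"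
    then obtain g0 where g0: "smooth g0" "g = (\<lambda>x. g0 (x - c))" by auto
    have d: "((\<lambda>x. g0 (x - c)) has_derivative (\<lambda>h. frechet_derivative g0 (at (x - c)) h)) (at x)" for x
      by (rule has_derivative_compose[where f="\<lambda>x. x - c" and f'="\<lambda>h. h" and g=g0])
         (auto intro!: derivative_eq_intros smooth_has_derivative g0)
    show "g differentiable_on UNIV"
      using d unfolding g0(2) differentiable_on_def by (auto intro!: differentiableI)
    have "dir_deriv b g = (\<lambda>x. dir_deriv b g0 (x - c))"
      using dir_derivI[OF d] unfolding g0(2) by (auto simp: dir_deriv_def)
    then show "dir_deriv b g \<in> (\<lambda>f x. f (x - c)) ` {g::real \<Rightarrow> real. smooth g}"
      using smooth_dir_deriv[OF g0(1)] by blast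
  qed (use that in auto)
  have "smooth (\<lambda>x. flat p (a * x))"
    by (rule smooth_compose_linear(1)[OF bounded_linear_mult_right smooth_flat])
  then show ?thesis using tr by blast
qed

lemma smooth_bump: "smooth (bump n c d)"
proof -
  have "bump n c d = (\<lambda>x. flat 1 (real (Suc n) * (x - c)) * flat 1 ((- real (Suc n)) * (x - d)))"
    unfolding bump_def by (auto simp: algebra_simps)
  then show ?thesis using smooth_mult[OF flat_affine_smooth flat_affine_smooth] by metis
qed

lemma flat_1_bounds: "0 \<le> flat 1 x" "flat 1 x \<le> 1" "flat 1 x \<noteq> 0 \<longleftrightarrow> x > 0"
  unfolding flat_def by auto

lemma bump_bounds: "0 \<le> bump n c d x" "bump n c d x \<le> 1" "bump n c d x \<noteq> 0 \<longleftrightarrow> c < x \<and> x < d"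
  unfolding bump_def using flat_1_bounds
  by (auto intro!: mult_nonneg_nonneg mult_le_one simp: zero_less_mult_iff)

lemma flat_1_tendsto: "0 < y \<Longrightarrow> (\<lambda>n. flat 1 (real (Suc n) * y)) \<longlonglongrightarrow> 1"
proof -
  assume y: "0 < y"
  have "(\<lambda>n. exp (- (inverse (real (Suc n)) * (1 / y)))) \<longlonglongrightarrow> exp (- (0 * (1 / y)))"
    by (intro tendsto_intros LIMSEQ_inverse_real_of_nat)
  moreover have "exp (- (inverse (real (Suc n)) * (1 / y))) = flat 1 (real (Suc n) * y)" for n
  proof -
    have "inverse (real (Suc n)) * (1 / y) = 1 / (real (Suc n) * y)" "0 < real (Suc n) * y"
      using y by (auto simp: divide_inverse)
    then show ?thesis unfolding flat_def by auto
  qed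
  ultimately show ?thesis by (simp del: of_nat_Suc)
qed

lemma bump_tendsto: "(\<lambda>n. bump n c d x) \<longlonglongrightarrow> indicator {c<..<d} x"
proof (cases "c < x \<and> x < d")
  case True
  then have "(\<lambda>n. flat 1 (real (Suc n) * (x - c)) * flat 1 (real (Suc n) * (d - x))) \<longlonglongrightarrow> 1 * 1"
    by (intro tendsto_mult flat_1_tendsto) auto
  then show ?thesis using True by (simp add: bump_def)
next
  case False
  then have "bump n c d x = 0" for n using bump_bounds(3) by blast
  then show ?thesis using False by auto
qed

definition box_bump :: "nat \<Rightarrow> 'a \<Rightarrow> 'a \<Rightarrow> 'a::euclidean_space \<Rightarrow> real" where
  "box_bump n c d x = (\<Prod>i\<in>Basis. bump n (c \<bullet> i) (d \<bullet> i) (x \<bullet> i))"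

lemma smooth_box_bump: "smooth (box_bump n c d)"
proof -
  have "smooth (\<lambda>x. \<Prod>i\<in>Basis. bump n (c \<bullet> i) (d \<bullet> i) (x \<bullet> i))"
    by (intro smooth_prod smooth_compose_linear(1)[OF bounded_linear_inner_left smooth_bump]) auto
  then show ?thesis unfolding box_bump_def .
qed

lemma box_bump_bounds:
  "0 \<le> box_bump n c d x" "box_bump n c d x \<le> 1" "box_bump n c d x \<noteq> 0 \<longleftrightarrow> x \<in> box c d"
  unfolding box_bump_def using bump_bounds
  by (auto intro!: prod_nonneg prod_le_1 simp: mem_box)

lemma box_bump_tendsto: "(\<lambda>n. box_bump n c d x) \<longlonglongrightarrow> indicator (box c d) x"
proof -
  have "(\<lambda>n. box_bump n c d x) \<longlonglongrightarrow> (\<Prod>i\<in>Basis. indicator {c \<bullet> i<..<d \<bullet> i} (x \<bullet> i))"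
    unfolding box_bump_def by (intro tendsto_prod bump_tendsto)
  moreover have "(\<Prod>i\<in>Basis. indicator {c \<bullet> i<..<d \<bullet> i} (x \<bullet> i)) = (indicator (box c d) x :: real)"
  proof (cases "x \<in> box c d")
    case True
    then show ?thesis by (auto simp: mem_box intro!: prod.neutral)
  next
    case False
    then obtain i where "i \<in> Basis" "\<not> (c \<bullet> i < x \<bullet> i \<and> x \<bullet> i < d \<bullet> i)" by (auto simp: mem_box)
    then have "(\<Prod>i\<in>Basis. indicator {c \<bullet> i<..<d \<bullet> i} (x \<bullet> i)) = (0::real)"
      by (intro prod_zero) (auto simp: indicator_def)
    then show ?thesis using False by simp
  qed
  ultimately show ?thesis by simp
qed

lemma test_function_box_bump:
  assumes "cbox c d \<subseteq> U"
  shows "test_function U (box_bump n c d)"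
proof -
  have "closure {x. box_bump n c d x \<noteq> 0} \<subseteq> cbox c d"
    using box_bump_bounds(3)[of n c d] box_subset_cbox by (intro closure_minimal) auto
  moreover then have "compact (closure {x. box_bump n c d x \<noteq> 0})"
    by (meson bounded_cbox bounded_subset closed_closure compact_eq_bounded_closed)
  ultimately show ?thesis unfolding test_function_def using smooth_box_bump assms by blast
qed

section \<open>The fundamental lemma of the calculus of variations\<close>

definition rational_point :: "'a::euclidean_space \<Rightarrow> bool" where
  "rational_point c \<longleftrightarrow> (\<forall>i\<in>Basis. c \<bullet> i \<in> \<rat>)"

lemma countable_rational_point: "countable {c::'a::euclidean_space. rational_point c}"
proof -
  have "{c::'a. rational_point c} \<subseteq> (\<lambda>f. \<Sum>i\<in>Basis. f i *\<^sub>R i) ` (Basis \<rightarrow>\<^sub>E \<rat>)"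
  proof
    fix c :: 'a assume "c \<in> {c. rational_point c}"
    then show "c \<in> (\<lambda>f. \<Sum>i\<in>Basis. f i *\<^sub>R i) ` (Basis \<rightarrow>\<^sub>E \<rat>)"
      by (intro image_eqI[where x="\<lambda>i\<in>Basis. c \<bullet> i"])
         (auto simp: rational_point_def euclidean_representation)
  qed
  then show ?thesis
    by (rule countable_subset) (intro countable_image countable_PiE countable_rat finite_Basis)
qed

text \<open>Countably many boxes suffice as tests.  This is what later allows one exceptional null set of
  times to serve for all of them.\<close>

definition rational_corners :: "'a::euclidean_space set \<Rightarrow> ('a \<times> 'a) set" where
  "rational_corners U = {(c, d). rational_point c \<and> rational_point d \<and> cbox c d \<subseteq> U}"

lemma countable_rational_corners: "countable (rational_corners U)"
proof -
  have "rational_corners U \<subseteq> {c. rational_point c} \<times> {c. rational_point c}"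
    unfolding rational_corners_def by auto
  then show ?thesis
    using countable_subset countable_SIGMA countable_rational_point by meson
qed

lemma open_eq_rational_boxes:
  assumes "open U"
  shows "U = (\<Union>(c, d)\<in>rational_corners U. box c d)"
proof -
  have "\<exists>c d. (c, d) \<in> rational_corners U \<and> x \<in> box c d" if x: "x \<in> U" for x
  proof -
    obtain e where e: "e > 0" "cball x e \<subseteq> U"
      using open_contains_cball assms x by blast
    obtain a b where ab: "x \<in> box a b" "\<forall>i\<in>Basis. a \<bullet> i \<in> \<rat>" "\<forall>i\<in>Basis. b \<bullet> i \<in> \<rat>" "box a b \<subseteq> ball x e"
      using rational_boxes[OF e(1)] by metis
    have "closure (box a b) \<subseteq> cball x e"
      using ab(4) ball_subset_cball by (intro closure_minimal) auto
    then have "cbox a b \<subseteq> U"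
      using ab(1) e(2) closure_box by (metis empty_iff subset_trans)
    then show ?thesis using ab unfolding rational_corners_def rational_point_def by auto
  qed
  moreover have "box c d \<subseteq> U" if "(c, d) \<in> rational_corners U" for c d
    using that box_subset_cbox unfolding rational_corners_def by blast
  ultimately show ?thesis by fast
qed

lemma borel_eq_rational_boxes:
  "(borel :: 'a::euclidean_space measure) = sigma UNIV ((\<lambda>(c, d). box c d) ` rational_corners UNIV)"
proof (rule borel_eq_sigmaI1[OF borel_def])
  fix M :: "'a set" assume "M \<in> {S. open S}"
  then have M: "M = (\<Union>(c, d)\<in>rational_corners M. box c d)" using open_eq_rational_boxes by blast
  have "(\<Union>(c, d)\<in>rational_corners M. box c d) \<in> sets (sigma UNIV ((\<lambda>(c, d). box c d) ` rational_corners UNIV))"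
    by (intro sets.countable_UN' countable_rational_corners) (auto simp: rational_corners_def)
  then show "M \<in> sets (sigma UNIV ((\<lambda>(c, d). box c d) ` rational_corners UNIV))" using M by simp
qed auto

lemma box_Int_box:
  "box a b \<inter> box c d = box (\<Sum>i\<in>Basis. max (a \<bullet> i) (c \<bullet> i) *\<^sub>R i) (\<Sum>i\<in>Basis. min (b \<bullet> i) (d \<bullet> i) *\<^sub>R i)"
  by (auto simp: mem_box)

text \<open>Inside a fixed box, the rational boxes are closed under intersection and generate the Borel
  sets; hence the integral of \<open>D\<close> vanishes over every Borel subset of the box, and \<open>D\<close> vanishes almost
  everywhere there.  Countably many such boxes cover \<open>U\<close>.\<close>

lemma AE_zero_if_box_integrals_zero:
  fixes D :: "'a::euclidean_space \<Rightarrow> 'b::euclidean_space"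
  assumes U: "open U"
    and int: "\<And>c d. (c, d) \<in> rational_corners U \<Longrightarrow> set_integrable lborel (box c d) D"
    and zero: "\<And>c d. (c, d) \<in> rational_corners U \<Longrightarrow> (LINT x:box c d|lborel. D x) = 0"
  shows "AE x\<in>U in lborel. D x = 0"
proof -
  have "AE x in lborel. x \<in> box c d \<longrightarrow> D x = 0" if cd: "(c, d) \<in> rational_corners U" for c d
  proof -
    let ?f = "\<lambda>x. indicator (box c d) x *\<^sub>R D x"
    let ?G = "(\<lambda>(c, d). box c d) ` rational_corners (UNIV :: 'a set)"
    have f: "integrable lborel ?f" using int[OF cd] unfolding set_integrable_def .
    have sf: "set_integrable lborel A ?f" if "A \<in> sets lborel" for A
      unfolding set_integrable_def by (rule integrable_mult_indicator[OF that f])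
    have "AE x in lborel. ?f x = 0"
    proof (rule sigma_finite_measure.density_zero[OF sigma_finite_lborel f])
      fix A :: "'a set" assume "A \<in> sets lborel"
      then have A: "A \<in> sigma_sets UNIV ?G"
        using borel_eq_rational_boxes by (metis sets_lborel sets_measure_of top_greatest Pow_UNIV)
      have eq: "B \<in> sigma_sets UNIV ?G \<Longrightarrow> B \<in> sets lborel" for B
        using borel_eq_rational_boxes by (metis sets_lborel sets_measure_of top_greatest Pow_UNIV)
      have basic: "set_lebesgue_integral lborel A ?f = 0" if rc: "rational_point a" "rational_point b" "A = box a b" for A a b
      proof (cases "box a b \<inter> box c d = {}")
        case True
        then have "(\<lambda>x. indicator A x *\<^sub>R ?f x) = (\<lambda>x. 0)" unfolding rc by (auto simp: indicator_def fun_eq_iff)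
        then show ?thesis unfolding set_lebesgue_integral_def by (simp only: integral_zero)
      next
        case False
        define a' where "a' = (\<Sum>i\<in>Basis. max (a \<bullet> i) (c \<bullet> i) *\<^sub>R i)"
        define b' where "b' = (\<Sum>i\<in>Basis. min (b \<bullet> i) (d \<bullet> i) *\<^sub>R i)"
        have i: "box a b \<inter> box c d = box a' b'" unfolding a'_def b'_def by (rule box_Int_box)
        have "box a' b' \<noteq> {}" using False i by simp
        then have "cbox a' b' \<subseteq> cbox c d" using i closure_mono[of "box a' b'" "box c d"]
          by (metis Int_lower2 closure_box subset_empty)
        then have "(a', b') \<in> rational_corners U"
          using cd rc unfolding rational_corners_def rational_point_def a'_def b'_def
          by (auto simp: max_def min_def)
        from zero[OF this] show ?thesis
          unfolding set_lebesgue_integral_def rc(3) i[symmetric]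
          by (simp add: indicator_inter_arith)
      qed
      have univ: "set_lebesgue_integral lborel UNIV ?f = 0"
        using zero[OF cd] unfolding set_lebesgue_integral_def by simp
      show "set_lebesgue_integral lborel A ?f = 0"
      proof (rule sigma_sets_induct_disjoint[OF _ _ A])
        show "Int_stable ?G"
        proof (rule Int_stableI)
          fix A B assume "A \<in> ?G" "B \<in> ?G"
          then obtain a b a' b' where ab: "rational_point a" "rational_point b" "rational_point a'" "rational_point b'" 
            "A = box a b" "B = box a' b'" unfolding rational_corners_def by auto
          have "A \<inter> B = box (\<Sum>i\<in>Basis. max (a \<bullet> i) (a' \<bullet> i) *\<^sub>R i) (\<Sum>i\<in>Basis. min (b \<bullet> i) (b' \<bullet> i) *\<^sub>R i)"
            unfolding ab by (rule box_Int_box)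
          moreover have "(\<Sum>i\<in>Basis. max (a \<bullet> i) (a' \<bullet> i) *\<^sub>R i, \<Sum>i\<in>Basis. min (b \<bullet> i) (b' \<bullet> i) *\<^sub>R i) \<in> rational_corners UNIV"
            using ab unfolding rational_corners_def rational_point_def by (auto simp: max_def min_def)
          ultimately show "A \<inter> B \<in> ?G" by force
        qed
        show "?G \<subseteq> Pow UNIV" by simp
        show "\<And>A. A \<in> ?G \<Longrightarrow> set_lebesgue_integral lborel A ?f = 0"
          using basic unfolding rational_corners_def by auto
        show "set_lebesgue_integral lborel {} ?f = 0" unfolding set_lebesgue_integral_def by simp
        show "set_lebesgue_integral lborel (UNIV - A) ?f = 0"
          if A: "A \<in> sigma_sets UNIV ?G" "set_lebesgue_integral lborel A ?f = 0" for A
        proof -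
          have "set_lebesgue_integral lborel (A \<union> (UNIV - A)) ?f = set_lebesgue_integral lborel A ?f + set_lebesgue_integral lborel (UNIV - A) ?f"
            using eq[OF A(1)] by (intro set_integral_Un sf) (auto intro: sets.Diff)
          then show ?thesis using univ A(2) by (simp add: Un_Diff_cancel)
        qed
        show "set_lebesgue_integral lborel (\<Union>i. A i) ?f = 0"
          if A: "disjoint_family A" "range A \<subseteq> sigma_sets UNIV ?G" "\<And>i. set_lebesgue_integral lborel (A i) ?f = 0"
          for A :: "nat \<Rightarrow> 'a set"
        proof -
          have m: "A i \<in> sets lborel" for i using A(2) eq by blast
          have "set_lebesgue_integral lborel (\<Union>i. A i) ?f = (\<Sum>i. set_lebesgue_integral lborel (A i) ?f)"
            using A(1) m by (intro lebesgue_integral_countable_add sf) (auto simp: disjoint_family_on_def)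
          then show ?thesis using A(3) by simp
        qed
      qed
    qed
    then show ?thesis by (auto simp: indicator_def)
  qed
  then have "AE x in lborel. \<forall>p\<in>rational_corners U. x \<in> box (fst p) (snd p) \<longrightarrow> D x = 0"
    by (subst AE_ball_countable[OF countable_rational_corners]) auto
  then show ?thesis
    by eventually_elim (use open_eq_rational_boxes[OF U] in fastforce)
qed

lemma test_function_bounded:
  assumes "test_function U \<psi>"
  obtains C where "\<And>x. norm (\<psi> x) \<le> C" "C \<ge> 0"
proof -
  let ?K = "closure {x. \<psi> x \<noteq> 0}"
  have "compact (\<psi> ` ?K)"
    using assms smooth_continuous_on unfolding test_function_def by (metis compact_continuous_image)
  then obtain C where C: "\<forall>y\<in>\<psi> ` ?K. norm y \<le> C" using compact_imp_bounded bounded_iff by metis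
  have "norm (\<psi> x) \<le> max C 0" for x
  proof (cases "\<psi> x = 0")
    case False
    then have "x \<in> ?K" using closure_subset[of "{x. \<psi> x \<noteq> 0}"] by blast
    then show ?thesis using C by (simp add: max.coboundedI1)
  qed auto
  then show ?thesis using that by (metis max.cobounded2)
qed

lemma test_function_measurable: "test_function U \<psi> \<Longrightarrow> \<psi> \<in> borel_measurable borel"
  unfolding test_function_def using smooth_continuous_on borel_measurable_continuous_onI by blast

lemma test_function_integrable:
  fixes \<psi> :: "'a::euclidean_space \<Rightarrow> real" and g :: "'a \<Rightarrow> 'b::euclidean_space"
  assumes \<psi>: "test_function U \<psi>" and g: "locally_integrable U g"
  shows "set_integrable lborel U (\<lambda>x. \<psi> x *\<^sub>R g x)"
proof -
  let ?K = "closure {x. \<psi> x \<noteq> 0}"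
  obtain C where C: "\<And>x. norm (\<psi> x) \<le> C" "C \<ge> 0" using test_function_bounded[OF \<psi>] by blast
  have K: "compact ?K" "?K \<subseteq> U" using \<psi> unfolding test_function_def by auto
  then have int: "integrable lborel (\<lambda>x. indicator ?K x *\<^sub>R g x)"
    using g unfolding locally_integrable_def set_integrable_def by blast
  have eq: "(\<lambda>x. indicator U x *\<^sub>R \<psi> x *\<^sub>R g x) = (\<lambda>x. \<psi> x *\<^sub>R (indicator ?K x *\<^sub>R g x))"
  proof
    fix x
    show "indicator U x *\<^sub>R \<psi> x *\<^sub>R g x = \<psi> x *\<^sub>R (indicator ?K x *\<^sub>R g x)"
    proof (cases "\<psi> x = 0")
      case False
      then have "x \<in> ?K" using closure_subset[of "{x. \<psi> x \<noteq> 0}"] by blast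
      then show ?thesis using K by auto
    qed auto
  qed
  show ?thesis unfolding set_integrable_def eq
  proof (rule Bochner_Integration.integrable_bound)
    show "integrable lborel (\<lambda>x. C * norm (indicator ?K x *\<^sub>R g x))"
      using int by (intro integrable_mult_right integrable_norm)
    show "(\<lambda>x. \<psi> x *\<^sub>R (indicator ?K x *\<^sub>R g x)) \<in> borel_measurable lborel"
      using test_function_measurable[OF \<psi>] borel_measurable_integrable[OF int]
      by - (rule borel_measurable_scaleR, simp_all)
    show "AE x in lborel. norm (\<psi> x *\<^sub>R (indicator ?K x *\<^sub>R g x)) \<le> norm (C * norm (indicator ?K x *\<^sub>R g x))"
    proof (rule AE_I2)
      fix x
      have "norm (\<psi> x) * norm (indicator ?K x *\<^sub>R g x) \<le> C * norm (indicator ?K x *\<^sub>R g x)"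
        using C by (intro mult_right_mono) auto
      then show "norm (\<psi> x *\<^sub>R (indicator ?K x *\<^sub>R g x)) \<le> norm (C * norm (indicator ?K x *\<^sub>R g x))"
        using C(2) by (simp only: norm_scaleR real_norm_def abs_mult abs_norm_cancel abs_of_nonneg)
    qed
  qed
qed

lemma locally_integrable_diff:
  "locally_integrable U f \<Longrightarrow> locally_integrable U g \<Longrightarrow> locally_integrable U (\<lambda>x. f x - g x)"
  unfolding locally_integrable_def using set_integral_diff by metis

text \<open>Box bumps are test functions that converge boundedly to indicators of boxes, so dominated
  convergence reduces the claim to integrals over boxes.\<close>

lemma AE_zero_if_test_integrals_zero:
  fixes g :: "'a::euclidean_space \<Rightarrow> 'b::euclidean_space"
  assumes U: "open U" and g: "locally_integrable U g"
    and zero: "\<And>\<psi>::'a \<Rightarrow> real. test_function U \<psi> \<Longrightarrow> (LINT x:U|lborel. \<psi> x *\<^sub>R g x) = 0"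
  shows "AE x\<in>U in lborel. g x = 0"
proof (rule AE_zero_if_box_integrals_zero[OF U])
  fix c d assume cd: "(c, d) \<in> rational_corners U"
  then have sub: "cbox c d \<subseteq> U" unfolding rational_corners_def by auto
  have i1: "set_integrable lborel (cbox c d) g"
    using g sub compact_cbox[of c d] unfolding locally_integrable_def by simp
  show "set_integrable lborel (box c d) g"
    by (rule set_integrable_subset[OF i1]) (simp_all add: box_subset_cbox)
  have eq: "(\<lambda>x. indicator U x *\<^sub>R box_bump n c d x *\<^sub>R g x) = (\<lambda>x. box_bump n c d x *\<^sub>R (indicator (cbox c d) x *\<^sub>R g x))" for n
  proof
    fix x
    show "indicator U x *\<^sub>R box_bump n c d x *\<^sub>R g x = box_bump n c d x *\<^sub>R (indicator (cbox c d) x *\<^sub>R g x)"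
    proof (cases "x \<in> box c d")
      case True
      then have "x \<in> U" "x \<in> cbox c d" using sub box_subset_cbox[of c d] by auto
      then show ?thesis by simp
    next
      case False
      then have "box_bump n c d x = 0" using box_bump_bounds(3)[of n c d x] by blast
      then show ?thesis by simp
    qed
  qed
  have "(\<lambda>n. LINT x|lborel. box_bump n c d x *\<^sub>R (indicator (cbox c d) x *\<^sub>R g x))
    \<longlonglongrightarrow> (LINT x|lborel. indicator (box c d) x *\<^sub>R (indicator (cbox c d) x *\<^sub>R g x))"
  proof (rule integral_dominated_convergence[where w="\<lambda>x. norm (indicator (cbox c d) x *\<^sub>R g x)"])
    show "(\<lambda>x. indicator (box c d) x *\<^sub>R (indicator (cbox c d) x *\<^sub>R g x)) \<in> borel_measurable lborel"
      using i1 unfolding set_integrable_def by - (rule borel_measurable_scaleR, auto)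
    show "(\<lambda>x. box_bump n c d x *\<^sub>R (indicator (cbox c d) x *\<^sub>R g x)) \<in> borel_measurable lborel" for n
      using i1 test_function_measurable[OF test_function_box_bump[OF sub]]
      unfolding set_integrable_def by - (rule borel_measurable_scaleR, auto)
    show "integrable lborel (\<lambda>x. norm (indicator (cbox c d) x *\<^sub>R g x))"
      using i1 unfolding set_integrable_def by (rule integrable_norm)
    show "AE x in lborel. (\<lambda>n. box_bump n c d x *\<^sub>R indicator (cbox c d) x *\<^sub>R g x) \<longlonglongrightarrow> indicator (box c d) x *\<^sub>R indicator (cbox c d) x *\<^sub>R g x"
      by (intro AE_I2 tendsto_scaleR box_bump_tendsto tendsto_const)
    show "AE x in lborel. norm (box_bump n c d x *\<^sub>R indicator (cbox c d) x *\<^sub>R g x) \<le> norm (indicator (cbox c d) x *\<^sub>R g x)" for n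
    proof (rule AE_I2)
      fix x
      have "norm (box_bump n c d x) * norm (indicator (cbox c d) x *\<^sub>R g x) \<le> 1 * norm (indicator (cbox c d) x *\<^sub>R g x)"
        using box_bump_bounds(1,2)[of n c d x] by (intro mult_right_mono) auto
      then show "norm (box_bump n c d x *\<^sub>R indicator (cbox c d) x *\<^sub>R g x) \<le> norm (indicator (cbox c d) x *\<^sub>R g x)"
        by (simp only: norm_scaleR real_norm_def mult_1)
    qed
  qed
  moreover have "(LINT x|lborel. box_bump n c d x *\<^sub>R (indicator (cbox c d) x *\<^sub>R g x)) = 0" for n
    using zero[OF test_function_box_bump[OF sub, of n]] unfolding set_lebesgue_integral_def eq .
  moreover have "(\<lambda>x. indicator (box c d) x *\<^sub>R (indicator (cbox c d) x *\<^sub>R g x)) = (\<lambda>x. indicator (box c d) x *\<^sub>R g x)"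
    using box_subset_cbox[of c d] by (auto simp: indicator_def fun_eq_iff)
  ultimately show "(LINT x:box c d|lborel. g x) = 0"
    unfolding set_lebesgue_integral_def by (simp only: LIMSEQ_const_iff)
qed

lemma has_weak_deriv_unique:
  assumes "open U" "has_weak_deriv U b u g" "has_weak_deriv U b u h"
  shows "AE x\<in>U in lborel. g x = h x"
proof -
  have "AE x\<in>U in lborel. g x - h x = 0"
  proof (rule AE_zero_if_test_integrals_zero[OF assms(1)])
    show "locally_integrable U (\<lambda>x. g x - h x)"
      using assms unfolding has_weak_deriv_def by (intro locally_integrable_diff) auto
    fix \<psi> :: "'a \<Rightarrow> real" assume t: "test_function U \<psi>"
    have "(LINT x:U|lborel. \<psi> x *\<^sub>R g x) = (LINT x:U|lborel. \<psi> x *\<^sub>R h x)"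
      using assms(2,3) t unfolding has_weak_deriv_def by (metis neg_equal_iff_equal)
    then show "(LINT x:U|lborel. \<psi> x *\<^sub>R (g x - h x)) = 0"
      using assms(2,3) test_function_integrable[OF t, of g] test_function_integrable[OF t, of h]
      unfolding has_weak_deriv_def scaleR_diff_right by (subst set_integral_diff) auto
  qed
  then show ?thesis by simp
qed

lemma has_weak_gradient_unique:
  assumes "open \<Omega>" "has_weak_gradient \<Omega> u G" "has_weak_gradient \<Omega> u H"
  shows "AE x\<in>\<Omega> in lborel. G x = H x"
proof -
  have "AE x in lborel. \<forall>j\<in>UNIV. x \<in> \<Omega> \<longrightarrow> column j (G x) = column j (H x)"
    using assms has_weak_deriv_unique unfolding has_weak_gradient_def
    by (intro AE_finite_allI) (auto, blast)
  then show ?thesis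
    by eventually_elim (auto simp: column_def vec_eq_iff)
qed

section \<open>Lebesgue seminorms and Hoelder inequalities\<close>

text \<open>The estimates hold for any measure, and below they are used with Lebesgue measure on the whole
  space, on \<open>\<Omega>\<close>, and on time intervals.\<close>

definition Lp_mem :: "real \<Rightarrow> 'a measure \<Rightarrow> ('a \<Rightarrow> 'b::euclidean_space) \<Rightarrow> bool" where
  "Lp_mem p M f \<longleftrightarrow> f \<in> borel_measurable M \<and> integrable M (\<lambda>x. norm (f x) powr p)"

definition Lp_seminorm :: "real \<Rightarrow> 'a measure \<Rightarrow> ('a \<Rightarrow> 'b::euclidean_space) \<Rightarrow> real" where
  "Lp_seminorm p M f = (\<integral>x. norm (f x) powr p \<partial>M) powr (1 / p)"

lemma in_Lp_iff: "A \<in> sets lborel \<Longrightarrow> in_Lp p A f \<longleftrightarrow> Lp_mem p (restrict_space lborel A) f"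
  unfolding in_Lp_def Lp_mem_def set_borel_measurable_def set_integrable_def
  by (simp add: borel_measurable_restrict_space_iff integrable_restrict_space)

lemma Lp_norm_eq: "A \<in> sets lborel \<Longrightarrow> Lp_norm p A f = Lp_seminorm p (restrict_space lborel A) f"
  unfolding Lp_norm_def Lp_seminorm_def set_lebesgue_integral_def
  by (simp add: integral_restrict_space)

lemma L2_inner_eq: "A \<in> sets lborel \<Longrightarrow> L2_inner A f g = (\<integral>x. f x \<bullet> g x \<partial>restrict_space lborel A)"
  unfolding L2_inner_def set_lebesgue_integral_def
  by (simp add: integral_restrict_space)

lemma Lp_seminorm_nonneg: "0 \<le> Lp_seminorm p M f"
  unfolding Lp_seminorm_def by simp

lemma Lp_seminorm_powr: "p > 0 \<Longrightarrow> Lp_seminorm p M f powr p = (\<integral>x. norm (f x) powr p \<partial>M)"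
  unfolding Lp_seminorm_def by (simp add: powr_powr)

lemma Lp_seminorm_2: "(Lp_seminorm 2 M f)\<^sup>2 = (\<integral>x. (norm (f x))\<^sup>2 \<partial>M)"
  using Lp_seminorm_powr[of 2 M f] Lp_seminorm_nonneg[of 2 M f] by simp

lemma Lp_seminorm_3: "(Lp_seminorm 3 M f) ^ 3 = (\<integral>x. (norm (f x)) ^ 3 \<partial>M)"
  using Lp_seminorm_powr[of 3 M f] Lp_seminorm_nonneg[of 3 M f] by simp

lemma Lp_mem_2: "Lp_mem 2 M f \<longleftrightarrow> f \<in> borel_measurable M \<and> integrable M (\<lambda>x. (norm (f x))\<^sup>2)"
  unfolding Lp_mem_def by simp

lemma Lp_mem_3: "Lp_mem 3 M f \<longleftrightarrow> f \<in> borel_measurable M \<and> integrable M (\<lambda>x. (norm (f x)) ^ 3)"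
  unfolding Lp_mem_def by simp

lemma Lp_seminorm_eq_0:
  assumes "p > 0" "Lp_mem p M f" "Lp_seminorm p M f = 0"
  shows "AE x in M. f x = 0"
proof -
  have "(\<integral>x. norm (f x) powr p \<partial>M) = 0"
    using Lp_seminorm_powr[OF assms(1), of M f] assms by simp
  then have "AE x in M. norm (f x) powr p = 0"
    using assms(2) unfolding Lp_mem_def by (subst (asm) integral_nonneg_eq_0_iff_AE) auto
  then show ?thesis by eventually_elim (use assms(1) in auto)
qed

text \<open>With $t = 1 - 1/p = 1/q + 1/r$, the weighted inequality for two factors is applied first to
  $a^p$ and $(bc)^{1/t}$ with weights $1/p$ and $t$, and then to $b^q$ and $c^r$ with weights
  $1/(qt)$ and $1/(rt)$.\<close>

lemma Young3:
  fixes a b c :: real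
  assumes "0 \<le> a" "0 \<le> b" "0 \<le> c" "p > 1" "q > 1" "r > 1" "1/p + 1/q + 1/r = 1"
  shows "a * b * c \<le> a powr p / p + b powr q / q + c powr r / r"
proof (cases "a = 0 \<or> b = 0 \<or> c = 0")
  case True
  then show ?thesis using assms by auto
next
  case False
  then have pos: "a > 0" "b > 0" "c > 0" using assms by auto
  define t where "t = 1 - 1 / p"
  have t: "t = 1/q + 1/r" "t > 0" using assms unfolding t_def by (auto simp: field_simps)
  define y where "y = (b * c) powr (1 / t)"
  have "a * (b * c) = (a powr p) powr (1/p) * y powr t"
    using pos assms t unfolding y_def by (simp add: powr_powr)
  also have "\<dots> \<le> 1/p * a powr p + t * y"
    using assms t pos by (intro Youngs_inequality_0) (auto simp: t_def y_def)
  also have yeq: "y = (b powr q) powr (1/(q*t)) * (c powr r) powr (1/(r*t))"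
    using pos assms t unfolding y_def by (simp add: powr_powr powr_mult field_simps)
  also have "1/p * a powr p + t * ((b powr q) powr (1/(q*t)) * (c powr r) powr (1/(r*t))) \<le> 1/p * a powr p + t * (1/(q*t) * b powr q + 1/(r*t) * c powr r)"
  proof (intro add_left_mono mult_left_mono Youngs_inequality_0)
    have "1/(q*t) + 1/(r*t) = (1/q + 1/r) / t" by (simp add: add_divide_distrib)
    then show "1/(q*t) + 1/(r*t) = 1" using t by simp
  qed (use assms t pos in auto)
  also have "\<dots> = a powr p / p + b powr q / q + c powr r / r"
    using t(2) by (simp add: distrib_left)
  finally show ?thesis by (simp add: mult.assoc)
qed

lemma Holder3:
  fixes f :: "'a \<Rightarrow> 'b::euclidean_space" and g :: "'a \<Rightarrow> 'c::euclidean_space" and h :: "'a \<Rightarrow> 'd::euclidean_space"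
  assumes f: "Lp_mem p M f" and g: "Lp_mem q M g" and h: "Lp_mem r M h"
    and pqr: "p > 1" "q > 1" "r > 1" "1/p + 1/q + 1/r = 1"
  shows "integrable M (\<lambda>x. norm (f x) * norm (g x) * norm (h x))"
    and "(\<integral>x. norm (f x) * norm (g x) * norm (h x) \<partial>M) \<le> Lp_seminorm p M f * Lp_seminorm q M g * Lp_seminorm r M h"
proof -
  have [measurable]: "f \<in> borel_measurable M" "g \<in> borel_measurable M" "h \<in> borel_measurable M"
    using f g h unfolding Lp_mem_def by auto
  have pos: "p > 0" "q > 0" "r > 0" using pqr(1-3) by linarith+
  let ?A = "Lp_seminorm p M f" and ?B = "Lp_seminorm q M g" and ?C = "Lp_seminorm r M h"
  show int: "integrable M (\<lambda>x. norm (f x) * norm (g x) * norm (h x))"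
  proof (rule Bochner_Integration.integrable_bound)
    show "integrable M (\<lambda>x. norm (f x) powr p / p + norm (g x) powr q / q + norm (h x) powr r / r)"
      using f g h unfolding Lp_mem_def by (intro Bochner_Integration.integrable_add) auto
    show "AE x in M. norm (norm (f x) * norm (g x) * norm (h x)) \<le> norm (norm (f x) powr p / p + norm (g x) powr q / q + norm (h x) powr r / r)"
    proof (rule AE_I2)
      fix x
      have "norm (f x) * norm (g x) * norm (h x) \<le> norm (f x) powr p / p + norm (g x) powr q / q + norm (h x) powr r / r"
        by (rule Young3) (use pqr in auto)
      then show "norm (norm (f x) * norm (g x) * norm (h x)) \<le> norm (norm (f x) powr p / p + norm (g x) powr q / q + norm (h x) powr r / r)"
        by (simp add: abs_of_nonneg)
    qed
  qed measurable
  show "(\<integral>x. norm (f x) * norm (g x) * norm (h x) \<partial>M) \<le> ?A * ?B * ?C"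
  proof (cases "?A = 0 \<or> ?B = 0 \<or> ?C = 0")
    case True
    then have "AE x in M. norm (f x) * norm (g x) * norm (h x) = 0"
      using Lp_seminorm_eq_0[OF pos(1) f] Lp_seminorm_eq_0[OF pos(2) g] Lp_seminorm_eq_0[OF pos(3) h]
      by (auto elim!: eventually_mono)
    then have "(\<integral>x. norm (f x) * norm (g x) * norm (h x) \<partial>M) = 0"
      by (simp add: integral_eq_zero_AE)
    then show ?thesis using Lp_seminorm_nonneg by (metis mult_nonneg_nonneg)
  next
    case False
    then have P: "?A > 0" "?B > 0" "?C > 0"
      using Lp_seminorm_nonneg[of p M f] Lp_seminorm_nonneg[of q M g] Lp_seminorm_nonneg[of r M h] by auto
    have "(\<integral>x. norm (f x) * norm (g x) * norm (h x) / (?A * ?B * ?C) \<partial>M)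
        \<le> (\<integral>x. norm (f x) powr p / (?A powr p * p) + norm (g x) powr q / (?B powr q * q) + norm (h x) powr r / (?C powr r * r) \<partial>M)"
    proof (rule integral_mono)
      show "integrable M (\<lambda>x. norm (f x) * norm (g x) * norm (h x) / (?A * ?B * ?C))"
        using int by (rule integrable_divide)
      show "integrable M (\<lambda>x. norm (f x) powr p / (?A powr p * p) + norm (g x) powr q / (?B powr q * q) + norm (h x) powr r / (?C powr r * r))"
        using f g h unfolding Lp_mem_def by (intro Bochner_Integration.integrable_add) auto
      fix x
      have "norm (f x) / ?A * (norm (g x) / ?B) * (norm (h x) / ?C) \<le>
          (norm (f x) / ?A) powr p / p + (norm (g x) / ?B) powr q / q + (norm (h x) / ?C) powr r / r"
        by (rule Young3) (use pqr P in auto)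
      also have "\<dots> = norm (f x) powr p / (?A powr p * p) + norm (g x) powr q / (?B powr q * q) + norm (h x) powr r / (?C powr r * r)"
        using P by (simp add: powr_divide)
      finally show "norm (f x) * norm (g x) * norm (h x) / (?A * ?B * ?C) \<le> norm (f x) powr p / (?A powr p * p) + norm (g x) powr q / (?B powr q * q) + norm (h x) powr r / (?C powr r * r)"
        by (simp add: field_simps)
    qed
    also have "\<dots> = ?A powr p / (?A powr p * p) + ?B powr q / (?B powr q * q) + ?C powr r / (?C powr r * r)"
      using f g h unfolding Lp_mem_def Lp_seminorm_powr[OF pos(1)] Lp_seminorm_powr[OF pos(2)] Lp_seminorm_powr[OF pos(3)]
      by (subst Bochner_Integration.integral_add Bochner_Integration.integrable_add; (intro Bochner_Integration.integrable_add)?; simp)+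
    also have "\<dots> = 1/p + 1/q + 1/r" using P by simp
    also have "\<dots> = 1" by (rule pqr)
    finally have "(\<integral>x. norm (f x) * norm (g x) * norm (h x) \<partial>M) / (?A * ?B * ?C) \<le> 1" by simp
    then show ?thesis using P by (simp add: divide_le_eq)
  qed
qed

lemma Cauchy_Schwarz_L2:
  fixes f :: "'a \<Rightarrow> 'b::euclidean_space" and g :: "'a \<Rightarrow> 'c::euclidean_space"
  assumes f: "Lp_mem 2 M f" and g: "Lp_mem 2 M g"
  shows "integrable M (\<lambda>x. norm (f x) * norm (g x))"
    and "(\<integral>x. norm (f x) * norm (g x) \<partial>M) \<le> Lp_seminorm 2 M f * Lp_seminorm 2 M g"
proof -
  have [measurable]: "f \<in> borel_measurable M" "g \<in> borel_measurable M"
    and i: "integrable M (\<lambda>x. (norm (f x))\<^sup>2)" "integrable M (\<lambda>x. (norm (g x))\<^sup>2)"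
    using f g unfolding Lp_mem_2 by auto
  let ?A = "Lp_seminorm 2 M f" and ?B = "Lp_seminorm 2 M g"
  have am: "a * b \<le> a\<^sup>2 / 2 + b\<^sup>2 / 2" for a b :: real
    using sum_squares_bound[of a b] by simp
  show int: "integrable M (\<lambda>x. norm (f x) * norm (g x))"
  proof (rule Bochner_Integration.integrable_bound)
    show "integrable M (\<lambda>x. (norm (f x))\<^sup>2 / 2 + (norm (g x))\<^sup>2 / 2)"
      using i by (intro Bochner_Integration.integrable_add) auto
    show "AE x in M. norm (norm (f x) * norm (g x)) \<le> norm ((norm (f x))\<^sup>2 / 2 + (norm (g x))\<^sup>2 / 2)"
      using am by (intro AE_I2) (simp add: abs_of_nonneg)
  qed measurable
  show "(\<integral>x. norm (f x) * norm (g x) \<partial>M) \<le> ?A * ?B"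
  proof (cases "?A = 0 \<or> ?B = 0")
    case True
    then have "AE x in M. norm (f x) * norm (g x) = 0"
      using Lp_seminorm_eq_0[OF _ f] Lp_seminorm_eq_0[OF _ g]
      by (auto elim!: eventually_mono)
    then have "(\<integral>x. norm (f x) * norm (g x) \<partial>M) = 0"
      by (simp add: integral_eq_zero_AE)
    then show ?thesis using Lp_seminorm_nonneg by (metis mult_nonneg_nonneg)
  next
    case False
    then have P: "?A > 0" "?B > 0"
      using Lp_seminorm_nonneg[of 2 M f] Lp_seminorm_nonneg[of 2 M g] by auto
    have "(\<integral>x. norm (f x) * norm (g x) / (?A * ?B) \<partial>M)
        \<le> (\<integral>x. (norm (f x))\<^sup>2 / (2 * ?A\<^sup>2) + (norm (g x))\<^sup>2 / (2 * ?B\<^sup>2) \<partial>M)"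
    proof (rule integral_mono)
      show "integrable M (\<lambda>x. norm (f x) * norm (g x) / (?A * ?B))"
        using int by (rule integrable_divide)
      show "integrable M (\<lambda>x. (norm (f x))\<^sup>2 / (2 * ?A\<^sup>2) + (norm (g x))\<^sup>2 / (2 * ?B\<^sup>2))"
        using i by (intro Bochner_Integration.integrable_add) auto
      fix x
      show "norm (f x) * norm (g x) / (?A * ?B) \<le> (norm (f x))\<^sup>2 / (2 * ?A\<^sup>2) + (norm (g x))\<^sup>2 / (2 * ?B\<^sup>2)"
        using am[of "norm (f x) / ?A" "norm (g x) / ?B"] by (simp add: power_divide mult.commute)
    qed
    also have "\<dots> = (\<integral>x. (norm (f x))\<^sup>2 \<partial>M) / (2 * ?A\<^sup>2) + (\<integral>x. (norm (g x))\<^sup>2 \<partial>M) / (2 * ?B\<^sup>2)"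
      using i by simp
    also have "\<dots> = 1" using P unfolding Lp_seminorm_2[symmetric] by simp
    finally have "(\<integral>x. norm (f x) * norm (g x) \<partial>M) / (?A * ?B) \<le> 1" by simp
    then show ?thesis using P by (simp add: divide_le_eq)
  qed
qed

lemma L2_inner_bound:
  fixes f g :: "'a \<Rightarrow> 'b::euclidean_space"
  assumes f: "Lp_mem 2 M f" and g: "Lp_mem 2 M g"
  shows "integrable M (\<lambda>x. f x \<bullet> g x)"
    and "\<bar>\<integral>x. f x \<bullet> g x \<partial>M\<bar> \<le> Lp_seminorm 2 M f * Lp_seminorm 2 M g"
proof -
  have [measurable]: "f \<in> borel_measurable M" "g \<in> borel_measurable M"
    using f g unfolding Lp_mem_2 by auto
  note cs = Cauchy_Schwarz_L2[OF f g]
  show i: "integrable M (\<lambda>x. f x \<bullet> g x)"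
    by (rule Bochner_Integration.integrable_bound[OF cs(1)])
       (auto intro!: AE_I2 simp: Cauchy_Schwarz_ineq2 abs_mult)
  have "\<bar>\<integral>x. f x \<bullet> g x \<partial>M\<bar> \<le> (\<integral>x. \<bar>f x \<bullet> g x\<bar> \<partial>M)"
    using integral_norm_bound[of M "\<lambda>x. f x \<bullet> g x"] by simp
  also have "\<dots> \<le> (\<integral>x. norm (f x) * norm (g x) \<partial>M)"
    using i cs(1) by (intro integral_mono) (auto simp: Cauchy_Schwarz_ineq2)
  also note cs(2)
  finally show "\<bar>\<integral>x. f x \<bullet> g x \<partial>M\<bar> \<le> Lp_seminorm 2 M f * Lp_seminorm 2 M g" .
qed

lemma Lp_mem_mono:
  assumes "finite_measure M" "Lp_mem p M f" "0 < q" "q \<le> p"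
  shows "Lp_mem q M f"
proof -
  have [measurable]: "f \<in> borel_measurable M" using assms unfolding Lp_mem_def by simp
  have "integrable M (\<lambda>x. norm (f x) powr q)"
  proof (rule Bochner_Integration.integrable_bound)
    show "integrable M (\<lambda>x. 1 + norm (f x) powr p)"
      using assms unfolding Lp_mem_def by (intro Bochner_Integration.integrable_add) (auto simp: finite_measure.integrable_const)
    show "AE x in M. norm (norm (f x) powr q) \<le> norm (1 + norm (f x) powr p)"
    proof (rule AE_I2)
      fix x
      show "norm (norm (f x) powr q) \<le> norm (1 + norm (f x) powr p)"
      proof (cases "norm (f x) \<le> 1")
        case True
        then have "norm (f x) powr q \<le> 1 powr q" using assms by (intro powr_mono2) auto
        then show ?thesis by (simp add: add_increasing2)
      next
        case False
        then have "norm (f x) powr q \<le> norm (f x) powr p" using assms by (intro powr_mono) auto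
        then show ?thesis by simp
      qed
    qed
  qed measurable
  then show ?thesis unfolding Lp_mem_def by simp
qed

text \<open>The factor $2$, in place of the sharp triangle inequality of Minkowski, comes from the pointwise
  bound $|f - g| \<le> 2 \max(|f|, |g|)$.  It costs nothing in arguments that only need some constant.\<close>

lemma Lp_mem_diff:
  fixes f g :: "'a \<Rightarrow> 'b::euclidean_space"
  assumes p: "p \<ge> 1" and f: "Lp_mem p M f" and g: "Lp_mem p M g"
  shows "Lp_mem p M (\<lambda>x. f x - g x)"
    and "Lp_seminorm p M (\<lambda>x. f x - g x) \<le> 2 * (Lp_seminorm p M f + Lp_seminorm p M g)"
proof -
  have [measurable]: "f \<in> borel_measurable M" "g \<in> borel_measurable M"
    and i: "integrable M (\<lambda>x. norm (f x) powr p)" "integrable M (\<lambda>x. norm (g x) powr p)"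
    using f g unfolding Lp_mem_def by auto
  have bd: "norm (f x - g x) powr p \<le> 2 powr p * (norm (f x) powr p + norm (g x) powr p)" for x
  proof -
    have "norm (f x - g x) \<le> 2 * max (norm (f x)) (norm (g x))"
      using norm_triangle_ineq4[of "f x" "g x"] by simp
    then have "norm (f x - g x) powr p \<le> (2 * max (norm (f x)) (norm (g x))) powr p"
      using p by (intro powr_mono2) auto
    also have "\<dots> = 2 powr p * max (norm (f x)) (norm (g x)) powr p" by (simp add: powr_mult)
    also have "\<dots> \<le> 2 powr p * (norm (f x) powr p + norm (g x) powr p)"
      by (intro mult_left_mono) (auto simp: max_def)
    finally show ?thesis .
  qed
  have j: "integrable M (\<lambda>x. 2 powr p * (norm (f x) powr p + norm (g x) powr p))"
    using i by simp
  have k: "integrable M (\<lambda>x. norm (f x - g x) powr p)"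
    by (rule Bochner_Integration.integrable_bound[OF j])
       (use bd in \<open>auto intro!: AE_I2 simp: abs_of_nonneg\<close>)
  then show "Lp_mem p M (\<lambda>x. f x - g x)" unfolding Lp_mem_def by simp
  let ?a = "\<integral>x. norm (f x) powr p \<partial>M" and ?b = "\<integral>x. norm (g x) powr p \<partial>M"
  have ab: "?a \<ge> 0" "?b \<ge> 0" by simp_all
  have sub: "(a + b) powr (1/p) \<le> a powr (1/p) + b powr (1/p)" if "a \<ge> 0" "b \<ge> 0" for a b :: real
  proof (cases "a + b = 0")
    case False
    then have P: "a + b > 0" using that by simp
    have le: "x \<le> x powr (1/p)" if "0 \<le> x" "x \<le> 1" for x :: real
      using that p powr_mono'[of "1/p" 1 x] by (cases "x = 0") auto
    have "1 = a / (a + b) + b / (a + b)" using P by (simp add: add_divide_distrib[symmetric])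
    also have "\<dots> \<le> (a / (a + b)) powr (1/p) + (b / (a + b)) powr (1/p)"
      using that P by (intro add_mono le) auto
    also have "\<dots> = (a powr (1/p) + b powr (1/p)) / (a + b) powr (1/p)"
      using that P by (simp add: powr_divide add_divide_distrib)
    finally show ?thesis using P by (simp add: le_divide_eq)
  qed (use that in auto)
  have "Lp_seminorm p M (\<lambda>x. f x - g x) \<le> (\<integral>x. 2 powr p * (norm (f x) powr p + norm (g x) powr p) \<partial>M) powr (1/p)"
    unfolding Lp_seminorm_def using k j bd p by (intro powr_mono2 integral_mono) (auto intro!: integral_nonneg_AE)
  also have "\<dots> = (2 powr p * (?a + ?b)) powr (1/p)" using i by simp
  also have "\<dots> = 2 * (?a + ?b) powr (1/p)" using ab p by (simp add: powr_mult powr_powr)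
  also have "\<dots> \<le> 2 * (?a powr (1/p) + ?b powr (1/p))" using sub[OF ab] by simp
  finally show "Lp_seminorm p M (\<lambda>x. f x - g x) \<le> 2 * (Lp_seminorm p M f + Lp_seminorm p M g)"
    unfolding Lp_seminorm_def .
qed

section \<open>Absolute continuity in time\<close>

lemma (in pair_sigma_finite) integrable_pair_scaleR:
  fixes f :: "'a \<Rightarrow> real" and g :: "'b \<Rightarrow> 'c::euclidean_space"
  assumes f: "integrable M1 f" and g: "integrable M2 g"
  shows "integrable (M1 \<Otimes>\<^sub>M M2) (\<lambda>(x, y). f x *\<^sub>R g y)"
proof (rule Fubini_integrable)
  have [measurable]: "f \<in> borel_measurable M1" "g \<in> borel_measurable M2" using f g by auto
  show "(\<lambda>(x, y). f x *\<^sub>R g y) \<in> borel_measurable (M1 \<Otimes>\<^sub>M M2)" by measurable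
  show "integrable M1 (\<lambda>x. \<integral>y. norm (case (x, y) of (x, y) \<Rightarrow> f x *\<^sub>R g y) \<partial>M2)"
    using f by simp
  show "AE x in M1. integrable M2 (\<lambda>y. case (x, y) of (x, y) \<Rightarrow> f x *\<^sub>R g y)"
    using g by simp
qed

text \<open>A smooth function supported in an interval is the derivative of another one exactly if its
  mean vanishes.  Such functions are the ones that a distributional derivative can be tested against.\<close>

lemma smooth_primitive:
  fixes \<beta> :: "real \<Rightarrow> real"
  assumes \<beta>: "smooth \<beta>" and out: "\<And>x. x \<notin> {a..b} \<Longrightarrow> \<beta> x = 0" and ab: "a < b"
    and zero: "(LINT x:{a..b}|lborel. \<beta> x) = (0::real)"
  obtains \<theta> where "smooth \<theta>" "\<And>x. dir_deriv 1 \<theta> x = \<beta> x" "\<And>x. x \<notin> {a..b} \<Longrightarrow> \<theta> x = 0"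
    "\<And>x. x \<in> {a..b} \<Longrightarrow> \<theta> x = - (LINT y:{x..b}|lborel. \<beta> y)"
proof -
  have cont: "continuous_on A \<beta>" for A using smooth_continuous_on[OF \<beta>] .
  then have isc: "isCont \<beta> x" for x using continuous_on_eq_continuous_at[OF open_UNIV] by blast
  obtain F where F: "(F has_vector_derivative \<beta> x) (at x)" for x
    using einterval_antiderivative[of "-\<infinity>" "\<infinity>" \<beta>] isc by auto
  define \<theta> where "\<theta> x = F x - F b" for x
  have d: "(\<theta> has_vector_derivative \<beta> x) (at x)" for x
    unfolding \<theta>_def using F[of x] by (auto intro!: derivative_eq_intros)
  have dd: "dir_deriv c \<theta> = (\<lambda>x. c * \<beta> x)" for c
    using dir_derivI[OF d[unfolded has_vector_derivative_def]] by auto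
  have ftc: "(LINT y:{x..z}|lborel. \<beta> y) = F z - F x" if "x \<le> z" for x z
    unfolding set_lebesgue_integral_def
    by (rule integral_FTC_Icc[OF that _ cont]) (use F has_vector_derivative_at_within in blast)
  have "smooth \<theta>"
  proof (rule smooth_step)
    show "\<theta> differentiable_on UNIV"
      using d unfolding differentiable_on_def has_vector_derivative_def by (auto intro: differentiableI)
    show "smooth (dir_deriv c \<theta>)" for c unfolding dd
      by (rule smooth_linear_image(1)[OF bounded_linear_mult_right \<beta>])
  qed
  moreover have "\<theta> x = 0" if x: "x \<notin> {a..b}" for x
  proof -
    have z: "(LINT y:A|lborel. \<beta> y) = 0" if "A \<inter> {a<..<b} = {}" for A
    proof -
      have ne: "\<beta> y = 0" if "y \<in> A" "y \<noteq> a" "y \<noteq> b" for y using out[of y] that \<open>A \<inter> {a<..<b} = {}\<close> by force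
      have "AE y in lborel. indicator A y *\<^sub>R \<beta> y = 0"
        using AE_lborel_singleton[of a] AE_lborel_singleton[of b]
        by eventually_elim (use ne in \<open>auto simp: indicator_def\<close>)
      then show ?thesis unfolding set_lebesgue_integral_def by (rule integral_eq_zero_AE)
    qed
    have "F b = F a" using ftc[of a b] zero ab by simp
    moreover have "F a - F x = 0" if "x < a" using ftc[of x a] z[of "{x..a}"] that by force
    moreover have "F x - F b = 0" if "x > b" using ftc[of b x] z[of "{b..x}"] that by force
    ultimately show ?thesis using x unfolding \<theta>_def by force
  qed
  moreover have "dir_deriv 1 \<theta> x = \<beta> x" for x using dd by simp
  moreover have "\<theta> x = - (LINT y:{x..b}|lborel. \<beta> y)" if "x \<in> {a..b}" for x
    using ftc[of x b] that unfolding \<theta>_def by simp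
  ultimately show ?thesis using that by blast
qed

lemma test_functionI:
  assumes "smooth \<psi>" "compact K" "K \<subseteq> U" "\<And>x. x \<notin> K \<Longrightarrow> \<psi> x = 0"
  shows "test_function U \<psi>"
proof -
  have "closure {x. \<psi> x \<noteq> 0} \<subseteq> K"
    using assms by (intro closure_minimal) (auto intro: compact_imp_closed)
  moreover then have "compact (closure {x. \<psi> x \<noteq> 0})"
    using assms(2) by (meson bounded_subset closed_closure compact_eq_bounded_closed)
  ultimately show ?thesis unfolding test_function_def using assms by blast
qed

text \<open>Integration by parts for a merely integrable \<open>g\<close>: both sides are the integral of
  $\beta(y)\, g(\tau)$ over the triangle $a \<le> \tau \<le> y \<le> b$.\<close>

lemma integral_against_primitive:
  fixes g :: "real \<Rightarrow> 'b::euclidean_space" and \<beta> \<theta> :: "real \<Rightarrow> real"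
  assumes g: "set_integrable lborel {a..b} g" and \<beta>: "set_integrable lborel {a..b} \<beta>"
    and \<theta>: "\<And>x. x \<in> {a..b} \<Longrightarrow> \<theta> x = - (LINT y:{x..b}|lborel. \<beta> y)"
  defines "P \<equiv> \<lambda>y. LINT \<tau>:{a..y}|lborel. g \<tau>"
  shows "(LINT \<tau>:{a..b}|lborel. \<theta> \<tau> *\<^sub>R g \<tau>) = - (LINT y:{a..b}|lborel. \<beta> y *\<^sub>R P y)"
    and "set_integrable lborel {a..b} (\<lambda>y. \<beta> y *\<^sub>R P y)"
proof -
  let ?b = "\<lambda>y. indicator {a..b} y * \<beta> y" and ?g = "\<lambda>\<tau>. indicator {a..b} \<tau> *\<^sub>R g \<tau>"
  let ?K = "\<lambda>(y, \<tau>). indicator {(y, \<tau>). \<tau> \<le> y} (y, \<tau>) *\<^sub>R (?b y *\<^sub>R ?g \<tau>)"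
  have i: "integrable (lborel \<Otimes>\<^sub>M lborel) (\<lambda>(y, \<tau>). ?b y *\<^sub>R ?g \<tau>)"
    using g \<beta> unfolding set_integrable_def by (intro lborel_pair.integrable_pair_scaleR) simp_all
  have m: "{(y, \<tau>). \<tau> \<le> (y::real)} \<in> sets (lborel \<Otimes>\<^sub>M lborel)"
  proof -
    have "closed {p :: real \<times> real. snd p \<le> fst p}" by (intro closed_Collect_le continuous_intros)
    then show ?thesis unfolding lborel_prod by (simp add: case_prod_unfold borel_closed)
  qed
  have K: "integrable (lborel \<Otimes>\<^sub>M lborel) ?K"
    using integrable_mult_indicator[OF m i] by (simp only: case_prod_unfold prod.collapse)
  have inner1: "(\<integral>\<tau>. ?K (y, \<tau>) \<partial>lborel) = indicator {a..b} y *\<^sub>R (\<beta> y *\<^sub>R P y)" for y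
  proof -
    have "(\<lambda>\<tau>. ?K (y, \<tau>)) = (\<lambda>\<tau>. ?b y *\<^sub>R (indicator {a..y} \<tau> *\<^sub>R g \<tau>))"
      by (auto simp: indicator_def fun_eq_iff)
    then have "(\<integral>\<tau>. ?K (y, \<tau>) \<partial>lborel) = ?b y *\<^sub>R P y"
      unfolding P_def set_lebesgue_integral_def by (simp only: integral_scaleR_right)
    then show ?thesis by simp
  qed
  have inner2: "(\<integral>y. ?K (y, \<tau>) \<partial>lborel) = - (indicator {a..b} \<tau> *\<^sub>R (\<theta> \<tau> *\<^sub>R g \<tau>))" for \<tau>
  proof -
    have i: "integrable lborel (\<lambda>y. indicator {\<tau>..b} y *\<^sub>R \<beta> y)" if "\<tau> \<in> {a..b}"
      using set_integrable_subset[OF \<beta>, of "{\<tau>..b}"] that unfolding set_integrable_def by simp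
    have eq: "(\<lambda>y. ?K (y, \<tau>)) = (\<lambda>y. (indicator {\<tau>..b} y *\<^sub>R \<beta> y) *\<^sub>R ?g \<tau>)"
      by (auto simp: indicator_def fun_eq_iff)
    have "(\<integral>y. ?K (y, \<tau>) \<partial>lborel) = (LINT y:{\<tau>..b}|lborel. \<beta> y) *\<^sub>R ?g \<tau>"
    proof (cases "\<tau> \<in> {a..b}")
      case True
      show ?thesis unfolding eq set_lebesgue_integral_def
        by (rule integral_scaleR_left) (rule i[OF True])
    next
      case False
      then have "(\<lambda>y. ?K (y, \<tau>)) = (\<lambda>y. 0)" by (auto simp: indicator_def)
      then show ?thesis using False by (simp only: integral_zero) simp
    qed
    then show ?thesis using \<theta>[of \<tau>] by (auto simp: indicator_def)
  qed
  show "set_integrable lborel {a..b} (\<lambda>y. \<beta> y *\<^sub>R P y)"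
    using lborel_pair.integrable_fst'[OF K] unfolding inner1 set_integrable_def .
  show "(LINT \<tau>:{a..b}|lborel. \<theta> \<tau> *\<^sub>R g \<tau>) = - (LINT y:{a..b}|lborel. \<beta> y *\<^sub>R P y)"
  proof -
    have "integrable (lborel \<Otimes>\<^sub>M lborel) (case_prod (\<lambda>y \<tau>. ?K (y, \<tau>)))"
      using K by (simp only: case_prod_conv)
    then have "(\<integral>\<tau>. (\<integral>y. ?K (y, \<tau>) \<partial>lborel) \<partial>lborel) = (\<integral>y. (\<integral>\<tau>. ?K (y, \<tau>) \<partial>lborel) \<partial>lborel)"
      by (rule lborel_pair.Fubini_integral)
    then have "- (LINT \<tau>:{a..b}|lborel. \<theta> \<tau> *\<^sub>R g \<tau>) = (LINT y:{a..b}|lborel. \<beta> y *\<^sub>R P y)"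
      unfolding inner1 inner2 set_lebesgue_integral_def Bochner_Integration.integral_minus .
    then show ?thesis by (metis minus_minus)
  qed
qed

text \<open>The lemma of du Bois-Reymond.  The difference \<open>F\<close> of \<open>f\<close> and the primitive of \<open>g\<close> annihilates
  all bumps of mean zero, so its averages over all subintervals coincide, and \<open>F\<close> is constant.\<close>

lemma distributional_FTC:
  fixes f g :: "real \<Rightarrow> 'b::euclidean_space"
  assumes ab: "a < b" "{a..b} \<subseteq> I"
    and f: "set_integrable lborel {a..b} f" and g: "set_integrable lborel {a..b} g"
    and dist: "\<And>\<theta>. test_function I \<theta> \<Longrightarrow> (\<And>x. x \<notin> {a..b} \<Longrightarrow> \<theta> x = 0) \<Longrightarrow>
      (LINT t:{a..b}|lborel. dir_deriv 1 \<theta> t *\<^sub>R f t) = - (LINT t:{a..b}|lborel. \<theta> t *\<^sub>R g t)"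
  shows "\<exists>C. AE t\<in>{a<..<b} in lborel. f t = C + (LINT \<tau>:{a..t}|lborel. g \<tau>)"
proof -
  define P where "P = (\<lambda>y. LINT \<tau>:{a..y}|lborel. g \<tau>)"
  define F where "F t = f t - P t" for t
  have one: "set_integrable lborel {a..b} (\<lambda>x. 1::real)"
    by (rule borel_integrable_atLeastAtMost') simp
  have iP: "set_integrable lborel {a..b} P"
    using integral_against_primitive(2)[OF g one, of "\<lambda>x. - (LINT y:{x..b}|lborel. 1)"] unfolding P_def by simp
  have iF: "set_integrable lborel {a..b} F"
    unfolding F_def using f iP by (rule set_integral_diff)
  have key: "(LINT t:{a..b}|lborel. \<beta> t *\<^sub>R F t) = 0"
    if \<beta>: "smooth \<beta>" and out: "\<And>x. x \<notin> {a..b} \<Longrightarrow> \<beta> x = 0" and zero: "(LINT x:{a..b}|lborel. \<beta> x) = 0" for \<beta>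
  proof -
    obtain \<theta> where \<theta>: "smooth \<theta>" "\<And>x. dir_deriv 1 \<theta> x = \<beta> x" "\<And>x. x \<notin> {a..b} \<Longrightarrow> \<theta> x = 0"
      "\<And>x. x \<in> {a..b} \<Longrightarrow> \<theta> x = - (LINT y:{x..b}|lborel. \<beta> y)"
      using smooth_primitive[OF \<beta> out ab(1) zero] by metis
    have t: "test_function I \<theta>"
      by (rule test_functionI[OF \<theta>(1) _ ab(2) \<theta>(3)]) auto
    have i\<beta>: "set_integrable lborel {a..b} \<beta>"
      using smooth_continuous_on[OF \<beta>] by (rule borel_integrable_atLeastAtMost')
    have t\<beta>: "test_function {a-1<..<b+1} \<beta>"
      by (rule test_functionI[OF \<beta>, of "{a..b}"]) (use out in auto)
    obtain C where C: "\<And>x. norm (\<beta> x) \<le> C" "C \<ge> 0" using test_function_bounded[OF t\<beta>] by blast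
    have i\<beta>f: "set_integrable lborel {a..b} (\<lambda>t. \<beta> t *\<^sub>R f t)"
      unfolding set_integrable_def
    proof (rule Bochner_Integration.integrable_bound)
      show "integrable lborel (\<lambda>x. C * norm (indicator {a..b} x *\<^sub>R f x))"
        using f unfolding set_integrable_def by (intro integrable_mult_right integrable_norm)
      have "(\<lambda>x. \<beta> x *\<^sub>R (indicator {a..b} x *\<^sub>R f x)) \<in> borel_measurable lborel"
        using test_function_measurable[OF t\<beta>] f unfolding set_integrable_def
        by - (rule borel_measurable_scaleR, auto)
      then show "(\<lambda>x. indicator {a..b} x *\<^sub>R \<beta> x *\<^sub>R f x) \<in> borel_measurable lborel"
        by (simp add: mult.commute)
      show "AE x in lborel. norm (indicator {a..b} x *\<^sub>R \<beta> x *\<^sub>R f x) \<le> norm (C * norm (indicator {a..b} x *\<^sub>R f x))"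
        using C by (intro AE_I2) (auto simp: indicator_def intro!: mult_right_mono)
    qed
    note ip = integral_against_primitive[OF g i\<beta> \<theta>(4)]
    have "(LINT t:{a..b}|lborel. \<beta> t *\<^sub>R f t) = (LINT y:{a..b}|lborel. \<beta> y *\<^sub>R P y)"
      using dist[OF t \<theta>(3)] \<theta>(2) ip(1) by (simp add: P_def)
    then show ?thesis
      unfolding F_def scaleR_diff_right using i\<beta>f ip(2) by (simp add: set_integral_diff(2) P_def)
  qed
  have bt: "set_integrable lborel {a..b} (\<lambda>t. bump n c d t *\<^sub>R F t)"
      "(\<lambda>n. LINT t:{a..b}|lborel. bump n c d t *\<^sub>R F t) \<longlonglongrightarrow> (LINT t:{c<..<d}|lborel. F t)"
      if cd: "a \<le> c" "d \<le> b" and iF: "set_integrable lborel {a..b} F" for c d n and F :: "real \<Rightarrow> 'c::euclidean_space"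
  proof -
    have m: "bump n c d \<in> borel_measurable borel" for n
      by (rule borel_measurable_continuous_onI[OF smooth_continuous_on[OF smooth_bump]])
    have meas: "(\<lambda>x. indicator {a..b} x *\<^sub>R (bump n c d x *\<^sub>R F x)) \<in> borel_measurable lborel" for n
    proof -
      have "(\<lambda>x. bump n c d x *\<^sub>R (indicator {a..b} x *\<^sub>R F x)) \<in> borel_measurable lborel"
        using m iF unfolding set_integrable_def by - (rule borel_measurable_scaleR, auto)
      then show ?thesis by (simp add: mult.commute)
    qed
    have bd: "AE x in lborel. norm (indicator {a..b} x *\<^sub>R (bump n c d x *\<^sub>R F x)) \<le> norm (indicator {a..b} x *\<^sub>R F x)" for n
      using bump_bounds(1,2)[of n c d] by (intro AE_I2) (auto simp: indicator_def intro!: mult_left_le_one_le)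
    show "set_integrable lborel {a..b} (\<lambda>t. bump n c d t *\<^sub>R F t)"
      unfolding set_integrable_def
      by (rule Bochner_Integration.integrable_bound[OF iF[unfolded set_integrable_def] meas bd])
    have eq: "(LINT t:{c<..<d}|lborel. F t) = (LINT t|lborel. indicator {c<..<d} t *\<^sub>R (indicator {a..b} t *\<^sub>R F t))"
      unfolding set_lebesgue_integral_def using cd
      by (intro Bochner_Integration.integral_cong) (auto simp: indicator_def)
    show "(\<lambda>n. LINT t:{a..b}|lborel. bump n c d t *\<^sub>R F t) \<longlonglongrightarrow> (LINT t:{c<..<d}|lborel. F t)"
      unfolding eq unfolding set_lebesgue_integral_def
    proof (rule integral_dominated_convergence[where w="\<lambda>x. norm (indicator {a..b} x *\<^sub>R F x)", OF _ meas _ _ bd])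
      show "(\<lambda>x. indicator {c<..<d} x *\<^sub>R (indicator {a..b} x *\<^sub>R F x)) \<in> borel_measurable lborel"
        using iF unfolding set_integrable_def by - (rule borel_measurable_scaleR, auto)
      show "integrable lborel (\<lambda>x. norm (indicator {a..b} x *\<^sub>R F x))"
        using iF unfolding set_integrable_def by (rule integrable_norm)
      show "AE x in lborel. (\<lambda>n. indicator {a..b} x *\<^sub>R (bump n c d x *\<^sub>R F x)) \<longlonglongrightarrow> indicator {c<..<d} x *\<^sub>R (indicator {a..b} x *\<^sub>R F x)"
      proof (rule AE_I2)
        fix x
        have "(\<lambda>n. bump n c d x *\<^sub>R (indicator {a..b} x *\<^sub>R F x)) \<longlonglongrightarrow> indicator {c<..<d} x *\<^sub>R (indicator {a..b} x *\<^sub>R F x)"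
          by (intro tendsto_scaleR bump_tendsto tendsto_const)
        then show "(\<lambda>n. indicator {a..b} x *\<^sub>R (bump n c d x *\<^sub>R F x)) \<longlonglongrightarrow> indicator {c<..<d} x *\<^sub>R (indicator {a..b} x *\<^sub>R F x)"
          by (simp add: mult.commute)
      qed
    qed
  qed
  define m where "m n c d = (LINT t:{a..b}|lborel. bump n c d t)" for n c d
  \<comment> \<open>combining two bumps with each other's masses produces a function of mean zero\<close>
  have avg: "m n a b *\<^sub>R (LINT t:{a..b}|lborel. bump n c d t *\<^sub>R F t) = m n c d *\<^sub>R (LINT t:{a..b}|lborel. bump n a b t *\<^sub>R F t)"
    if cd: "a \<le> c" "d \<le> b" for c d n
  proof -
    let ?\<beta> = "\<lambda>t. m n a b * bump n c d t - m n c d * bump n a b t"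
    have sm: "smooth ?\<beta>"
      by (intro smooth_diff(1) smooth_linear_image(1)[OF bounded_linear_mult_right] smooth_bump)
    have i1: "set_integrable lborel {a..b} (bump n c d)" "set_integrable lborel {a..b} (bump n a b)"
      using bt(1)[OF _ _ one] cd by simp_all
    have "(LINT t:{a..b}|lborel. ?\<beta> t *\<^sub>R F t) = 0"
    proof (rule key[OF sm])
      show "?\<beta> x = 0" if "x \<notin> {a..b}" for x
        using bump_bounds(3)[of n c d x] bump_bounds(3)[of n a b x] that cd by fastforce
      show "(LINT x:{a..b}|lborel. ?\<beta> x) = 0"
        using i1 by (simp add: set_integral_diff m_def)
    qed
    then show ?thesis using bt(1)[OF cd iF] bt(1)[of a b, OF _ _ iF]
      by (simp add: scaleR_diff_left set_integral_diff flip: scaleR_scaleR)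
  qed
  define C where "C = (1 / (b - a)) *\<^sub>R (LINT t:{a<..<b}|lborel. F t)"
  have lim: "(LINT t:{c<..<d}|lborel. F t) = (d - c) *\<^sub>R C" if cd: "a \<le> c" "d \<le> b" "c \<le> d" for c d
  proof -
    have m: "(\<lambda>n. m n c d) \<longlonglongrightarrow> d - c" if "a \<le> c" "d \<le> b" "c \<le> d" for c d
      using bt(2)[OF that(1,2) one] that unfolding m_def set_lebesgue_integral_def by simp
    have "(\<lambda>n. m n a b *\<^sub>R (LINT t:{a..b}|lborel. bump n c d t *\<^sub>R F t)) \<longlonglongrightarrow> (b - a) *\<^sub>R (LINT t:{c<..<d}|lborel. F t)"
      using cd ab by (intro tendsto_scaleR m bt(2) iF) auto
    moreover have "(\<lambda>n. m n c d *\<^sub>R (LINT t:{a..b}|lborel. bump n a b t *\<^sub>R F t)) \<longlonglongrightarrow> (d - c) *\<^sub>R (LINT t:{a<..<b}|lborel. F t)"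
      using cd ab by (intro tendsto_scaleR m bt(2) iF) auto
    ultimately have "(b - a) *\<^sub>R (LINT t:{c<..<d}|lborel. F t) = (d - c) *\<^sub>R (LINT t:{a<..<b}|lborel. F t)"
      unfolding avg[OF cd(1,2)] by (rule LIMSEQ_unique)
    then have "(1 / (b - a)) *\<^sub>R (b - a) *\<^sub>R (LINT t:{c<..<d}|lborel. F t) = (1 / (b - a)) *\<^sub>R (d - c) *\<^sub>R (LINT t:{a<..<b}|lborel. F t)"
      by simp
    then show ?thesis using ab unfolding C_def by (simp add: mult.commute)
  qed
  have iC: "set_integrable lborel {c<..<d} (\<lambda>t. C)" for c d :: real
    unfolding set_integrable_def by (cases "c \<le> d") auto
  have iF': "set_integrable lborel {c<..<d} F" if "(c, d) \<in> rational_corners {a<..<b}" for c d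
  proof (rule set_integrable_subset[OF iF])
    have "{c..d} \<subseteq> {a<..<b}" using that unfolding rational_corners_def by auto
    then show "{c<..<d} \<subseteq> {a..b}" by (meson atLeastAtMost_iff greaterThanLessThan_iff less_imp_le subset_iff)
  qed simp
  have "AE t\<in>{a<..<b} in lborel. F t - C = 0"
  proof (rule AE_zero_if_box_integrals_zero)
    fix c d assume cd: "(c, d) \<in> rational_corners {a<..<b}"
    show "set_integrable lborel (box c d) (\<lambda>t. F t - C)"
      using iF'[OF cd] iC by (simp add: box_real)
    show "(LINT t:box c d|lborel. F t - C) = 0"
    proof (cases "c \<le> d")
      case True
      then have "a \<le> c" "d \<le> b" using cd unfolding rational_corners_def by auto
      then have "(LINT t:{c<..<d}|lborel. F t) = (d - c) *\<^sub>R C" using lim True by blast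
      moreover have "(LINT t:{c<..<d}|lborel. C) = (d - c) *\<^sub>R C"
        unfolding set_lebesgue_integral_def using True by simp
      ultimately show ?thesis using iF'[OF cd] iC by (simp add: set_integral_diff)
    qed (auto simp: set_lebesgue_integral_def)
  qed auto
  then have "AE t\<in>{a<..<b} in lborel. f t = C + (LINT \<tau>:{a..t}|lborel. g \<tau>)"
    by eventually_elim (auto simp: F_def P_def algebra_simps)
  then show ?thesis by blast
qed

lemma set_integral_Icc_split:
  fixes f :: "real \<Rightarrow> 'b::euclidean_space"
  assumes f: "set_integrable lborel {a..b} f" and "a \<le> s" "s \<le> t" "t \<le> b"
  shows "(LINT \<tau>:{a..t}|lborel. f \<tau>) = (LINT \<tau>:{a..s}|lborel. f \<tau>) + (LINT \<tau>:{s..t}|lborel. f \<tau>)"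
proof -
  have "(LINT \<tau>:{a..s}\<union>{s..t}|lborel. f \<tau>) = (LINT \<tau>:{a..s}|lborel. f \<tau>) + (LINT \<tau>:{s..t}|lborel. f \<tau>)"
  proof (rule set_integral_Un_AE)
    show "AE x in lborel. \<not> (x \<in> {a..s} \<and> x \<in> {s..t})"
      using AE_lborel_singleton[of s] by eventually_elim auto
    show "set_integrable lborel {a..s} f" "set_integrable lborel {s..t} f"
      by (rule set_integrable_subset[OF f]; use assms in auto)+
  qed auto
  moreover have "{a..s}\<union>{s..t} = {a..t}" using assms by auto
  ultimately show ?thesis by simp
qed

lemma restrict_space_pair_measure:
  assumes M1: "sigma_finite_measure M1" and M2: "sigma_finite_measure M2"
    and A: "A \<in> sets M1" and B: "B \<in> sets M2"
  shows "restrict_space M1 A \<Otimes>\<^sub>M restrict_space M2 B = restrict_space (M1 \<Otimes>\<^sub>M M2) (A \<times> B)"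
    (is "?L = ?R")
proof (rule pair_measure_eqI)
  interpret M2: sigma_finite_measure M2 by fact
  have AB: "A \<inter> space M1 \<in> sets M1" "B \<inter> space M2 \<in> sets M2" "A \<times> B \<in> sets (M1 \<Otimes>\<^sub>M M2)"
    using A B by auto
  show "sigma_finite_measure (restrict_space M1 A)" "sigma_finite_measure (restrict_space M2 B)"
    using sigma_finite_measure_restrict_space M1 M2 A B by auto
  have sp: "space ?L = A \<times> B" "space (restrict_space M1 A) = A" "space (restrict_space M2 B) = B"
    using sets.sets_into_space[OF A] sets.sets_into_space[OF B]
    by (auto simp: space_pair_measure space_restrict_space)
  show "sets ?L = sets ?R"
  proof
    have "sets ?L = sigma_sets (A \<times> B) {a \<times> b |a b. a \<in> sets (restrict_space M1 A) \<and> b \<in> sets (restrict_space M2 B)}"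
      unfolding sets_pair_measure sp by simp
    also have "\<dots> \<subseteq> sets ?R"
    proof -
      have spR: "space ?R = A \<times> B"
        using sets.sets_into_space[OF A] sets.sets_into_space[OF B] by (auto simp: space_restrict_space space_pair_measure)
      have sub: "{a \<times> b |a b. a \<in> sets (restrict_space M1 A) \<and> b \<in> sets (restrict_space M2 B)} \<subseteq> sets ?R"
      proof safe
        fix a b assume "a \<in> sets (restrict_space M1 A)" "b \<in> sets (restrict_space M2 B)"
        then obtain a' b' where ab': "a' \<in> sets M1" "a = A \<inter> a'" "b' \<in> sets M2" "b = B \<inter> b'"
          unfolding sets_restrict_space by auto
        have "a \<times> b = (A \<times> B) \<inter> (a' \<times> b')" unfolding ab' by (simp add: Times_Int_Times)
        moreover have "a' \<times> b' \<in> sets (M1 \<Otimes>\<^sub>M M2)" using ab' by (intro pair_measureI)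
        ultimately show "a \<times> b \<in> sets ?R" unfolding sets_restrict_space by blast
      qed
      show ?thesis using sets.sigma_sets_subset[OF sub] unfolding spR .
    qed
    finally show "sets ?L \<subseteq> sets ?R" .
    show "sets ?R \<subseteq> sets ?L"
    proof
      fix X assume "X \<in> sets ?R"
      then obtain Y where Y: "Y \<in> sets (M1 \<Otimes>\<^sub>M M2)" "X = (A \<times> B) \<inter> Y"
        unfolding sets_restrict_space by auto
      have "(\<lambda>p. (fst p, snd p)) \<in> ?L \<rightarrow>\<^sub>M M1 \<Otimes>\<^sub>M M2"
      proof (rule measurable_Pair)
        have "id \<in> restrict_space M1 A \<rightarrow>\<^sub>M M1" "id \<in> restrict_space M2 B \<rightarrow>\<^sub>M M2"
          by (auto intro: measurable_restrict_space1)
        then show "fst \<in> ?L \<rightarrow>\<^sub>M M1" "snd \<in> ?L \<rightarrow>\<^sub>M M2"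
          using measurable_comp[OF measurable_fst, of id] measurable_comp[OF measurable_snd, of id] by fastforce+
      qed
      from measurable_sets[OF this Y(1)] show "X \<in> sets ?L"
        unfolding Y(2) sp by (simp add: Int_commute vimage_def)
    qed
  qed
  fix a b assume ab: "a \<in> sets (restrict_space M1 A)" "b \<in> sets (restrict_space M2 B)"
  then obtain a' b' where ab': "a' \<in> sets M1" "a = A \<inter> a'" "b' \<in> sets M2" "b = B \<inter> b'"
    unfolding sets_restrict_space by auto
  have "emeasure ?R (a \<times> b) = emeasure (M1 \<Otimes>\<^sub>M M2) (a \<times> b)"
    using AB(3) ab' by (intro emeasure_restrict_space) auto
  also have "\<dots> = emeasure M1 a * emeasure M2 b"
    using A B ab' by (intro M2.emeasure_pair_measure_Times) auto
  finally show "emeasure (restrict_space M1 A) a * emeasure (restrict_space M2 B) b = emeasure ?R (a \<times> b)"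
    using A B ab' by (simp add: emeasure_restrict_space AB)
qed

lemma finite_measure_restrict_lborel:
  assumes "A \<in> sets lborel" "bounded A"
  shows "finite_measure (restrict_space lborel A)"
proof (rule finite_measureI)
  show "emeasure (restrict_space lborel A) (space (restrict_space lborel A)) \<noteq> \<infinity>"
    using assms(1) emeasure_bounded_finite[OF assms(2)] by (simp add: emeasure_restrict_space space_restrict_space)
qed

lemma integral_restrict_lborel:
  fixes f :: "'a::euclidean_space \<Rightarrow> 'b::euclidean_space"
  assumes "A \<in> sets lborel" "B \<subseteq> A"
  shows "(\<integral>x. indicator B x *\<^sub>R f x \<partial>restrict_space lborel A) = (LINT x:B|lborel. f x)"
proof -
  have "indicator A x *\<^sub>R indicator B x *\<^sub>R f x = indicator B x *\<^sub>R f x" for x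
    using assms(2) by (auto simp: indicator_def)
  then show ?thesis using assms(1) by (simp add: integral_restrict_space set_lebesgue_integral_def del: scaleR_scaleR)
qed

lemma integrable_restrict_lborel:
  fixes f :: "'a::euclidean_space \<Rightarrow> 'b::euclidean_space"
  assumes "A \<in> sets lborel" "B \<subseteq> A"
  shows "integrable (restrict_space lborel A) (\<lambda>x. indicator B x *\<^sub>R f x) \<longleftrightarrow> set_integrable lborel B f"
proof -
  have "indicator A x *\<^sub>R indicator B x *\<^sub>R f x = indicator B x *\<^sub>R f x" for x
    using assms(2) by (auto simp: indicator_def)
  then show ?thesis using assms(1) by (simp add: integrable_restrict_space set_integrable_def del: scaleR_scaleR)
qed

lemma integral_restrict_lborel_self:
  fixes f :: "'a::euclidean_space \<Rightarrow> 'b::euclidean_space"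
  assumes "A \<in> sets lborel"
  shows "(\<integral>x. f x \<partial>restrict_space lborel A) = (LINT x:A|lborel. f x)"
    "integrable (restrict_space lborel A) f \<longleftrightarrow> set_integrable lborel A f"
  using assms by (simp_all add: integral_restrict_space integrable_restrict_space set_integrable_def set_lebesgue_integral_def)

text \<open>The average over one rational box in space satisfies the hypotheses of
  \<open>distributional_FTC\<close>, hence is absolutely continuous outside a null set of times.  Countably many
  boxes have a common exceptional null set \<open>N\<close>; for two times outside of it,
  \<open>u t - u s\<close> and the time integral of \<open>z\<close> have the same integral over every rational box and thus
  agree almost everywhere in space.\<close>

lemma space_time_FTC:
  fixes u z :: "real \<Rightarrow> 'a::euclidean_space \<Rightarrow> 'b::euclidean_space" and \<Omega> :: "'a set"
  defines "S \<equiv> restrict_space lborel \<Omega>"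
  assumes \<Omega>: "open \<Omega>" and ab: "a < b" "{a..b} \<subseteq> I"
    and u: "integrable (restrict_space lborel {a..b} \<Otimes>\<^sub>M S) (\<lambda>(t, x). u t x)"
    and z: "integrable (restrict_space lborel {a..b} \<Otimes>\<^sub>M S) (\<lambda>(t, x). z t x)"
    and dist: "\<And>\<theta> \<eta>. test_function I \<theta> \<Longrightarrow> (\<And>t. t \<notin> {a..b} \<Longrightarrow> \<theta> t = 0) \<Longrightarrow> test_function \<Omega> \<eta> \<Longrightarrow>
      (\<integral>(t, x). (dir_deriv 1 \<theta> t * \<eta> x) *\<^sub>R u t x \<partial>(restrict_space lborel {a..b} \<Otimes>\<^sub>M S))
      = - (\<integral>(t, x). (\<theta> t * \<eta> x) *\<^sub>R z t x \<partial>(restrict_space lborel {a..b} \<Otimes>\<^sub>M S))"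
  shows "\<exists>N\<in>null_sets lborel. \<forall>s t. a < s \<and> s < t \<and> t < b \<and> s \<notin> N \<and> t \<notin> N \<longrightarrow>
     (AE x in S. u t x - u s x = (LINT \<tau>:{s..t}|lborel. z \<tau> x))"
proof -
  let ?T = "restrict_space lborel {a..b}"
  have mO: "\<Omega> \<in> sets lborel" using \<Omega> by simp
  have [simp]: "space S = \<Omega>" unfolding S_def by (simp add: space_restrict_space)
  interpret T: sigma_finite_measure ?T
    by (rule sigma_finite_measure_restrict_space[OF sigma_finite_lborel]) simp
  interpret S: sigma_finite_measure S
    unfolding S_def by (rule sigma_finite_measure_restrict_space[OF sigma_finite_lborel]) (use \<Omega> in simp)
  interpret P: pair_sigma_finite ?T S ..
  have box_meas: "(\<lambda>x. indicator (box c d) x :: real) \<in> borel_measurable S" for c d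
    unfolding S_def by (rule measurable_restrict_space1) simp
  have box_int: "integrable S (\<lambda>x. indicator (box c d) x *\<^sub>R h x)" if "integrable S h" for h :: "'a \<Rightarrow> 'b" and c d
  proof (rule Bochner_Integration.integrable_bound[OF that])
    show "(\<lambda>x. indicator (box c d) x *\<^sub>R h x) \<in> borel_measurable S"
      using that box_meas by - (rule borel_measurable_scaleR, auto)
  qed (auto simp: indicator_def)
  define A where "A w c d t = (\<integral>x. indicator (box c d) x *\<^sub>R w t x \<partial>S)" for w :: "real \<Rightarrow> 'a \<Rightarrow> 'b" and c d t
  have W: "integrable (?T \<Otimes>\<^sub>M S) (\<lambda>(t, x). indicator (box c d) x *\<^sub>R w t x)"
    if w: "integrable (?T \<Otimes>\<^sub>M S) (\<lambda>(t, x). w t x)" for w :: "real \<Rightarrow> 'a \<Rightarrow> 'b" and c d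
  proof (rule Bochner_Integration.integrable_bound[OF w])
    have "(\<lambda>p. indicator (box c d) (snd p) *\<^sub>R (\<lambda>(t, x). w t x) p) \<in> borel_measurable (?T \<Otimes>\<^sub>M S)"
      by (rule borel_measurable_scaleR[OF measurable_compose[OF measurable_snd box_meas] borel_measurable_integrable[OF w]])
    then show "(\<lambda>(t, x). indicator (box c d) x *\<^sub>R w t x) \<in> borel_measurable (?T \<Otimes>\<^sub>M S)"
      by (simp add: case_prod_unfold)
  qed (auto simp: indicator_def)
  have A_int: "set_integrable lborel {a..b} (A w c d)"
    if w: "integrable (?T \<Otimes>\<^sub>M S) (\<lambda>(t, x). w t x)" for w :: "real \<Rightarrow> 'a \<Rightarrow> 'b" and c d
    using P.integrable_fst'[OF W[OF w]] unfolding A_def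
    by (simp add: integral_restrict_lborel_self)
  \<comment> \<open>letting the spatial bump tend to the indicator of a box turns tests on space-time into tests of the box averages\<close>
  have lim: "(\<lambda>n. \<integral>(t, x). (\<psi> t * box_bump n c d x) *\<^sub>R w t x \<partial>(?T \<Otimes>\<^sub>M S)) \<longlonglongrightarrow> (LINT t:{a..b}|lborel. \<psi> t *\<^sub>R A w c d t)"
    if w: "integrable (?T \<Otimes>\<^sub>M S) (\<lambda>(t, x). w t x)" and \<psi>: "continuous_on UNIV \<psi>"
    and bd: "\<And>t. \<bar>\<psi> t\<bar> \<le> C" for w :: "real \<Rightarrow> 'a \<Rightarrow> 'b" and c d \<psi> C
  proof -
    have C: "C \<ge> 0" using bd[of 0] by linarith
    have \<psi>m: "\<psi> \<in> borel_measurable ?T"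
      by (rule measurable_restrict_space1) (use \<psi> borel_measurable_continuous_onI in auto)
    have bm: "box_bump n c d \<in> borel_measurable S" for n
      unfolding S_def by (rule measurable_restrict_space1) (use borel_measurable_continuous_onI[OF smooth_continuous_on[OF smooth_box_bump]] in simp)
    have wm: "(\<lambda>p. w (fst p) (snd p)) \<in> borel_measurable (?T \<Otimes>\<^sub>M S)"
      using borel_measurable_integrable[OF w] by (simp add: case_prod_unfold)
    have m1: "(\<lambda>p. (\<psi> (fst p) * k (snd p)) *\<^sub>R w (fst p) (snd p)) \<in> borel_measurable (?T \<Otimes>\<^sub>M S)"
      if "k \<in> borel_measurable S" for k
      by (rule borel_measurable_scaleR[OF borel_measurable_times[OF measurable_compose[OF measurable_fst \<psi>m] measurable_compose[OF measurable_snd that]] wm])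
    have bound: "norm ((\<psi> t * k) *\<^sub>R w t x) \<le> norm (C * norm (w t x))" if "0 \<le> k" "k \<le> 1" for t x k
    proof -
      have "\<bar>\<psi> t * k\<bar> \<le> C * 1" unfolding abs_mult using bd[of t] that C by (intro mult_mono) auto
      then have "\<bar>\<psi> t * k\<bar> * norm (w t x) \<le> C * norm (w t x)" by (intro mult_right_mono) auto
      then show ?thesis using C by (simp add: abs_mult)
    qed
    have iw: "integrable (?T \<Otimes>\<^sub>M S) (\<lambda>p. C * norm (w (fst p) (snd p)))"
      using integrable_norm[OF w] by (intro integrable_mult_right) (simp add: case_prod_unfold)
    have "(\<lambda>n. \<integral>p. (\<psi> (fst p) * box_bump n c d (snd p)) *\<^sub>R w (fst p) (snd p) \<partial>(?T \<Otimes>\<^sub>M S))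
        \<longlonglongrightarrow> (\<integral>p. (\<psi> (fst p) * indicator (box c d) (snd p)) *\<^sub>R w (fst p) (snd p) \<partial>(?T \<Otimes>\<^sub>M S))"
    proof (rule integral_dominated_convergence[OF m1[OF box_meas] m1[OF bm] iw])
      show "AE p in ?T \<Otimes>\<^sub>M S. (\<lambda>n. (\<psi> (fst p) * box_bump n c d (snd p)) *\<^sub>R w (fst p) (snd p))
          \<longlonglongrightarrow> (\<psi> (fst p) * indicator (box c d) (snd p)) *\<^sub>R w (fst p) (snd p)"
        by (intro AE_I2 tendsto_scaleR tendsto_mult box_bump_tendsto tendsto_const)
      show "AE p in ?T \<Otimes>\<^sub>M S. norm ((\<psi> (fst p) * box_bump n c d (snd p)) *\<^sub>R w (fst p) (snd p)) \<le> C * norm (w (fst p) (snd p))" for n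
        using bound[OF box_bump_bounds(1,2)] C by (intro AE_I2) (simp del: norm_scaleR)
    qed
    moreover have "(\<integral>p. (\<psi> (fst p) * indicator (box c d) (snd p)) *\<^sub>R w (fst p) (snd p) \<partial>(?T \<Otimes>\<^sub>M S))
        = (LINT t:{a..b}|lborel. \<psi> t *\<^sub>R A w c d t)"
    proof -
      have i: "integrable (?T \<Otimes>\<^sub>M S) (\<lambda>p. (\<psi> (fst p) * indicator (box c d) (snd p)) *\<^sub>R w (fst p) (snd p))"
        by (rule Bochner_Integration.integrable_bound[OF iw m1[OF box_meas]])
           (use bound in \<open>auto intro!: AE_I2 simp del: norm_scaleR\<close>)
      have "(\<integral>p. (\<psi> (fst p) * indicator (box c d) (snd p)) *\<^sub>R w (fst p) (snd p) \<partial>(?T \<Otimes>\<^sub>M S))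
         = (\<integral>t. \<integral>x. \<psi> t *\<^sub>R (indicator (box c d) x *\<^sub>R w t x) \<partial>S \<partial>?T)"
        using P.integral_fst'[OF i] by simp
      then show ?thesis unfolding A_def by (simp add: integral_restrict_lborel_self del: scaleR_scaleR)
    qed
    ultimately show ?thesis by (simp add: case_prod_unfold)
  qed
  have scalar: "\<exists>C. AE t\<in>{a<..<b} in lborel. A u c d t = C + (LINT \<tau>:{a..t}|lborel. A z c d \<tau>)"
    if cd: "(c, d) \<in> rational_corners \<Omega>" for c d
  proof (rule distributional_FTC[OF ab A_int[OF u] A_int[OF z]])
    fix \<theta> :: "real \<Rightarrow> real" assume \<theta>: "test_function I \<theta>" "\<And>x. x \<notin> {a..b} \<Longrightarrow> \<theta> x = 0"
    have sub: "cbox c d \<subseteq> \<Omega>" using cd unfolding rational_corners_def by auto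
    obtain C where C: "\<And>x. norm (\<theta> x) \<le> C" using test_function_bounded[OF \<theta>(1)] by blast
    have sm: "smooth \<theta>" using \<theta>(1) unfolding test_function_def by auto
    have "test_function {a-1<..<b+1} (dir_deriv 1 \<theta>)"
    proof (rule test_functionI[OF smooth_dir_deriv[OF sm], of "{a..b}"])
      show "dir_deriv 1 \<theta> x = 0" if "x \<notin> {a..b}" for x
        using \<theta>(2) that by (intro dir_deriv_outside_closed[of "{a..b}"]) auto
    qed auto
    then obtain C' where C': "\<And>x. norm (dir_deriv 1 \<theta> x) \<le> C'" using test_function_bounded by blast
    note l1 = lim[OF u smooth_continuous_on[OF smooth_dir_deriv[OF sm]], of 1 C' c d]
    note l2 = lim[OF z smooth_continuous_on[OF sm], of C c d]
    have "(\<lambda>n. - (\<integral>(t, x). (\<theta> t * box_bump n c d x) *\<^sub>R z t x \<partial>(?T \<Otimes>\<^sub>M S))) \<longlonglongrightarrow> (LINT t:{a..b}|lborel. dir_deriv 1 \<theta> t *\<^sub>R A u c d t)"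
      using l1 C' dist[OF \<theta> test_function_box_bump[OF sub]] by simp
    moreover have "(\<lambda>n. - (\<integral>(t, x). (\<theta> t * box_bump n c d x) *\<^sub>R z t x \<partial>(?T \<Otimes>\<^sub>M S))) \<longlonglongrightarrow> - (LINT t:{a..b}|lborel. \<theta> t *\<^sub>R A z c d t)"
      using l2 C by (intro tendsto_minus) simp
    ultimately show "(LINT t:{a..b}|lborel. dir_deriv 1 \<theta> t *\<^sub>R A u c d t) = - (LINT t:{a..b}|lborel. \<theta> t *\<^sub>R A z c d t)"
      by (rule LIMSEQ_unique)
  qed
  then have "\<forall>p\<in>rational_corners \<Omega>. \<exists>C. AE t\<in>{a<..<b} in lborel.
      A u (fst p) (snd p) t = C + (LINT \<tau>:{a..t}|lborel. A z (fst p) (snd p) \<tau>)"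
    by auto
  from bchoice[OF this] obtain C where C: "\<And>p. p \<in> rational_corners \<Omega> \<Longrightarrow> AE t\<in>{a<..<b} in lborel.
      A u (fst p) (snd p) t = C p + (LINT \<tau>:{a..t}|lborel. A z (fst p) (snd p) \<tau>)"
    by blast
  have "AE t in lborel. t \<in> {a..b} \<longrightarrow> integrable S (u t)"
    using P.AE_integrable_fst'[OF u] by (simp add: AE_restrict_space_iff)
  moreover have "AE t in lborel. \<forall>p\<in>rational_corners \<Omega>. t \<in> {a<..<b} \<longrightarrow> A u (fst p) (snd p) t = C p + (LINT \<tau>:{a..t}|lborel. A z (fst p) (snd p) \<tau>)"
    using C by (subst AE_ball_countable[OF countable_rational_corners]) auto
  ultimately have "AE t in lborel. (t \<in> {a..b} \<longrightarrow> integrable S (u t)) \<and>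
      (\<forall>p\<in>rational_corners \<Omega>. t \<in> {a<..<b} \<longrightarrow> A u (fst p) (snd p) t = C p + (LINT \<tau>:{a..t}|lborel. A z (fst p) (snd p) \<tau>))"
    by eventually_elim blast
  then obtain N where N: "N \<in> null_sets lborel" "\<And>t. t \<notin> N \<Longrightarrow> (t \<in> {a..b} \<longrightarrow> integrable S (u t)) \<and>
      (\<forall>p\<in>rational_corners \<Omega>. t \<in> {a<..<b} \<longrightarrow> A u (fst p) (snd p) t = C p + (LINT \<tau>:{a..t}|lborel. A z (fst p) (snd p) \<tau>))"
    by (rule AE_E3) auto
  show ?thesis
  proof (intro bexI[OF _ N(1)] allI impI)
    fix s t assume st: "a < s \<and> s < t \<and> t < b \<and> s \<notin> N \<and> t \<notin> N"
    define Z where "Z x = (LINT \<tau>:{s..t}|lborel. z \<tau> x)" for x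
    define D where "D x = u t x - u s x - Z x" for x
    have ist: "integrable S (u s)" "integrable S (u t)" using N(2) st by auto
    let ?z = "\<lambda>(\<tau>, x). indicator {s..t} \<tau> *\<^sub>R z \<tau> x"
    have iz: "integrable (?T \<Otimes>\<^sub>M S) ?z"
    proof (rule Bochner_Integration.integrable_bound[OF z])
      have "(\<lambda>\<tau>. indicator {s..t} \<tau> :: real) \<in> borel_measurable ?T" by (rule measurable_restrict_space1) simp
      then have "(\<lambda>p. indicator {s..t} (fst p) *\<^sub>R (\<lambda>(t, x). z t x) p) \<in> borel_measurable (?T \<Otimes>\<^sub>M S)"
        by (rule borel_measurable_scaleR[OF measurable_compose[OF measurable_fst] borel_measurable_integrable[OF z]])
      then show "?z \<in> borel_measurable (?T \<Otimes>\<^sub>M S)" by (simp add: case_prod_unfold)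
    qed (auto simp: indicator_def)
    have Z: "Z x = (\<integral>\<tau>. indicator {s..t} \<tau> *\<^sub>R z \<tau> x \<partial>?T)" for x
      unfolding Z_def using st by (intro integral_restrict_lborel[symmetric]) auto
    have iZ: "integrable S Z"
      using P.integrable_snd[of "\<lambda>\<tau> x. indicator {s..t} \<tau> *\<^sub>R z \<tau> x"] iz unfolding Z[abs_def] by simp
    have iD: "integrable S D" unfolding D_def[abs_def] using ist iZ by (intro Bochner_Integration.integrable_diff)
    have "AE x\<in>\<Omega> in lborel. D x = 0"
    proof (rule AE_zero_if_box_integrals_zero[OF \<Omega>])
      fix c d assume cd: "(c, d) \<in> rational_corners \<Omega>"
      then have sub: "box c d \<subseteq> \<Omega>" using box_subset_cbox[of c d] unfolding rational_corners_def by auto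
      show "set_integrable lborel (box c d) D"
        using box_int[OF iD, of c d] integrable_restrict_lborel[OF mO sub, of D] unfolding S_def by blast
      have zb: "set_integrable lborel {a..b} (A z c d)" by (rule A_int[OF z])
      have "(LINT \<tau>:{a..t}|lborel. A z c d \<tau>) = (LINT \<tau>:{a..s}|lborel. A z c d \<tau>) + (LINT \<tau>:{s..t}|lborel. A z c d \<tau>)"
        using st by (intro set_integral_Icc_split[OF zb]) auto
      moreover have "A u c d t = C (c, d) + (LINT \<tau>:{a..t}|lborel. A z c d \<tau>)" "A u c d s = C (c, d) + (LINT \<tau>:{a..s}|lborel. A z c d \<tau>)"
        using N(2)[of t] N(2)[of s] st cd by force+
      ultimately have 1: "A u c d t - A u c d s = (LINT \<tau>:{s..t}|lborel. A z c d \<tau>)" by simp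
      have iB: "integrable (?T \<Otimes>\<^sub>M S) (case_prod (\<lambda>\<tau> x. indicator (box c d) x *\<^sub>R (indicator {s..t} \<tau> *\<^sub>R z \<tau> x)))"
        using W[of "\<lambda>\<tau> x. indicator {s..t} \<tau> *\<^sub>R z \<tau> x" c d] iz by simp
      have "(LINT \<tau>:{s..t}|lborel. A z c d \<tau>) = (\<integral>\<tau>. indicator {s..t} \<tau> *\<^sub>R A z c d \<tau> \<partial>?T)"
        using st by (intro integral_restrict_lborel[symmetric]) auto
      also have "\<dots> = (\<integral>\<tau>. \<integral>x. indicator (box c d) x *\<^sub>R (indicator {s..t} \<tau> *\<^sub>R z \<tau> x) \<partial>S \<partial>?T)"
      proof (rule Bochner_Integration.integral_cong)
        fix \<tau>
        show "indicator {s..t} \<tau> *\<^sub>R A z c d \<tau> = (\<integral>x. indicator (box c d) x *\<^sub>R (indicator {s..t} \<tau> *\<^sub>R z \<tau> x) \<partial>S)"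
          unfolding A_def by (cases "\<tau> \<in> {s..t}") auto
      qed simp
      also have "\<dots> = (\<integral>x. \<integral>\<tau>. indicator (box c d) x *\<^sub>R (indicator {s..t} \<tau> *\<^sub>R z \<tau> x) \<partial>?T \<partial>S)"
        by (rule P.Fubini_integral[OF iB, symmetric])
      also have "\<dots> = (\<integral>x. indicator (box c d) x *\<^sub>R Z x \<partial>S)"
      proof (rule Bochner_Integration.integral_cong)
        fix x
        show "(\<integral>\<tau>. indicator (box c d) x *\<^sub>R (indicator {s..t} \<tau> *\<^sub>R z \<tau> x) \<partial>?T) = indicator (box c d) x *\<^sub>R Z x"
          unfolding Z by (cases "x \<in> box c d") auto
      qed simp
      finally have 2: "(LINT \<tau>:{s..t}|lborel. A z c d \<tau>) = (\<integral>x. indicator (box c d) x *\<^sub>R Z x \<partial>S)" .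
      have "(LINT x:box c d|lborel. D x) = (\<integral>x. indicator (box c d) x *\<^sub>R D x \<partial>S)"
        unfolding S_def using sub mO by (intro integral_restrict_lborel[symmetric]) auto
      also have "\<dots> = A u c d t - A u c d s - (\<integral>x. indicator (box c d) x *\<^sub>R Z x \<partial>S)"
        unfolding D_def A_def scaleR_diff_right using box_int[OF ist(1)] box_int[OF ist(2)] box_int[OF iZ] by simp
      also have "\<dots> = 0" using 1 2 by simp
      finally show "(LINT x:box c d|lborel. D x) = 0" .
    qed
    then have "AE x in S. D x = 0" unfolding S_def using \<Omega> by (simp add: AE_restrict_space_iff)
    then show "AE x in S. u t x - u s x = (LINT \<tau>:{s..t}|lborel. z \<tau> x)"
      by eventually_elim (simp add: D_def Z_def)
  qed
qed

section \<open>Energy inequality and integral Gronwall lemma\<close>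

lemma null_set_avoids:
  fixes a b :: real
  assumes "N \<in> null_sets lborel" "a < b"
  obtains x where "a < x" "x < b" "x \<notin> N"
proof -
  have "\<not> {a<..<b} \<subseteq> N"
  proof
    assume "{a<..<b} \<subseteq> N"
    then have "{a<..<b} \<in> null_sets lborel"
      using assms(1) null_sets_subset[of N lborel "{a<..<b}"] by simp
    then show False using assms(2) by (simp add: null_sets_def)
  qed
  then obtain x where "x \<in> {a<..<b}" "x \<notin> N" by blast
  then show ?thesis using that[of x] by simp
qed

lemma null_set_AE: "N \<in> null_sets lborel \<Longrightarrow> AE x in lborel. x \<notin> N"
  by (rule AE_not_in)

lemma continuous_indefinite_integral:
  fixes f :: "real \<Rightarrow> real"
  assumes f: "set_integrable lborel {a..b} f"
  shows "continuous_on {a..b} (\<lambda>t. LINT \<tau>:{a..t}|lborel. f \<tau>)"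
proof -
  have sub: "set_integrable lborel {a..t} f" if "t \<in> {a..b}" for t
    by (rule set_integrable_subset[OF f]) (use that in auto)
  have "f integrable_on {a..b}" using set_borel_integral_eq_integral(1)[OF f] .
  then have "continuous_on {a..b} (\<lambda>t. integral {a..t} f)" by (rule indefinite_integral_continuous_1)
  then show ?thesis
    using set_borel_integral_eq_integral(2)[OF sub] by (subst continuous_on_cong[OF refl]) auto
qed

text \<open>Increments of quadratic order add up to nothing: on a partition so fine that \<open>\<Gamma>\<close> grows by less
  than \<open>\<epsilon>\<close> in each step, the squares sum to at most \<open>\<epsilon> * (\<Gamma> t - \<Gamma> s)\<close>.  The partition points must
  avoid \<open>N\<close>; the induction therefore advances by half of the admissible step, which leaves an open
  interval in which to choose the next point.\<close>

lemma nonincreasing_if_quadratic_increments: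
  fixes e \<Gamma> :: "real \<Rightarrow> real"
  assumes N: "N \<in> null_sets lborel"
    and \<Gamma>: "continuous_on {a..b} \<Gamma>" and mono: "\<And>s t. a \<le> s \<Longrightarrow> s \<le> t \<Longrightarrow> t \<le> b \<Longrightarrow> \<Gamma> s \<le> \<Gamma> t"
    and incr: "\<And>s t. a < s \<Longrightarrow> s < t \<Longrightarrow> t < b \<Longrightarrow> s \<notin> N \<Longrightarrow> t \<notin> N \<Longrightarrow> e t - e s \<le> (\<Gamma> t - \<Gamma> s)\<^sup>2"
    and st: "a < s" "s < t" "t < b" "s \<notin> N" "t \<notin> N"
  shows "e t \<le> e s"
proof -
  have "e t - e s \<le> \<epsilon> * (\<Gamma> t - \<Gamma> s)" if \<epsilon>: "\<epsilon> > 0" for \<epsilon>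
  proof -
    obtain \<delta> where \<delta>: "\<delta> > 0" "\<And>x y. x \<in> {a..b} \<Longrightarrow> y \<in> {a..b} \<Longrightarrow> dist y x < \<delta> \<Longrightarrow> dist (\<Gamma> y) (\<Gamma> x) < \<epsilon>"
      using compact_uniformly_continuous[OF \<Gamma>] \<epsilon> unfolding uniformly_continuous_on_def by auto
    have step: "e r' - e r \<le> \<epsilon> * (\<Gamma> r' - \<Gamma> r)"
      if "a < r" "r < r'" "r' < b" "r \<notin> N" "r' \<notin> N" "r' - r < \<delta>" for r r'
    proof -
      have "dist (\<Gamma> r') (\<Gamma> r) < \<epsilon>" using \<delta>(2)[of r r'] that by (auto simp: dist_real_def)
      moreover have "0 \<le> \<Gamma> r' - \<Gamma> r" using mono[of r r'] that by simp
      ultimately have "(\<Gamma> r' - \<Gamma> r)\<^sup>2 \<le> \<epsilon> * (\<Gamma> r' - \<Gamma> r)"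
        unfolding power2_eq_square by (intro mult_right_mono) (auto simp: dist_real_def)
      then show ?thesis using incr[OF that(1-5)] by simp
    qed
    have claim: "\<forall>r. s \<le> r \<and> r < s + real k * (\<delta> / 2) \<and> r \<le> t \<and> r \<notin> N \<longrightarrow> e r - e s \<le> \<epsilon> * (\<Gamma> r - \<Gamma> s)" for k
    proof (induction k)
      case 0
      then show ?case by auto
    next
      case (Suc k)
      show ?case
      proof (intro allI impI)
        fix r assume r: "s \<le> r \<and> r < s + real (Suc k) * (\<delta> / 2) \<and> r \<le> t \<and> r \<notin> N"
        show "e r - e s \<le> \<epsilon> * (\<Gamma> r - \<Gamma> s)"
        proof (cases "r < s + real k * (\<delta> / 2) \<or> r = s \<or> k = 0")
          case True
          then consider "r < s + real k * (\<delta> / 2)" | "r = s" | "k = 0" "s < r" using r by linarith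
          then show ?thesis
          proof cases
            case 3
            then show ?thesis using step[of s r] r st \<delta>(1) by auto
          qed (use Suc r in auto)
        next
          case False
          then have k: "real k \<ge> 1" "s + real k * (\<delta> / 2) \<le> r" by auto
          have "\<delta> / 2 > 0" using \<delta> by simp
          obtain r0 where r0: "s + (real k - 1) * (\<delta> / 2) < r0" "r0 < s + real k * (\<delta> / 2)" "r0 \<notin> N"
            using null_set_avoids[OF N, of "s + (real k - 1) * (\<delta> / 2)" "s + real k * (\<delta> / 2)"] \<delta>(1)
            by (auto simp: algebra_simps)
          have "0 \<le> (real k - 1) * (\<delta> / 2)" using k \<delta>(1) by simp
          then have s0: "s < r0" using r0 by linarith
          have "real (Suc k) * (\<delta> / 2) = (real k - 1) * (\<delta> / 2) + \<delta>" by (simp add: field_simps)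
          then have "r - r0 < \<delta>" using r r0 by linarith
          then have "e r - e r0 \<le> \<epsilon> * (\<Gamma> r - \<Gamma> r0)"
            using step[of r0 r] s0 r0 k r st by auto
          moreover have "e r0 - e s \<le> \<epsilon> * (\<Gamma> r0 - \<Gamma> s)" using Suc r0 s0 k r by auto
          ultimately show ?thesis by (simp add: algebra_simps)
        qed
      qed
    qed
    obtain k :: nat where "(t - s) / (\<delta> / 2) < real k" using reals_Archimedean2 by blast
    then have "t < s + real k * (\<delta> / 2)" using \<delta>(1) by (simp add: field_simps)
    then show ?thesis using claim[of k] st by auto
  qed
  then have bd: "\<And>\<epsilon>. \<epsilon> > 0 \<Longrightarrow> e t - e s \<le> \<epsilon> * (\<Gamma> t - \<Gamma> s)" .
  have "((\<lambda>\<epsilon>. \<epsilon> * (\<Gamma> t - \<Gamma> s)) \<longlongrightarrow> 0 * (\<Gamma> t - \<Gamma> s)) (at_right 0)"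
    by (intro tendsto_intros)
  then have "e t - e s \<le> 0"
    using bd by (intro tendsto_lowerbound[of "\<lambda>\<epsilon>. \<epsilon> * (\<Gamma> t - \<Gamma> s)" _ "at_right 0"])
      (auto simp: eventually_at_right_less eventually_at_filter)
  then show ?thesis by simp
qed

text \<open>Where \<open>E\<close> already vanishes up to time \<open>r\<close>, and on a following stretch over which \<open>\<alpha>\<close> has integral
  at most $1/2$, the integral inequality halves every upper bound \<open>m\<close> of \<open>E\<close>: it gives
  $E(t) \<le> E(s) + m/2$ with arbitrarily small $E(s)$.  So \<open>E\<close> vanishes on that stretch as well, and
  finitely many of them exhaust the interval.  The small values of \<open>E\<close> at times accumulating at \<open>0\<close> play the part
  of the initial value.\<close>

lemma integral_Gronwall_zero:
  fixes E \<alpha> :: "real \<Rightarrow> real"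
  assumes T: "T > 0" and N: "N \<in> null_sets lborel"
    and \<alpha>: "set_integrable lborel {0<..<T} \<alpha>" "\<And>t. \<alpha> t \<ge> 0"
    and E0: "\<And>t. 0 < t \<Longrightarrow> t < T \<Longrightarrow> t \<notin> N \<Longrightarrow> E t \<ge> 0"
    and EK: "\<And>t. 0 < t \<Longrightarrow> t < T \<Longrightarrow> t \<notin> N \<Longrightarrow> E t \<le> K"
    and ineq: "\<And>s t. 0 < s \<Longrightarrow> s < t \<Longrightarrow> t < T \<Longrightarrow> s \<notin> N \<Longrightarrow> t \<notin> N \<Longrightarrow> E t \<le> E s + (LINT \<tau>:{s..t}|lborel. \<alpha> \<tau> * E \<tau>)"
    and small: "\<And>\<epsilon> h. \<epsilon> > 0 \<Longrightarrow> h > 0 \<Longrightarrow> \<exists>s. 0 < s \<and> s < h \<and> s < T \<and> s \<notin> N \<and> E s < \<epsilon>"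
    and t: "0 < t" "t < T" "t \<notin> N"
  shows "E t = 0"
proof -
  define \<alpha>' where "\<alpha>' t = indicator {0<..<T} t * \<alpha> t" for t
  have \<alpha>': "integrable lborel \<alpha>'" "\<And>t. \<alpha>' t \<ge> 0"
    using \<alpha> unfolding \<alpha>'_def set_integrable_def by auto
  have \<alpha>i: "set_integrable lborel A \<alpha>'" if "A \<in> sets lborel" for A
    unfolding set_integrable_def by (rule integrable_mult_indicator[OF that \<alpha>'(1)])
  define A where "A t = (LINT \<tau>:{0..t}|lborel. \<alpha>' \<tau>)" for t
  have cont: "continuous_on {0..T} A"
    unfolding A_def by (rule continuous_indefinite_integral) (rule \<alpha>i, simp)
  obtain \<delta> where \<delta>: "\<delta> > 0" "\<And>x y. x \<in> {0..T} \<Longrightarrow> y \<in> {0..T} \<Longrightarrow> dist y x < \<delta> \<Longrightarrow> dist (A y) (A x) < 1/2"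
    using compact_uniformly_continuous[OF cont] unfolding uniformly_continuous_on_def
    by (metis compact_Icc half_gt_zero_iff zero_less_one)
  have K0: "K \<ge> 0"
    using small[of 1 1] E0 EK by (metis order_trans zero_less_one)
  define P where "P r \<longleftrightarrow> (\<forall>t. 0 < t \<and> t < r \<and> t < T \<and> t \<notin> N \<longrightarrow> E t = 0)" for r
  have step: "P r'" if r: "P r" "0 \<le> r" "r < r'" "r' \<le> T" "r' - r < \<delta>" for r r'
  proof -
    have "\<forall>t. 0 < t \<and> t < r' \<and> t \<notin> N \<longrightarrow> E t \<le> K / 2 ^ n" for n
    proof (induction n)
      case 0
      then show ?case using EK r(4) by auto
    next
      case (Suc n)
      let ?m = "K / 2 ^ n"
      have m0: "?m \<ge> 0" using K0 by simp
      show ?case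
      proof (intro allI impI)
        fix t assume t: "0 < t \<and> t < r' \<and> t \<notin> N"
        show "E t \<le> K / 2 ^ Suc n"
        proof (cases "t < r")
          case True
          then show ?thesis using r(1,4) t K0 unfolding P_def by auto
        next
          case False
          have "E t \<le> \<epsilon> + ?m / 2" if \<epsilon>: "\<epsilon> > 0" for \<epsilon>
          proof -
            obtain s where s: "0 < s" "s < t" "s \<notin> N" "E s < \<epsilon>" using small[OF \<epsilon>, of t] t by auto
            have "(LINT \<tau>:{s..t}|lborel. \<alpha> \<tau> * E \<tau>) \<le> (LINT \<tau>:{r..t}|lborel. ?m * \<alpha>' \<tau>)"
            proof (cases "set_integrable lborel {s..t} (\<lambda>\<tau>. \<alpha> \<tau> * E \<tau>)")
              case True
              show ?thesis unfolding set_lebesgue_integral_def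
              proof (rule integral_mono_AE)
                show "integrable lborel (\<lambda>\<tau>. indicator {s..t} \<tau> *\<^sub>R (\<alpha> \<tau> * E \<tau>))"
                  using True unfolding set_integrable_def .
                show "integrable lborel (\<lambda>\<tau>. indicator {r..t} \<tau> *\<^sub>R (?m * \<alpha>' \<tau>))"
                  using set_integrable_mult_right[of ?m lborel "{r..t}" \<alpha>'] \<alpha>i[of "{r..t}"] unfolding set_integrable_def by simp
                show "AE \<tau> in lborel. indicator {s..t} \<tau> *\<^sub>R (\<alpha> \<tau> * E \<tau>) \<le> indicator {r..t} \<tau> *\<^sub>R (?m * \<alpha>' \<tau>)"
                  using null_set_AE[OF N]
                proof eventually_elim
                  case (elim \<tau>)
                  show ?case
                  proof (cases "\<tau> \<in> {s..t}")
                    case in1: True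
                    then have \<tau>: "0 < \<tau>" "\<tau> < r'" "\<tau> < T" using s t r(4) by auto
                    show ?thesis
                    proof (cases "\<tau> < r")
                      case True
                      then have "E \<tau> = 0" using r(1) \<tau> elim unfolding P_def by auto
                      moreover have "0 \<le> ?m * \<alpha>' \<tau>" by (rule mult_nonneg_nonneg[OF m0 \<alpha>'(2)])
                      ultimately show ?thesis by (simp add: indicator_def)
                    next
                      case F: False
                      have "E \<tau> \<le> ?m" using Suc \<tau> elim by auto
                      then have "\<alpha> \<tau> * E \<tau> \<le> ?m * \<alpha>' \<tau>"
                        using mult_right_mono[OF _ \<alpha>(2)[of \<tau>], of "E \<tau>" ?m] \<tau> unfolding \<alpha>'_def by (simp add: mult.commute)
                      then show ?thesis using in1 F by simp
                    qed
                  next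
                    case False
                    moreover have "0 \<le> ?m * \<alpha>' \<tau>" by (rule mult_nonneg_nonneg[OF m0 \<alpha>'(2)])
                    ultimately show ?thesis using False by (auto simp: indicator_def)
                  qed
                qed
              qed
            next
              case False
              \<comment> \<open>a non-integrable left-hand side has the value \<open>0\<close> by convention\<close>
              have "0 \<le> (LINT \<tau>:{r..t}|lborel. ?m * \<alpha>' \<tau>)"
                unfolding set_lebesgue_integral_def
                using mult_nonneg_nonneg[OF m0 \<alpha>'(2)] by (intro integral_nonneg_AE AE_I2) (auto simp: indicator_def)
              then show ?thesis using False unfolding set_lebesgue_integral_def set_integrable_def
                by (simp add: not_integrable_integral_eq)
            qed
            also have "\<dots> = ?m * (A t - A r)"
              using set_integral_Icc_split[OF \<alpha>i, of 0 T r t] r False t unfolding A_def by simp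
            also have "\<dots> \<le> ?m * (1/2)"
            proof (rule mult_left_mono[OF _ m0])
              have "dist (A t) (A r) < 1/2" using \<delta>(2)[of r t] r t False by (auto simp: dist_real_def)
              then show "A t - A r \<le> 1/2" unfolding dist_real_def by linarith
            qed
            finally show ?thesis using ineq[of s t] s t r(4) by auto
          qed
          then have "E t \<le> ?m / 2" by (simp add: field_le_epsilon add.commute)
          then show ?thesis by simp
        qed
      qed
    qed
    note bd = this
    show "P r'" unfolding P_def
    proof (intro allI impI)
      fix t assume t: "0 < t \<and> t < r' \<and> t < T \<and> t \<notin> N"
      have "(\<lambda>n. K * (1/2) ^ n) \<longlonglongrightarrow> K * 0" by (intro tendsto_mult tendsto_const LIMSEQ_power_zero) simp
      moreover have "E t \<le> K * (1/2) ^ n" for n 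
      proof -
        have "E t \<le> K / 2 ^ n" using bd[of n] t by blast
        then show ?thesis by (simp add: power_one_over)
      qed
      ultimately have "E t \<le> K * 0" by (intro LIMSEQ_le_const[where X="\<lambda>n. K * (1/2) ^ n"]) auto
      then have "E t \<le> 0" by simp
      then show "E t = 0" using E0[of t] t by simp
    qed
  qed
  have "P (min T (real k * (\<delta> / 2)))" for k
  proof (induction k)
    case 0
    then show ?case using T unfolding P_def by auto
  next
    case (Suc k)
    show ?case
    proof (cases "T \<le> real k * (\<delta> / 2)")
      case True
      then have "T \<le> real (Suc k) * (\<delta> / 2)" using \<delta>(1) by (simp add: algebra_simps)
      then show ?thesis using True Suc by (simp add: min_absorb1)
    next
      case False
      have "real (Suc k) * (\<delta> / 2) = real k * (\<delta> / 2) + \<delta> / 2" by (simp add: algebra_simps)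
      then obtain x where x: "x = real k * (\<delta> / 2)" "real (Suc k) * (\<delta> / 2) = x + \<delta> / 2" by blast
      have x0: "0 \<le> x" "x < T" using False \<delta>(1) unfolding x(1) by auto
      then have mx: "min T x = x" by simp
      show ?thesis unfolding x(2)
      proof (rule step[of x])
        show "P x" using Suc unfolding x(1)[symmetric] mx .
        show "x < min T (x + \<delta> / 2)" using x0 \<delta>(1) by simp
        show "min T (x + \<delta> / 2) - x < \<delta>" using \<delta>(1) min.cobounded2[of T "x + \<delta> / 2"] by linarith
      qed (use x0 in auto)
    qed
  qed
  note PT = this
  obtain k :: nat where "T / (\<delta> / 2) < real k" using reals_Archimedean2 by blast
  then have "T < real k * (\<delta> / 2)" using \<delta>(1) by (simp add: field_simps)
  then have "min T (real k * (\<delta> / 2)) = T" by (intro min_absorb1) simp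
  with PT[of k] have "P T" by simp
  then show ?thesis using t unfolding P_def by auto
qed

text \<open>By Fubini, pairing with a fixed field commutes with the time integral that represents the
  increment of \<open>u\<close>.\<close>

lemma energy_pairing:
  fixes u z :: "real \<Rightarrow> 'a \<Rightarrow> 'b::euclidean_space"
  assumes M: "finite_measure M" and N: "N \<in> null_sets lborel"
    and z_int: "integrable (restrict_space lborel {a..b} \<Otimes>\<^sub>M M) (\<lambda>(t, x). z t x)"
    and z_mem: "\<And>t. a < t \<Longrightarrow> t < b \<Longrightarrow> t \<notin> N \<Longrightarrow> Lp_mem 2 M (z t)"
    and \<rho>: "set_integrable lborel {a..b} (\<lambda>\<tau>. Lp_seminorm 2 M (z \<tau>))"
    and st: "a < s" "s < t" "t < b"
    and ftc: "AE x in M. u t x - u s x = (LINT \<tau>:{s..t}|lborel. z \<tau> x)"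
    and us: "Lp_mem 2 M (u s)" and ut: "Lp_mem 2 M (u t)" and v: "Lp_mem 2 M v"
  shows "set_integrable lborel {s..t} (\<lambda>\<tau>. \<integral>x. z \<tau> x \<bullet> v x \<partial>M)"
    and "(\<integral>x. (u t x - u s x) \<bullet> v x \<partial>M) = (LINT \<tau>:{s..t}|lborel. \<integral>x. z \<tau> x \<bullet> v x \<partial>M)"
proof -
  let ?T = "restrict_space lborel {a..b}"
  interpret M: finite_measure M by fact
  interpret T: sigma_finite_measure ?T
    by (rule sigma_finite_measure_restrict_space[OF sigma_finite_lborel]) simp
  interpret P: pair_sigma_finite ?T M ..
  have [measurable]: "v \<in> borel_measurable M" "u s \<in> borel_measurable M" "u t \<in> borel_measurable M"
    using us ut v unfolding Lp_mem_def by auto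
  have zm: "(\<lambda>p. z (fst p) (snd p)) \<in> borel_measurable (?T \<Otimes>\<^sub>M M)"
    using borel_measurable_integrable[OF z_int] by (simp add: case_prod_unfold)
  have im: "(\<lambda>\<tau>. indicator {s..t} \<tau> :: real) \<in> borel_measurable ?T" by (rule measurable_restrict_space1) simp
  define Q where "Q p = indicator {s..t} (fst p) *\<^sub>R (z (fst p) (snd p) \<bullet> v (snd p))" for p
  have good: "AE \<tau> in ?T. Lp_mem 2 M (z \<tau>)"
    using null_set_AE[OF N] AE_lborel_singleton[of a] AE_lborel_singleton[of b]
    by (subst AE_restrict_space_iff, simp, eventually_elim) (use z_mem in force)
  have Qm: "Q \<in> borel_measurable (?T \<Otimes>\<^sub>M M)"
    unfolding Q_def by (intro borel_measurable_scaleR borel_measurable_inner zm measurable_compose[OF measurable_fst im]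
        measurable_compose[OF measurable_snd]) simp
  have i\<rho>: "integrable ?T (\<lambda>\<tau>. Lp_seminorm 2 M (z \<tau>) * Lp_seminorm 2 M v)"
    using \<rho> by (intro integrable_mult_left) (simp add: integral_restrict_lborel_self)
  have Q: "integrable (?T \<Otimes>\<^sub>M M) Q"
  proof (rule P.Fubini_integrable[OF Qm])
    show "AE \<tau> in ?T. integrable M (\<lambda>x. Q (\<tau>, x))"
      using good by eventually_elim (auto simp: Q_def intro!: L2_inner_bound(1) v)
    show "integrable ?T (\<lambda>\<tau>. \<integral>x. norm (Q (\<tau>, x)) \<partial>M)"
    proof (rule Bochner_Integration.integrable_bound[OF i\<rho>])
      show "(\<lambda>\<tau>. \<integral>x. norm (Q (\<tau>, x)) \<partial>M) \<in> borel_measurable ?T"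
        by (rule M.borel_measurable_lebesgue_integral) (use Qm in \<open>simp add: case_prod_unfold\<close>)
      show "AE \<tau> in ?T. norm (\<integral>x. norm (Q (\<tau>, x)) \<partial>M) \<le> norm (Lp_seminorm 2 M (z \<tau>) * Lp_seminorm 2 M v)"
        using good
      proof eventually_elim
        case (elim \<tau>)
        have "(\<integral>x. norm (Q (\<tau>, x)) \<partial>M) \<le> (\<integral>x. norm (z \<tau> x) * norm (v x) \<partial>M)"
        proof (rule integral_mono)
          show "integrable M (\<lambda>x. norm (Q (\<tau>, x)))"
            unfolding Q_def by (auto intro!: integrable_norm L2_inner_bound(1) v elim)
          show "integrable M (\<lambda>x. norm (z \<tau> x) * norm (v x))" by (rule Cauchy_Schwarz_L2(1)[OF elim v])
          show "norm (Q (\<tau>, x)) \<le> norm (z \<tau> x) * norm (v x)" for x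
            unfolding Q_def by (auto simp: indicator_def Cauchy_Schwarz_ineq2)
        qed
        also have "\<dots> \<le> Lp_seminorm 2 M (z \<tau>) * Lp_seminorm 2 M v" by (rule Cauchy_Schwarz_L2(2)[OF elim v])
        finally show ?case
          by (simp add: Lp_seminorm_nonneg abs_mult integral_nonneg_AE)
      qed
    qed
  qed
  have inner: "(\<integral>x. Q (\<tau>, x) \<partial>M) = indicator {s..t} \<tau> *\<^sub>R (\<integral>x. z \<tau> x \<bullet> v x \<partial>M)" for \<tau>
    unfolding Q_def by simp
  have sub: "{s..t} \<subseteq> {a..b}" using st by auto
  show "set_integrable lborel {s..t} (\<lambda>\<tau>. \<integral>x. z \<tau> x \<bullet> v x \<partial>M)"
    using P.integrable_fst'[OF Q] unfolding inner by (simp add: integrable_restrict_lborel[OF _ sub] del: real_scaleR_def)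
  have "(LINT \<tau>:{s..t}|lborel. \<integral>x. z \<tau> x \<bullet> v x \<partial>M) = (\<integral>\<tau>. \<integral>x. Q (\<tau>, x) \<partial>M \<partial>?T)"
    unfolding inner by (rule integral_restrict_lborel[OF _ sub, symmetric]) simp
  also have "\<dots> = (\<integral>x. \<integral>\<tau>. Q (\<tau>, x) \<partial>?T \<partial>M)"
    by (rule P.Fubini_integral[symmetric]) (use Q in \<open>simp add: case_prod_unfold\<close>)
  also have "\<dots> = (\<integral>x. (u t x - u s x) \<bullet> v x \<partial>M)"
  proof (rule integral_cong_AE)
    show "(\<lambda>x. \<integral>\<tau>. Q (\<tau>, x) \<partial>?T) \<in> borel_measurable M"
      using P.integrable_snd[of "\<lambda>\<tau> x. Q (\<tau>, x)"] Q by (auto simp: case_prod_unfold)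
    show "(\<lambda>x. (u t x - u s x) \<bullet> v x) \<in> borel_measurable M" by measurable
    have "AE x in M. integrable ?T (\<lambda>\<tau>. z \<tau> x)"
      using P.AE_integrable_snd[of z] z_int by simp
    then show "AE x in M. (\<integral>\<tau>. Q (\<tau>, x) \<partial>?T) = (u t x - u s x) \<bullet> v x"
      using ftc
    proof eventually_elim
      case (elim x)
      have "integrable ?T (\<lambda>\<tau>. indicator {s..t} \<tau> *\<^sub>R z \<tau> x)"
        by (rule Bochner_Integration.integrable_bound[OF elim(1)])
           (use elim(1) im in \<open>auto intro!: borel_measurable_scaleR simp: indicator_def\<close>)
      then have "(\<integral>\<tau>. (indicator {s..t} \<tau> *\<^sub>R z \<tau> x) \<bullet> v x \<partial>?T) = (\<integral>\<tau>. indicator {s..t} \<tau> *\<^sub>R z \<tau> x \<partial>?T) \<bullet> v x"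
        by (intro integral_inner_left)
      also have "(\<integral>\<tau>. indicator {s..t} \<tau> *\<^sub>R z \<tau> x \<partial>?T) = u t x - u s x"
        unfolding elim(2) using sub by (intro integral_restrict_lborel) auto
      finally show ?case unfolding Q_def by simp
    qed
  qed
  finally show "(\<integral>x. (u t x - u s x) \<bullet> v x \<partial>M) = (LINT \<tau>:{s..t}|lborel. \<integral>x. z \<tau> x \<bullet> v x \<partial>M)" ..
qed

text \<open>The product rule for a function that is absolutely continuous in time with values in $L^2$.
  The increment of $\|u\|^2$ from \<open>s\<close> to \<open>t\<close> is
  $\int_s^t (z(\tau), u(t) + u(s))\, d\tau$.  Replacing $u(t) + u(s)$ by $2 u(\tau)$ costs at most
  $\int_s^t \|z\| \cdot (\|u(t) - u(\tau)\| + \|u(\tau) - u(s)\|)\, d\tau$, which is bounded by the square of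
  $\int_s^t \|z\|$.  Errors of this order disappear by
  \<open>nonincreasing_if_quadratic_increments\<close>.\<close>

lemma energy_inequality:
  fixes u z :: "real \<Rightarrow> 'a \<Rightarrow> 'b::euclidean_space"
  assumes M: "finite_measure M" and N: "N \<in> null_sets lborel"
    and u_mem: "\<And>t. a < t \<Longrightarrow> t < b \<Longrightarrow> t \<notin> N \<Longrightarrow> Lp_mem 2 M (u t)"
    and u_bd: "\<And>t. a < t \<Longrightarrow> t < b \<Longrightarrow> t \<notin> N \<Longrightarrow> Lp_seminorm 2 M (u t) \<le> K"
    and um: "(\<lambda>(t, x). u t x) \<in> borel_measurable (restrict_space lborel {a..b} \<Otimes>\<^sub>M M)"
    and z_int: "integrable (restrict_space lborel {a..b} \<Otimes>\<^sub>M M) (\<lambda>(t, x). z t x)"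
    and z_mem: "\<And>t. a < t \<Longrightarrow> t < b \<Longrightarrow> t \<notin> N \<Longrightarrow> Lp_mem 2 M (z t)"
    and \<rho>: "set_integrable lborel {a..b} (\<lambda>\<tau>. Lp_seminorm 2 M (z \<tau>))"
    and ftc: "\<And>s t. a < s \<Longrightarrow> s < t \<Longrightarrow> t < b \<Longrightarrow> s \<notin> N \<Longrightarrow> t \<notin> N \<Longrightarrow>
       AE x in M. u t x - u s x = (LINT \<tau>:{s..t}|lborel. z \<tau> x)"
    and st: "a < s" "s < t" "t < b" "s \<notin> N" "t \<notin> N"
  shows "set_integrable lborel {a..b} (\<lambda>\<tau>. \<integral>x. z \<tau> x \<bullet> u \<tau> x \<partial>M)"
    and "(Lp_seminorm 2 M (u t))\<^sup>2 \<le> (Lp_seminorm 2 M (u s))\<^sup>2 + 2 * (LINT \<tau>:{s..t}|lborel. \<integral>x. z \<tau> x \<bullet> u \<tau> x \<partial>M)"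
proof -
  let ?T = "restrict_space lborel {a..b}"
  interpret M: finite_measure M by fact
  interpret T: sigma_finite_measure ?T
    by (rule sigma_finite_measure_restrict_space[OF sigma_finite_lborel]) simp
  interpret P: pair_sigma_finite ?T M ..
  define \<rho>' where "\<rho>' \<tau> = Lp_seminorm 2 M (z \<tau>)" for \<tau>
  define q where "q \<tau> = (\<integral>x. z \<tau> x \<bullet> u \<tau> x \<partial>M)" for \<tau>
  define \<Gamma> where "\<Gamma> t = (LINT \<tau>:{a..t}|lborel. \<rho>' \<tau>)" for t
  have \<rho>0: "0 \<le> \<rho>' \<tau>" for \<tau> unfolding \<rho>'_def by (rule Lp_seminorm_nonneg)
  have i\<rho>: "set_integrable lborel {a..b} \<rho>'" unfolding \<rho>'_def by (rule \<rho>)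
  have i\<rho>s: "set_integrable lborel {s..t} \<rho>'" if "a \<le> s" "t \<le> b" for s t
    by (rule set_integrable_subset[OF i\<rho>]) (use that in auto)
  have good: "AE \<tau> in lborel. \<tau> \<in> {a..b} \<longrightarrow> a < \<tau> \<and> \<tau> < b \<and> \<tau> \<notin> N"
    using null_set_AE[OF N] AE_lborel_singleton[of a] AE_lborel_singleton[of b]
    by eventually_elim auto
  show iq: "set_integrable lborel {a..b} q"
  proof -
    have "integrable ?T q"
    proof (rule Bochner_Integration.integrable_bound)
      show "integrable ?T (\<lambda>\<tau>. \<rho>' \<tau> * K)"
        using i\<rho> by (intro integrable_mult_left) (simp add: integral_restrict_lborel_self)
      have "(\<lambda>p. (\<lambda>(t, x). z t x) p \<bullet> (\<lambda>(t, x). u t x) p) \<in> borel_measurable (?T \<Otimes>\<^sub>M M)"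
        by (rule borel_measurable_inner[OF borel_measurable_integrable[OF z_int] um])
      then show "q \<in> borel_measurable ?T"
        unfolding q_def by (intro M.borel_measurable_lebesgue_integral) (simp add: case_prod_unfold)
      show "AE \<tau> in ?T. norm (q \<tau>) \<le> norm (\<rho>' \<tau> * K)"
      proof (subst AE_restrict_space_iff, simp, use good in eventually_elim, intro impI)
        fix \<tau> assume \<tau>: "\<tau> \<in> {a..b} \<longrightarrow> a < \<tau> \<and> \<tau> < b \<and> \<tau> \<notin> N" "\<tau> \<in> {a..b}"
        have "\<bar>q \<tau>\<bar> \<le> \<rho>' \<tau> * Lp_seminorm 2 M (u \<tau>)"
          unfolding q_def \<rho>'_def using \<tau> by (intro L2_inner_bound(2) z_mem u_mem) auto
        also have "\<dots> \<le> \<rho>' \<tau> * K" using \<tau> u_bd[of \<tau>] \<rho>0 by (intro mult_left_mono) auto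
        finally show "norm (q \<tau>) \<le> norm (\<rho>' \<tau> * K)" by simp
      qed
    qed
    then show ?thesis by (simp add: integral_restrict_lborel_self)
  qed
  have iqs: "set_integrable lborel {s..t} q" if "a \<le> s" "t \<le> b" for s t
    by (rule set_integrable_subset[OF iq]) (use that in auto)
  have \<Gamma>_diff: "\<Gamma> t - \<Gamma> s = (LINT \<tau>:{s..t}|lborel. \<rho>' \<tau>)" if "a \<le> s" "s \<le> t" "t \<le> b" for s t
    unfolding \<Gamma>_def using set_integral_Icc_split[OF i\<rho> that] by simp
  have \<Gamma>_mono: "\<Gamma> s \<le> \<Gamma> t" if "a \<le> s" "s \<le> t" "t \<le> b" for s t
  proof -
    have "0 \<le> (LINT \<tau>:{s..t}|lborel. \<rho>' \<tau>)"
      unfolding set_lebesgue_integral_def using \<rho>0 by (intro integral_nonneg_AE AE_I2) simp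
    then show ?thesis using \<Gamma>_diff[OF that] by simp
  qed
  \<comment> \<open>Minkowski's inequality for the time integral, obtained by pairing the increment with itself\<close>
  have dist: "Lp_seminorm 2 M (\<lambda>x. u t x - u s x) \<le> \<Gamma> t - \<Gamma> s"
    if st: "a < s" "s < t" "t < b" "s \<notin> N" "t \<notin> N" for s t
  proof -
    let ?d = "\<lambda>x. u t x - u s x"
    have d: "Lp_mem 2 M ?d" using st by (intro Lp_mem_diff(1) u_mem) auto
    note pr = energy_pairing[OF M N z_int z_mem \<rho> st(1-3) ftc[OF st] u_mem u_mem d]
    have "(Lp_seminorm 2 M ?d)\<^sup>2 = (\<integral>x. ?d x \<bullet> ?d x \<partial>M)"
      unfolding Lp_seminorm_2 power2_norm_eq_inner ..
    also have "\<dots> = (LINT \<tau>:{s..t}|lborel. \<integral>x. z \<tau> x \<bullet> ?d x \<partial>M)"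
      using st by (intro pr(2)) auto
    also have "\<dots> \<le> (LINT \<tau>:{s..t}|lborel. \<rho>' \<tau> * Lp_seminorm 2 M ?d)"
    proof (rule set_integral_mono_AE)
      show "set_integrable lborel {s..t} (\<lambda>\<tau>. \<integral>x. z \<tau> x \<bullet> ?d x \<partial>M)" using st by (intro pr(1)) auto
      show "set_integrable lborel {s..t} (\<lambda>\<tau>. \<rho>' \<tau> * Lp_seminorm 2 M ?d)"
        using st by (intro set_integrable_mult_left i\<rho>s) auto
      show "AE \<tau>\<in>{s..t} in lborel. (\<integral>x. z \<tau> x \<bullet> ?d x \<partial>M) \<le> \<rho>' \<tau> * Lp_seminorm 2 M ?d"
        using good
      proof (eventually_elim, intro impI)
        fix \<tau> assume "\<tau> \<in> {a..b} \<longrightarrow> a < \<tau> \<and> \<tau> < b \<and> \<tau> \<notin> N" "\<tau> \<in> {s..t}"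
        then have "Lp_mem 2 M (z \<tau>)" using st by (intro z_mem) auto
        from L2_inner_bound(2)[OF this d] show "(\<integral>x. z \<tau> x \<bullet> ?d x \<partial>M) \<le> \<rho>' \<tau> * Lp_seminorm 2 M ?d"
          unfolding \<rho>'_def by linarith
      qed
    qed
    also have "\<dots> = (\<Gamma> t - \<Gamma> s) * Lp_seminorm 2 M ?d" using \<Gamma>_diff[of s t] st by simp
    finally have "Lp_seminorm 2 M ?d * Lp_seminorm 2 M ?d \<le> (\<Gamma> t - \<Gamma> s) * Lp_seminorm 2 M ?d"
      by (simp add: power2_eq_square)
    then show ?thesis
      using Lp_seminorm_nonneg[of 2 M ?d] \<Gamma>_mono[of s t] st
      by (cases "Lp_seminorm 2 M ?d = 0") (auto simp: mult_le_cancel_right)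
  qed
  have dist': "Lp_seminorm 2 M (\<lambda>x. u t x - u \<tau> x) + Lp_seminorm 2 M (\<lambda>x. u \<tau> x - u s x) \<le> \<Gamma> t - \<Gamma> s"
    if st: "a < s" "s < t" "t < b" "s \<notin> N" "t \<notin> N" "s \<le> \<tau>" "\<tau> \<le> t" "\<tau> \<notin> N" for s t \<tau>
  proof -
    have z: "Lp_seminorm 2 M (\<lambda>x. 0 :: 'b) = 0" unfolding Lp_seminorm_def by simp
    have "Lp_seminorm 2 M (\<lambda>x. u t x - u \<tau> x) \<le> \<Gamma> t - \<Gamma> \<tau>"
      using dist[of \<tau> t] st z by (cases "\<tau> = t") auto
    moreover have "Lp_seminorm 2 M (\<lambda>x. u \<tau> x - u s x) \<le> \<Gamma> \<tau> - \<Gamma> s"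
      using dist[of s \<tau>] st z by (cases "\<tau> = s") auto
    ultimately show ?thesis by simp
  qed
  define e where "e t = (Lp_seminorm 2 M (u t))\<^sup>2 - 2 * (LINT \<tau>:{a..t}|lborel. q \<tau>)" for t
  have "e t \<le> e s"
  proof (rule nonincreasing_if_quadratic_increments[OF N _ \<Gamma>_mono _ st])
    show "continuous_on {a..b} \<Gamma>" unfolding \<Gamma>_def by (rule continuous_indefinite_integral[OF i\<rho>])
    fix s t assume st: "a < s" "s < t" "t < b" "s \<notin> N" "t \<notin> N"
    note ms = u_mem[of s] u_mem[of t]
    have mst: "Lp_mem 2 M (u s)" "Lp_mem 2 M (u t)" using st by (auto intro!: u_mem)
    let ?v = "\<lambda>x. u t x + u s x"
    have v: "Lp_mem 2 M ?v"
      using Lp_mem_diff(1)[OF _ mst(2), of "\<lambda>x. - u s x"] mst(1) by (simp add: Lp_mem_def)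
    note pr = energy_pairing[OF M N z_int z_mem \<rho> st(1-3) ftc[OF st] mst v]
    have i2: "integrable M (\<lambda>x. (norm (u t x))\<^sup>2)" "integrable M (\<lambda>x. (norm (u s x))\<^sup>2)" using mst unfolding Lp_mem_2 by auto
    have "(Lp_seminorm 2 M (u t))\<^sup>2 - (Lp_seminorm 2 M (u s))\<^sup>2 = (\<integral>x. (norm (u t x))\<^sup>2 - (norm (u s x))\<^sup>2 \<partial>M)"
      unfolding Lp_seminorm_2 using i2 by simp
    also have "\<dots> = (\<integral>x. (u t x - u s x) \<bullet> ?v x \<partial>M)"
      by (intro Bochner_Integration.integral_cong) (auto simp: power2_norm_eq_inner inner_add_right inner_diff_left inner_commute[of "u s _" "u t _"])
    also have "\<dots> = (LINT \<tau>:{s..t}|lborel. \<integral>x. z \<tau> x \<bullet> ?v x \<partial>M)" by (rule pr(2))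
    finally have 1: "(Lp_seminorm 2 M (u t))\<^sup>2 - (Lp_seminorm 2 M (u s))\<^sup>2 = (LINT \<tau>:{s..t}|lborel. \<integral>x. z \<tau> x \<bullet> ?v x \<partial>M)" .
    have "e t - e s = (LINT \<tau>:{s..t}|lborel. \<integral>x. z \<tau> x \<bullet> ?v x \<partial>M) - 2 * (LINT \<tau>:{s..t}|lborel. q \<tau>)"
      using set_integral_Icc_split[OF iq, of s t] st 1 unfolding e_def by simp
    also have "\<dots> = (LINT \<tau>:{s..t}|lborel. (\<integral>x. z \<tau> x \<bullet> ?v x \<partial>M) - 2 * q \<tau>)"
      using pr(1) iqs[of s t] st by (simp add: set_integral_diff)
    also have "\<dots> \<le> (LINT \<tau>:{s..t}|lborel. \<rho>' \<tau> * (\<Gamma> t - \<Gamma> s))"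
    proof (rule set_integral_mono_AE)
      show "set_integrable lborel {s..t} (\<lambda>\<tau>. (\<integral>x. z \<tau> x \<bullet> ?v x \<partial>M) - 2 * q \<tau>)"
        using pr(1) iqs[of s t] st by (intro set_integral_diff set_integrable_mult_right) auto
      show "set_integrable lborel {s..t} (\<lambda>\<tau>. \<rho>' \<tau> * (\<Gamma> t - \<Gamma> s))"
        using st by (intro set_integrable_mult_left i\<rho>s) auto
      show "AE \<tau>\<in>{s..t} in lborel. (\<integral>x. z \<tau> x \<bullet> ?v x \<partial>M) - 2 * q \<tau> \<le> \<rho>' \<tau> * (\<Gamma> t - \<Gamma> s)"
        using good
      proof (eventually_elim, intro impI)
        fix \<tau> assume \<tau>: "\<tau> \<in> {a..b} \<longrightarrow> a < \<tau> \<and> \<tau> < b \<and> \<tau> \<notin> N" "\<tau> \<in> {s..t}"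
        then have zt: "Lp_mem 2 M (z \<tau>)" and ut: "Lp_mem 2 M (u \<tau>)" using st by (auto intro!: z_mem u_mem)
        have d: "Lp_mem 2 M (\<lambda>x. u t x - u \<tau> x)" "Lp_mem 2 M (\<lambda>x. u \<tau> x - u s x)"
          using mst ut by (auto intro!: Lp_mem_diff(1))
        have "(\<integral>x. z \<tau> x \<bullet> ?v x \<partial>M) - 2 * q \<tau> = (\<integral>x. z \<tau> x \<bullet> ?v x - 2 * (z \<tau> x \<bullet> u \<tau> x) \<partial>M)"
          unfolding q_def using L2_inner_bound(1)[OF zt v] L2_inner_bound(1)[OF zt ut] by simp
        also have "\<dots> = (\<integral>x. z \<tau> x \<bullet> (u t x - u \<tau> x) - z \<tau> x \<bullet> (u \<tau> x - u s x) \<partial>M)"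
          by (intro Bochner_Integration.integral_cong) (auto simp: inner_add_right inner_diff_right)
        also have "\<dots> = (\<integral>x. z \<tau> x \<bullet> (u t x - u \<tau> x) \<partial>M) - (\<integral>x. z \<tau> x \<bullet> (u \<tau> x - u s x) \<partial>M)"
          by (rule Bochner_Integration.integral_diff[OF L2_inner_bound(1)[OF zt d(1)] L2_inner_bound(1)[OF zt d(2)]])
        also have "\<dots> \<le> \<rho>' \<tau> * Lp_seminorm 2 M (\<lambda>x. u t x - u \<tau> x) + \<rho>' \<tau> * Lp_seminorm 2 M (\<lambda>x. u \<tau> x - u s x)"
          using L2_inner_bound(2)[OF zt d(1)] L2_inner_bound(2)[OF zt d(2)] unfolding \<rho>'_def by linarith
        also have "\<dots> \<le> \<rho>' \<tau> * (\<Gamma> t - \<Gamma> s)"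
          unfolding distrib_left[symmetric] using dist'[of s t \<tau>] st \<tau> \<rho>0 by (intro mult_left_mono) auto
        finally show "(\<integral>x. z \<tau> x \<bullet> ?v x \<partial>M) - 2 * q \<tau> \<le> \<rho>' \<tau> * (\<Gamma> t - \<Gamma> s)" .
      qed
    qed
    also have "\<dots> = (\<Gamma> t - \<Gamma> s)\<^sup>2" using \<Gamma>_diff[of s t] st by (simp add: power2_eq_square)
    finally show "e t - e s \<le> (\<Gamma> t - \<Gamma> s)\<^sup>2" .
  qed
  then show "(Lp_seminorm 2 M (u t))\<^sup>2 \<le> (Lp_seminorm 2 M (u s))\<^sup>2 + 2 * (LINT \<tau>:{s..t}|lborel. q \<tau>)"
    using set_integral_Icc_split[OF iq, of s t] st unfolding e_def by simp
qed

section \<open>The Ladyzhenskaya inequality in two and three dimensions\<close>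

lemma nn_integral_PiM_insert_direction:
  fixes F :: "'a::euclidean_space \<Rightarrow> ennreal"
  assumes [measurable]: "F \<in> borel_measurable borel" and I: "finite I" "i \<notin> I"
  shows "(\<integral>\<^sup>+x. F (\<Sum>b\<in>insert i I. x b *\<^sub>R b) \<partial>(\<Pi>\<^sub>M b\<in>insert i I. lborel))
    = (\<integral>\<^sup>+y. \<integral>\<^sup>+x. F (y *\<^sub>R i + (\<Sum>b\<in>I. x b *\<^sub>R b)) \<partial>(\<Pi>\<^sub>M b\<in>I. lborel) \<partial>lborel)"
proof -
  interpret product_sigma_finite "\<lambda>_::'a. lborel :: real measure" by standard
  have "(\<integral>\<^sup>+x. F (\<Sum>b\<in>insert i I. x b *\<^sub>R b) \<partial>(\<Pi>\<^sub>M b\<in>insert i I. lborel))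
     = (\<integral>\<^sup>+y. \<integral>\<^sup>+x. F (\<Sum>b\<in>insert i I. (x(i := y)) b *\<^sub>R b) \<partial>(\<Pi>\<^sub>M b\<in>I. lborel) \<partial>lborel)"
    by (rule product_nn_integral_insert_rev[OF I]) measurable
  also have "\<dots> = (\<integral>\<^sup>+y. \<integral>\<^sup>+x. F (y *\<^sub>R i + (\<Sum>b\<in>I. x b *\<^sub>R b)) \<partial>(\<Pi>\<^sub>M b\<in>I. lborel) \<partial>lborel)"
  proof (intro nn_integral_cong arg_cong[where f=F])
    fix x y
    have "(\<Sum>b\<in>I. (x(i := y)) b *\<^sub>R b) = (\<Sum>b\<in>I. x b *\<^sub>R b)"
      using I(2) by (intro sum.cong) auto
    then show "(\<Sum>b\<in>insert i I. (x(i := y)) b *\<^sub>R b) = y *\<^sub>R i + (\<Sum>b\<in>I. x b *\<^sub>R b)" using I by simp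
  qed
  finally show ?thesis .
qed

lemma nn_integral_PiM_empty_direction:
  fixes F :: "'a::euclidean_space \<Rightarrow> ennreal"
  shows "(\<integral>\<^sup>+x. F (v + (\<Sum>b\<in>{}. x b *\<^sub>R b)) \<partial>(\<Pi>\<^sub>M b\<in>{}. lborel :: real measure)) = F v"
  by (simp add: PiM_empty nn_integral_count_space_finite)

text \<open>The order of the basis vectors is free, which lets any coordinate direction be integrated
  first.\<close>

lemma nn_integral_lborel_2:
  fixes F :: "'a::euclidean_space \<Rightarrow> ennreal"
  assumes F[measurable]: "F \<in> borel_measurable borel" and B: "Basis = {e1, e2}" "e1 \<noteq> e2"
  shows "(\<integral>\<^sup>+x. F x \<partial>lborel) = (\<integral>\<^sup>+a. \<integral>\<^sup>+b. F (a *\<^sub>R e1 + b *\<^sub>R e2) \<partial>lborel \<partial>lborel)"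
proof -
  have "(\<integral>\<^sup>+x. F x \<partial>lborel) = (\<integral>\<^sup>+x. F (\<Sum>b\<in>{e1, e2}. x b *\<^sub>R b) \<partial>(\<Pi>\<^sub>M b\<in>{e1, e2}. lborel))"
    by (subst lborel_eq) (simp add: nn_integral_distr B(1))
  also have "\<dots> = (\<integral>\<^sup>+a. \<integral>\<^sup>+x. F (a *\<^sub>R e1 + (\<Sum>b\<in>{e2}. x b *\<^sub>R b)) \<partial>(\<Pi>\<^sub>M b\<in>{e2}. lborel) \<partial>lborel)"
    using B(2) by (intro nn_integral_PiM_insert_direction) auto
  also have "\<dots> = (\<integral>\<^sup>+a. \<integral>\<^sup>+b. \<integral>\<^sup>+x. F (a *\<^sub>R e1 + (b *\<^sub>R e2 + (\<Sum>b\<in>{}. x b *\<^sub>R b))) \<partial>(\<Pi>\<^sub>M b\<in>{}. lborel :: real measure) \<partial>lborel \<partial>lborel)"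
    by (intro nn_integral_cong nn_integral_PiM_insert_direction[where F="\<lambda>v. F (_ + v)"]) auto
  also have "\<dots> = (\<integral>\<^sup>+a. \<integral>\<^sup>+b. F (a *\<^sub>R e1 + b *\<^sub>R e2) \<partial>lborel \<partial>lborel)"
    unfolding add.assoc[symmetric] nn_integral_PiM_empty_direction ..
  finally show ?thesis .
qed

lemma nn_integral_lborel_3:
  fixes F :: "'a::euclidean_space \<Rightarrow> ennreal"
  assumes F[measurable]: "F \<in> borel_measurable borel" and B: "Basis = {e1, e2, e3}" "distinct [e1, e2, e3]"
  shows "(\<integral>\<^sup>+x. F x \<partial>lborel) = (\<integral>\<^sup>+a. \<integral>\<^sup>+b. \<integral>\<^sup>+c. F (a *\<^sub>R e1 + b *\<^sub>R e2 + c *\<^sub>R e3) \<partial>lborel \<partial>lborel \<partial>lborel)"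
proof -
  have "(\<integral>\<^sup>+x. F x \<partial>lborel) = (\<integral>\<^sup>+x. F (\<Sum>b\<in>{e1, e2, e3}. x b *\<^sub>R b) \<partial>(\<Pi>\<^sub>M b\<in>{e1, e2, e3}. lborel))"
    by (subst lborel_eq) (simp add: nn_integral_distr B(1))
  also have "\<dots> = (\<integral>\<^sup>+a. \<integral>\<^sup>+x. F (a *\<^sub>R e1 + (\<Sum>b\<in>{e2, e3}. x b *\<^sub>R b)) \<partial>(\<Pi>\<^sub>M b\<in>{e2, e3}. lborel) \<partial>lborel)"
    using B(2) by (intro nn_integral_PiM_insert_direction) auto
  also have "\<dots> = (\<integral>\<^sup>+a. \<integral>\<^sup>+b. \<integral>\<^sup>+x. F (a *\<^sub>R e1 + (b *\<^sub>R e2 + (\<Sum>b\<in>{e3}. x b *\<^sub>R b))) \<partial>(\<Pi>\<^sub>M b\<in>{e3}. lborel) \<partial>lborel \<partial>lborel)"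
    using B(2) by (intro nn_integral_cong nn_integral_PiM_insert_direction[where F="\<lambda>v. F (_ + v)"]) auto
  also have "\<dots> = (\<integral>\<^sup>+a. \<integral>\<^sup>+b. \<integral>\<^sup>+c. \<integral>\<^sup>+x. F (a *\<^sub>R e1 + (b *\<^sub>R e2 + (c *\<^sub>R e3 + (\<Sum>b\<in>{}. x b *\<^sub>R b)))) \<partial>(\<Pi>\<^sub>M b\<in>{}. lborel :: real measure) \<partial>lborel \<partial>lborel \<partial>lborel)"
    by (intro nn_integral_cong nn_integral_PiM_insert_direction[where F="\<lambda>v. F (_ + (_ + v))"]) auto
  also have "\<dots> = (\<integral>\<^sup>+a. \<integral>\<^sup>+b. \<integral>\<^sup>+c. F (a *\<^sub>R e1 + b *\<^sub>R e2 + c *\<^sub>R e3) \<partial>lborel \<partial>lborel \<partial>lborel)"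
    unfolding add.assoc[symmetric] nn_integral_PiM_empty_direction ..
  finally show ?thesis .
qed

text \<open>Cauchy-Schwarz in $(x, y)$ separates $h$ from $\int f(y, z)\, g(x, z)\, dz$, and Cauchy-Schwarz in $z$
  separates $f$ from $g$.\<close>

lemma Loomis_Whitney_3:
  fixes f g h :: "real \<times> real \<Rightarrow> ennreal"
  assumes f[measurable]: "f \<in> borel_measurable (lborel \<Otimes>\<^sub>M lborel)"
    and g[measurable]: "g \<in> borel_measurable (lborel \<Otimes>\<^sub>M lborel)"
    and h[measurable]: "h \<in> borel_measurable (lborel \<Otimes>\<^sub>M lborel)"
  shows "(\<integral>\<^sup>+x. \<integral>\<^sup>+y. \<integral>\<^sup>+z. f (y, z) * g (x, z) * h (x, y) \<partial>lborel \<partial>lborel \<partial>lborel)\<^sup>2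
     \<le> (\<integral>\<^sup>+y. \<integral>\<^sup>+z. (f (y, z))\<^sup>2 \<partial>lborel \<partial>lborel) * (\<integral>\<^sup>+x. \<integral>\<^sup>+z. (g (x, z))\<^sup>2 \<partial>lborel \<partial>lborel)
       * (\<integral>\<^sup>+x. \<integral>\<^sup>+y. (h (x, y))\<^sup>2 \<partial>lborel \<partial>lborel)"
proof -
  define k where "k p = (\<integral>\<^sup>+z. f (snd p, z) * g (fst p, z) \<partial>lborel)" for p
  have km[measurable]: "k \<in> borel_measurable (lborel \<Otimes>\<^sub>M lborel)"
    unfolding k_def by measurable
  have "(\<integral>\<^sup>+x. \<integral>\<^sup>+y. \<integral>\<^sup>+z. f (y, z) * g (x, z) * h (x, y) \<partial>lborel \<partial>lborel \<partial>lborel)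
     = (\<integral>\<^sup>+x. \<integral>\<^sup>+y. h (x, y) * k (x, y) \<partial>lborel \<partial>lborel)"
  proof (intro nn_integral_cong)
    fix x y :: real
    have "(\<integral>\<^sup>+z. f (y, z) * g (x, z) * h (x, y) \<partial>lborel) = (\<integral>\<^sup>+z. f (y, z) * g (x, z) \<partial>lborel) * h (x, y)"
      by (rule nn_integral_multc) measurable
    then show "(\<integral>\<^sup>+z. f (y, z) * g (x, z) * h (x, y) \<partial>lborel) = h (x, y) * k (x, y)"
      unfolding k_def by (simp add: mult.commute)
  qed
  also have "\<dots> = (\<integral>\<^sup>+p. h p * k p \<partial>(lborel \<Otimes>\<^sub>M lborel))"
    by (subst lborel.nn_integral_fst[symmetric]) simp_all
  also have "\<dots>\<^sup>2 \<le> (\<integral>\<^sup>+p. (h p)\<^sup>2 \<partial>(lborel \<Otimes>\<^sub>M lborel)) * (\<integral>\<^sup>+p. (k p)\<^sup>2 \<partial>(lborel \<Otimes>\<^sub>M lborel))"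
    by (rule Cauchy_Schwarz_nn_integral) measurable
  also have "(\<integral>\<^sup>+p. (h p)\<^sup>2 \<partial>(lborel \<Otimes>\<^sub>M lborel)) = (\<integral>\<^sup>+x. \<integral>\<^sup>+y. (h (x, y))\<^sup>2 \<partial>lborel \<partial>lborel)"
    by (subst lborel.nn_integral_fst[symmetric]) simp_all
  finally have 1: "(\<integral>\<^sup>+x. \<integral>\<^sup>+y. \<integral>\<^sup>+z. f (y, z) * g (x, z) * h (x, y) \<partial>lborel \<partial>lborel \<partial>lborel)\<^sup>2
    \<le> (\<integral>\<^sup>+x. \<integral>\<^sup>+y. (h (x, y))\<^sup>2 \<partial>lborel \<partial>lborel) * (\<integral>\<^sup>+p. (k p)\<^sup>2 \<partial>(lborel \<Otimes>\<^sub>M lborel))" .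
  have 2: "(\<integral>\<^sup>+p. (k p)\<^sup>2 \<partial>(lborel \<Otimes>\<^sub>M lborel)) \<le> (\<integral>\<^sup>+y. \<integral>\<^sup>+z. (f (y, z))\<^sup>2 \<partial>lborel \<partial>lborel) * (\<integral>\<^sup>+x. \<integral>\<^sup>+z. (g (x, z))\<^sup>2 \<partial>lborel \<partial>lborel)"
  proof -
    have "(\<integral>\<^sup>+p. (k p)\<^sup>2 \<partial>(lborel \<Otimes>\<^sub>M lborel)) = (\<integral>\<^sup>+x. \<integral>\<^sup>+y. (k (x, y))\<^sup>2 \<partial>lborel \<partial>lborel)"
      by (subst lborel.nn_integral_fst[symmetric]) simp_all
    also have "\<dots> \<le> (\<integral>\<^sup>+x. \<integral>\<^sup>+y. (\<integral>\<^sup>+z. (f (y, z))\<^sup>2 \<partial>lborel) * (\<integral>\<^sup>+z. (g (x, z))\<^sup>2 \<partial>lborel) \<partial>lborel \<partial>lborel)"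
      unfolding k_def fst_conv snd_conv by (intro nn_integral_mono Cauchy_Schwarz_nn_integral) measurable
    also have "\<dots> = (\<integral>\<^sup>+x. (\<integral>\<^sup>+y. \<integral>\<^sup>+z. (f (y, z))\<^sup>2 \<partial>lborel \<partial>lborel) * (\<integral>\<^sup>+z. (g (x, z))\<^sup>2 \<partial>lborel) \<partial>lborel)"
      by (intro nn_integral_cong nn_integral_multc) measurable
    also have "\<dots> = (\<integral>\<^sup>+y. \<integral>\<^sup>+z. (f (y, z))\<^sup>2 \<partial>lborel \<partial>lborel) * (\<integral>\<^sup>+x. \<integral>\<^sup>+z. (g (x, z))\<^sup>2 \<partial>lborel \<partial>lborel)"
      by (rule nn_integral_cmult) measurable
    finally show ?thesis .
  qed
  show ?thesis
    using order_trans[OF 1 mult_left_mono[OF 2 zero_le]] by (simp only: mult.commute mult.left_commute)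
qed

text \<open>Along a line, $|u|^2$ is the integral of its derivative $2\, u \cdot \partial_b u$ from a point outside the
  support of \<open>u\<close>.\<close>

lemma square_le_line_integral:
  fixes u :: "'a::euclidean_space \<Rightarrow> 'b::euclidean_space"
  assumes u: "smooth u" and out: "\<And>x. norm x > R \<Longrightarrow> u x = 0" and b: "norm b = 1"
    and D: "\<And>x. norm (dir_deriv b u x) \<le> D x" "continuous_on UNIV D"
  shows "ennreal ((norm (u (x + s *\<^sub>R b)))\<^sup>2) \<le> 2 * (\<integral>\<^sup>+t. ennreal (norm (u (x + t *\<^sub>R b)) * D (x + t *\<^sub>R b)) \<partial>lborel)"
proof -
  define R' where "R' = \<bar>R\<bar> + norm x + \<bar>s\<bar> + 1"
  have zero: "u (x + t *\<^sub>R b) = 0" if "\<bar>t\<bar> \<ge> R'" for t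
  proof (rule out)
    have "norm (t *\<^sub>R b) \<le> norm (x + t *\<^sub>R b) + norm x"
      using norm_triangle_ineq4[of "x + t *\<^sub>R b" x] by simp
    then show "norm (x + t *\<^sub>R b) > R" using that b unfolding R'_def by simp
  qed
  define g where "g t = (norm (u (x + t *\<^sub>R b)))\<^sup>2" for t
  define g' where "g' t = 2 * (u (x + t *\<^sub>R b) \<bullet> dir_deriv b u (x + t *\<^sub>R b))" for t
  have lin: "((\<lambda>t. x + t *\<^sub>R b) has_derivative (\<lambda>h. h *\<^sub>R b)) (at t)" for t
    by (auto intro!: derivative_eq_intros)
  have du: "((\<lambda>t. u (x + t *\<^sub>R b)) has_derivative (\<lambda>h. h *\<^sub>R dir_deriv b u (x + t *\<^sub>R b))) (at t)" for t
  proof -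
    have "((\<lambda>t. u (x + t *\<^sub>R b)) has_derivative (\<lambda>h. frechet_derivative u (at (x + t *\<^sub>R b)) (h *\<^sub>R b))) (at t)"
      by (rule has_derivative_compose[OF lin smooth_has_derivative[OF u]])
    moreover have "frechet_derivative u (at (x + t *\<^sub>R b)) (h *\<^sub>R b) = h *\<^sub>R dir_deriv b u (x + t *\<^sub>R b)" for h
      unfolding dir_deriv_def
      using has_derivative_linear[OF smooth_has_derivative[OF u]] by (simp add: linear_cmul)
    ultimately show ?thesis by simp
  qed
  have "((\<lambda>t. u (x + t *\<^sub>R b) \<bullet> u (x + t *\<^sub>R b)) has_derivative
    (\<lambda>h. u (x + t *\<^sub>R b) \<bullet> (h *\<^sub>R dir_deriv b u (x + t *\<^sub>R b)) + (h *\<^sub>R dir_deriv b u (x + t *\<^sub>R b)) \<bullet> u (x + t *\<^sub>R b))) (at t)" for t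
    by (rule has_derivative_inner[OF du du])
  then have dg: "(g has_real_derivative g' t) (at t)" for t
    unfolding g_def g'_def has_field_derivative_def power2_norm_eq_inner
    by (rule has_derivative_eq_rhs) (auto simp: inner_commute algebra_simps)
  have cu: "continuous_on UNIV (\<lambda>t. u (x + t *\<^sub>R b))" "continuous_on UNIV (\<lambda>t. dir_deriv b u (x + t *\<^sub>R b))"
    "continuous_on UNIV (\<lambda>t. D (x + t *\<^sub>R b))"
    by (intro continuous_on_compose2[OF smooth_continuous_on[OF u, of UNIV]] continuous_on_compose2[OF smooth_continuous_on[OF smooth_dir_deriv[OF u], of UNIV]]
       continuous_on_compose2[OF D(2)] continuous_intros; simp)+
  have cg': "continuous_on UNIV g'" unfolding g'_def by (intro continuous_intros cu)
  let ?k = "\<lambda>t. norm (u (x + t *\<^sub>R b)) * D (x + t *\<^sub>R b)"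
  have ck: "continuous_on UNIV ?k" by (intro continuous_intros cu)
  have k0: "0 \<le> ?k t" for t using D(1) norm_ge_zero order_trans by (metis mult_nonneg_nonneg)
  have g'k: "g' t \<le> 2 * ?k t" for t
  proof -
    have "u (x + t *\<^sub>R b) \<bullet> dir_deriv b u (x + t *\<^sub>R b) \<le> norm (u (x + t *\<^sub>R b)) * norm (dir_deriv b u (x + t *\<^sub>R b))"
      by (rule norm_cauchy_schwarz)
    also have "\<dots> \<le> ?k t" by (intro mult_left_mono D(1)) auto
    finally show ?thesis unfolding g'_def by simp
  qed
  have le: "- R' \<le> s" unfolding R'_def using norm_ge_zero[of x] by linarith
  have "g s = g s - g (- R')" using zero[of "-R'"] unfolding g_def R'_def by simp
  also have "\<dots> = (LINT t|lborel. g' t * indicator {- R'..s} t)"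
    by (rule integral_FTC_Icc_real[OF le, symmetric]) (use dg cg' continuous_on_eq_continuous_at[OF open_UNIV] in auto)
  also have "\<dots> \<le> (LINT t|lborel. indicator {-R'..s} t *\<^sub>R (2 * ?k t))"
  proof (rule integral_mono)
    show "integrable lborel (\<lambda>t. g' t * indicator {- R'..s} t)"
      using borel_integrable_atLeastAtMost'[OF continuous_on_subset[OF cg'], of "-R'" s]
      unfolding set_integrable_def by (simp add: mult.commute)
    show "integrable lborel (\<lambda>t. indicator {-R'..s} t *\<^sub>R (2 * ?k t))"
      using borel_integrable_atLeastAtMost'[OF continuous_on_subset[OF continuous_on_mult_left[OF ck]], of "-R'" s 2]
      unfolding set_integrable_def by simp
  qed (use g'k in \<open>auto simp: indicator_def\<close>)
  finally have "ennreal (g s) \<le> ennreal (LINT t|lborel. indicator {-R'..s} t *\<^sub>R (2 * ?k t))" by (rule ennreal_leI)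
  also have "\<dots> = (\<integral>\<^sup>+t. ennreal (indicator {-R'..s} t *\<^sub>R (2 * ?k t)) \<partial>lborel)"
  proof (rule nn_integral_eq_integral[symmetric])
    show "integrable lborel (\<lambda>t. indicator {-R'..s} t *\<^sub>R (2 * ?k t))"
      using borel_integrable_atLeastAtMost'[OF continuous_on_subset[OF continuous_on_mult_left[OF ck]], of "-R'" s 2]
      unfolding set_integrable_def by simp
  qed (use k0 in \<open>auto simp: indicator_def\<close>)
  also have "\<dots> \<le> (\<integral>\<^sup>+t. 2 * ennreal (?k t) \<partial>lborel)"
    using k0 by (intro nn_integral_mono) (auto simp: indicator_def ennreal_mult)
  also have "\<dots> = 2 * (\<integral>\<^sup>+t. ennreal (?k t) \<partial>lborel)"
    by (rule nn_integral_cmult) (use borel_measurable_continuous_onI[OF ck] in measurable)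
  finally show ?thesis unfolding g_def .
qed

lemma line_integral_finite:
  fixes k :: "'a::euclidean_space \<Rightarrow> real"
  assumes k: "continuous_on UNIV k" and out: "\<And>x. norm x > R \<Longrightarrow> k x = 0" and k0: "\<And>x. 0 \<le> k x" and b: "norm b = 1"
  shows "(\<integral>\<^sup>+t. ennreal (k (x + t *\<^sub>R b)) \<partial>lborel) < \<infinity>"
proof -
  define R' where "R' = \<bar>R\<bar> + norm x + 1"
  have zero: "k (x + t *\<^sub>R b) = 0" if "\<bar>t\<bar> \<ge> R'" for t
  proof (rule out)
    have "norm (t *\<^sub>R b) \<le> norm (x + t *\<^sub>R b) + norm x"
      using norm_triangle_ineq4[of "x + t *\<^sub>R b" x] by simp
    then show "norm (x + t *\<^sub>R b) > R" using that b unfolding R'_def by simp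
  qed
  have c: "continuous_on A (\<lambda>t. k (x + t *\<^sub>R b))" for A
    by (intro continuous_on_compose2[OF k] continuous_intros) simp
  have i: "integrable lborel (\<lambda>t. indicator {-R'..R'} t *\<^sub>R k (x + t *\<^sub>R b))"
    using borel_integrable_atLeastAtMost'[OF c, of "-R'" R'] unfolding set_integrable_def .
  have eq: "indicator {-R'..R'} t *\<^sub>R k (x + t *\<^sub>R b) = k (x + t *\<^sub>R b)" for t
    using zero[of t] by (cases "R' \<le> \<bar>t\<bar>") (auto simp: indicator_def)
  have "integrable lborel (\<lambda>t. k (x + t *\<^sub>R b))" using i unfolding eq .
  then show ?thesis using k0 by (simp add: integrable_iff_bounded)
qed

text \<open>Each of the three factors of $|u|^3$ is bounded by the square root of the integral of
  $2 |u| |Du|$ along one coordinate direction.  Such a bound does not depend on the coordinate that was integrated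
  out, which is the situation of the Loomis-Whitney inequality; the squares of the
  three roots all have the integral $2 \int |u| |Du|$.\<close>

lemma Ladyzhenskaya_3D:
  fixes u :: "'a::euclidean_space \<Rightarrow> 'b::euclidean_space"
  assumes u: "smooth u" and out: "\<And>x. norm x > R \<Longrightarrow> u x = 0"
    and D: "\<And>x b. b \<in> Basis \<Longrightarrow> norm (dir_deriv b u x) \<le> D x" "continuous_on UNIV D" and D0: "\<And>x. 0 \<le> D x"
    and B: "Basis = {e1, e2, e3 :: 'a}" "distinct [e1, e2, e3]"
  shows "(\<integral>\<^sup>+x. ennreal (norm (u x) ^ 3) \<partial>lborel)\<^sup>2 \<le> 8 * (\<integral>\<^sup>+x. ennreal (norm (u x) * D x) \<partial>lborel) ^ 3"
proof -
  define k where "k x = norm (u x) * D x" for x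
  have ck: "continuous_on UNIV k" unfolding k_def by (intro continuous_intros D(2) smooth_continuous_on[OF u])
  have km[measurable]: "k \<in> borel_measurable borel" by (rule borel_measurable_continuous_onI[OF ck])
  have um[measurable]: "u \<in> borel_measurable borel" by (rule borel_measurable_continuous_onI[OF smooth_continuous_on[OF u]])
  have k0: "0 \<le> k x" for x unfolding k_def using D0 by simp
  have kR: "k x = 0" if "norm x > R" for x unfolding k_def using out[OF that] by simp
  let ?X = "\<lambda>a b c. a *\<^sub>R e1 + b *\<^sub>R e2 + c *\<^sub>R e3"
  define H where "H = (\<integral>\<^sup>+x. ennreal (k x) \<partial>lborel)"
  define I1 where "I1 p = (\<integral>\<^sup>+t. ennreal (k (?X t (fst p) (snd p))) \<partial>lborel)" for p
  define I2 where "I2 p = (\<integral>\<^sup>+t. ennreal (k (?X (fst p) t (snd p))) \<partial>lborel)" for p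
  define I3 where "I3 p = (\<integral>\<^sup>+t. ennreal (k (?X (fst p) (snd p) t)) \<partial>lborel)" for p
  have [measurable]: "I1 \<in> borel_measurable (lborel \<Otimes>\<^sub>M lborel)" "I2 \<in> borel_measurable (lborel \<Otimes>\<^sub>M lborel)"
     "I3 \<in> borel_measurable (lborel \<Otimes>\<^sub>M lborel)"
    unfolding I1_def I2_def I3_def by measurable
  \<comment> \<open>a square root on the extended reals: it dominates \<open>norm w\<close> at finite arguments only, while
    \<open>(r x)\<^sup>2 \<le> 2 * x\<close> holds also at infinity, where the default value of \<open>enn2real\<close> is \<open>0\<close>\<close>
  define r where "r x = ennreal (sqrt (enn2real (2 * x)))" for x
  have rm[measurable]: "r \<in> borel_measurable borel" unfolding r_def by measurable
  have r2: "(r x)\<^sup>2 \<le> 2 * x" for x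
    unfolding r_def by (cases "2 * x") (auto simp: ennreal_power top_unique)
  have ur: "ennreal (norm w) \<le> r J" if "ennreal ((norm w)\<^sup>2) \<le> 2 * J" "J < \<infinity>" for w :: 'b and J
  proof -
    have f: "2 * J < \<infinity>" using that(2) by (simp add: ennreal_mult_less_top)
    then have "(norm w)\<^sup>2 \<le> enn2real (2 * J)" using that(1) enn2real_mono[OF that(1)] by simp
    then have "norm w \<le> sqrt (enn2real (2 * J))" by (rule real_le_rsqrt)
    then show ?thesis unfolding r_def by (rule ennreal_leI)
  qed
  have e: "norm e1 = 1" "norm e2 = 1" "norm e3 = 1" "e1 \<in> Basis" "e2 \<in> Basis" "e3 \<in> Basis"
    using norm_Basis B(1) by auto
  have b1: "ennreal (norm (u (?X a b c))) \<le> r (I1 (b, c))" for a b c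
  proof (rule ur)
    have eq: "?X t b c = (b *\<^sub>R e2 + c *\<^sub>R e3) + t *\<^sub>R e1" for t by (simp add: ac_simps)
    show "ennreal ((norm (u (?X a b c)))\<^sup>2) \<le> 2 * I1 (b, c)"
      unfolding I1_def k_def fst_conv snd_conv eq by (rule square_le_line_integral[OF u out e(1) D(1)[OF e(4)] D(2)])
    show "I1 (b, c) < \<infinity>" unfolding I1_def fst_conv snd_conv eq by (rule line_integral_finite[OF ck kR k0 e(1)])
  qed
  have b2: "ennreal (norm (u (?X a b c))) \<le> r (I2 (a, c))" for a b c
  proof (rule ur)
    have eq: "?X a t c = (a *\<^sub>R e1 + c *\<^sub>R e3) + t *\<^sub>R e2" for t by (simp add: ac_simps)
    show "ennreal ((norm (u (?X a b c)))\<^sup>2) \<le> 2 * I2 (a, c)"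
      unfolding I2_def k_def fst_conv snd_conv eq by (rule square_le_line_integral[OF u out e(2) D(1)[OF e(5)] D(2)])
    show "I2 (a, c) < \<infinity>" unfolding I2_def fst_conv snd_conv eq by (rule line_integral_finite[OF ck kR k0 e(2)])
  qed
  have b3: "ennreal (norm (u (?X a b c))) \<le> r (I3 (a, b))" for a b c
  proof (rule ur)
    show "ennreal ((norm (u (?X a b c)))\<^sup>2) \<le> 2 * I3 (a, b)"
      unfolding I3_def k_def fst_conv snd_conv by (rule square_le_line_integral[OF u out e(3) D(1)[OF e(6)] D(2)])
    show "I3 (a, b) < \<infinity>" unfolding I3_def fst_conv snd_conv by (rule line_integral_finite[OF ck kR k0 e(3)])
  qed
  have rJ: "(\<integral>\<^sup>+b. \<integral>\<^sup>+c. (r (J (b, c)))\<^sup>2 \<partial>lborel \<partial>lborel) \<le> 2 * H"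
    if [measurable]: "J \<in> borel_measurable (lborel \<Otimes>\<^sub>M lborel)" and J: "(\<integral>\<^sup>+b. \<integral>\<^sup>+c. J (b, c) \<partial>lborel \<partial>lborel) = H"
    for J :: "real \<times> real \<Rightarrow> ennreal"
  proof -
    have "(\<integral>\<^sup>+b. \<integral>\<^sup>+c. (r (J (b, c)))\<^sup>2 \<partial>lborel \<partial>lborel) \<le> (\<integral>\<^sup>+b. \<integral>\<^sup>+c. 2 * J (b, c) \<partial>lborel \<partial>lborel)"
      by (intro nn_integral_mono r2)
    also have "\<dots> = 2 * (\<integral>\<^sup>+b. \<integral>\<^sup>+c. J (b, c) \<partial>lborel \<partial>lborel)"
      by (subst nn_integral_cmult, measurable)+
    finally show ?thesis unfolding J .
  qed
  have H1: "(\<integral>\<^sup>+b. \<integral>\<^sup>+c. I1 (b, c) \<partial>lborel \<partial>lborel) = H"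
    unfolding H_def I1_def fst_conv snd_conv using B
    by (subst nn_integral_lborel_3[of _ e2 e3 e1]) (auto intro!: nn_integral_cong simp: ac_simps)
  have H2: "(\<integral>\<^sup>+b. \<integral>\<^sup>+c. I2 (b, c) \<partial>lborel \<partial>lborel) = H"
    unfolding H_def I2_def fst_conv snd_conv using B
    by (subst nn_integral_lborel_3[of _ e1 e3 e2]) (auto intro!: nn_integral_cong simp: ac_simps)
  have H3: "(\<integral>\<^sup>+b. \<integral>\<^sup>+c. I3 (b, c) \<partial>lborel \<partial>lborel) = H"
    unfolding H_def I3_def fst_conv snd_conv using B
    by (subst nn_integral_lborel_3[of _ e1 e2 e3]) (auto intro!: nn_integral_cong simp: ac_simps)
  have "(\<integral>\<^sup>+x. ennreal (norm (u x) ^ 3) \<partial>lborel) = (\<integral>\<^sup>+a. \<integral>\<^sup>+b. \<integral>\<^sup>+c. ennreal (norm (u (?X a b c)) ^ 3) \<partial>lborel \<partial>lborel \<partial>lborel)"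
    by (rule nn_integral_lborel_3[OF _ B]) measurable
  also have "\<dots> \<le> (\<integral>\<^sup>+a. \<integral>\<^sup>+b. \<integral>\<^sup>+c. r (I1 (b, c)) * r (I2 (a, c)) * r (I3 (a, b)) \<partial>lborel \<partial>lborel \<partial>lborel)"
  proof (intro nn_integral_mono)
    fix a b c :: real
    have "ennreal (norm (u (?X a b c)) ^ 3) = ennreal (norm (u (?X a b c))) * ennreal (norm (u (?X a b c))) * ennreal (norm (u (?X a b c)))"
      by (simp add: power3_eq_cube ennreal_mult)
    also have "\<dots> \<le> r (I1 (b, c)) * r (I2 (a, c)) * r (I3 (a, b))"
      by (intro mult_mono b1 b2 b3) auto
    finally show "ennreal (norm (u (?X a b c)) ^ 3) \<le> r (I1 (b, c)) * r (I2 (a, c)) * r (I3 (a, b))" .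
  qed
  finally have "(\<integral>\<^sup>+x. ennreal (norm (u x) ^ 3) \<partial>lborel)\<^sup>2 \<le> (\<integral>\<^sup>+a. \<integral>\<^sup>+b. \<integral>\<^sup>+c. r (I1 (b, c)) * r (I2 (a, c)) * r (I3 (a, b)) \<partial>lborel \<partial>lborel \<partial>lborel)\<^sup>2"
    by (intro power_mono) auto
  also have "\<dots> \<le> (\<integral>\<^sup>+b. \<integral>\<^sup>+c. (r (I1 (b, c)))\<^sup>2 \<partial>lborel \<partial>lborel) * (\<integral>\<^sup>+b. \<integral>\<^sup>+c. (r (I2 (b, c)))\<^sup>2 \<partial>lborel \<partial>lborel)
     * (\<integral>\<^sup>+b. \<integral>\<^sup>+c. (r (I3 (b, c)))\<^sup>2 \<partial>lborel \<partial>lborel)"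
    by (rule Loomis_Whitney_3) measurable
  also have "\<dots> \<le> (2 * H) * (2 * H) * (2 * H)" by (intro mult_mono rJ H1 H2 H3) auto
  also have "\<dots> = 8 * H ^ 3" by (simp add: power3_eq_cube ac_simps)
  finally show ?thesis unfolding H_def k_def .
qed

text \<open>Two factors $|u|^2$, bounded by line integrals in the two directions, depend on one
  variable each, so the double integral of their product is a product of integrals.\<close>

lemma Ladyzhenskaya_2D:
  fixes u :: "'a::euclidean_space \<Rightarrow> 'b::euclidean_space"
  assumes u: "smooth u" and out: "\<And>x. norm x > R \<Longrightarrow> u x = 0"
    and D: "\<And>x b. b \<in> Basis \<Longrightarrow> norm (dir_deriv b u x) \<le> D x" "continuous_on UNIV D" and D0: "\<And>x. 0 \<le> D x"
    and B: "Basis = {e1, e2 :: 'a}" "e1 \<noteq> e2"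
  shows "(\<integral>\<^sup>+x. ennreal (norm (u x) ^ 4) \<partial>lborel) \<le> 4 * (\<integral>\<^sup>+x. ennreal (norm (u x) * D x) \<partial>lborel)\<^sup>2"
proof -
  define k where "k x = norm (u x) * D x" for x
  have ck: "continuous_on UNIV k" unfolding k_def by (intro continuous_intros D(2) smooth_continuous_on[OF u])
  have km[measurable]: "k \<in> borel_measurable borel" by (rule borel_measurable_continuous_onI[OF ck])
  have um[measurable]: "u \<in> borel_measurable borel" by (rule borel_measurable_continuous_onI[OF smooth_continuous_on[OF u]])
  let ?X = "\<lambda>a b. a *\<^sub>R e1 + b *\<^sub>R e2"
  define H where "H = (\<integral>\<^sup>+x. ennreal (k x) \<partial>lborel)"
  define I1 where "I1 b = (\<integral>\<^sup>+t. ennreal (k (?X t b)) \<partial>lborel)" for b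
  define I2 where "I2 a = (\<integral>\<^sup>+t. ennreal (k (?X a t)) \<partial>lborel)" for a
  have [measurable]: "I1 \<in> borel_measurable lborel" "I2 \<in> borel_measurable lborel"
    unfolding I1_def I2_def by measurable
  have e: "norm e1 = 1" "norm e2 = 1" "e1 \<in> Basis" "e2 \<in> Basis"
    using norm_Basis B(1) by auto
  have b1: "ennreal ((norm (u (?X a b)))\<^sup>2) \<le> 2 * I1 b" for a b
  proof -
    have eq: "?X t b = b *\<^sub>R e2 + t *\<^sub>R e1" for t by (simp add: ac_simps)
    show ?thesis
      unfolding I1_def k_def eq by (rule square_le_line_integral[OF u out e(1) D(1)[OF e(3)] D(2)])
  qed
  have b2: "ennreal ((norm (u (?X a b)))\<^sup>2) \<le> 2 * I2 a" for a b
    unfolding I2_def k_def by (rule square_le_line_integral[OF u out e(2) D(1)[OF e(4)] D(2)])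
  have H1: "(\<integral>\<^sup>+b. I1 b \<partial>lborel) = H"
    unfolding H_def I1_def using B
    by (subst nn_integral_lborel_2[of _ e2 e1]) (auto intro!: nn_integral_cong simp: ac_simps)
  have H2: "(\<integral>\<^sup>+a. I2 a \<partial>lborel) = H"
    unfolding H_def I2_def using B
    by (subst nn_integral_lborel_2[of _ e1 e2]) (auto intro!: nn_integral_cong simp: ac_simps)
  have "(\<integral>\<^sup>+x. ennreal (norm (u x) ^ 4) \<partial>lborel) = (\<integral>\<^sup>+a. \<integral>\<^sup>+b. ennreal (norm (u (?X a b)) ^ 4) \<partial>lborel \<partial>lborel)"
    by (rule nn_integral_lborel_2[OF _ B]) measurable
  also have "\<dots> \<le> (\<integral>\<^sup>+a. \<integral>\<^sup>+b. (2 * I2 a) * (2 * I1 b) \<partial>lborel \<partial>lborel)"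
  proof (intro nn_integral_mono)
    fix a b :: real
    have "ennreal (norm (u (?X a b)) ^ 4) = ennreal ((norm (u (?X a b)))\<^sup>2) * ennreal ((norm (u (?X a b)))\<^sup>2)"
      by (simp add: ennreal_mult[symmetric] flip: power_add)
    also have "\<dots> \<le> (2 * I2 a) * (2 * I1 b)"
      by (intro mult_mono b1 b2) auto
    finally show "ennreal (norm (u (?X a b)) ^ 4) \<le> (2 * I2 a) * (2 * I1 b)" .
  qed
  also have "\<dots> = (2 * H) * (2 * H)"
    unfolding H1[symmetric] by (simp add: nn_integral_cmult nn_integral_multc H1 H2)
  also have "\<dots> = 4 * H\<^sup>2" by (simp add: power2_eq_square ac_simps)
  finally show ?thesis unfolding H_def k_def .
qed

lemma continuous_compact_support_bounded:
  fixes f :: "'a::euclidean_space \<Rightarrow> 'b::real_normed_vector"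
  assumes "continuous_on UNIV f" "compact K" "\<And>x. x \<notin> K \<Longrightarrow> f x = 0"
  obtains C where "\<And>x. norm (f x) \<le> C" "0 \<le> C"
proof -
  have "compact (f ` K)"
    using assms by (intro compact_continuous_image continuous_on_subset[OF assms(1)]) auto
  then obtain C where C: "\<forall>y\<in>f ` K. norm y \<le> C" using compact_imp_bounded bounded_iff by metis
  have "norm (f x) \<le> max C 0" for x
    using C assms(3)[of x] by (cases "x \<in> K") (auto simp: max.coboundedI1)
  then show ?thesis using that[of "max C 0"] by simp
qed

lemma continuous_compact_support_integrable:
  fixes f :: "'a::euclidean_space \<Rightarrow> real"
  assumes c: "continuous_on UNIV f" and out: "\<And>x. norm x > R \<Longrightarrow> f x = 0"
  shows "integrable lborel f"
proof -
  have "integrable lborel (\<lambda>x. indicator (cball 0 R) x *\<^sub>R f x)"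
    by (rule borel_integrable_compact[OF compact_cball continuous_on_subset[OF c]]) simp
  moreover have "(\<lambda>x. indicator (cball 0 R) x *\<^sub>R f x) = f"
  proof
    show "indicator (cball 0 R) x *\<^sub>R f x = f x" for x
      using out[of x] by (cases "norm x \<le> R") (auto simp: indicator_def)
  qed
  ultimately show ?thesis by (simp only:)
qed

text \<open>In two dimensions the cube is interpolated by Cauchy-Schwarz between the second and the fourth
  power; in both dimensions $2 |u| |Du| \<le> |u|^2 + |Du|^2$ then yields the same bound.\<close>

lemma Ladyzhenskaya_smooth:
  fixes u :: "'a::euclidean_space \<Rightarrow> 'b::euclidean_space"
  assumes dim: "DIM('a) = 2 \<or> DIM('a) = 3"
    and u: "smooth u" and out: "\<And>x. norm x > R \<Longrightarrow> u x = 0" and Dout: "\<And>x. norm x > R \<Longrightarrow> D x = 0"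
    and D: "\<And>x b. b \<in> Basis \<Longrightarrow> norm (dir_deriv b u x) \<le> D x" "continuous_on UNIV D" and D0: "\<And>x. 0 \<le> D x"
  shows "(LINT x|lborel. norm (u x) ^ 3)\<^sup>2 \<le> ((LINT x|lborel. (norm (u x))\<^sup>2) + (LINT x|lborel. (D x)\<^sup>2)) ^ 3"
proof -
  note cu = smooth_continuous_on[OF u, of UNIV]
  have i: "integrable lborel (\<lambda>x. norm (u x) ^ 3)" "integrable lborel (\<lambda>x. norm (u x) ^ 4)" "integrable lborel (\<lambda>x. (norm (u x))\<^sup>2)"
    "integrable lborel (\<lambda>x. (D x)\<^sup>2)" "integrable lborel (\<lambda>x. norm (u x) * D x)"
    by (rule continuous_compact_support_integrable[of _ R], intro continuous_intros cu D(2), use out Dout in simp)+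
  let ?Y = "(LINT x|lborel. (norm (u x))\<^sup>2) + (LINT x|lborel. (D x)\<^sup>2)"
  let ?K = "LINT x|lborel. norm (u x) * D x"
  have Y0: "0 \<le> ?Y" by (intro add_nonneg_nonneg integral_nonneg_AE AE_I2) auto
  have K0: "0 \<le> ?K" by (intro integral_nonneg_AE AE_I2) (simp add: D0)
  have "2 * ?K = (LINT x|lborel. 2 * (norm (u x) * D x))" by simp
  also have "\<dots> \<le> (LINT x|lborel. (norm (u x))\<^sup>2 + (D x)\<^sup>2)"
  proof (rule integral_mono)
    show "2 * (norm (u x) * D x) \<le> (norm (u x))\<^sup>2 + (D x)\<^sup>2" for x
      using sum_squares_bound[of "norm (u x)" "D x"] by simp
  qed (use i in auto)
  also have "\<dots> = ?Y" using i by simp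
  finally have KY: "2 * ?K \<le> ?Y" .
  have nK: "(\<integral>\<^sup>+x. ennreal (norm (u x) * D x) \<partial>lborel) = ennreal ?K"
    using i(5) D0 by (intro nn_integral_eq_integral) auto
  show ?thesis
  proof (cases "DIM('a) = 3")
    case True
    then obtain e1 e2 e3 :: 'a where B: "Basis = {e1, e2, e3}" "distinct [e1, e2, e3]"
      by (auto simp: card_3_iff)
    have "(\<integral>\<^sup>+x. ennreal (norm (u x) ^ 3) \<partial>lborel) = ennreal (LINT x|lborel. norm (u x) ^ 3)"
      using i(1) by (intro nn_integral_eq_integral) auto
    then have "ennreal ((LINT x|lborel. norm (u x) ^ 3)\<^sup>2) \<le> ennreal (8 * ?K ^ 3)"
      using Ladyzhenskaya_3D[OF u out D D0 B] K0 unfolding nK by (simp add: ennreal_power ennreal_mult)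
    then have "(LINT x|lborel. norm (u x) ^ 3)\<^sup>2 \<le> 8 * ?K ^ 3"
      using K0 by (subst (asm) ennreal_le_iff) auto
    also have "\<dots> = (2 * ?K) ^ 3" by (simp add: power_mult_distrib)
    also have "\<dots> \<le> ?Y ^ 3" using KY K0 by (intro power_mono) auto
    finally show ?thesis .
  next
    case False
    then obtain e1 e2 :: 'a where B: "Basis = {e1, e2}" "e1 \<noteq> e2"
      using dim by (auto simp: card_2_iff)
    have "(\<integral>\<^sup>+x. ennreal (norm (u x) ^ 4) \<partial>lborel) = ennreal (LINT x|lborel. norm (u x) ^ 4)"
      using i(2) by (intro nn_integral_eq_integral) auto
    then have "ennreal (LINT x|lborel. norm (u x) ^ 4) \<le> ennreal (4 * ?K\<^sup>2)"
      using Ladyzhenskaya_2D[OF u out D D0 B] K0 unfolding nK by (simp add: ennreal_power ennreal_mult)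
    then have "(LINT x|lborel. norm (u x) ^ 4) \<le> 4 * ?K\<^sup>2"
      using K0 by (subst (asm) ennreal_le_iff) auto
    also have "\<dots> = (2 * ?K)\<^sup>2" by (simp add: power_mult_distrib)
    also have "\<dots> \<le> ?Y\<^sup>2" using KY K0 by (intro power_mono) auto
    finally have 4: "(LINT x|lborel. norm (u x) ^ 4) \<le> ?Y\<^sup>2" .
    let ?v = "\<lambda>x. (norm (u x))\<^sup>2"
    have um: "u \<in> borel_measurable borel" by (rule borel_measurable_continuous_onI[OF cu])
    have "Lp_mem 2 lborel u" "Lp_mem 2 lborel ?v"
      unfolding Lp_mem_2 using i um by (auto simp flip: power_mult)
    from Cauchy_Schwarz_L2(2)[OF this]
    have "(LINT x|lborel. norm (u x) ^ 3) \<le> Lp_seminorm 2 lborel u * Lp_seminorm 2 lborel ?v"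
      by (simp add: power2_eq_square power3_eq_cube mult.assoc)
    then have "(LINT x|lborel. norm (u x) ^ 3)\<^sup>2 \<le> (Lp_seminorm 2 lborel u * Lp_seminorm 2 lborel ?v)\<^sup>2"
      by (intro power_mono integral_nonneg_AE) auto
    also have "\<dots> = (LINT x|lborel. (norm (u x))\<^sup>2) * (LINT x|lborel. norm (u x) ^ 4)"
      unfolding power_mult_distrib Lp_seminorm_2 by (simp flip: power_mult)
    also have "\<dots> \<le> ?Y * ?Y\<^sup>2" using 4 Y0 by (intro mult_mono) (auto intro!: integral_nonneg_AE)
    also have "\<dots> = ?Y ^ 3" by (simp add: power2_eq_square power3_eq_cube)
    finally show ?thesis .
  qed
qed

lemma Lp_seminorm_2_le_3:
  fixes f :: "'a \<Rightarrow> 'b::euclidean_space"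
  assumes M: "finite_measure M" and f: "Lp_mem 3 M f"
  shows "Lp_seminorm 2 M f \<le> sqrt (Lp_seminorm 3 M (\<lambda>x. 1 :: real)) * Lp_seminorm 3 M f"
proof -
  have one: "Lp_mem 3 M (\<lambda>x. 1 :: real)"
    unfolding Lp_mem_def using M by (simp add: finite_measure.integrable_const)
  have "(Lp_seminorm 2 M f)\<^sup>2 \<le> (Lp_seminorm 3 M f)\<^sup>2 * Lp_seminorm 3 M (\<lambda>x. 1 :: real)"
    using Holder3(2)[OF f f one] unfolding Lp_seminorm_2 by (simp add: power2_eq_square)
  then have "Lp_seminorm 2 M f \<le> sqrt ((Lp_seminorm 3 M f)\<^sup>2 * Lp_seminorm 3 M (\<lambda>x. 1 :: real))"
    by (rule real_le_rsqrt)
  then show ?thesis by (simp add: real_sqrt_mult Lp_seminorm_nonneg mult.commute)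
qed

section \<open>Sobolev functions vanishing on the boundary\<close>

definition gradient_matrix :: "(real ^ 'd \<Rightarrow> real ^ 'd) \<Rightarrow> real ^ 'd \<Rightarrow> real ^ 'd ^ 'd" where
  "gradient_matrix \<Phi> x = matrix (frechet_derivative \<Phi> (at x))"

lemma gradient_matrix_nth: "gradient_matrix \<Phi> x $ i $ j = dir_deriv (axis j 1) \<Phi> x $ i"
  unfolding gradient_matrix_def matrix_def dir_deriv_def by simp

lemma gradient_matrix_continuous: "smooth \<Phi> \<Longrightarrow> continuous_on A (gradient_matrix \<Phi>)"
proof -
  assume s: "smooth \<Phi>"
  have "continuous_on A (\<lambda>x. \<chi> i j. dir_deriv (axis j 1) \<Phi> x $ i)"
    by (intro continuous_on_vec_lambda continuous_on_component smooth_continuous_on smooth_dir_deriv s)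
  moreover have "(\<lambda>x. \<chi> i j. dir_deriv (axis j 1) \<Phi> x $ i) = gradient_matrix \<Phi>"
    by (auto simp: vec_eq_iff gradient_matrix_nth)
  ultimately show ?thesis by (simp only:)
qed

lemma norm_column_le: "norm (column j A) \<le> norm (A :: real ^ 'n ^ 'm)"
proof -
  have "L2_set (\<lambda>i. norm (column j A $ i)) UNIV \<le> L2_set (\<lambda>i. norm (A $ i)) UNIV"
    by (intro L2_set_mono) (auto simp: column_def component_le_norm_cart)
  then show ?thesis unfolding norm_vec_def .
qed

lemma dir_deriv_le_gradient_matrix:
  assumes "b \<in> Basis"
  shows "norm (dir_deriv b \<Phi> x) \<le> norm (gradient_matrix \<Phi> x)"
proof -
  obtain j where j: "b = axis j 1" using assms by (auto simp: Basis_vec_def)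
  have "dir_deriv b \<Phi> x = column j (gradient_matrix \<Phi> x)"
    unfolding j by (simp add: vec_eq_iff column_def gradient_matrix_nth)
  then show ?thesis using norm_column_le by metis
qed

lemma test_function_support:
  assumes "test_function \<Omega> \<Phi>"
  obtains K where "compact K" "K \<subseteq> \<Omega>" "\<And>x. x \<notin> K \<Longrightarrow> \<Phi> x = 0"
    "\<And>x b. x \<notin> K \<Longrightarrow> dir_deriv b \<Phi> x = 0"
proof -
  let ?K = "closure {x. \<Phi> x \<noteq> 0}"
  have 0: "\<Phi> x = 0" if "x \<notin> ?K" for x using that closure_subset[of "{x. \<Phi> x \<noteq> 0}"] by blast
  have "dir_deriv b \<Phi> x = 0" if "x \<notin> ?K" for x b
    by (rule dir_deriv_outside_closed[OF closed_closure 0 that])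
  then show ?thesis using that[of ?K] assms 0 unfolding test_function_def by blast
qed

lemma Ladyzhenskaya_test_function:
  fixes \<Phi> :: "real ^ 'd \<Rightarrow> real ^ 'd"
  assumes dim: "CARD('d) = 2 \<or> CARD('d) = 3" and \<Omega>: "open \<Omega>" and \<Phi>: "test_function \<Omega> \<Phi>"
  defines "S \<equiv> restrict_space lborel \<Omega>"
  shows "Lp_seminorm 3 S \<Phi> \<le> sqrt ((Lp_seminorm 2 S \<Phi>)\<^sup>2 + (Lp_seminorm 2 S (gradient_matrix \<Phi>))\<^sup>2)"
proof -
  obtain K where K: "compact K" "K \<subseteq> \<Omega>" "\<And>x. x \<notin> K \<Longrightarrow> \<Phi> x = 0" "\<And>x b. x \<notin> K \<Longrightarrow> dir_deriv b \<Phi> x = 0"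
    using test_function_support[OF \<Phi>] by blast
  have Kg: "gradient_matrix \<Phi> x = 0" if "x \<notin> K" for x
    using K(4)[OF that] by (simp add: vec_eq_iff gradient_matrix_nth)
  obtain R where R: "\<forall>x\<in>K. norm x \<le> R" using compact_imp_bounded[OF K(1)] bounded_iff by metis
  have sm: "smooth \<Phi>" using \<Phi> unfolding test_function_def by auto
  have S: "(\<integral>x. F x \<partial>S) = (LINT x|lborel. F x)" if "\<And>x. x \<notin> K \<Longrightarrow> F x = 0" for F :: "real ^ 'd \<Rightarrow> real"
  proof -
    have eq: "(\<lambda>x. indicator \<Omega> x *\<^sub>R F x) = F" using that K(2) by (auto simp: indicator_def fun_eq_iff)
    have "(\<integral>x. F x \<partial>S) = (LINT x|lborel. indicator \<Omega> x *\<^sub>R F x)"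
      unfolding S_def using \<Omega> by (intro integral_restrict_space) simp
    then show ?thesis unfolding eq .
  qed
  have "(LINT x|lborel. norm (\<Phi> x) ^ 3)\<^sup>2 \<le> ((LINT x|lborel. (norm (\<Phi> x))\<^sup>2) + (LINT x|lborel. (norm (gradient_matrix \<Phi> x))\<^sup>2)) ^ 3"
  proof (rule Ladyzhenskaya_smooth[OF _ sm])
    show "DIM(real ^ 'd) = 2 \<or> DIM(real ^ 'd) = 3" using dim by simp
    show "\<Phi> x = 0" "norm (gradient_matrix \<Phi> x) = 0" if "norm x > R" for x
      using that R K(3)[of x] Kg[of x] by force+
    show "continuous_on UNIV (\<lambda>x. norm (gradient_matrix \<Phi> x))"
      by (intro continuous_intros gradient_matrix_continuous sm)
  qed (auto intro: dir_deriv_le_gradient_matrix)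
  then have "((Lp_seminorm 3 S \<Phi>) ^ 3)\<^sup>2 \<le> ((Lp_seminorm 2 S \<Phi>)\<^sup>2 + (Lp_seminorm 2 S (gradient_matrix \<Phi>))\<^sup>2) ^ 3"
    unfolding Lp_seminorm_2 Lp_seminorm_3 using K(3) Kg by (simp add: S)
  then have "((Lp_seminorm 3 S \<Phi>)\<^sup>2) ^ 3 \<le> ((Lp_seminorm 2 S \<Phi>)\<^sup>2 + (Lp_seminorm 2 S (gradient_matrix \<Phi>))\<^sup>2) ^ 3"
    by (simp flip: power_mult)
  then have "(Lp_seminorm 3 S \<Phi>)\<^sup>2 \<le> (Lp_seminorm 2 S \<Phi>)\<^sup>2 + (Lp_seminorm 2 S (gradient_matrix \<Phi>))\<^sup>2"
    by (subst (asm) power_mono_iff) auto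
  then show ?thesis by (rule real_le_rsqrt)
qed

lemma Lp_mem_test_function:
  fixes \<Phi> :: "real ^ 'd \<Rightarrow> real ^ 'd"
  assumes \<Omega>: "open \<Omega>" "bounded \<Omega>" and \<Phi>: "test_function \<Omega> \<Phi>" and p: "p > 0"
  defines "S \<equiv> restrict_space lborel \<Omega>"
  shows "finite_measure S" "Lp_mem p S \<Phi>" "Lp_mem p S (gradient_matrix \<Phi>)"
proof -
  show fin: "finite_measure S"
    unfolding S_def using \<Omega> by (intro finite_measure_restrict_lborel) auto
  have mem: "Lp_mem p S f" if c: "continuous_on UNIV f" and C: "\<And>x. norm (f x) \<le> C" for f :: "real ^ 'd \<Rightarrow> 'b::euclidean_space" and C
  proof -
    have m: "f \<in> borel_measurable S" unfolding S_def
      by (rule measurable_restrict_space1) (use borel_measurable_continuous_onI[OF c] in simp)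
    have "integrable S (\<lambda>x. norm (f x) powr p)"
    proof (rule finite_measure.integrable_const_bound[OF fin])
      show "AE x in S. norm (norm (f x) powr p) \<le> C powr p"
        using C p by (intro AE_I2) (simp add: powr_mono2)
    qed (use m in measurable)
    then show ?thesis using m unfolding Lp_mem_def by simp
  qed
  obtain K where K: "compact K" "K \<subseteq> \<Omega>" "\<And>x. x \<notin> K \<Longrightarrow> \<Phi> x = 0" "\<And>x b. x \<notin> K \<Longrightarrow> dir_deriv b \<Phi> x = 0"
    using test_function_support[OF \<Phi>] by blast
  have Kg: "gradient_matrix \<Phi> x = 0" if "x \<notin> K" for x
    using K(4)[OF that] by (simp add: vec_eq_iff gradient_matrix_nth)
  have sm: "smooth \<Phi>" using \<Phi> unfolding test_function_def by auto
  note c = smooth_continuous_on[OF sm, of UNIV] gradient_matrix_continuous[OF sm, of UNIV]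
  obtain C where C: "\<And>x. norm (\<Phi> x) \<le> C" using continuous_compact_support_bounded[OF c(1) K(1,3)] by blast
  show "Lp_mem p S \<Phi>" by (rule mem[OF c(1) C])
  obtain C' where C': "\<And>x. norm (gradient_matrix \<Phi> x) \<le> C'" using continuous_compact_support_bounded[OF c(2) K(1) Kg] by blast
  show "Lp_mem p S (gradient_matrix \<Phi>)" by (rule mem[OF c(2) C'])
qed

text \<open>On a bounded domain convergence in $L^3$ implies convergence in $L^2$, the norm of the energy.\<close>

lemma W0_approximation:
  fixes u :: "real ^ 'd \<Rightarrow> real ^ 'd"
  assumes \<Omega>: "open \<Omega>" "bounded \<Omega>" and W: "W0 3 \<Omega> u G"
  defines "S \<equiv> restrict_space lborel \<Omega>"
  obtains \<Phi> where "\<And>n. test_function \<Omega> (\<Phi> n)"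
    "(\<lambda>n. Lp_seminorm 3 S (\<lambda>x. \<Phi> n x - u x)) \<longlonglongrightarrow> 0"
    "(\<lambda>n. Lp_seminorm 2 S (\<lambda>x. \<Phi> n x - u x)) \<longlonglongrightarrow> 0"
    "(\<lambda>n. Lp_seminorm 2 S (\<lambda>x. gradient_matrix (\<Phi> n) x - G x)) \<longlonglongrightarrow> 0"
proof -
  have m: "\<Omega> \<in> sets lborel" using \<Omega> by simp
  obtain \<Phi> where \<Phi>: "\<And>n. test_function \<Omega> (\<Phi> n)"
    "(\<lambda>n. Lp_norm 3 \<Omega> (\<lambda>x. \<Phi> n x - u x)) \<longlonglongrightarrow> 0"
    "(\<lambda>n. Lp_norm 3 \<Omega> (\<lambda>x. matrix (frechet_derivative (\<Phi> n) (at x)) - G x)) \<longlonglongrightarrow> 0"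
    using W unfolding W0_def by blast
  have mem: "Lp_mem 3 S u" "Lp_mem 3 S G" using W unfolding W0_def in_Lp_iff[OF m] S_def by auto
  have \<Phi>': "(\<lambda>n. Lp_seminorm 3 S (\<lambda>x. \<Phi> n x - u x)) \<longlonglongrightarrow> 0"
    "(\<lambda>n. Lp_seminorm 3 S (\<lambda>x. gradient_matrix (\<Phi> n) x - G x)) \<longlonglongrightarrow> 0"
    using \<Phi>(2,3) unfolding Lp_norm_eq[OF m] gradient_matrix_def S_def by auto
  note T = Lp_mem_test_function[OF \<Omega> \<Phi>(1), folded S_def]
  have fin: "finite_measure S" by (rule T(1)[of 3]) simp
  have lim: "(\<lambda>n. Lp_seminorm 2 S (F n)) \<longlonglongrightarrow> 0"
    if "(\<lambda>n. Lp_seminorm 3 S (F n)) \<longlonglongrightarrow> 0" "\<And>n. Lp_mem 3 S (F n)" for F :: "nat \<Rightarrow> real ^ 'd \<Rightarrow> 'c::euclidean_space"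
  proof (rule tendsto_sandwich[OF _ _ tendsto_const])
    show "(\<lambda>n. sqrt (Lp_seminorm 3 S (\<lambda>x. 1 :: real)) * Lp_seminorm 3 S (F n)) \<longlonglongrightarrow> 0"
      using tendsto_mult_right_zero[OF that(1)] .
    show "\<forall>\<^sub>F n in sequentially. Lp_seminorm 2 S (F n) \<le> sqrt (Lp_seminorm 3 S (\<lambda>x. 1 :: real)) * Lp_seminorm 3 S (F n)"
      by (intro always_eventually allI Lp_seminorm_2_le_3[OF fin that(2)])
    show "\<forall>\<^sub>F n in sequentially. 0 \<le> Lp_seminorm 2 S (F n)"
      by (intro always_eventually allI Lp_seminorm_nonneg)
  qed
  show ?thesis
  proof (rule that[OF \<Phi>(1) \<Phi>'(1)])
    show "(\<lambda>n. Lp_seminorm 2 S (\<lambda>x. \<Phi> n x - u x)) \<longlonglongrightarrow> 0"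
      by (rule lim[OF \<Phi>'(1)]) (intro Lp_mem_diff(1) T mem; simp)
    show "(\<lambda>n. Lp_seminorm 2 S (\<lambda>x. gradient_matrix (\<Phi> n) x - G x)) \<longlonglongrightarrow> 0"
      by (rule lim[OF \<Phi>'(2)]) (intro Lp_mem_diff(1) T mem; simp)
  qed
qed

text \<open>The inequality for test functions survives in the limit.  The constant $4$ is the product of two
  quasi-triangle constants, one for each side.\<close>

lemma Ladyzhenskaya:
  fixes u :: "real ^ 'd \<Rightarrow> real ^ 'd"
  assumes dim: "CARD('d) = 2 \<or> CARD('d) = 3" and \<Omega>: "open \<Omega>" "bounded \<Omega>" and W: "W0 3 \<Omega> u G"
  defines "S \<equiv> restrict_space lborel \<Omega>"
  shows "Lp_seminorm 3 S u \<le> 4 * sqrt ((Lp_seminorm 2 S u)\<^sup>2 + (Lp_seminorm 2 S G)\<^sup>2)"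
proof -
  have m: "\<Omega> \<in> sets lborel" using \<Omega> by simp
  obtain \<Phi> where \<Phi>: "\<And>n. test_function \<Omega> (\<Phi> n)"
    "(\<lambda>n. Lp_seminorm 3 S (\<lambda>x. \<Phi> n x - u x)) \<longlonglongrightarrow> 0"
    "(\<lambda>n. Lp_seminorm 2 S (\<lambda>x. \<Phi> n x - u x)) \<longlonglongrightarrow> 0"
    "(\<lambda>n. Lp_seminorm 2 S (\<lambda>x. gradient_matrix (\<Phi> n) x - G x)) \<longlonglongrightarrow> 0"
    using W0_approximation[OF \<Omega> W] unfolding S_def by blast
  note T = Lp_mem_test_function[OF \<Omega> \<Phi>(1), folded S_def]
  have fin: "finite_measure S" by (rule T(1)[of 3]) simp
  have mem: "Lp_mem 3 S u" "Lp_mem 3 S G" using W unfolding W0_def in_Lp_iff[OF m] S_def by auto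
  have mem2: "Lp_mem 2 S u" "Lp_mem 2 S G" by (rule Lp_mem_mono[OF fin, of 3]; simp add: mem)+
  let ?a = "\<lambda>n. Lp_seminorm 2 S (\<lambda>x. \<Phi> n x - u x)" and ?b = "\<lambda>n. Lp_seminorm 2 S (\<lambda>x. gradient_matrix (\<Phi> n) x - G x)"
  let ?c = "\<lambda>n. Lp_seminorm 3 S (\<lambda>x. \<Phi> n x - u x)"
  have quasi: "Lp_seminorm p S f \<le> 2 * (Lp_seminorm p S g + Lp_seminorm p S (\<lambda>x. g x - f x))"
    if "p \<ge> 1" "Lp_mem p S f" "Lp_mem p S g" for p and f g :: "real ^ 'd \<Rightarrow> 'c::euclidean_space"
    using Lp_mem_diff(2)[OF that(1,3) Lp_mem_diff(1)[OF that(1,3,2)]] by simp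
  have minus: "Lp_seminorm p S (\<lambda>x. f x - g x) = Lp_seminorm p S (\<lambda>x. g x - f x)" for p and f g :: "real ^ 'd \<Rightarrow> 'c::euclidean_space"
    unfolding Lp_seminorm_def by (simp add: norm_minus_commute)
  have bound: "Lp_seminorm 3 S u \<le> 2 * (sqrt ((2 * (Lp_seminorm 2 S u + ?a n))\<^sup>2 + (2 * (Lp_seminorm 2 S G + ?b n))\<^sup>2) + ?c n)" for n
  proof -
    have 1: "Lp_seminorm 3 S u \<le> 2 * (Lp_seminorm 3 S (\<Phi> n) + ?c n)"
      by (rule quasi) (use mem T in auto)
    have 2: "Lp_seminorm 3 S (\<Phi> n) \<le> sqrt ((Lp_seminorm 2 S (\<Phi> n))\<^sup>2 + (Lp_seminorm 2 S (gradient_matrix (\<Phi> n)))\<^sup>2)"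
      unfolding S_def by (rule Ladyzhenskaya_test_function[OF dim \<Omega>(1) \<Phi>(1)])
    have 3: "Lp_seminorm 2 S (\<Phi> n) \<le> 2 * (Lp_seminorm 2 S u + ?a n)"
      using quasi[of 2 "\<Phi> n" u] T(2)[of 2] mem2 minus[of 2 u "\<Phi> n"] by simp
    have 4: "Lp_seminorm 2 S (gradient_matrix (\<Phi> n)) \<le> 2 * (Lp_seminorm 2 S G + ?b n)"
      using quasi[of 2 "gradient_matrix (\<Phi> n)" G] T(3)[of 2] mem2 minus[of 2 G "gradient_matrix (\<Phi> n)"] by simp
    have 5: "sqrt ((Lp_seminorm 2 S (\<Phi> n))\<^sup>2 + (Lp_seminorm 2 S (gradient_matrix (\<Phi> n)))\<^sup>2) \<le> sqrt ((2 * (Lp_seminorm 2 S u + ?a n))\<^sup>2 + (2 * (Lp_seminorm 2 S G + ?b n))\<^sup>2)"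
      using 3 4 by (intro real_sqrt_le_mono add_mono power_mono Lp_seminorm_nonneg)
    show ?thesis
      by (rule order_trans[OF 1 mult_left_mono[OF add_right_mono[OF order_trans[OF 2 5]]]]) simp
  qed
  have "(\<lambda>n. 2 * (sqrt ((2 * (Lp_seminorm 2 S u + ?a n))\<^sup>2 + (2 * (Lp_seminorm 2 S G + ?b n))\<^sup>2) + ?c n))
     \<longlonglongrightarrow> 2 * (sqrt ((2 * (Lp_seminorm 2 S u + 0))\<^sup>2 + (2 * (Lp_seminorm 2 S G + 0))\<^sup>2) + 0)"
    by (intro tendsto_intros \<Phi>)
  then have "Lp_seminorm 3 S u \<le> 2 * (sqrt ((2 * (Lp_seminorm 2 S u + 0))\<^sup>2 + (2 * (Lp_seminorm 2 S G + 0))\<^sup>2) + 0)"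
    by (rule LIMSEQ_le_const) (use bound in auto)
  also have "\<dots> = 2 * sqrt (4 * ((Lp_seminorm 2 S u)\<^sup>2 + (Lp_seminorm 2 S G)\<^sup>2))"
    by (simp add: power_mult_distrib distrib_left)
  also have "\<dots> = 4 * sqrt ((Lp_seminorm 2 S u)\<^sup>2 + (Lp_seminorm 2 S G)\<^sup>2)"
    by (subst real_sqrt_mult) simp
  finally show ?thesis .
qed

section \<open>Estimates for the model at a fixed time\<close>

lemma norm_matrix_vector_mult_le:
  fixes A :: "real ^ 'n ^ 'm"
  shows "norm (A *v x) \<le> norm A * norm x"
proof -
  have "norm ((A *v x) $ i) \<le> norm (A $ i) * norm x" for i
    using Cauchy_Schwarz_ineq2[of "A $ i" x] by (simp add: matrix_vector_mul_component)
  then have "norm (A *v x) \<le> L2_set (\<lambda>i. norm (A $ i) * norm x) UNIV"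
    unfolding norm_vec_def[of "A *v x"] by (intro L2_set_mono) auto
  also have "\<dots> = norm A * norm x"
    unfolding norm_vec_def[of A] by (simp add: L2_set_left_distrib)
  finally show ?thesis .
qed

lemma borel_measurable_matrix_vector_mult:
  fixes A :: "'a \<Rightarrow> real ^ 'n ^ 'm"
  assumes "A \<in> borel_measurable M" "x \<in> borel_measurable M"
  shows "(\<lambda>t. A t *v x t) \<in> borel_measurable M"
proof (rule borel_measurable_continuous_Pair[OF assms])
  have "continuous_on UNIV (\<lambda>p :: (real ^ 'n ^ 'm) \<times> (real ^ 'n). \<chi> i. fst p $ i \<bullet> snd p)"
    by (intro continuous_on_vec_lambda continuous_intros)
  moreover have "(\<lambda>p :: (real ^ 'n ^ 'm) \<times> (real ^ 'n). \<chi> i. fst p $ i \<bullet> snd p) = (\<lambda>p. fst p *v snd p)"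
    by (auto simp: vec_eq_iff matrix_vector_mul_component)
  ultimately show "continuous_on UNIV (\<lambda>p :: (real ^ 'n ^ 'm) \<times> (real ^ 'n). fst p *v snd p)" by (simp only:)
qed

text \<open>The map $A \mapsto |A| A$ is the gradient of the convex function $|A|^3 / 3$, hence monotone.\<close>

lemma Smagorinsky_monotone:
  fixes A B :: "'a::real_inner"
  shows "0 \<le> (norm A *\<^sub>R A - norm B *\<^sub>R B) \<bullet> (A - B)"
proof -
  have "(norm A *\<^sub>R A - norm B *\<^sub>R B) \<bullet> (A - B) = norm A * (norm A)\<^sup>2 + norm B * (norm B)\<^sup>2 - (norm A + norm B) * (A \<bullet> B)"
    by (simp add: inner_diff_left inner_diff_right power2_norm_eq_inner inner_commute[of B A] algebra_simps)
  moreover have "(norm A + norm B) * (A \<bullet> B) \<le> (norm A + norm B) * (norm A * norm B)"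
    by (intro mult_left_mono norm_cauchy_schwarz) auto
  moreover have "norm A * (norm A)\<^sup>2 + norm B * (norm B)\<^sup>2 - (norm A + norm B) * (norm A * norm B) = (norm A + norm B) * (norm A - norm B)\<^sup>2"
    by (simp add: power2_eq_square algebra_simps)
  moreover have "0 \<le> (norm A + norm B) * (norm A - norm B)\<^sup>2" by simp
  ultimately show ?thesis by linarith
qed

text \<open>The integrability that a velocity of the solution class has at almost every single time.\<close>

definition velocity_fields :: "'a measure \<Rightarrow> ('a \<Rightarrow> real ^ 'd) \<Rightarrow> ('a \<Rightarrow> real ^ 'd ^ 'd) \<Rightarrow> bool" where
  "velocity_fields M w G \<longleftrightarrow> Lp_mem 2 M w \<and> Lp_mem 3 M w \<and> Lp_mem 6 M w \<and> Lp_mem 2 M G \<and> Lp_mem 3 M G"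

lemma convection_bound:
  fixes G :: "'a \<Rightarrow> real ^ 'd ^ 'd" and w v :: "'a \<Rightarrow> real ^ 'd"
  assumes G: "Lp_mem p M G" and w: "Lp_mem q M w" and v: "Lp_mem r M v"
    and pqr: "p > 1" "q > 1" "r > 1" "1/p + 1/q + 1/r = 1"
  shows "integrable M (\<lambda>x. (G x *v w x) \<bullet> v x)"
    and "\<bar>\<integral>x. (G x *v w x) \<bullet> v x \<partial>M\<bar> \<le> Lp_seminorm p M G * Lp_seminorm q M w * Lp_seminorm r M v"
proof -
  have m: "G \<in> borel_measurable M" "w \<in> borel_measurable M" "v \<in> borel_measurable M"
    using assms unfolding Lp_mem_def by auto
  note H = Holder3[OF G w v pqr]
  have b: "\<bar>(G x *v w x) \<bullet> v x\<bar> \<le> norm (G x) * norm (w x) * norm (v x)" for x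
    using Cauchy_Schwarz_ineq2[of "G x *v w x" "v x"] norm_matrix_vector_mult_le[of "G x" "w x"]
    by (meson mult_right_mono norm_ge_zero order_trans)
  show i: "integrable M (\<lambda>x. (G x *v w x) \<bullet> v x)"
    by (rule Bochner_Integration.integrable_bound[OF H(1)])
       (use b in \<open>auto intro!: borel_measurable_inner borel_measurable_matrix_vector_mult m simp: abs_mult\<close>)
  have "\<bar>\<integral>x. (G x *v w x) \<bullet> v x \<partial>M\<bar> \<le> (\<integral>x. \<bar>(G x *v w x) \<bullet> v x\<bar> \<partial>M)"
    using integral_norm_bound[of M "\<lambda>x. (G x *v w x) \<bullet> v x"] by simp
  also have "\<dots> \<le> (\<integral>x. norm (G x) * norm (w x) * norm (v x) \<partial>M)"
    using i H(1) b by (intro integral_mono) auto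
  also note H(2)
  finally show "\<bar>\<integral>x. (G x *v w x) \<bullet> v x \<partial>M\<bar> \<le> Lp_seminorm p M G * Lp_seminorm q M w * Lp_seminorm r M v" .
qed

text \<open>Pointwise $a^2 b \<le> a^3 + b^3$.  The additive form separates the solution, whose cubes are
  integrable in time, from a test field that is constant in time.\<close>

lemma Smagorinsky_term_bound:
  fixes G H :: "'a \<Rightarrow> 'b::euclidean_space"
  assumes G: "Lp_mem 3 M G" and H: "Lp_mem 3 M H"
  shows "integrable M (\<lambda>x. (norm (G x) *\<^sub>R G x) \<bullet> H x)"
    and "\<bar>\<integral>x. (norm (G x) *\<^sub>R G x) \<bullet> H x \<partial>M\<bar> \<le> Lp_seminorm 3 M G ^ 3 + Lp_seminorm 3 M H ^ 3"
proof -
  have m: "G \<in> borel_measurable M" "H \<in> borel_measurable M"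
    and i: "integrable M (\<lambda>x. norm (G x) ^ 3)" "integrable M (\<lambda>x. norm (H x) ^ 3)"
    using assms unfolding Lp_mem_3 by auto
  have b: "\<bar>(norm (G x) *\<^sub>R G x) \<bullet> H x\<bar> \<le> norm (G x) ^ 3 + norm (H x) ^ 3" for x
  proof -
    define c where "c = max (norm (G x)) (norm (H x))"
    have "\<bar>(norm (G x) *\<^sub>R G x) \<bullet> H x\<bar> = norm (G x) * \<bar>G x \<bullet> H x\<bar>" by (simp add: abs_mult)
    also have "\<dots> \<le> norm (G x) * (norm (G x) * norm (H x))"
      by (intro mult_left_mono Cauchy_Schwarz_ineq2) simp
    also have "\<dots> \<le> c * (c * c)" unfolding c_def by (intro mult_mono) (auto simp: le_max_iff_disj)
    also have "\<dots> \<le> norm (G x) ^ 3 + norm (H x) ^ 3"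
      unfolding c_def by (auto simp: max_def power3_eq_cube)
    finally show ?thesis .
  qed
  show j: "integrable M (\<lambda>x. (norm (G x) *\<^sub>R G x) \<bullet> H x)"
    by (rule Bochner_Integration.integrable_bound[OF Bochner_Integration.integrable_add[OF i]])
       (use b m in \<open>auto simp: abs_of_nonneg\<close>)
  have "\<bar>\<integral>x. (norm (G x) *\<^sub>R G x) \<bullet> H x \<partial>M\<bar> \<le> (\<integral>x. \<bar>(norm (G x) *\<^sub>R G x) \<bullet> H x\<bar> \<partial>M)"
    using integral_norm_bound[of M "\<lambda>x. (norm (G x) *\<^sub>R G x) \<bullet> H x"] by simp
  also have "\<dots> \<le> (\<integral>x. norm (G x) ^ 3 + norm (H x) ^ 3 \<partial>M)"
    using i j b by (intro integral_mono) auto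
  also have "\<dots> = Lp_seminorm 3 M G ^ 3 + Lp_seminorm 3 M H ^ 3" unfolding Lp_seminorm_3 using i by simp
  finally show "\<bar>\<integral>x. (norm (G x) *\<^sub>R G x) \<bullet> H x \<partial>M\<bar> \<le> Lp_seminorm 3 M G ^ 3 + Lp_seminorm 3 M H ^ 3" .
qed

text \<open>The body force cancels, and both pressures drop out because the test field is divergence
  free.\<close>

lemma momentum_difference:
  fixes \<Omega> :: "(real ^ 'd) set"
  assumes \<Omega>: "open \<Omega>"
  defines "S \<equiv> restrict_space lborel \<Omega>"
  assumes F: "velocity_fields S w1 G1" "velocity_fields S w2 G2"
    and t: "Lp_mem 2 S wt1" "Lp_mem 2 S wt2" "Lp_mem 2 S Gt1" "Lp_mem 2 S Gt2"
    and p: "p1 \<in> pressure_space \<Omega>" "p2 \<in> pressure_space \<Omega>"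
    and v: "velocity_fields S v H" "weak_incompressible \<Omega> H"
    and m: "weak_momentum \<nu> Cs \<delta> \<mu> \<Omega> f w1 G1 wt1 Gt1 p1 v H" "weak_momentum \<nu> Cs \<delta> \<mu> \<Omega> f w2 G2 wt2 Gt2 p2 v H"
  shows "(\<integral>x. (wt1 x - wt2 x) \<bullet> v x \<partial>S) + Cs ^ 4 / \<mu>\<^sup>2 * \<delta>\<^sup>2 * (\<integral>x. (Gt1 x - Gt2 x) \<bullet> H x \<partial>S)
     = (\<integral>x. (G2 x *v w2 x) \<bullet> v x \<partial>S) - (\<integral>x. (G1 x *v w1 x) \<bullet> v x \<partial>S)
       - \<nu> * (\<integral>x. (G1 x - G2 x) \<bullet> H x \<partial>S)
       - (Cs * \<delta>)\<^sup>2 * ((\<integral>x. (norm (G1 x) *\<^sub>R G1 x) \<bullet> H x \<partial>S) - (\<integral>x. (norm (G2 x) *\<^sub>R G2 x) \<bullet> H x \<partial>S))"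
proof -
  have mO: "\<Omega> \<in> sets lborel" using \<Omega> by simp
  note L = L2_inner_eq[OF mO, folded S_def]
  have f: "Lp_mem 2 S v" "Lp_mem 2 S H" "Lp_mem 2 S G1" "Lp_mem 2 S G2"
    using F v unfolding velocity_fields_def by auto
  have sm: "L2_inner \<Omega> (\<lambda>x. ((Cs * \<delta>)\<^sup>2 * norm (G x)) *\<^sub>R G x) H = (Cs * \<delta>)\<^sup>2 * (\<integral>x. (norm (G x) *\<^sub>R G x) \<bullet> H x \<partial>S)"
    for G unfolding L by (simp add: mult.assoc del: inner_scaleR_left add: inner_scaleR_left[of _ "_ :: real ^ 'd ^ 'd"])
  have pz: "L2_inner \<Omega> p1 (\<lambda>x. trace (H x)) = 0" "L2_inner \<Omega> p2 (\<lambda>x. trace (H x)) = 0"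
    using p v(2) unfolding weak_incompressible_def by auto
  have d: "(\<integral>x. (a x - b x) \<bullet> c x \<partial>S) = (\<integral>x. a x \<bullet> c x \<partial>S) - (\<integral>x. b x \<bullet> c x \<partial>S)"
    if "Lp_mem 2 S a" "Lp_mem 2 S b" "Lp_mem 2 S c" for a b c :: "real ^ 'd \<Rightarrow> 'e::euclidean_space"
    using L2_inner_bound(1)[OF that(1,3)] L2_inner_bound(1)[OF that(2,3)] by (simp add: inner_diff_left)
  note e = m[unfolded weak_momentum_def, unfolded sm pz, unfolded L]
  show ?thesis
    unfolding d[OF t(1,2) f(1)] d[OF t(3,4) f(2)] d[OF f(3,4,2)] right_diff_distrib using e by linarith
qed

text \<open>The difference \<open>\<phi>\<close> of the solutions is the test field.  The viscous term has a sign and the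
  Smagorinsky term is monotone.  The convective terms differ by
  $(\nabla\phi\, w_1 + \nabla w_2\, \phi, \phi)$, which Hoelder's inequality with exponents $(2,6,3)$ and
  $(3,3,3)$ and the Ladyzhenskaya inequality bound by $\|\phi\|^2 + \|\nabla\phi\|^2$.  A right-hand side with
  the full gradient is affordable because the energy of the corrected model contains $\|\nabla\phi\|^2$.\<close>

lemma difference_energy_bound:
  fixes \<Omega> :: "(real ^ 'd) set"
  assumes dim: "CARD('d) = 2 \<or> CARD('d) = 3" and \<Omega>: "open \<Omega>" "bounded \<Omega>"
  defines "S \<equiv> restrict_space lborel \<Omega>"
  assumes \<nu>: "\<nu> \<ge> 0"
    and F: "velocity_fields S w1 G1" "velocity_fields S w2 G2"
    and t: "Lp_mem 2 S wt1" "Lp_mem 2 S wt2" "Lp_mem 2 S Gt1" "Lp_mem 2 S Gt2"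
    and p: "p1 \<in> pressure_space \<Omega>" "p2 \<in> pressure_space \<Omega>"
    and v: "weak_incompressible \<Omega> (\<lambda>x. G1 x - G2 x)"
    and W: "W0 3 \<Omega> (\<lambda>x. w1 x - w2 x) (\<lambda>x. G1 x - G2 x)"
    and m: "weak_momentum \<nu> Cs \<delta> \<mu> \<Omega> f w1 G1 wt1 Gt1 p1 (\<lambda>x. w1 x - w2 x) (\<lambda>x. G1 x - G2 x)"
     "weak_momentum \<nu> Cs \<delta> \<mu> \<Omega> f w2 G2 wt2 Gt2 p2 (\<lambda>x. w1 x - w2 x) (\<lambda>x. G1 x - G2 x)"
  shows "(\<integral>x. (wt1 x - wt2 x) \<bullet> (w1 x - w2 x) \<partial>S) + Cs ^ 4 / \<mu>\<^sup>2 * \<delta>\<^sup>2 * (\<integral>x. (Gt1 x - Gt2 x) \<bullet> (G1 x - G2 x) \<partial>S)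
     \<le> 16 * (Lp_seminorm 6 S w1 + Lp_seminorm 3 S G2) * ((Lp_seminorm 2 S (\<lambda>x. w1 x - w2 x))\<^sup>2 + (Lp_seminorm 2 S (\<lambda>x. G1 x - G2 x))\<^sup>2)"
proof -
  let ?v = "\<lambda>x. w1 x - w2 x" and ?H = "\<lambda>x. G1 x - G2 x"
  have vH: "velocity_fields S ?v ?H"
    using F unfolding velocity_fields_def by (auto intro!: Lp_mem_diff(1))
  note f = F[unfolded velocity_fields_def] vH[unfolded velocity_fields_def]
  have eq: "(\<integral>x. (wt1 x - wt2 x) \<bullet> ?v x \<partial>S) + Cs ^ 4 / \<mu>\<^sup>2 * \<delta>\<^sup>2 * (\<integral>x. (Gt1 x - Gt2 x) \<bullet> ?H x \<partial>S)
     = (\<integral>x. (G2 x *v w2 x) \<bullet> ?v x \<partial>S) - (\<integral>x. (G1 x *v w1 x) \<bullet> ?v x \<partial>S)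
       - \<nu> * (\<integral>x. ?H x \<bullet> ?H x \<partial>S)
       - (Cs * \<delta>)\<^sup>2 * ((\<integral>x. (norm (G1 x) *\<^sub>R G1 x) \<bullet> ?H x \<partial>S) - (\<integral>x. (norm (G2 x) *\<^sub>R G2 x) \<bullet> ?H x \<partial>S))"
    unfolding S_def by (rule momentum_difference[OF \<Omega>(1)]) (use F t p v vH m in \<open>auto simp: S_def\<close>)
  have "0 \<le> (\<integral>x. ?H x \<bullet> ?H x \<partial>S)" by (intro integral_nonneg_AE AE_I2) simp
  then have 1: "0 \<le> \<nu> * (\<integral>x. ?H x \<bullet> ?H x \<partial>S)" using \<nu> by simp
  have "(\<integral>x. (norm (G1 x) *\<^sub>R G1 x) \<bullet> ?H x \<partial>S) - (\<integral>x. (norm (G2 x) *\<^sub>R G2 x) \<bullet> ?H x \<partial>S)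
      = (\<integral>x. (norm (G1 x) *\<^sub>R G1 x - norm (G2 x) *\<^sub>R G2 x) \<bullet> ?H x \<partial>S)"
    unfolding inner_diff_left[of "norm (G1 _) *\<^sub>R G1 _"]
    using f by (intro Bochner_Integration.integral_diff[symmetric] Smagorinsky_term_bound(1)) auto
  also have "\<dots> \<ge> 0" by (intro integral_nonneg_AE AE_I2 Smagorinsky_monotone)
  finally have 2: "0 \<le> (Cs * \<delta>)\<^sup>2 * ((\<integral>x. (norm (G1 x) *\<^sub>R G1 x) \<bullet> ?H x \<partial>S) - (\<integral>x. (norm (G2 x) *\<^sub>R G2 x) \<bullet> ?H x \<partial>S))"
    by simp
  let ?A = "(Lp_seminorm 2 S ?v)\<^sup>2 + (Lp_seminorm 2 S ?H)\<^sup>2"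
  have A0: "0 \<le> ?A" by simp
  have alg: "s * l * (4 * s) = 4 * l * (s * s)" "l * (4 * s) * (4 * s) = 16 * l * (s * s)" for s l :: real
    by simp_all
  have lad: "Lp_seminorm 3 S ?v \<le> 4 * sqrt ?A"
    unfolding S_def by (rule Ladyzhenskaya[OF dim \<Omega> W])
  have HA: "Lp_seminorm 2 S ?H \<le> sqrt ?A" by (rule real_le_rsqrt) simp
  have c1: "\<bar>\<integral>x. (?H x *v w1 x) \<bullet> ?v x \<partial>S\<bar> \<le> Lp_seminorm 2 S ?H * Lp_seminorm 6 S w1 * Lp_seminorm 3 S ?v"
    using f by (intro convection_bound(2)) auto
  also have "\<dots> \<le> sqrt ?A * Lp_seminorm 6 S w1 * (4 * sqrt ?A)"
    by (intro mult_mono lad HA) (auto simp: Lp_seminorm_nonneg)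
  also have "\<dots> = 4 * Lp_seminorm 6 S w1 * (sqrt ?A * sqrt ?A)" by (rule alg(1))
  also have "\<dots> = 4 * Lp_seminorm 6 S w1 * ?A" by (simp only: real_sqrt_mult_self abs_of_nonneg[OF A0])
  finally have 3: "\<bar>\<integral>x. (?H x *v w1 x) \<bullet> ?v x \<partial>S\<bar> \<le> 4 * Lp_seminorm 6 S w1 * ?A" .
  have "\<bar>\<integral>x. (G2 x *v ?v x) \<bullet> ?v x \<partial>S\<bar> \<le> Lp_seminorm 3 S G2 * Lp_seminorm 3 S ?v * Lp_seminorm 3 S ?v"
    using f by (intro convection_bound(2)) auto
  also have "\<dots> \<le> Lp_seminorm 3 S G2 * (4 * sqrt ?A) * (4 * sqrt ?A)"
    by (intro mult_mono lad) (auto simp: Lp_seminorm_nonneg)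
  also have "\<dots> = 16 * Lp_seminorm 3 S G2 * (sqrt ?A * sqrt ?A)" by (rule alg(2))
  also have "\<dots> = 16 * Lp_seminorm 3 S G2 * ?A" by (simp only: real_sqrt_mult_self abs_of_nonneg[OF A0])
  finally have 4: "\<bar>\<integral>x. (G2 x *v ?v x) \<bullet> ?v x \<partial>S\<bar> \<le> 16 * Lp_seminorm 3 S G2 * ?A" .
  have i: "integrable S (\<lambda>x. (?H x *v w1 x) \<bullet> ?v x)" "integrable S (\<lambda>x. (G1 x *v w1 x) \<bullet> ?v x)" "integrable S (\<lambda>x. (G2 x *v w2 x) \<bullet> ?v x)"
    by (rule convection_bound(1)[of 2 _ _ 6 _ 3], use f in auto)+
  have j: "integrable S (\<lambda>x. (G2 x *v ?v x) \<bullet> ?v x)"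
    by (rule convection_bound(1)[of 3 _ _ 3 _ 3], use f in auto)
  have "(\<integral>x. (G2 x *v w2 x) \<bullet> ?v x \<partial>S) - (\<integral>x. (G1 x *v w1 x) \<bullet> ?v x \<partial>S)
     = (\<integral>x. (G2 x *v w2 x) \<bullet> ?v x - (G1 x *v w1 x) \<bullet> ?v x \<partial>S)"
    using i by simp
  also have "\<dots> = (\<integral>x. - ((?H x *v w1 x) \<bullet> ?v x) - (G2 x *v ?v x) \<bullet> ?v x \<partial>S)"
    by (intro Bochner_Integration.integral_cong)
       (auto simp: matrix_vector_mult_diff_distrib matrix_vector_mult_diff_rdistrib inner_diff_left)
  also have "\<dots> = - (\<integral>x. (?H x *v w1 x) \<bullet> ?v x \<partial>S) - (\<integral>x. (G2 x *v ?v x) \<bullet> ?v x \<partial>S)"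
    by (subst Bochner_Integration.integral_diff[OF integrable_minus[OF i(1)] j]) simp
  also have "\<dots> \<le> 4 * Lp_seminorm 6 S w1 * ?A + 16 * Lp_seminorm 3 S G2 * ?A" using 3 4 by linarith
  also have "\<dots> \<le> 16 * (Lp_seminorm 6 S w1 + Lp_seminorm 3 S G2) * ?A"
  proof -
    have "4 * (Lp_seminorm 6 S w1 * ?A) \<le> 16 * (Lp_seminorm 6 S w1 * ?A)"
      using mult_nonneg_nonneg[OF Lp_seminorm_nonneg[of 6 S w1] A0] by linarith
    then show ?thesis by (simp only: distrib_left distrib_right mult.assoc)
  qed
  finally show ?thesis using eq 1 2 by linarith
qed

text \<open>The same identity with a test field that is not the current difference, so that no term has
  a sign and all are estimated by size.  This is used on short time intervals with the
  field frozen at their right end.\<close>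

lemma difference_functional_bound:
  fixes \<Omega> :: "(real ^ 'd) set"
  assumes \<Omega>: "open \<Omega>"
  defines "S \<equiv> restrict_space lborel \<Omega>"
  assumes \<nu>: "\<nu> \<ge> 0"
    and F: "velocity_fields S w1 G1" "velocity_fields S w2 G2"
    and t: "Lp_mem 2 S wt1" "Lp_mem 2 S wt2" "Lp_mem 2 S Gt1" "Lp_mem 2 S Gt2"
    and p: "p1 \<in> pressure_space \<Omega>" "p2 \<in> pressure_space \<Omega>"
    and v: "velocity_fields S v H" "weak_incompressible \<Omega> H"
    and m: "weak_momentum \<nu> Cs \<delta> \<mu> \<Omega> f w1 G1 wt1 Gt1 p1 v H" "weak_momentum \<nu> Cs \<delta> \<mu> \<Omega> f w2 G2 wt2 Gt2 p2 v H"
  shows "(\<integral>x. (wt1 x - wt2 x) \<bullet> v x \<partial>S) + Cs ^ 4 / \<mu>\<^sup>2 * \<delta>\<^sup>2 * (\<integral>x. (Gt1 x - Gt2 x) \<bullet> H x \<partial>S)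
     \<le> (Lp_seminorm 2 S G1 * Lp_seminorm 6 S w1 + Lp_seminorm 2 S G2 * Lp_seminorm 6 S w2) * Lp_seminorm 3 S v
       + \<nu> * (2 * (Lp_seminorm 2 S G1 + Lp_seminorm 2 S G2) * Lp_seminorm 2 S H)
       + (Cs * \<delta>)\<^sup>2 * (Lp_seminorm 3 S G1 ^ 3 + Lp_seminorm 3 S G2 ^ 3 + 2 * Lp_seminorm 3 S H ^ 3)"
proof -
  note f = F[unfolded velocity_fields_def] v[unfolded velocity_fields_def]
  have eq: "(\<integral>x. (wt1 x - wt2 x) \<bullet> v x \<partial>S) + Cs ^ 4 / \<mu>\<^sup>2 * \<delta>\<^sup>2 * (\<integral>x. (Gt1 x - Gt2 x) \<bullet> H x \<partial>S)
     = (\<integral>x. (G2 x *v w2 x) \<bullet> v x \<partial>S) - (\<integral>x. (G1 x *v w1 x) \<bullet> v x \<partial>S)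
       - \<nu> * (\<integral>x. (G1 x - G2 x) \<bullet> H x \<partial>S)
       - (Cs * \<delta>)\<^sup>2 * ((\<integral>x. (norm (G1 x) *\<^sub>R G1 x) \<bullet> H x \<partial>S) - (\<integral>x. (norm (G2 x) *\<^sub>R G2 x) \<bullet> H x \<partial>S))"
    unfolding S_def by (rule momentum_difference[OF \<Omega>]) (use F t p v m in \<open>auto simp: S_def\<close>)
  have 1: "\<bar>\<integral>x. (G1 x *v w1 x) \<bullet> v x \<partial>S\<bar> \<le> Lp_seminorm 2 S G1 * Lp_seminorm 6 S w1 * Lp_seminorm 3 S v"
    "\<bar>\<integral>x. (G2 x *v w2 x) \<bullet> v x \<partial>S\<bar> \<le> Lp_seminorm 2 S G2 * Lp_seminorm 6 S w2 * Lp_seminorm 3 S v"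
    using f by (auto intro!: convection_bound(2))
  have "\<bar>\<integral>x. (G1 x - G2 x) \<bullet> H x \<partial>S\<bar> \<le> Lp_seminorm 2 S (\<lambda>x. G1 x - G2 x) * Lp_seminorm 2 S H"
    using f by (intro L2_inner_bound(2) Lp_mem_diff(1)) auto
  also have "\<dots> \<le> 2 * (Lp_seminorm 2 S G1 + Lp_seminorm 2 S G2) * Lp_seminorm 2 S H"
    using f by (intro mult_right_mono Lp_mem_diff(2) Lp_seminorm_nonneg) auto
  finally have "- (\<integral>x. (G1 x - G2 x) \<bullet> H x \<partial>S) \<le> 2 * (Lp_seminorm 2 S G1 + Lp_seminorm 2 S G2) * Lp_seminorm 2 S H"
    by linarith
  from mult_left_mono[OF this \<nu>]
  have 2: "- (\<nu> * (\<integral>x. (G1 x - G2 x) \<bullet> H x \<partial>S)) \<le> \<nu> * (2 * (Lp_seminorm 2 S G1 + Lp_seminorm 2 S G2) * Lp_seminorm 2 S H)"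
    by simp
  have "\<bar>\<integral>x. (norm (G1 x) *\<^sub>R G1 x) \<bullet> H x \<partial>S\<bar> \<le> Lp_seminorm 3 S G1 ^ 3 + Lp_seminorm 3 S H ^ 3"
    "\<bar>\<integral>x. (norm (G2 x) *\<^sub>R G2 x) \<bullet> H x \<partial>S\<bar> \<le> Lp_seminorm 3 S G2 ^ 3 + Lp_seminorm 3 S H ^ 3"
    by (rule Smagorinsky_term_bound(2); use f in simp)+
  then have "- ((\<integral>x. (norm (G1 x) *\<^sub>R G1 x) \<bullet> H x \<partial>S) - (\<integral>x. (norm (G2 x) *\<^sub>R G2 x) \<bullet> H x \<partial>S))
      \<le> Lp_seminorm 3 S G1 ^ 3 + Lp_seminorm 3 S G2 ^ 3 + 2 * Lp_seminorm 3 S H ^ 3" by linarith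
  from mult_left_mono[OF this, of "(Cs * \<delta>)\<^sup>2"]
  have 3: "- ((Cs * \<delta>)\<^sup>2 * ((\<integral>x. (norm (G1 x) *\<^sub>R G1 x) \<bullet> H x \<partial>S) - (\<integral>x. (norm (G2 x) *\<^sub>R G2 x) \<bullet> H x \<partial>S)))
      \<le> (Cs * \<delta>)\<^sup>2 * (Lp_seminorm 3 S G1 ^ 3 + Lp_seminorm 3 S G2 ^ 3 + 2 * Lp_seminorm 3 S H ^ 3)"
    by (simp only: mult_minus_right zero_le_power2 simp_thms)
  show ?thesis unfolding distrib_right using eq 1 2 3 by linarith
qed

section \<open>Closure properties of the function classes\<close>

lemma restrict_lborel_pair:
  assumes "J \<in> sets lborel" "\<Omega> \<in> sets lborel"
  shows "restrict_space lborel J \<Otimes>\<^sub>M restrict_space lborel \<Omega> = restrict_space lborel (J \<times> \<Omega>)"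
  using restrict_space_pair_measure[OF sigma_finite_lborel sigma_finite_lborel assms] unfolding lborel_prod .

lemma sigma_finite_restrict_lborel: "A \<in> sets lborel \<Longrightarrow> sigma_finite_measure (restrict_space lborel A)"
  by (rule sigma_finite_measure_restrict_space[OF sigma_finite_lborel])

lemma pair_sigma_finite_restrict:
  assumes "J \<in> sets lborel" "\<Omega> \<in> sets lborel"
  shows "pair_sigma_finite (restrict_space lborel J) (restrict_space lborel \<Omega>)"
  using assms by (intro pair_sigma_finite.intro sigma_finite_restrict_lborel)

lemma AE_restrict_iff: "A \<in> sets lborel \<Longrightarrow> (AE t in restrict_space lborel A. P t) \<longleftrightarrow> (AE t\<in>A in lborel. P t)"
  by (simp add: AE_restrict_space_iff)

lemma set_borel_measurable_pair_iff:
  fixes f :: "'a::euclidean_space \<times> 'b::euclidean_space \<Rightarrow> 'c::euclidean_space"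
  assumes "J \<in> sets lborel" "\<Omega> \<in> sets lborel"
  shows "set_borel_measurable lborel (J \<times> \<Omega>) f \<longleftrightarrow> f \<in> borel_measurable (restrict_space lborel J \<Otimes>\<^sub>M restrict_space lborel \<Omega>)"
proof -
  have "J \<times> \<Omega> \<in> sets (lborel \<Otimes>\<^sub>M lborel)" using assms by (rule pair_measureI)
  then have "J \<times> \<Omega> \<in> sets lborel" unfolding lborel_prod .
  then show ?thesis
    unfolding restrict_lborel_pair[OF assms] set_borel_measurable_def by (simp add: borel_measurable_restrict_space_iff)
qed

lemma bochner_measurable_iff:
  assumes "J \<in> sets lborel" "\<Omega> \<in> sets lborel"
  shows "bochner_measurable J \<Omega> q u \<longleftrightarrow>
    (\<lambda>(t, x). u t x) \<in> borel_measurable (restrict_space lborel J \<Otimes>\<^sub>M restrict_space lborel \<Omega>)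
    \<and> (AE t in restrict_space lborel J. Lp_mem q (restrict_space lborel \<Omega>) (u t))"
  unfolding bochner_measurable_def set_borel_measurable_pair_iff[OF assms] in_Lp_iff[OF assms(2)] AE_restrict_iff[OF assms(1)] ..

lemma bochner_measurable_subset:
  assumes "J \<in> sets lborel" "J' \<in> sets lborel" "\<Omega> \<in> sets lborel" "J' \<subseteq> J" "bochner_measurable J \<Omega> q u"
  shows "bochner_measurable J' \<Omega> q u"
proof -
  have "J' \<times> \<Omega> \<in> sets (lborel \<Otimes>\<^sub>M lborel)" using assms by (intro pair_measureI)
  then have m: "J' \<times> \<Omega> \<in> sets lborel" unfolding lborel_prod .
  have "set_borel_measurable lborel (J' \<times> \<Omega>) (\<lambda>(t, x). u t x)"
    by (rule set_borel_measurable_subset[of _ "J \<times> \<Omega>"]) (use assms m in \<open>auto simp: bochner_measurable_def\<close>)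
  moreover have "AE t\<in>J' in lborel. in_Lp q \<Omega> (u t)"
    using assms(5) unfolding bochner_measurable_def by (auto elim!: eventually_mono dest: subsetD[OF assms(4)])
  ultimately show ?thesis unfolding bochner_measurable_def by simp
qed

lemma Lp_seminorm_measurable:
  fixes u :: "real \<Rightarrow> 'a::euclidean_space \<Rightarrow> 'b::euclidean_space"
  assumes J: "J \<in> sets lborel" and \<Omega>: "\<Omega> \<in> sets lborel"
    and u: "(\<lambda>(t, x). u t x) \<in> borel_measurable (restrict_space lborel J \<Otimes>\<^sub>M restrict_space lborel \<Omega>)"
  shows "(\<lambda>t. Lp_seminorm q (restrict_space lborel \<Omega>) (u t)) \<in> borel_measurable (restrict_space lborel J)"
proof -
  interpret S: sigma_finite_measure "restrict_space lborel \<Omega>" by (rule sigma_finite_restrict_lborel[OF \<Omega>])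
  have "(\<lambda>p. norm ((\<lambda>(t, x). u t x) p) powr q) \<in> borel_measurable (restrict_space lborel J \<Otimes>\<^sub>M restrict_space lborel \<Omega>)"
    using u by measurable
  then have "(\<lambda>t. \<integral>x. norm (u t x) powr q \<partial>restrict_space lborel \<Omega>) \<in> borel_measurable (restrict_space lborel J)"
    by (intro S.borel_measurable_lebesgue_integral) (simp add: case_prod_unfold)
  then show ?thesis unfolding Lp_seminorm_def by measurable
qed

lemma bochner_measurable_diff:
  assumes J: "J \<in> sets lborel" and \<Omega>: "\<Omega> \<in> sets lborel" and q: "q \<ge> 1"
    and u: "bochner_measurable J \<Omega> q u" and v: "bochner_measurable J \<Omega> q v"
  shows "bochner_measurable J \<Omega> q (\<lambda>t x. u t x - v t x)"
  unfolding bochner_measurable_iff[OF J \<Omega>]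
proof
  let ?P = "restrict_space lborel J \<Otimes>\<^sub>M restrict_space lborel \<Omega>"
  have "(\<lambda>p. (\<lambda>(t, x). u t x) p - (\<lambda>(t, x). v t x) p) \<in> borel_measurable ?P"
    using u v unfolding bochner_measurable_iff[OF J \<Omega>] by (intro borel_measurable_diff) auto
  then show "(\<lambda>(t, x). u t x - v t x) \<in> borel_measurable ?P" by (simp add: case_prod_unfold)
  have "AE t in restrict_space lborel J. Lp_mem q (restrict_space lborel \<Omega>) (u t)"
       "AE t in restrict_space lborel J. Lp_mem q (restrict_space lborel \<Omega>) (v t)"
    using u v unfolding bochner_measurable_iff[OF J \<Omega>] by auto
  then show "AE t in restrict_space lborel J. Lp_mem q (restrict_space lborel \<Omega>) (\<lambda>x. u t x - v t x)"
    by eventually_elim (rule Lp_mem_diff(1)[OF q])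
qed

lemma in_Linf_Lq_diff:
  assumes J: "J \<in> sets lborel" and \<Omega>: "\<Omega> \<in> sets lborel" and q: "q \<ge> 1"
    and u: "in_Linf_Lq q J \<Omega> u" and v: "in_Linf_Lq q J \<Omega> v"
  shows "in_Linf_Lq q J \<Omega> (\<lambda>t x. u t x - v t x)"
proof -
  obtain C D where C: "AE t\<in>J in lborel. Lp_norm q \<Omega> (u t) \<le> C" and D: "AE t\<in>J in lborel. Lp_norm q \<Omega> (v t) \<le> D"
    using u v unfolding in_Linf_Lq_def by blast
  have b: "bochner_measurable J \<Omega> q u" "bochner_measurable J \<Omega> q v" using u v unfolding in_Linf_Lq_def by auto
  have m: "AE t\<in>J in lborel. in_Lp q \<Omega> (u t)" "AE t\<in>J in lborel. in_Lp q \<Omega> (v t)"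
    using b unfolding bochner_measurable_def by auto
  have "AE t\<in>J in lborel. Lp_norm q \<Omega> (\<lambda>x. u t x - v t x) \<le> 2 * (C + D)"
    using C D m
  proof eventually_elim
    case (elim t)
    show ?case
    proof
      assume t: "t \<in> J"
      have "Lp_norm q \<Omega> (\<lambda>x. u t x - v t x) \<le> 2 * (Lp_norm q \<Omega> (u t) + Lp_norm q \<Omega> (v t))"
        using elim t unfolding Lp_norm_eq[OF \<Omega>] in_Lp_iff[OF \<Omega>] by (intro Lp_mem_diff(2)[OF q]) auto
      then show "Lp_norm q \<Omega> (\<lambda>x. u t x - v t x) \<le> 2 * (C + D)" using elim t by force
    qed
  qed
  then show ?thesis using bochner_measurable_diff[OF J \<Omega> q b] unfolding in_Linf_Lq_def by blast
qed

lemma in_Lr_Lq_iff: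
  assumes "J \<in> sets lborel" "\<Omega> \<in> sets lborel"
  shows "in_Lr_Lq r q J \<Omega> u \<longleftrightarrow> bochner_measurable J \<Omega> q u \<and>
    Lp_mem r (restrict_space lborel J) (\<lambda>t. Lp_seminorm q (restrict_space lborel \<Omega>) (u t))"
  unfolding in_Lr_Lq_def in_Lp_iff[OF assms(1)] Lp_norm_eq[OF assms(2)] ..

lemma in_Lr_Lq_diff:
  assumes J: "J \<in> sets lborel" and \<Omega>: "\<Omega> \<in> sets lborel" and q: "q \<ge> 1" and r: "r \<ge> 1"
    and u: "in_Lr_Lq r q J \<Omega> u" and v: "in_Lr_Lq r q J \<Omega> v"
  shows "in_Lr_Lq r q J \<Omega> (\<lambda>t x. u t x - v t x)"
proof -
  let ?T = "restrict_space lborel J" and ?S = "restrict_space lborel \<Omega>"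
  have b: "bochner_measurable J \<Omega> q u" "bochner_measurable J \<Omega> q v"
    and L: "Lp_mem r ?T (\<lambda>t. Lp_seminorm q ?S (u t))" "Lp_mem r ?T (\<lambda>t. Lp_seminorm q ?S (v t))"
    using u v unfolding in_Lr_Lq_iff[OF J \<Omega>] by auto
  note bd = bochner_measurable_diff[OF J \<Omega> q b]
  have m: "AE t in ?T. Lp_mem q ?S (u t)" "AE t in ?T. Lp_mem q ?S (v t)"
    using b unfolding bochner_measurable_iff[OF J \<Omega>] by auto
  have meas: "(\<lambda>t. Lp_seminorm q ?S (\<lambda>x. u t x - v t x)) \<in> borel_measurable ?T"
    using bd unfolding bochner_measurable_iff[OF J \<Omega>] by (intro Lp_seminorm_measurable[OF J \<Omega>]) auto
  have i: "Lp_mem r ?T (\<lambda>t. 2 * (Lp_seminorm q ?S (u t) + Lp_seminorm q ?S (v t)))"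
  proof -
    have "Lp_mem r ?T (\<lambda>t. - Lp_seminorm q ?S (v t))" using L(2) unfolding Lp_mem_def by simp
    from Lp_mem_diff(1)[OF r L(1) this]
    have "Lp_mem r ?T (\<lambda>t. Lp_seminorm q ?S (u t) + Lp_seminorm q ?S (v t))" by simp
    then show ?thesis unfolding Lp_mem_def by (auto simp: abs_mult powr_mult simp del: distrib_left_numeral intro!: borel_measurable_times)
  qed
  have "integrable ?T (\<lambda>t. norm (Lp_seminorm q ?S (\<lambda>x. u t x - v t x)) powr r)"
  proof (rule Bochner_Integration.integrable_bound[of ?T "\<lambda>t. norm (2 * (Lp_seminorm q ?S (u t) + Lp_seminorm q ?S (v t))) powr r"])
    show "AE t in ?T. norm (norm (Lp_seminorm q ?S (\<lambda>x. u t x - v t x)) powr r) \<le> norm (norm (2 * (Lp_seminorm q ?S (u t) + Lp_seminorm q ?S (v t))) powr r)"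
      using m
    proof eventually_elim
      case (elim t)
      have "Lp_seminorm q ?S (\<lambda>x. u t x - v t x) powr r \<le> (2 * (Lp_seminorm q ?S (u t) + Lp_seminorm q ?S (v t))) powr r"
        using r by (intro powr_mono2 Lp_mem_diff(2)[OF q] elim Lp_seminorm_nonneg) auto
      then show ?case
        using Lp_seminorm_nonneg[of q ?S "\<lambda>x. u t x - v t x"] Lp_seminorm_nonneg[of q ?S "u t"] Lp_seminorm_nonneg[of q ?S "v t"]
        by (simp add: abs_of_nonneg)
    qed
    show "(\<lambda>t. norm (Lp_seminorm q ?S (\<lambda>x. u t x - v t x)) powr r) \<in> borel_measurable ?T"
      using meas by measurable
  qed (use i in \<open>simp add: Lp_mem_def\<close>)
  then show ?thesis using bd meas unfolding in_Lr_Lq_iff[OF J \<Omega>] Lp_mem_def by simp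
qed

lemma test_function_dir_deriv:
  assumes "test_function U \<psi>"
  shows "test_function U (dir_deriv b \<psi>)"
proof -
  obtain K where K: "compact K" "K \<subseteq> U" "\<And>x. x \<notin> K \<Longrightarrow> \<psi> x = 0" "\<And>x b. x \<notin> K \<Longrightarrow> dir_deriv b \<psi> x = 0"
    using test_function_support[OF assms] by blast
  show ?thesis
    by (rule test_functionI[OF smooth_dir_deriv K(1,2,4)]) (use assms in \<open>simp add: test_function_def\<close>)
qed

lemma has_weak_deriv_diff:
  assumes "has_weak_deriv U b u g" "has_weak_deriv U b v h"
  shows "has_weak_deriv U b (\<lambda>x. u x - v x) (\<lambda>x. g x - h x)"
  unfolding has_weak_deriv_def
proof (intro conjI allI impI)
  have li: "locally_integrable U u" "locally_integrable U v" "locally_integrable U g" "locally_integrable U h"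
    using assms unfolding has_weak_deriv_def by auto
  show "locally_integrable U (\<lambda>x. u x - v x)" "locally_integrable U (\<lambda>x. g x - h x)"
    by (intro locally_integrable_diff li)+
  fix \<psi> :: "'a \<Rightarrow> real" assume t: "test_function U \<psi>"
  note t' = test_function_dir_deriv[OF t, of b]
  have "(LINT x:U|lborel. dir_deriv b \<psi> x *\<^sub>R (u x - v x)) = (LINT x:U|lborel. dir_deriv b \<psi> x *\<^sub>R u x) - (LINT x:U|lborel. dir_deriv b \<psi> x *\<^sub>R v x)"
    unfolding scaleR_diff_right by (intro set_integral_diff(2) test_function_integrable[OF t'] li)
  moreover have "(LINT x:U|lborel. \<psi> x *\<^sub>R (g x - h x)) = (LINT x:U|lborel. \<psi> x *\<^sub>R g x) - (LINT x:U|lborel. \<psi> x *\<^sub>R h x)"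
    unfolding scaleR_diff_right by (intro set_integral_diff(2) test_function_integrable[OF t] li)
  ultimately show "(LINT x:U|lborel. dir_deriv b \<psi> x *\<^sub>R (u x - v x)) = - (LINT x:U|lborel. \<psi> x *\<^sub>R (g x - h x))"
    using assms t unfolding has_weak_deriv_def by simp
qed

lemma has_weak_gradient_diff:
  assumes "has_weak_gradient \<Omega> u G" "has_weak_gradient \<Omega> v H"
  shows "has_weak_gradient \<Omega> (\<lambda>x. u x - v x) (\<lambda>x. G x - H x)"
proof -
  have "column j (G x - H x) = column j (G x) - column j (H x)" for j x
    by (simp add: column_def vec_eq_iff)
  then show ?thesis using assms unfolding has_weak_gradient_def by (simp add: has_weak_deriv_diff)
qed

lemma test_function_diff:
  assumes "test_function U f" "test_function U g"
  shows "test_function U (\<lambda>x. f x - g x)"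
proof -
  obtain F where F: "compact F" "F \<subseteq> U" "\<And>x. x \<notin> F \<Longrightarrow> f x = 0" "\<And>x b. x \<notin> F \<Longrightarrow> dir_deriv b f x = 0"
    using test_function_support[OF assms(1)] by blast
  obtain G where G: "compact G" "G \<subseteq> U" "\<And>x. x \<notin> G \<Longrightarrow> g x = 0" "\<And>x b. x \<notin> G \<Longrightarrow> dir_deriv b g x = 0"
    using test_function_support[OF assms(2)] by blast
  show ?thesis
  proof (rule test_functionI[of _ "F \<union> G"])
    show "smooth (\<lambda>x. f x - g x)" using assms unfolding test_function_def by (intro smooth_diff(1)) auto
  qed (use F G in auto)
qed

lemma W0_diff:
  fixes \<Omega> :: "(real ^ 'd) set"
  assumes \<Omega>: "open \<Omega>" "bounded \<Omega>" and u: "W0 3 \<Omega> u G" and v: "W0 3 \<Omega> v H"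
  shows "W0 3 \<Omega> (\<lambda>x. u x - v x) (\<lambda>x. G x - H x)"
proof -
  have m: "\<Omega> \<in> sets lborel" using \<Omega> by simp
  let ?S = "restrict_space lborel \<Omega>"
  note Lp = in_Lp_iff[OF m] Lp_norm_eq[OF m]
  have mem: "Lp_mem 3 ?S u" "Lp_mem 3 ?S v" "Lp_mem 3 ?S G" "Lp_mem 3 ?S H"
    using u v unfolding W0_def Lp by auto
  obtain \<Phi> where \<Phi>: "\<And>n. test_function \<Omega> (\<Phi> n)" "(\<lambda>n. Lp_seminorm 3 ?S (\<lambda>x. \<Phi> n x - u x)) \<longlonglongrightarrow> 0"
    "(\<lambda>n. Lp_seminorm 3 ?S (\<lambda>x. gradient_matrix (\<Phi> n) x - G x)) \<longlonglongrightarrow> 0"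
    using u unfolding W0_def Lp gradient_matrix_def by blast
  obtain \<Psi> where \<Psi>: "\<And>n. test_function \<Omega> (\<Psi> n)" "(\<lambda>n. Lp_seminorm 3 ?S (\<lambda>x. \<Psi> n x - v x)) \<longlonglongrightarrow> 0"
    "(\<lambda>n. Lp_seminorm 3 ?S (\<lambda>x. gradient_matrix (\<Psi> n) x - H x)) \<longlonglongrightarrow> 0"
    using v unfolding W0_def Lp gradient_matrix_def by blast
  note T = Lp_mem_test_function[OF \<Omega>]
  have lim: "(\<lambda>n. Lp_seminorm 3 ?S (\<lambda>x. (F n x - f x) - (K n x - g x))) \<longlonglongrightarrow> 0"
    if "(\<lambda>n. Lp_seminorm 3 ?S (\<lambda>x. F n x - f x)) \<longlonglongrightarrow> 0" "(\<lambda>n. Lp_seminorm 3 ?S (\<lambda>x. K n x - g x)) \<longlonglongrightarrow> 0"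
      "\<And>n. Lp_mem 3 ?S (F n)" "\<And>n. Lp_mem 3 ?S (K n)" "Lp_mem 3 ?S f" "Lp_mem 3 ?S g"
    for F K :: "nat \<Rightarrow> real ^ 'd \<Rightarrow> 'c::euclidean_space" and f g
  proof (rule tendsto_sandwich[OF _ _ tendsto_const])
    show "(\<lambda>n. 2 * (Lp_seminorm 3 ?S (\<lambda>x. F n x - f x) + Lp_seminorm 3 ?S (\<lambda>x. K n x - g x))) \<longlonglongrightarrow> 0"
      using tendsto_mult_right_zero[OF tendsto_add_zero[OF that(1,2)]] .
    show "\<forall>\<^sub>F n in sequentially. Lp_seminorm 3 ?S (\<lambda>x. (F n x - f x) - (K n x - g x)) \<le> 2 * (Lp_seminorm 3 ?S (\<lambda>x. F n x - f x) + Lp_seminorm 3 ?S (\<lambda>x. K n x - g x))"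
      using that by (intro always_eventually allI Lp_mem_diff) auto
    show "\<forall>\<^sub>F n in sequentially. 0 \<le> Lp_seminorm 3 ?S (\<lambda>x. (F n x - f x) - (K n x - g x))"
      by (intro always_eventually allI Lp_seminorm_nonneg)
  qed
  have g: "gradient_matrix (\<lambda>x. \<Phi> n x - \<Psi> n x) x = gradient_matrix (\<Phi> n) x - gradient_matrix (\<Psi> n) x" for n x
    using smooth_diff(2)[of "\<Phi> n" "\<Psi> n"] \<Phi>(1) \<Psi>(1)
    by (simp add: vec_eq_iff gradient_matrix_nth test_function_def)
  show ?thesis unfolding W0_def Lp
  proof (intro conjI exI[of _ "\<lambda>n x. \<Phi> n x - \<Psi> n x"] allI)
    show "test_function \<Omega> (\<lambda>x. \<Phi> n x - \<Psi> n x)" for n by (intro test_function_diff \<Phi> \<Psi>)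
    show "has_weak_gradient \<Omega> (\<lambda>x. u x - v x) (\<lambda>x. G x - H x)"
      using u v unfolding W0_def by (intro has_weak_gradient_diff) auto
    show "(\<lambda>n. Lp_seminorm 3 ?S (\<lambda>x. \<Phi> n x - \<Psi> n x - (u x - v x))) \<longlonglongrightarrow> 0"
      using lim[OF \<Phi>(2) \<Psi>(2) T(2)[OF \<Phi>(1)] T(2)[OF \<Psi>(1)] mem(1,2)] by (simp add: algebra_simps)
    show "(\<lambda>n. Lp_seminorm 3 ?S (\<lambda>x. matrix (frechet_derivative (\<lambda>x. \<Phi> n x - \<Psi> n x) (at x)) - (G x - H x))) \<longlonglongrightarrow> 0"
      unfolding gradient_matrix_def[symmetric] g
      using lim[OF \<Phi>(3) \<Psi>(3) T(3)[OF \<Phi>(1)] T(3)[OF \<Psi>(1)] mem(3,4)] by (simp add: algebra_simps)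
  qed (use mem in \<open>auto intro!: Lp_mem_diff(1)\<close>)
qed

text \<open>This admits the difference of two solutions as a test field.\<close>

lemma velocity_class_diff:
  assumes \<Omega>: "open \<Omega>" "bounded \<Omega>" and u: "velocity_class T \<Omega> u G" and v: "velocity_class T \<Omega> v H"
  shows "velocity_class T \<Omega> (\<lambda>t x. u t x - v t x) (\<lambda>t x. G t x - H t x)"
proof -
  have m: "{0<..<T} \<in> sets lborel" "\<Omega> \<in> sets lborel" using \<Omega> by auto
  have 1: "has_spatial_gradient {0<..<T} \<Omega> (\<lambda>t x. u t x - v t x) (\<lambda>t x. G t x - H t x)"
  proof -
    have "AE t\<in>{0<..<T} in lborel. has_weak_gradient \<Omega> (u t) (G t)" "AE t\<in>{0<..<T} in lborel. has_weak_gradient \<Omega> (v t) (H t)"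
      using u v unfolding velocity_class_def has_spatial_gradient_def by auto
    then show ?thesis unfolding has_spatial_gradient_def by eventually_elim (auto intro: has_weak_gradient_diff)
  qed
  have 2: "AE t\<in>{0<..<T} in lborel. velocity_space \<Omega> (\<lambda>x. u t x - v t x) (\<lambda>x. G t x - H t x)"
  proof -
    have "AE t\<in>{0<..<T} in lborel. velocity_space \<Omega> (u t) (G t)" "AE t\<in>{0<..<T} in lborel. velocity_space \<Omega> (v t) (H t)"
      using u v unfolding velocity_class_def by auto
    then show ?thesis by eventually_elim (auto intro: W0_diff[OF \<Omega>])
  qed
  show ?thesis
    using u v 1 2 unfolding velocity_class_def by (auto intro!: in_Linf_Lq_diff in_Lr_Lq_diff m)
qed

text \<open>Fields frozen at one time are admissible test fields.\<close>

lemma velocity_class_const: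
  fixes \<Omega> :: "(real ^ 'd) set"
  assumes \<Omega>: "open \<Omega>" "bounded \<Omega>" and W: "W0 3 \<Omega> v H" and f: "velocity_fields (restrict_space lborel \<Omega>) v H"
  shows "velocity_class T \<Omega> (\<lambda>t. v) (\<lambda>t. H)"
proof -
  have m: "{0<..<T} \<in> sets lborel" "\<Omega> \<in> sets lborel" using \<Omega> by auto
  let ?T = "restrict_space lborel {0<..<T}" and ?S = "restrict_space lborel \<Omega>"
  have fin: "finite_measure ?T"
  proof (rule finite_measureI)
    show "emeasure ?T (space ?T) \<noteq> \<infinity>"
      by (cases "0 \<le> T") (auto simp: emeasure_restrict_space space_restrict_space)
  qed
  have bm: "bochner_measurable {0<..<T} \<Omega> q (\<lambda>t. g)" if "Lp_mem q ?S g" for q and g :: "real ^ 'd \<Rightarrow> 'c::euclidean_space"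
    unfolding bochner_measurable_iff[OF m]
  proof
    have "g \<in> borel_measurable ?S" using that unfolding Lp_mem_def by simp
    from measurable_compose[OF measurable_snd this]
    show "(\<lambda>(t, x). g x) \<in> borel_measurable (?T \<Otimes>\<^sub>M ?S)" by (simp add: case_prod_unfold)
  qed (use that in simp)
  have Linf: "in_Linf_Lq q {0<..<T} \<Omega> (\<lambda>t. g)" if "Lp_mem q ?S g" for q and g :: "real ^ 'd \<Rightarrow> 'c::euclidean_space"
    unfolding in_Linf_Lq_def using bm[OF that] by auto
  have Lr: "in_Lr_Lq r q {0<..<T} \<Omega> (\<lambda>t. g)" if "Lp_mem q ?S g" for r q and g :: "real ^ 'd \<Rightarrow> 'c::euclidean_space"
    unfolding in_Lr_Lq_iff[OF m] using bm[OF that] finite_measure.integrable_const[OF fin] by (simp add: Lp_mem_def)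
  show ?thesis
    using W f unfolding velocity_class_def velocity_fields_def has_spatial_gradient_def
    by (auto intro!: Linf Lr simp: W0_def)
qed

lemma velocity_class_imp_fields:
  assumes \<Omega>: "open \<Omega>" and u: "velocity_class T \<Omega> u G"
  shows "AE t\<in>{0<..<T} in lborel. velocity_fields (restrict_space lborel \<Omega>) (u t) (G t)"
proof -
  have m: "\<Omega> \<in> sets lborel" using \<Omega> by auto
  have "AE t\<in>{0<..<T} in lborel. in_Lp 2 \<Omega> (u t)" "AE t\<in>{0<..<T} in lborel. in_Lp 3 \<Omega> (u t)"
    "AE t\<in>{0<..<T} in lborel. in_Lp 6 \<Omega> (u t)" "AE t\<in>{0<..<T} in lborel. in_Lp 2 \<Omega> (G t)" "AE t\<in>{0<..<T} in lborel. in_Lp 3 \<Omega> (G t)"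
    using u unfolding velocity_class_def in_Linf_Lq_def in_Lr_Lq_def bochner_measurable_def by auto
  then show ?thesis by eventually_elim (auto simp: velocity_fields_def in_Lp_iff[OF m])
qed

section \<open>Weak time derivatives of velocities and gradients\<close>

text \<open>Distributional time derivatives on a compact interval, tested with products of functions of time
  and of space only.  In this form the property passes from a velocity to its gradient, and it is
  what \<open>space_time_FTC\<close> asks for.\<close>

definition weak_time_deriv ::
  "real \<Rightarrow> real \<Rightarrow> real set \<Rightarrow> 'a::euclidean_space set \<Rightarrow> (real \<Rightarrow> 'a \<Rightarrow> 'b::euclidean_space) \<Rightarrow> (real \<Rightarrow> 'a \<Rightarrow> 'b) \<Rightarrow> bool" where
  "weak_time_deriv a b I \<Omega> u z \<longleftrightarrow>
    integrable (restrict_space lborel {a..b} \<Otimes>\<^sub>M restrict_space lborel \<Omega>) (\<lambda>(t, x). u t x) \<and>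
    integrable (restrict_space lborel {a..b} \<Otimes>\<^sub>M restrict_space lborel \<Omega>) (\<lambda>(t, x). z t x) \<and>
    (\<forall>\<theta> \<eta>. test_function I \<theta> \<longrightarrow> (\<forall>t. t \<notin> {a..b} \<longrightarrow> \<theta> t = 0) \<longrightarrow> test_function \<Omega> \<eta> \<longrightarrow>
      (\<integral>(t, x). (dir_deriv 1 \<theta> t * \<eta> x) *\<^sub>R u t x \<partial>(restrict_space lborel {a..b} \<Otimes>\<^sub>M restrict_space lborel \<Omega>))
      = - (\<integral>(t, x). (\<theta> t * \<eta> x) *\<^sub>R z t x \<partial>(restrict_space lborel {a..b} \<Otimes>\<^sub>M restrict_space lborel \<Omega>)))"

lemma tensor_integrable:
  fixes u :: "real \<Rightarrow> 'a::euclidean_space \<Rightarrow> 'b::euclidean_space" and \<theta> :: "real \<Rightarrow> real" and \<eta> :: "'a \<Rightarrow> real"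
  assumes \<theta>: "test_function I \<theta>" and \<eta>: "test_function \<Omega> \<eta>"
    and u: "integrable (restrict_space lborel {a..b} \<Otimes>\<^sub>M restrict_space lborel \<Omega>) (\<lambda>(t, x). u t x)"
  shows "integrable (restrict_space lborel {a..b} \<Otimes>\<^sub>M restrict_space lborel \<Omega>) (\<lambda>(t, x). (\<theta> t * \<eta> x) *\<^sub>R u t x)"
proof -
  let ?P = "restrict_space lborel {a..b} \<Otimes>\<^sub>M restrict_space lborel \<Omega>"
  obtain C where C: "\<And>x. norm (\<theta> x) \<le> C" "C \<ge> 0" using test_function_bounded[OF \<theta>] by blast
  obtain D where D: "\<And>x. norm (\<eta> x) \<le> D" "D \<ge> 0" using test_function_bounded[OF \<eta>] by blast
  have m: "(\<lambda>t. \<theta> t) \<in> borel_measurable (restrict_space lborel {a..b})" "(\<lambda>x. \<eta> x) \<in> borel_measurable (restrict_space lborel \<Omega>)"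
    using test_function_measurable[OF \<theta>] test_function_measurable[OF \<eta>] by (auto intro: measurable_restrict_space1)
  have "integrable ?P (\<lambda>p. (\<theta> (fst p) * \<eta> (snd p)) *\<^sub>R u (fst p) (snd p))"
  proof (rule Bochner_Integration.integrable_bound)
    show "integrable ?P (\<lambda>p. (C * D) * norm (u (fst p) (snd p)))"
      using integrable_norm[OF u] by (intro integrable_mult_right) (simp add: case_prod_unfold)
    show "(\<lambda>p. (\<theta> (fst p) * \<eta> (snd p)) *\<^sub>R u (fst p) (snd p)) \<in> borel_measurable ?P"
      using borel_measurable_integrable[OF u]
      by (intro borel_measurable_scaleR borel_measurable_times measurable_compose[OF measurable_fst m(1)] measurable_compose[OF measurable_snd m(2)])
         (simp add: case_prod_unfold)
    show "AE p in ?P. norm ((\<theta> (fst p) * \<eta> (snd p)) *\<^sub>R u (fst p) (snd p)) \<le> norm ((C * D) * norm (u (fst p) (snd p)))"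
    proof (rule AE_I2)
      fix p :: "real \<times> 'a"
      have "norm (\<theta> (fst p)) * norm (\<eta> (snd p)) * norm (u (fst p) (snd p)) \<le> C * D * norm (u (fst p) (snd p))"
        using C D by (intro mult_right_mono mult_mono) auto
      then show "norm ((\<theta> (fst p) * \<eta> (snd p)) *\<^sub>R u (fst p) (snd p)) \<le> norm ((C * D) * norm (u (fst p) (snd p)))"
        using C(2) D(2) by (simp add: abs_mult)
    qed
  qed
  then show ?thesis by (simp add: case_prod_unfold)
qed

lemma weak_time_deriv_linear:
  fixes u z :: "real \<Rightarrow> 'a::euclidean_space \<Rightarrow> 'b::euclidean_space" and L :: "'b \<Rightarrow> 'c::euclidean_space"
  assumes L: "bounded_linear L" and w: "weak_time_deriv a b I \<Omega> u z"
  shows "weak_time_deriv a b I \<Omega> (\<lambda>t x. L (u t x)) (\<lambda>t x. L (z t x))"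
  unfolding weak_time_deriv_def
proof (intro conjI allI impI)
  let ?P = "restrict_space lborel {a..b} \<Otimes>\<^sub>M restrict_space lborel \<Omega>"
  have i: "integrable ?P (\<lambda>(t, x). u t x)" "integrable ?P (\<lambda>(t, x). z t x)"
    using w unfolding weak_time_deriv_def by auto
  show "integrable ?P (\<lambda>(t, x). L (u t x))" "integrable ?P (\<lambda>(t, x). L (z t x))"
    using integrable_bounded_linear[OF L i(1)] integrable_bounded_linear[OF L i(2)] by (simp_all add: case_prod_unfold)
  fix \<theta> :: "real \<Rightarrow> real" and \<eta> :: "'a \<Rightarrow> real" assume t: "test_function I \<theta>" "\<forall>t. t \<notin> {a..b} \<longrightarrow> \<theta> t = 0" "test_function \<Omega> \<eta>"
  have pull: "(\<integral>(t, x). (k t * \<eta> x) *\<^sub>R L (f t x) \<partial>?P) = L (\<integral>(t, x). (k t * \<eta> x) *\<^sub>R f t x \<partial>?P)"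
    if "test_function I k" "integrable ?P (\<lambda>(t, x). f t x)" for k f
    using integral_bounded_linear[OF L tensor_integrable[OF that(1) t(3) that(2)]]
    by (simp add: case_prod_unfold linear_cmul[OF bounded_linear.linear[OF L]])
  have e: "(\<integral>(t, x). (dir_deriv 1 \<theta> t * \<eta> x) *\<^sub>R u t x \<partial>?P) = - (\<integral>(t, x). (\<theta> t * \<eta> x) *\<^sub>R z t x \<partial>?P)"
    using w t unfolding weak_time_deriv_def by simp
  show "(\<integral>(t, x). (dir_deriv 1 \<theta> t * \<eta> x) *\<^sub>R L (u t x) \<partial>?P) = - (\<integral>(t, x). (\<theta> t * \<eta> x) *\<^sub>R L (z t x) \<partial>?P)"
    unfolding pull[OF test_function_dir_deriv[OF t(1)] i(1)] pull[OF t(1) i(2)]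
    unfolding e by (rule linear_neg[OF bounded_linear.linear[OF L]])
qed

lemma weak_time_deriv_add:
  fixes u v :: "real \<Rightarrow> 'a::euclidean_space \<Rightarrow> 'b::euclidean_space"
  assumes u: "weak_time_deriv a b I \<Omega> u z" and v: "weak_time_deriv a b I \<Omega> v y"
  shows "weak_time_deriv a b I \<Omega> (\<lambda>t x. u t x + v t x) (\<lambda>t x. z t x + y t x)"
  unfolding weak_time_deriv_def
proof (intro conjI allI impI)
  let ?P = "restrict_space lborel {a..b} \<Otimes>\<^sub>M restrict_space lborel \<Omega>"
  have i: "integrable ?P (\<lambda>(t, x). u t x)" "integrable ?P (\<lambda>(t, x). z t x)" "integrable ?P (\<lambda>(t, x). v t x)" "integrable ?P (\<lambda>(t, x). y t x)"
    using u v unfolding weak_time_deriv_def by auto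
  show "integrable ?P (\<lambda>(t, x). u t x + v t x)" "integrable ?P (\<lambda>(t, x). z t x + y t x)"
    using Bochner_Integration.integrable_add[OF i(1,3)] Bochner_Integration.integrable_add[OF i(2,4)] by (simp_all add: case_prod_unfold)
  fix \<theta> :: "real \<Rightarrow> real" and \<eta> :: "'a \<Rightarrow> real" assume t: "test_function I \<theta>" "\<forall>t. t \<notin> {a..b} \<longrightarrow> \<theta> t = 0" "test_function \<Omega> \<eta>"
  have split: "(\<integral>(t, x). (k t * \<eta> x) *\<^sub>R (f t x + g t x) \<partial>?P) = (\<integral>(t, x). (k t * \<eta> x) *\<^sub>R f t x \<partial>?P) + (\<integral>(t, x). (k t * \<eta> x) *\<^sub>R g t x \<partial>?P)"
    if "test_function I k" "integrable ?P (\<lambda>(t, x). f t x)" "integrable ?P (\<lambda>(t, x). g t x)" for k and f g :: "real \<Rightarrow> 'a \<Rightarrow> 'b"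
    using Bochner_Integration.integral_add[OF tensor_integrable[OF that(1) t(3) that(2)] tensor_integrable[OF that(1) t(3) that(3)]]
    by (simp add: case_prod_unfold scaleR_add_right)
  show "(\<integral>(t, x). (dir_deriv 1 \<theta> t * \<eta> x) *\<^sub>R (u t x + v t x) \<partial>?P) = - (\<integral>(t, x). (\<theta> t * \<eta> x) *\<^sub>R (z t x + y t x) \<partial>?P)"
    unfolding split[OF test_function_dir_deriv[OF t(1)] i(1,3)] split[OF t(1) i(2,4)]
    using u v t unfolding weak_time_deriv_def by simp
qed

lemma weak_time_deriv_diff:
  assumes u: "weak_time_deriv a b I \<Omega> u z" and v: "weak_time_deriv a b I \<Omega> v y"
  shows "weak_time_deriv a b I \<Omega> (\<lambda>t x. u t x - v t x) (\<lambda>t x. z t x - y t x)"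
  using weak_time_deriv_add[OF u weak_time_deriv_linear[OF bounded_linear_minus[OF bounded_linear_ident] v]] by simp

lemma test_function_tensor:
  fixes \<theta> :: "real \<Rightarrow> real" and \<eta> :: "'a::euclidean_space \<Rightarrow> real"
  assumes \<theta>: "test_function I \<theta>" and \<eta>: "test_function \<Omega> \<eta>"
  shows "test_function (I \<times> \<Omega>) (\<lambda>p. \<theta> (fst p) * \<eta> (snd p) :: real)"
    and "dir_deriv (1, 0) (\<lambda>p. \<theta> (fst p) * \<eta> (snd p) :: real) (t, x) = dir_deriv 1 \<theta> t * \<eta> x"
proof -
  have sm: "smooth \<theta>" "smooth \<eta>" using assms unfolding test_function_def by auto
  note c = smooth_compose_linear[OF bounded_linear_fst sm(1)] smooth_compose_linear[OF bounded_linear_snd sm(2)]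
  obtain K where K: "compact K" "K \<subseteq> I" "\<And>x. x \<notin> K \<Longrightarrow> \<theta> x = 0" "\<And>x b. x \<notin> K \<Longrightarrow> dir_deriv b \<theta> x = 0"
    using test_function_support[OF \<theta>] by blast
  obtain L where L: "compact L" "L \<subseteq> \<Omega>" "\<And>x. x \<notin> L \<Longrightarrow> \<eta> x = 0" "\<And>x b. x \<notin> L \<Longrightarrow> dir_deriv b \<eta> x = 0"
    using test_function_support[OF \<eta>] by blast
  show "test_function (I \<times> \<Omega>) (\<lambda>p. \<theta> (fst p) * \<eta> (snd p))"
  proof (rule test_functionI[of _ "K \<times> L"])
    show "smooth (\<lambda>p. \<theta> (fst p) * \<eta> (snd p))" by (rule smooth_mult[OF c(1) c(3)])
    show "\<theta> (fst p) * \<eta> (snd p) = 0" if "p \<notin> K \<times> L" for p using that K(3) L(3) by (cases p) auto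
  qed (use K L in \<open>auto intro: compact_Times\<close>)
  have z: "dir_deriv 0 \<eta> y = 0" for y
    unfolding dir_deriv_def using linear_0[OF has_derivative_linear[OF smooth_has_derivative[OF sm(2)]]] .
  show "dir_deriv (1, 0) (\<lambda>p. \<theta> (fst p) * \<eta> (snd p)) (t, x) = dir_deriv 1 \<theta> t * \<eta> x"
    unfolding dir_deriv_mult(2)[OF c(1) c(3)] c(2) c(4) by (simp add: z)
qed

text \<open>A product of test functions of time and of space is a test function on space-time, and a
  derivative in time falls on its first factor only.\<close>

lemma has_weak_deriv_imp_weak_time_deriv:
  fixes w wt :: "real \<Rightarrow> 'a::euclidean_space \<Rightarrow> 'b::euclidean_space"
  assumes w: "has_weak_deriv (I \<times> \<Omega>) (1, 0) (\<lambda>(t, x). w t x) (\<lambda>(t, x). wt t x)"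
    and \<Omega>: "open \<Omega>" and ab: "{a..b} \<subseteq> I"
    and i: "integrable (restrict_space lborel {a..b} \<Otimes>\<^sub>M restrict_space lborel \<Omega>) (\<lambda>(t, x). w t x)"
      "integrable (restrict_space lborel {a..b} \<Otimes>\<^sub>M restrict_space lborel \<Omega>) (\<lambda>(t, x). wt t x)"
  shows "weak_time_deriv a b I \<Omega> w wt"
  unfolding weak_time_deriv_def
proof (intro conjI i allI impI)
  let ?P = "restrict_space lborel {a..b} \<Otimes>\<^sub>M restrict_space lborel \<Omega>"
  fix \<theta> :: "real \<Rightarrow> real" and \<eta> :: "'a \<Rightarrow> real" assume t: "test_function I \<theta>" "\<forall>t. t \<notin> {a..b} \<longrightarrow> \<theta> t = 0" "test_function \<Omega> \<eta>"
  have \<theta>': "dir_deriv 1 \<theta> t = 0" if "t \<notin> {a..b}" for t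
    using t(2) that by (intro dir_deriv_outside_closed[of "{a..b}"]) auto
  have "{a..b} \<times> \<Omega> \<in> sets (lborel \<Otimes>\<^sub>M lborel)" using \<Omega> by (intro pair_measureI) auto
  then have mab: "{a..b} \<times> \<Omega> \<in> sets lborel" unfolding lborel_prod .
  have conv: "(LINT p:I \<times> \<Omega>|lborel. F p) = (\<integral>p. F p \<partial>?P)" if "\<And>t x. t \<notin> {a..b} \<Longrightarrow> F (t, x) = 0" for F :: "real \<times> 'a \<Rightarrow> 'b"
  proof -
    have "(\<lambda>p. indicator (I \<times> \<Omega>) p *\<^sub>R F p) = (\<lambda>p. indicator ({a..b} \<times> \<Omega>) p *\<^sub>R F p)"
      using that ab by (auto simp: fun_eq_iff indicator_def)
    then have "(LINT p:I \<times> \<Omega>|lborel. F p) = (LINT p:{a..b} \<times> \<Omega>|lborel. F p)"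
      unfolding set_lebesgue_integral_def by (simp only:)
    also have "\<dots> = (\<integral>p. F p \<partial>restrict_space lborel ({a..b} \<times> \<Omega>))"
      by (rule integral_restrict_lborel_self(1)[OF mab, symmetric])
    also have "restrict_space lborel ({a..b} \<times> \<Omega>) = ?P"
      using \<Omega> by (intro restrict_lborel_pair[symmetric]) auto
    finally show ?thesis .
  qed
  note T = test_function_tensor[OF t(1,3)]
  have "(LINT p:I \<times> \<Omega>|lborel. dir_deriv (1, 0) (\<lambda>p. \<theta> (fst p) * \<eta> (snd p)) p *\<^sub>R (\<lambda>(t, x). w t x) p)
    = - (LINT p:I \<times> \<Omega>|lborel. (\<theta> (fst p) * \<eta> (snd p)) *\<^sub>R (\<lambda>(t, x). wt t x) p)"
    using w T(1) unfolding has_weak_deriv_def by blast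
  moreover have "(LINT p:I \<times> \<Omega>|lborel. dir_deriv (1, 0) (\<lambda>p. \<theta> (fst p) * \<eta> (snd p)) p *\<^sub>R (\<lambda>(t, x). w t x) p)
     = (\<integral>p. dir_deriv (1, 0) (\<lambda>p. \<theta> (fst p) * \<eta> (snd p)) p *\<^sub>R (\<lambda>(t, x). w t x) p \<partial>?P)"
    by (rule conv) (simp add: T(2) \<theta>')
  moreover have "(LINT p:I \<times> \<Omega>|lborel. (\<theta> (fst p) * \<eta> (snd p)) *\<^sub>R (\<lambda>(t, x). wt t x) p)
     = (\<integral>p. (\<theta> (fst p) * \<eta> (snd p)) *\<^sub>R (\<lambda>(t, x). wt t x) p \<partial>?P)"
    by (rule conv) (use t(2) in simp)
  moreover have "dir_deriv (1, 0) (\<lambda>p. \<theta> (fst p) * \<eta> (snd p)) p = dir_deriv 1 \<theta> (fst p) * \<eta> (snd p)" for p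
    using T(2)[of "fst p" "snd p"] by simp
  ultimately show "(\<integral>(t, x). (dir_deriv 1 \<theta> t * \<eta> x) *\<^sub>R w t x \<partial>?P) = - (\<integral>(t, x). (\<theta> t * \<eta> x) *\<^sub>R wt t x \<partial>?P)"
    by (simp add: case_prod_unfold)
qed

lemma weak_gradient_column:
  fixes \<eta> :: "real ^ 'd \<Rightarrow> real"
  assumes \<Omega>: "open \<Omega>" and G: "has_weak_gradient \<Omega> u G" and \<eta>: "test_function \<Omega> \<eta>"
  shows "(\<integral>x. \<eta> x *\<^sub>R column j (G x) \<partial>restrict_space lborel \<Omega>) = - (\<integral>x. dir_deriv (axis j 1) \<eta> x *\<^sub>R u x \<partial>restrict_space lborel \<Omega>)"
proof -
  have m: "\<Omega> \<in> sets lborel" using \<Omega> by simp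
  show ?thesis
    unfolding integral_restrict_lborel_self(1)[OF m]
    using G \<eta> unfolding has_weak_gradient_def has_weak_deriv_def by simp
qed

lemma bounded_linear_column: "bounded_linear (column j :: real ^ 'n ^ 'm \<Rightarrow> real ^ 'm)"
proof (rule bounded_linear_intro)
  show "norm (column j A) \<le> norm A * 1" for A :: "real ^ 'n ^ 'm" using norm_column_le by simp
qed (simp_all add: column_def vec_eq_iff)

lemma matrix_eq_columns: "(\<And>j. column j A = column j B) \<Longrightarrow> A = B"
  by (simp add: column_def vec_eq_iff)

text \<open>Space and time derivatives commute once both have been moved to the test function.\<close>

lemma weak_time_deriv_gradient:
  fixes w wt :: "real \<Rightarrow> real ^ 'd \<Rightarrow> real ^ 'd"
  assumes \<Omega>: "open \<Omega>" and w: "weak_time_deriv a b I \<Omega> w wt"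
    and G: "AE t in restrict_space lborel {a..b}. has_weak_gradient \<Omega> (w t) (G t)"
    and Gt: "AE t in restrict_space lborel {a..b}. has_weak_gradient \<Omega> (wt t) (Gt t)"
    and i: "integrable (restrict_space lborel {a..b} \<Otimes>\<^sub>M restrict_space lborel \<Omega>) (\<lambda>(t, x). G t x)"
      "integrable (restrict_space lborel {a..b} \<Otimes>\<^sub>M restrict_space lborel \<Omega>) (\<lambda>(t, x). Gt t x)"
  shows "weak_time_deriv a b I \<Omega> G Gt"
  unfolding weak_time_deriv_def
proof (intro conjI i allI impI)
  let ?T = "restrict_space lborel {a..b}" and ?S = "restrict_space lborel \<Omega>"
  let ?P = "?T \<Otimes>\<^sub>M ?S"
  interpret P: pair_sigma_finite ?T ?S using \<Omega> by (intro pair_sigma_finite_restrict) auto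
  have iw: "integrable ?P (\<lambda>(t, x). w t x)" "integrable ?P (\<lambda>(t, x). wt t x)" using w unfolding weak_time_deriv_def by auto
  fix \<theta> :: "real \<Rightarrow> real" and \<eta> :: "real ^ 'd \<Rightarrow> real" assume t: "test_function I \<theta>" "\<forall>t. t \<notin> {a..b} \<longrightarrow> \<theta> t = 0" "test_function \<Omega> \<eta>"
  have col: "column j (\<integral>(t, x). (k t * \<eta> x) *\<^sub>R F t x \<partial>?P) = - (\<integral>(t, x). (k t * dir_deriv (axis j 1) \<eta> x) *\<^sub>R f t x \<partial>?P)"
    if k: "test_function I k" and F: "integrable ?P (\<lambda>(t, x). F t x)" and f: "integrable ?P (\<lambda>(t, x). f t x)"
      and wg: "AE t in ?T. has_weak_gradient \<Omega> (f t) (F t)" for k j f F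
  proof -
    note iF = tensor_integrable[OF k t(3) F]
    note \<eta>' = test_function_dir_deriv[OF t(3), of "axis j 1"]
    note if' = tensor_integrable[OF k \<eta>' f]
    have "column j (\<integral>(t, x). (k t * \<eta> x) *\<^sub>R F t x \<partial>?P) = (\<integral>(t, x). (k t * \<eta> x) *\<^sub>R column j (F t x) \<partial>?P)"
      using integral_bounded_linear[OF bounded_linear_column iF, of j]
      by (simp add: case_prod_unfold linear_cmul[OF bounded_linear.linear[OF bounded_linear_column]])
    also have "\<dots> = (\<integral>t. \<integral>x. (k t * \<eta> x) *\<^sub>R column j (F t x) \<partial>?S \<partial>?T)"
    proof -
      have "integrable ?P (\<lambda>(t, x). column j (F t x))"
        using integrable_bounded_linear[OF bounded_linear_column F] by (simp add: case_prod_unfold)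
      from P.integral_fst'[OF tensor_integrable[OF k t(3) this]] show ?thesis by simp
    qed
    also have "\<dots> = (\<integral>t. - (\<integral>x. (k t * dir_deriv (axis j 1) \<eta> x) *\<^sub>R f t x \<partial>?S) \<partial>?T)"
    proof (rule integral_cong_AE)
      have m1: "integrable ?P (\<lambda>(t, x). column j (F t x))"
        using integrable_bounded_linear[OF bounded_linear_column F] by (simp add: case_prod_unfold)
      show "(\<lambda>t. \<integral>x. (k t * \<eta> x) *\<^sub>R column j (F t x) \<partial>?S) \<in> borel_measurable ?T"
        using P.integrable_fst'[OF tensor_integrable[OF k t(3) m1]] by (intro borel_measurable_integrable) simp
      show "(\<lambda>t. - (\<integral>x. (k t * dir_deriv (axis j 1) \<eta> x) *\<^sub>R f t x \<partial>?S)) \<in> borel_measurable ?T"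
        using P.integrable_fst'[OF if'] by (intro borel_measurable_uminus borel_measurable_integrable) simp
      show "AE t in ?T. (\<integral>x. (k t * \<eta> x) *\<^sub>R column j (F t x) \<partial>?S) = - (\<integral>x. (k t * dir_deriv (axis j 1) \<eta> x) *\<^sub>R f t x \<partial>?S)"
        using wg
      proof eventually_elim
        case (elim s)
        have "(\<integral>x. k s *\<^sub>R (\<eta> x *\<^sub>R column j (F s x)) \<partial>?S) = k s *\<^sub>R (\<integral>x. \<eta> x *\<^sub>R column j (F s x) \<partial>?S)"
          by (rule integral_scaleR_right)
        also have "\<dots> = k s *\<^sub>R (- (\<integral>x. dir_deriv (axis j 1) \<eta> x *\<^sub>R f s x \<partial>?S))"
          unfolding weak_gradient_column[OF \<Omega> elim t(3)] ..
        also have "\<dots> = - (\<integral>x. k s *\<^sub>R (dir_deriv (axis j 1) \<eta> x *\<^sub>R f s x) \<partial>?S)"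
          unfolding integral_scaleR_right by simp
        finally show ?case by simp
      qed
    qed
    also have "\<dots> = - (\<integral>(t, x). (k t * dir_deriv (axis j 1) \<eta> x) *\<^sub>R f t x \<partial>?P)"
      using P.integral_fst'[OF if'] by simp
    finally show ?thesis .
  qed
  show "(\<integral>(t, x). (dir_deriv 1 \<theta> t * \<eta> x) *\<^sub>R G t x \<partial>?P) = - (\<integral>(t, x). (\<theta> t * \<eta> x) *\<^sub>R Gt t x \<partial>?P)"
  proof (rule matrix_eq_columns)
    fix j
    have "column j (\<integral>(t, x). (dir_deriv 1 \<theta> t * \<eta> x) *\<^sub>R G t x \<partial>?P) = - (\<integral>(t, x). (dir_deriv 1 \<theta> t * dir_deriv (axis j 1) \<eta> x) *\<^sub>R w t x \<partial>?P)"
      by (rule col[OF test_function_dir_deriv[OF t(1)] i(1) iw(1) G])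
    also have "(\<integral>(t, x). (dir_deriv 1 \<theta> t * dir_deriv (axis j 1) \<eta> x) *\<^sub>R w t x \<partial>?P) = - (\<integral>(t, x). (\<theta> t * dir_deriv (axis j 1) \<eta> x) *\<^sub>R wt t x \<partial>?P)"
      using w t(1,2) test_function_dir_deriv[OF t(3), of "axis j 1"] unfolding weak_time_deriv_def by blast
    also have "\<dots> = column j (\<integral>(t, x). (\<theta> t * \<eta> x) *\<^sub>R Gt t x \<partial>?P)"
      using col[OF t(1) i(2) iw(2) Gt] by simp
    finally show "column j (\<integral>(t, x). (dir_deriv 1 \<theta> t * \<eta> x) *\<^sub>R G t x \<partial>?P) = column j (- (\<integral>(t, x). (\<theta> t * \<eta> x) *\<^sub>R Gt t x \<partial>?P))"
      by (simp add: linear_neg[OF bounded_linear.linear[OF bounded_linear_column]])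
  qed
qed

text \<open>On a set of finite measure the $L^1$ norm in space is bounded by the $L^2$ norm; Tonelli's theorem
  does the rest.\<close>

lemma bochner_integrable:
  fixes u :: "real \<Rightarrow> 'a::euclidean_space \<Rightarrow> 'b::euclidean_space"
  assumes J: "J \<in> sets lborel" and \<Omega>: "\<Omega> \<in> sets lborel" and fin: "finite_measure (restrict_space lborel \<Omega>)"
    and u: "bochner_measurable J \<Omega> 2 u"
    and B: "integrable (restrict_space lborel J) B" "AE t in restrict_space lborel J. Lp_seminorm 2 (restrict_space lborel \<Omega>) (u t) \<le> B t"
  shows "integrable (restrict_space lborel J \<Otimes>\<^sub>M restrict_space lborel \<Omega>) (\<lambda>(t, x). u t x)"
proof -
  let ?T = "restrict_space lborel J" and ?S = "restrict_space lborel \<Omega>"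
  interpret P: pair_sigma_finite ?T ?S using J \<Omega> by (rule pair_sigma_finite_restrict)
  have um: "(\<lambda>(t, x). u t x) \<in> borel_measurable (?T \<Otimes>\<^sub>M ?S)" and mem: "AE t in ?T. Lp_mem 2 ?S (u t)"
    using u unfolding bochner_measurable_iff[OF J \<Omega>] by auto
  have one: "Lp_mem 2 ?S (\<lambda>x. 1 :: real)"
    unfolding Lp_mem_def using fin by (simp add: finite_measure.integrable_const)
  show ?thesis
  proof (rule P.Fubini_integrable[OF um])
    show "AE t in ?T. integrable ?S (\<lambda>x. case (t, x) of (t, x) \<Rightarrow> u t x)"
      using mem
    proof eventually_elim
      case (elim t)
      from Cauchy_Schwarz_L2(1)[OF elim one] elim show ?case
        by (simp add: integrable_norm_iff Lp_mem_def)
    qed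
    show "integrable ?T (\<lambda>t. \<integral>x. norm (case (t, x) of (t, x) \<Rightarrow> u t x) \<partial>?S)"
    proof (rule Bochner_Integration.integrable_bound)
      show "integrable ?T (\<lambda>t. B t * Lp_seminorm 2 ?S (\<lambda>x. 1 :: real))"
        using B(1) by (rule integrable_mult_left)
      show "(\<lambda>t. \<integral>x. norm (case (t, x) of (t, x) \<Rightarrow> u t x) \<partial>?S) \<in> borel_measurable ?T"
        using um by (intro P.M2.borel_measurable_lebesgue_integral) (simp add: case_prod_unfold)
      show "AE t in ?T. norm (\<integral>x. norm (case (t, x) of (t, x) \<Rightarrow> u t x) \<partial>?S) \<le> norm (B t * Lp_seminorm 2 ?S (\<lambda>x. 1 :: real))"
        using mem B(2)
      proof eventually_elim
        case (elim t)
        have "(\<integral>x. norm (u t x) \<partial>?S) \<le> Lp_seminorm 2 ?S (u t) * Lp_seminorm 2 ?S (\<lambda>x. 1 :: real)"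
          using Cauchy_Schwarz_L2(2)[OF elim(1) one] by simp
        also have "\<dots> \<le> B t * Lp_seminorm 2 ?S (\<lambda>x. 1 :: real)"
          by (intro mult_right_mono elim Lp_seminorm_nonneg)
        finally show ?case by (simp add: integral_nonneg_AE)
      qed
    qed
  qed
qed

text \<open>Moving the derivative to the smooth field \<open>\<Phi>\<close> shows that pairing with its gradient is
  continuous in the $L^2$ norm of \<open>u\<close> alone.\<close>

lemma gradient_pairing_bound:
  fixes \<Phi> :: "real ^ 'd \<Rightarrow> real ^ 'd"
  assumes \<Omega>: "open \<Omega>" "bounded \<Omega>" and \<Phi>: "test_function \<Omega> \<Phi>"
  defines "S \<equiv> restrict_space lborel \<Omega>"
  obtains C where "C \<ge> 0" "\<And>u G. has_weak_gradient \<Omega> u G \<Longrightarrow> Lp_mem 2 S u \<Longrightarrow> Lp_mem 2 S G \<Longrightarrow>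
     \<bar>\<integral>x. G x \<bullet> gradient_matrix \<Phi> x \<partial>S\<bar> \<le> C * Lp_seminorm 2 S u"
proof -
  define \<psi> where "\<psi> i j x = dir_deriv (axis j 1) \<Phi> x $ i" for i j :: 'd and x
  have sm: "smooth \<Phi>" using \<Phi> unfolding test_function_def by auto
  obtain K where K: "compact K" "K \<subseteq> \<Omega>" "\<And>x. x \<notin> K \<Longrightarrow> \<Phi> x = 0" "\<And>x b. x \<notin> K \<Longrightarrow> dir_deriv b \<Phi> x = 0"
    using test_function_support[OF \<Phi>] by blast
  have t: "test_function \<Omega> (\<psi> i j)" for i j
  proof (rule test_functionI[OF _ K(1,2)])
    show "smooth (\<psi> i j)" unfolding \<psi>_def
      by (rule smooth_linear_image(1)[OF bounded_linear_vec_nth smooth_dir_deriv[OF sm]])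
  qed (simp add: \<psi>_def K(4))
  define \<zeta> where "\<zeta> i j = dir_deriv (axis j 1) (\<psi> i j)" for i j
  have t2: "test_function \<Omega> (\<zeta> i j)" for i j unfolding \<zeta>_def by (rule test_function_dir_deriv[OF t])
  have fin: "finite_measure S" unfolding S_def by (rule Lp_mem_test_function(1)[OF \<Omega> \<Phi>, of 1]) simp
  have mem: "Lp_mem 2 S k" if k: "test_function \<Omega> k" for k :: "real ^ 'd \<Rightarrow> real"
  proof -
    obtain C where C: "\<And>x. norm (k x) \<le> C" "C \<ge> 0" using test_function_bounded[OF k] by blast
    have m: "k \<in> borel_measurable S" unfolding S_def
      by (rule measurable_restrict_space1) (use test_function_measurable[OF k] in simp)
    have "integrable S (\<lambda>x. (norm (k x))\<^sup>2)"
    proof (rule finite_measure.integrable_const_bound[OF fin])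
      show "AE x in S. norm ((norm (k x))\<^sup>2) \<le> C\<^sup>2"
      proof (rule AE_I2)
        fix x
        have "(norm (k x))\<^sup>2 \<le> C\<^sup>2" using C(1)[of x] by (intro power_mono) auto
        then show "norm ((norm (k x))\<^sup>2) \<le> C\<^sup>2" by simp
      qed
    qed (use m in measurable)
    then show ?thesis unfolding Lp_mem_2 using m by simp
  qed
  define C where "C = (\<Sum>i\<in>UNIV. \<Sum>j\<in>UNIV. Lp_seminorm 2 S (\<zeta> i j))"
  have C0: "C \<ge> 0" unfolding C_def by (intro sum_nonneg Lp_seminorm_nonneg)
  have "\<bar>\<integral>x. G x \<bullet> gradient_matrix \<Phi> x \<partial>S\<bar> \<le> C * Lp_seminorm 2 S u"
    if G: "has_weak_gradient \<Omega> u G" and u: "Lp_mem 2 S u" and G2: "Lp_mem 2 S G" for u G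
  proof -
    have comp: "Lp_mem 2 S (\<lambda>x. L (f x))" if "Lp_mem 2 S f" "bounded_linear L" "\<And>y. norm (L y) \<le> norm y" for f :: "real ^ 'd \<Rightarrow> 'e::euclidean_space" and L :: "'e \<Rightarrow> 'f::euclidean_space"
    proof -
      have m: "(\<lambda>x. L (f x)) \<in> borel_measurable S"
        using that(1) borel_measurable_continuous_onI[OF linear_continuous_on[OF that(2)]] unfolding Lp_mem_def by (auto intro: measurable_compose)
      have i: "integrable S (\<lambda>x. (norm (f x))\<^sup>2)" using that(1) unfolding Lp_mem_2 by simp
      have "integrable S (\<lambda>x. (norm (L (f x)))\<^sup>2)"
        by (rule Bochner_Integration.integrable_bound[OF i]) (use m that(3) in \<open>auto intro!: power_mono\<close>)
      then show ?thesis unfolding Lp_mem_2 using m by simp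
    qed
    have col: "Lp_mem 2 S (\<lambda>x. column j (G x))" for j
      by (rule comp[OF G2 bounded_linear_column norm_column_le])
    have Gij: "Lp_mem 2 S (\<lambda>x. G x $ i $ j)" for i j
      using comp[OF col[of j] bounded_linear_vec_nth[of i]] by (simp add: column_def component_le_norm_cart)
    have ui: "Lp_mem 2 S (\<lambda>x. u x $ i)" for i
      using comp[OF u bounded_linear_vec_nth[of i]] by (simp add: component_le_norm_cart)
    have prod_int: "integrable S (\<lambda>x. a x * k x)" if "Lp_mem 2 S a" "Lp_mem 2 S k" for a k :: "real ^ 'd \<Rightarrow> real"
      using L2_inner_bound(1)[OF that] by simp
    have ij: "(\<integral>x. \<psi> i j x * (G x $ i $ j) \<partial>S) = - (\<integral>x. \<zeta> i j x * (u x $ i) \<partial>S)" for i j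
    proof -
      have iv: "integrable S (\<lambda>x. k x *\<^sub>R f x)" if "Lp_mem 2 S k" "Lp_mem 2 S f" for k :: "real ^ 'd \<Rightarrow> real" and f :: "real ^ 'd \<Rightarrow> real ^ 'd"
      proof -
        have "(\<lambda>x. k x *\<^sub>R f x) \<in> borel_measurable S" using that unfolding Lp_mem_def by (intro borel_measurable_scaleR) auto
        then show ?thesis using Cauchy_Schwarz_L2(1)[OF that] by (subst integrable_norm_iff[symmetric]) auto
      qed
      have "(\<integral>x. \<psi> i j x *\<^sub>R column j (G x) \<partial>S) $ i = (\<integral>x. (\<psi> i j x *\<^sub>R column j (G x)) $ i \<partial>S)"
        by (rule integral_bounded_linear[OF bounded_linear_vec_nth iv[OF mem[OF t] col], symmetric])
      moreover have "(\<integral>x. \<zeta> i j x *\<^sub>R u x \<partial>S) $ i = (\<integral>x. (\<zeta> i j x *\<^sub>R u x) $ i \<partial>S)"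
        by (rule integral_bounded_linear[OF bounded_linear_vec_nth iv[OF mem[OF t2] u], symmetric])
      moreover have "(\<integral>x. \<psi> i j x *\<^sub>R column j (G x) \<partial>S) = - (\<integral>x. \<zeta> i j x *\<^sub>R u x \<partial>S)"
        unfolding S_def \<zeta>_def by (rule weak_gradient_column[OF \<Omega>(1) G t])
      ultimately show ?thesis by (simp add: column_def)
    qed
    have "(\<integral>x. G x \<bullet> gradient_matrix \<Phi> x \<partial>S) = (\<integral>x. (\<Sum>i\<in>UNIV. \<Sum>j\<in>UNIV. \<psi> i j x * (G x $ i $ j)) \<partial>S)"
      by (intro Bochner_Integration.integral_cong) (auto simp: inner_vec_def gradient_matrix_nth \<psi>_def mult.commute)
    also have "\<dots> = (\<Sum>i\<in>UNIV. \<Sum>j\<in>UNIV. \<integral>x. \<psi> i j x * (G x $ i $ j) \<partial>S)"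
      using prod_int[OF mem[OF t] Gij] by simp
    also have "\<bar>\<dots>\<bar> \<le> (\<Sum>i\<in>UNIV. \<Sum>j\<in>UNIV. \<bar>\<integral>x. \<psi> i j x * (G x $ i $ j) \<partial>S\<bar>)"
      by (intro order_trans[OF sum_abs] sum_mono sum_abs)
    also have "\<dots> \<le> (\<Sum>i\<in>UNIV. \<Sum>j\<in>UNIV. Lp_seminorm 2 S (\<zeta> i j) * Lp_seminorm 2 S u)"
    proof (intro sum_mono)
      fix i j :: 'd
      have "\<bar>\<integral>x. \<psi> i j x * (G x $ i $ j) \<partial>S\<bar> \<le> Lp_seminorm 2 S (\<zeta> i j) * Lp_seminorm 2 S (\<lambda>x. u x $ i)"
        unfolding ij using L2_inner_bound(2)[OF mem[OF t2[of i j]] ui[of i]] by simp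
      also have "\<dots> \<le> Lp_seminorm 2 S (\<zeta> i j) * Lp_seminorm 2 S u"
      proof (rule mult_left_mono[OF _ Lp_seminorm_nonneg])
        have "(Lp_seminorm 2 S (\<lambda>x. u x $ i))\<^sup>2 \<le> (Lp_seminorm 2 S u)\<^sup>2"
          unfolding Lp_seminorm_2 using ui[of i] u unfolding Lp_mem_2
          by (intro integral_mono power_mono) (auto simp: component_le_norm_cart)
        then show "Lp_seminorm 2 S (\<lambda>x. u x $ i) \<le> Lp_seminorm 2 S u"
          by (rule power2_le_imp_le) (rule Lp_seminorm_nonneg)
      qed
      finally show "\<bar>\<integral>x. \<psi> i j x * (G x $ i $ j) \<partial>S\<bar> \<le> Lp_seminorm 2 S (\<zeta> i j) * Lp_seminorm 2 S u" .
    qed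
    also have "\<dots> = C * Lp_seminorm 2 S u" unfolding C_def by (simp add: sum_distrib_right)
    finally show ?thesis .
  qed
  then show ?thesis using that[OF C0] by blast
qed

section \<open>Two solutions with the same data\<close>

text \<open>Packing a velocity and its weighted gradient into one field makes the energy of the model a
  squared $L^2$ norm.\<close>

lemma Lp_mem_2_Pair:
  fixes f :: "'a \<Rightarrow> 'b::euclidean_space" and g :: "'a \<Rightarrow> 'c::euclidean_space"
  assumes f: "Lp_mem 2 M f" and g: "Lp_mem 2 M g"
  shows "Lp_mem 2 M (\<lambda>x. (f x, c *\<^sub>R g x))"
    and "(Lp_seminorm 2 M (\<lambda>x. (f x, c *\<^sub>R g x)))\<^sup>2 = (Lp_seminorm 2 M f)\<^sup>2 + c\<^sup>2 * (Lp_seminorm 2 M g)\<^sup>2"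
proof -
  have m: "f \<in> borel_measurable M" "g \<in> borel_measurable M"
    and i: "integrable M (\<lambda>x. (norm (f x))\<^sup>2)" "integrable M (\<lambda>x. (norm (g x))\<^sup>2)"
    using f g unfolding Lp_mem_2 by auto
  have n: "(norm (f x, c *\<^sub>R g x))\<^sup>2 = (norm (f x))\<^sup>2 + c\<^sup>2 * (norm (g x))\<^sup>2" for x
    by (simp add: norm_Pair power_mult_distrib)
  show "Lp_mem 2 M (\<lambda>x. (f x, c *\<^sub>R g x))"
    unfolding Lp_mem_2 n using m i by (auto intro!: borel_measurable_Pair borel_measurable_scaleR)
  show "(Lp_seminorm 2 M (\<lambda>x. (f x, c *\<^sub>R g x)))\<^sup>2 = (Lp_seminorm 2 M f)\<^sup>2 + c\<^sup>2 * (Lp_seminorm 2 M g)\<^sup>2"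
    unfolding Lp_seminorm_2 n using i by simp
qed

lemma integral_inner_Pair:
  fixes f f' :: "'a \<Rightarrow> 'b::euclidean_space" and g g' :: "'a \<Rightarrow> 'c::euclidean_space"
  assumes "Lp_mem 2 M f" "Lp_mem 2 M f'" "Lp_mem 2 M g" "Lp_mem 2 M g'"
  shows "(\<integral>x. (f x, c *\<^sub>R g x) \<bullet> (f' x, c *\<^sub>R g' x) \<partial>M) = (\<integral>x. f x \<bullet> f' x \<partial>M) + c\<^sup>2 * (\<integral>x. g x \<bullet> g' x \<partial>M)"
proof -
  have "(f x, c *\<^sub>R g x) \<bullet> (f' x, c *\<^sub>R g' x) = f x \<bullet> f' x + c\<^sup>2 * (g x \<bullet> g' x)" for x
    by (simp add: inner_Pair power2_eq_square mult.assoc)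
  then have "(\<integral>x. (f x, c *\<^sub>R g x) \<bullet> (f' x, c *\<^sub>R g' x) \<partial>M) = (\<integral>x. f x \<bullet> f' x + c\<^sup>2 * (g x \<bullet> g' x) \<partial>M)"
    by (simp only:)
  also have "\<dots> = (\<integral>x. f x \<bullet> f' x \<partial>M) + c\<^sup>2 * (\<integral>x. g x \<bullet> g' x \<partial>M)"
    using L2_inner_bound(1)[OF assms(1,2)] L2_inner_bound(1)[OF assms(3,4)] by simp
  finally show ?thesis .
qed

text \<open>The open time interval is exhausted by \<open>{T / (n + 3)..T - T / (n + 3)}\<close>; the offset \<open>3\<close> makes all of
  these intervals nondegenerate.\<close>

lemma interval_exhaustion:
  fixes T :: real
  assumes "0 < s" "t < T" "0 < T"
  obtains n :: nat where "T / (real n + 3) < s" "t < T - T / (real n + 3)"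
proof -
  define m where "m = min s (T - t)"
  have m: "m > 0" unfolding m_def using assms by simp
  obtain n :: nat where "T / m < real n" using reals_Archimedean2 by blast
  then have "T / m < real n + 3" by simp
  then have "T / (real n + 3) < m" using m assms by (simp add: field_simps)
  then show ?thesis using that[of n] unfolding m_def by simp
qed

lemma trace_Lp_mem:
  fixes G :: "'a \<Rightarrow> real ^ 'd ^ 'd"
  assumes G: "Lp_mem 2 M G"
  shows "Lp_mem 2 M (\<lambda>x. trace (G x))"
proof -
  have m: "G \<in> borel_measurable M" and i: "integrable M (\<lambda>x. (norm (G x))\<^sup>2)" using G unfolding Lp_mem_2 by auto
  have b: "norm (trace A) \<le> real CARD('d) * norm A" for A :: "real ^ 'd ^ 'd"
  proof -
    have "norm (trace A) \<le> (\<Sum>i\<in>UNIV. norm (A $ i $ i))" unfolding trace_def by (rule norm_sum)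
    also have "\<dots> \<le> (\<Sum>i\<in>(UNIV::'d set). norm A)"
    proof (rule sum_mono)
      fix i
      have "norm (A $ i $ i) \<le> norm (A $ i)" by (rule component_le_norm_cart[unfolded real_norm_def[symmetric]])
      also have "\<dots> \<le> norm A" by (rule Finite_Cartesian_Product.norm_nth_le)
      finally show "norm (A $ i $ i) \<le> norm A" .
    qed
    finally show ?thesis by simp
  qed
  have "continuous_on UNIV (\<lambda>A :: real ^ 'd ^ 'd. trace A)" unfolding trace_def by (intro continuous_intros)
  then have "(\<lambda>A :: real ^ 'd ^ 'd. trace A) \<in> borel_measurable borel" by (rule borel_measurable_continuous_onI)
  from measurable_compose[OF m this] have mt: "(\<lambda>x. trace (G x)) \<in> borel_measurable M" .
  have "integrable M (\<lambda>x. (norm (trace (G x)))\<^sup>2)"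
  proof (rule Bochner_Integration.integrable_bound)
    show "integrable M (\<lambda>x. (real CARD('d))\<^sup>2 * (norm (G x))\<^sup>2)" using i by simp
    show "AE x in M. norm ((norm (trace (G x)))\<^sup>2) \<le> norm ((real CARD('d))\<^sup>2 * (norm (G x))\<^sup>2)"
    proof (rule AE_I2)
      fix x
      have "(norm (trace (G x)))\<^sup>2 \<le> (real CARD('d) * norm (G x))\<^sup>2" using b by (intro power_mono) auto
      then show "norm ((norm (trace (G x)))\<^sup>2) \<le> norm ((real CARD('d))\<^sup>2 * (norm (G x))\<^sup>2)"
        by (simp add: power_mult_distrib)
    qed
  qed (use mt in measurable)
  then show ?thesis unfolding Lp_mem_2 using mt by simp
qed

lemma weak_incompressible_diff:
  fixes \<Omega> :: "(real ^ 'd) set"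
  assumes \<Omega>: "open \<Omega>" and G: "weak_incompressible \<Omega> G" "weak_incompressible \<Omega> H"
    and m: "Lp_mem 2 (restrict_space lborel \<Omega>) G" "Lp_mem 2 (restrict_space lborel \<Omega>) H"
  shows "weak_incompressible \<Omega> (\<lambda>x. G x - H x)"
  unfolding weak_incompressible_def
proof
  have mO: "\<Omega> \<in> sets lborel" using \<Omega> by simp
  fix q assume q: "q \<in> pressure_space \<Omega>"
  have ql: "Lp_mem 2 (restrict_space lborel \<Omega>) q" using q unfolding pressure_space_def in_Lp_iff[OF mO] by simp
  have "L2_inner \<Omega> q (\<lambda>x. trace (G x - H x)) = L2_inner \<Omega> q (\<lambda>x. trace (G x)) - L2_inner \<Omega> q (\<lambda>x. trace (H x))"
    unfolding L2_inner_eq[OF mO] trace_sub inner_diff_right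
    by (rule Bochner_Integration.integral_diff[OF L2_inner_bound(1)[OF ql trace_Lp_mem[OF m(1)]] L2_inner_bound(1)[OF ql trace_Lp_mem[OF m(2)]]])
  then show "L2_inner \<Omega> q (\<lambda>x. trace (G x - H x)) = 0" using G q unfolding weak_incompressible_def by simp
qed

lemma L1_L2_integrable:
  assumes J: "J \<in> sets lborel" "\<Omega> \<in> sets lborel" and u: "in_Lr_Lq 1 2 J \<Omega> u"
  shows "integrable (restrict_space lborel J) (\<lambda>t. Lp_seminorm 2 (restrict_space lborel \<Omega>) (u t))"
proof -
  have "Lp_mem 1 (restrict_space lborel J) (\<lambda>t. Lp_seminorm 2 (restrict_space lborel \<Omega>) (u t))"
    using u unfolding in_Lr_Lq_iff[OF J] by simp
  then show ?thesis unfolding Lp_mem_def by (simp add: abs_of_nonneg[OF Lp_seminorm_nonneg])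
qed

lemma time_deriv_weak:
  fixes \<Omega> :: "(real ^ 'd) set"
  assumes \<Omega>: "open \<Omega>" "bounded \<Omega>" and vc: "velocity_class T \<Omega> w G" and td: "has_time_deriv T \<Omega> w wt Gt"
    and ab: "0 < a" "a < b" "b < T"
  shows "weak_time_deriv a b {0<..<T} \<Omega> w wt" "weak_time_deriv a b {0<..<T} \<Omega> G Gt"
proof -
  let ?T = "restrict_space lborel {a..b}" and ?S = "restrict_space lborel \<Omega>"
  have m: "{a..b} \<in> sets lborel" "\<Omega> \<in> sets lborel" "{0<..<T} \<in> sets lborel" using \<Omega> by auto
  have sub: "{a..b} \<subseteq> {0<..<T}" using ab by auto
  have fin: "finite_measure ?S" "finite_measure ?T"
    using finite_measure_restrict_lborel[OF m(2) \<Omega>(2)] finite_measure_restrict_lborel[OF m(1) bounded_closed_interval] by auto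
  have AEsub: "AE t in ?T. P t" if "AE t\<in>{0<..<T} in lborel. P t" for P
    unfolding AE_restrict_iff[OF m(1)] using that by eventually_elim (use sub in auto)
  have Linf: "integrable (?T \<Otimes>\<^sub>M ?S) (\<lambda>(t, x). g t x)" if g: "in_Linf_Lq 2 {0<..<T} \<Omega> g" for g :: "real \<Rightarrow> real ^ 'd \<Rightarrow> 'c::euclidean_space"
  proof -
    obtain C where "AE t\<in>{0<..<T} in lborel. Lp_norm 2 \<Omega> (g t) \<le> C" using g unfolding in_Linf_Lq_def by blast
    from AEsub[OF this] have "AE t in ?T. Lp_seminorm 2 ?S (g t) \<le> C" unfolding Lp_norm_eq[OF m(2)] .
    moreover have "bochner_measurable {a..b} \<Omega> 2 g"
      using g unfolding in_Linf_Lq_def by (intro bochner_measurable_subset[OF m(3) m(1) m(2) sub]) auto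
    ultimately show ?thesis
      by (intro bochner_integrable[OF m(1,2) fin(1), where B="\<lambda>_. C"]) (simp_all add: finite_measure.integrable_const[OF fin(2)])
  qed
  have L1: "integrable (?T \<Otimes>\<^sub>M ?S) (\<lambda>(t, x). g t x)" if g: "in_Lr_Lq 1 2 {a..b} \<Omega> g" for g :: "real \<Rightarrow> real ^ 'd \<Rightarrow> 'c::euclidean_space"
    using g by (intro bochner_integrable[OF m(1,2) fin(1) _ L1_L2_integrable[OF m(1,2) g]]) (auto simp: in_Lr_Lq_def)
  have i: "integrable (?T \<Otimes>\<^sub>M ?S) (\<lambda>(t, x). w t x)" "integrable (?T \<Otimes>\<^sub>M ?S) (\<lambda>(t, x). G t x)"
    using vc unfolding velocity_class_def by (simp_all add: Linf)
  have j: "integrable (?T \<Otimes>\<^sub>M ?S) (\<lambda>(t, x). wt t x)" "integrable (?T \<Otimes>\<^sub>M ?S) (\<lambda>(t, x). Gt t x)"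
    using td ab unfolding has_time_deriv_def by (simp_all add: L1)
  show 1: "weak_time_deriv a b {0<..<T} \<Omega> w wt"
  proof (rule has_weak_deriv_imp_weak_time_deriv[OF _ \<Omega>(1) sub])
    show "has_weak_deriv ({0<..<T} \<times> \<Omega>) (1, 0) (\<lambda>(t, x). w t x) (\<lambda>(t, x). wt t x)" using td unfolding has_time_deriv_def by simp
  qed (fact i(1) j(1))+
  show "weak_time_deriv a b {0<..<T} \<Omega> G Gt"
  proof (rule weak_time_deriv_gradient[OF \<Omega>(1) 1])
    show "AE t in ?T. has_weak_gradient \<Omega> (w t) (G t)" "AE t in ?T. has_weak_gradient \<Omega> (wt t) (Gt t)"
      using vc td unfolding velocity_class_def has_time_deriv_def has_spatial_gradient_def by (auto intro: AEsub)
  qed (fact i(2) j(2))+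
qed

lemma time_deriv_Lp_mem:
  fixes \<Omega> :: "(real ^ 'd) set"
  assumes \<Omega>: "open \<Omega>" and T: "0 < T" and td: "has_time_deriv T \<Omega> w wt Gt"
  shows "AE t\<in>{0<..<T} in lborel. Lp_mem 2 (restrict_space lborel \<Omega>) (wt t) \<and> Lp_mem 2 (restrict_space lborel \<Omega>) (Gt t)"
proof -
  have m: "\<Omega> \<in> sets lborel" using \<Omega> by simp
  let ?a = "\<lambda>n::nat. T / (real n + 3)"
  have "AE t in lborel. t \<in> {?a n..T - ?a n} \<longrightarrow> in_Lp 2 \<Omega> (wt t) \<and> in_Lp 2 \<Omega> (Gt t)" for n
  proof -
    have "2 * T / (real n + 3) < T" using T by (simp add: field_simps add_pos_nonneg)
    then have "0 < ?a n \<and> ?a n < T - ?a n \<and> T - ?a n < T" using T by auto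
    then have "in_Lr_Lq 1 2 {?a n..T - ?a n} \<Omega> wt" "in_Lr_Lq 1 2 {?a n..T - ?a n} \<Omega> Gt"
      using td unfolding has_time_deriv_def by blast+
    then have "AE t in lborel. t \<in> {?a n..T - ?a n} \<longrightarrow> in_Lp 2 \<Omega> (wt t)" "AE t in lborel. t \<in> {?a n..T - ?a n} \<longrightarrow> in_Lp 2 \<Omega> (Gt t)"
      unfolding in_Lr_Lq_def bochner_measurable_def by auto
    then show ?thesis by eventually_elim auto
  qed
  then have "AE t in lborel. \<forall>n. t \<in> {?a n..T - ?a n} \<longrightarrow> in_Lp 2 \<Omega> (wt t) \<and> in_Lp 2 \<Omega> (Gt t)"
    by (subst AE_all_countable) auto
  then show ?thesis
  proof eventually_elim
    case (elim t)
    show ?case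
    proof
      assume t: "t \<in> {0<..<T}"
      then obtain n :: nat where "?a n < t" "t < T - ?a n" using interval_exhaustion[of t t T] T by auto
      then show "Lp_mem 2 (restrict_space lborel \<Omega>) (wt t) \<and> Lp_mem 2 (restrict_space lborel \<Omega>) (Gt t)"
        using elim[rule_format, of n] unfolding in_Lp_iff[OF m] by simp
    qed
  qed
qed

text \<open>The integrability assumption is made for some gradient of \<open>w\<close>, the estimates use the gradient
  that comes with the weak form; they agree almost everywhere.\<close>

lemma gradient_cube_integrable:
  fixes \<Omega> :: "(real ^ 'd) set"
  assumes \<Omega>: "open \<Omega>" and vc: "velocity_class T \<Omega> w H"
    and G: "has_spatial_gradient {0<..<T} \<Omega> w G" "in_Lr_Lq 3 3 {0<..<T} \<Omega> G"
  shows "set_integrable lborel {0<..<T} (\<lambda>t. Lp_seminorm 3 (restrict_space lborel \<Omega>) (H t) ^ 3)"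
proof -
  let ?T = "restrict_space lborel {0<..<T}" and ?S = "restrict_space lborel \<Omega>"
  have m: "{0<..<T} \<in> sets lborel" "\<Omega> \<in> sets lborel" using \<Omega> by auto
  have meas: "(\<lambda>t. Lp_seminorm 3 ?S (H t)) \<in> borel_measurable ?T"
    using vc unfolding velocity_class_def in_Lr_Lq_iff[OF m] Lp_mem_def by auto
  have iG: "integrable ?T (\<lambda>t. Lp_seminorm 3 ?S (G t) ^ 3)"
    using G(2) unfolding in_Lr_Lq_iff[OF m] Lp_mem_3 by (simp add: abs_of_nonneg[OF Lp_seminorm_nonneg])
  have "AE t\<in>{0<..<T} in lborel. has_weak_gradient \<Omega> (w t) (H t)" "AE t\<in>{0<..<T} in lborel. has_weak_gradient \<Omega> (w t) (G t)"
    "AE t\<in>{0<..<T} in lborel. in_Lp 3 \<Omega> (H t)" "AE t\<in>{0<..<T} in lborel. in_Lp 3 \<Omega> (G t)"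
    using vc G unfolding velocity_class_def has_spatial_gradient_def in_Lr_Lq_def bochner_measurable_def by auto
  then have "AE t\<in>{0<..<T} in lborel. Lp_seminorm 3 ?S (G t) ^ 3 = Lp_seminorm 3 ?S (H t) ^ 3"
  proof eventually_elim
    case (elim t)
    show ?case
    proof
      assume t: "t \<in> {0<..<T}"
      have "AE x in ?S. G t x = H t x"
        unfolding AE_restrict_iff[OF m(2)] using elim t by (intro has_weak_gradient_unique[OF \<Omega>]) auto
      then have ae: "AE x in ?S. norm (G t x) powr 3 = norm (H t x) powr 3" by eventually_elim simp
      have "(\<integral>x. norm (G t x) powr 3 \<partial>?S) = (\<integral>x. norm (H t x) powr 3 \<partial>?S)"
        by (rule integral_cong_AE[OF _ _ ae]) (use elim t in \<open>auto simp: in_Lp_iff[OF m(2)] Lp_mem_def\<close>)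
      then show "Lp_seminorm 3 ?S (G t) ^ 3 = Lp_seminorm 3 ?S (H t) ^ 3" unfolding Lp_seminorm_def by simp
    qed
  qed
  then have ae: "AE t in ?T. Lp_seminorm 3 ?S (G t) ^ 3 = Lp_seminorm 3 ?S (H t) ^ 3" unfolding AE_restrict_iff[OF m(1)] .
  have "integrable ?T (\<lambda>t. Lp_seminorm 3 ?S (H t) ^ 3)"
    by (rule integrable_cong_AE_imp[OF iG _ ae]) (use meas in measurable)
  then show ?thesis unfolding integral_restrict_lborel_self(2)[OF m(1)] .
qed

text \<open>On a short interval \<open>{0<..<h}\<close> some value of \<open>g\<close> is nearly as small as its mean, and \<open>h\<close> times the
  mean is the integral of \<open>g\<close>, which is small.\<close>

lemma vanishing_times:
  fixes g :: "real \<Rightarrow> real"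
  assumes T: "T > 0" and g: "set_integrable lborel {0<..<T} g" "\<And>t. g t \<ge> 0"
    and N: "N \<in> null_sets lborel" and \<epsilon>: "\<epsilon> > 0" and h: "h > 0"
  shows "\<exists>t. 0 < t \<and> t < h \<and> t < T \<and> t \<notin> N \<and> (LINT \<tau>:{0<..<t}|lborel. g \<tau>) + t * g t < \<epsilon>"
proof -
  define k where "k t = indicator {0<..<T} t * g t" for t
  have k: "integrable lborel k" "\<And>t. k t \<ge> 0" using g unfolding k_def set_integrable_def by auto
  have ki: "set_integrable lborel A k" if "A \<in> sets lborel" for A
    unfolding set_integrable_def by (rule integrable_mult_indicator[OF that k(1)])
  define A where "A t = (LINT \<tau>:{0..t}|lborel. k \<tau>)" for t
  have cont: "continuous_on {0..T} A" unfolding A_def by (rule continuous_indefinite_integral) (rule ki, simp)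
  have A0: "A 0 = 0"
  proof -
    have "AE \<tau> in lborel. indicator {0..0} \<tau> *\<^sub>R k \<tau> = 0"
      using AE_lborel_singleton[of 0] by eventually_elim (simp add: indicator_def)
    then show ?thesis unfolding A_def set_lebesgue_integral_def by (rule integral_eq_zero_AE)
  qed
  obtain \<delta> where \<delta>: "\<delta> > 0" "\<And>x. x \<in> {0..T} \<Longrightarrow> dist x 0 < \<delta> \<Longrightarrow> dist (A x) (A 0) < \<epsilon> / 3"
    using cont[unfolded continuous_on_iff, rule_format, of 0 "\<epsilon> / 3"] T \<epsilon> by auto
  define h' where "h' = min (\<delta> / 2) (min h (T / 2))"
  have h': "0 < h'" "h' < \<delta>" "h' \<le> h" "h' < T" unfolding h'_def using \<delta>(1) h T by (auto simp: min_def)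
  have Ah: "A h' < \<epsilon> / 3" using \<delta>(2)[of h'] h' unfolding A0 by (simp add: dist_real_def)
  have "\<exists>t. 0 < t \<and> t < h' \<and> t \<notin> N \<and> h' * g t \<le> A h' + \<epsilon> / 3"
  proof (rule ccontr)
    assume "\<nexists>t. 0 < t \<and> t < h' \<and> t \<notin> N \<and> h' * g t \<le> A h' + \<epsilon> / 3"
    then have big: "(A h' + \<epsilon> / 3) / h' \<le> g t" if "0 < t" "t < h'" "t \<notin> N" for t
      using that h'(1) by (force simp: field_simps)
    have "(LINT \<tau>:{0..h'}|lborel. (A h' + \<epsilon> / 3) / h') \<le> (LINT \<tau>:{0..h'}|lborel. k \<tau>)"
    proof (rule set_integral_mono_AE)
      show "set_integrable lborel {0..h'} (\<lambda>\<tau>. (A h' + \<epsilon> / 3) / h')" by (rule borel_integrable_atLeastAtMost') simp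
      show "set_integrable lborel {0..h'} k" by (rule ki) simp
      show "AE \<tau>\<in>{0..h'} in lborel. (A h' + \<epsilon> / 3) / h' \<le> k \<tau>"
        using null_set_AE[OF N] AE_lborel_singleton[of 0] AE_lborel_singleton[of h']
      proof eventually_elim
        case (elim \<tau>)
        show ?case
        proof
          assume "\<tau> \<in> {0..h'}"
          then have \<tau>: "0 < \<tau>" "\<tau> < h'" "\<tau> < T" using elim h' by auto
          then show "(A h' + \<epsilon> / 3) / h' \<le> k \<tau>" using big[of \<tau>] elim unfolding k_def by simp
        qed
      qed
    qed
    moreover have "(LINT \<tau>:{0..h'}|lborel. (A h' + \<epsilon> / 3) / h') = A h' + \<epsilon> / 3"
      unfolding set_lebesgue_integral_def using h'(1) by simp
    ultimately show False using \<epsilon> unfolding A_def by linarith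
  qed
  then obtain t where t: "0 < t" "t < h'" "t \<notin> N" "h' * g t \<le> A h' + \<epsilon> / 3" by blast
  have "t * g t \<le> h' * g t" using t g(2) by (intro mult_right_mono) auto
  moreover have "(LINT \<tau>:{0<..<t}|lborel. g \<tau>) \<le> A h'"
    unfolding A_def set_lebesgue_integral_def
  proof (rule integral_mono)
    show "integrable lborel (\<lambda>\<tau>. indicator {0<..<t} \<tau> *\<^sub>R g \<tau>)"
    proof -
      have "{0<..<t} \<subseteq> {0<..<T}" using t h' by auto
      then show ?thesis using set_integrable_subset[OF g(1), of "{0<..<t}"] unfolding set_integrable_def by simp
    qed
    show "integrable lborel (\<lambda>\<tau>. indicator {0..h'} \<tau> *\<^sub>R k \<tau>)" using ki[of "{0..h'}"] unfolding set_integrable_def by simp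
    show "indicator {0<..<t} \<tau> *\<^sub>R g \<tau> \<le> indicator {0..h'} \<tau> *\<^sub>R k \<tau>" for \<tau>
      using t h' g(2)[of \<tau>] unfolding k_def by (auto simp: indicator_def)
  qed
  ultimately have "(LINT \<tau>:{0<..<t}|lborel. g \<tau>) + t * g t < \<epsilon>" using t(4) Ah by linarith
  then show ?thesis using t h' by (intro exI[of _ t]) auto
qed

text \<open>Two solutions with all the data that the notion of a strong solution asserts to exist: \<open>H1\<close>, \<open>H2\<close> are
  the gradients, \<open>wt1\<close>, \<open>wt2\<close>, \<open>Gt1\<close>, \<open>Gt2\<close> the time derivatives.\<close>

locale two_solutions =
  fixes \<Omega> :: "(real ^ 'd) set" and \<nu> Cs \<delta> \<mu> T :: real and f w0 :: "real ^ 'd \<Rightarrow> real ^ 'd"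
    and w1 w2 wt1 wt2 :: "real \<Rightarrow> real ^ 'd \<Rightarrow> real ^ 'd" and H1 H2 Gt1 Gt2 :: "real \<Rightarrow> real ^ 'd \<Rightarrow> real ^ 'd ^ 'd"
    and p1 p2 :: "real \<Rightarrow> real ^ 'd \<Rightarrow> real"
  assumes dim: "CARD('d) = 2 \<or> CARD('d) = 3" and domain: "open \<Omega>" "bounded \<Omega>"
    and constants: "0 < \<nu>" "0 < Cs" "0 < \<delta>" "0 < \<mu>" "0 < T"
    and classes: "velocity_class T \<Omega> w1 H1" "velocity_class T \<Omega> w2 H2"
    and derivs: "has_time_deriv T \<Omega> w1 wt1 Gt1" "has_time_deriv T \<Omega> w2 wt2 Gt2"
    and pressures: "AE t\<in>{0<..<T} in lborel. p1 t \<in> pressure_space \<Omega>" "AE t\<in>{0<..<T} in lborel. p2 t \<in> pressure_space \<Omega>"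
    and incompressible: "AE t\<in>{0<..<T} in lborel. weak_incompressible \<Omega> (H1 t)" "AE t\<in>{0<..<T} in lborel. weak_incompressible \<Omega> (H2 t)"
    and momentum: "\<And>v H. velocity_class T \<Omega> v H \<Longrightarrow> AE t\<in>{0<..<T} in lborel.
        weak_momentum \<nu> Cs \<delta> \<mu> \<Omega> f (w1 t) (H1 t) (wt1 t) (Gt1 t) (p1 t) (v t) (H t)"
      "\<And>v H. velocity_class T \<Omega> v H \<Longrightarrow> AE t\<in>{0<..<T} in lborel.
        weak_momentum \<nu> Cs \<delta> \<mu> \<Omega> f (w2 t) (H2 t) (wt2 t) (Gt2 t) (p2 t) (v t) (H t)"
    and initial_mem: "in_Lp 2 \<Omega> w0"
    and initial: "\<And>\<epsilon>. 0 < \<epsilon> \<Longrightarrow> \<exists>\<eta>>0. AE t\<in>{0<..<\<eta>} in lborel. Lp_norm 2 \<Omega> (\<lambda>x. w1 t x - w0 x) < \<epsilon>"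
      "\<And>\<epsilon>. 0 < \<epsilon> \<Longrightarrow> \<exists>\<eta>>0. AE t\<in>{0<..<\<eta>} in lborel. Lp_norm 2 \<Omega> (\<lambda>x. w2 t x - w0 x) < \<epsilon>"
    and cubes: "set_integrable lborel {0<..<T} (\<lambda>t. Lp_seminorm 3 (restrict_space lborel \<Omega>) (H1 t) ^ 3)"
      "set_integrable lborel {0<..<T} (\<lambda>t. Lp_seminorm 3 (restrict_space lborel \<Omega>) (H2 t) ^ 3)"
begin

abbreviation "S \<equiv> restrict_space lborel \<Omega>"
abbreviation "\<phi> t x \<equiv> w1 t x - w2 t x"
abbreviation "\<Gamma> t x \<equiv> H1 t x - H2 t x"
definition "\<kappa> = Cs ^ 4 / \<mu>\<^sup>2 * \<delta>\<^sup>2"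
text \<open>The coefficient $\sqrt\kappa$ makes $(z, u)$ in $L^2$ equal to
  $(\phi_t, \phi) + \kappa (\nabla\phi_t, \nabla\phi)$.\<close>

definition "u t x = (\<phi> t x, sqrt \<kappa> *\<^sub>R \<Gamma> t x)"
definition "z t x = (wt1 t x - wt2 t x, sqrt \<kappa> *\<^sub>R (Gt1 t x - Gt2 t x))"
definition "E t = (Lp_seminorm 2 S (u t))\<^sup>2"

text \<open>Everything that is needed at a single time.  Only the difference itself occurs as a test field:
  the exceptional null set of the momentum equation depends on the test field, so almost every time is good for this
  field but not for all fields at once.\<close>

definition good :: "real \<Rightarrow> real \<Rightarrow> bool" where
  "good K t \<longleftrightarrow> velocity_fields S (w1 t) (H1 t) \<and> velocity_fields S (w2 t) (H2 t)
     \<and> Lp_mem 2 S (wt1 t) \<and> Lp_mem 2 S (Gt1 t) \<and> Lp_mem 2 S (wt2 t) \<and> Lp_mem 2 S (Gt2 t)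
     \<and> W0 3 \<Omega> (\<phi> t) (\<Gamma> t) \<and> p1 t \<in> pressure_space \<Omega> \<and> p2 t \<in> pressure_space \<Omega> \<and> weak_incompressible \<Omega> (\<Gamma> t)
     \<and> Lp_seminorm 2 S (w1 t) \<le> K \<and> Lp_seminorm 2 S (w2 t) \<le> K \<and> Lp_seminorm 2 S (H1 t) \<le> K \<and> Lp_seminorm 2 S (H2 t) \<le> K
     \<and> weak_momentum \<nu> Cs \<delta> \<mu> \<Omega> f (w1 t) (H1 t) (wt1 t) (Gt1 t) (p1 t) (\<phi> t) (\<Gamma> t)
     \<and> weak_momentum \<nu> Cs \<delta> \<mu> \<Omega> f (w2 t) (H2 t) (wt2 t) (Gt2 t) (p2 t) (\<phi> t) (\<Gamma> t)"

lemma \<kappa>_pos: "0 < \<kappa>" unfolding \<kappa>_def using constants by simp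

lemma \<Omega>_sets: "\<Omega> \<in> sets lborel" using domain by simp

lemma finite_S: "finite_measure S" by (rule finite_measure_restrict_lborel[OF \<Omega>_sets domain(2)])

lemma good_AE: "\<exists>K\<ge>0. AE t\<in>{0<..<T} in lborel. good K t"
proof -
  have bound: "\<exists>C. AE t\<in>{0<..<T} in lborel. Lp_seminorm 2 S (g t) \<le> C" if "in_Linf_Lq 2 {0<..<T} \<Omega> g" for g :: "real \<Rightarrow> real ^ 'd \<Rightarrow> 'e::euclidean_space"
    using that unfolding in_Linf_Lq_def Lp_norm_eq[OF \<Omega>_sets] by blast
  obtain C1 where C1: "AE t\<in>{0<..<T} in lborel. Lp_seminorm 2 S (w1 t) \<le> C1" using bound[of w1] classes unfolding velocity_class_def by blast
  obtain C2 where C2: "AE t\<in>{0<..<T} in lborel. Lp_seminorm 2 S (w2 t) \<le> C2" using bound[of w2] classes unfolding velocity_class_def by blast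
  obtain C3 where C3: "AE t\<in>{0<..<T} in lborel. Lp_seminorm 2 S (H1 t) \<le> C3" using bound[of H1] classes unfolding velocity_class_def by blast
  obtain C4 where C4: "AE t\<in>{0<..<T} in lborel. Lp_seminorm 2 S (H2 t) \<le> C4" using bound[of H2] classes unfolding velocity_class_def by blast
  define K where "K = \<bar>C1\<bar> + \<bar>C2\<bar> + \<bar>C3\<bar> + \<bar>C4\<bar>"
  have vcd: "velocity_class T \<Omega> (\<lambda>t x. \<phi> t x) (\<lambda>t x. \<Gamma> t x)" by (rule velocity_class_diff[OF domain classes])
  have W: "AE t\<in>{0<..<T} in lborel. W0 3 \<Omega> (\<phi> t) (\<Gamma> t)" using vcd unfolding velocity_class_def by simp
  note fc = velocity_class_imp_fields[OF domain(1) classes(1)] velocity_class_imp_fields[OF domain(1) classes(2)]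
  note td = time_deriv_Lp_mem[OF domain(1) constants(5) derivs(1)] time_deriv_Lp_mem[OF domain(1) constants(5) derivs(2)]
  note mo = momentum(1)[OF vcd] momentum(2)[OF vcd]
  have "AE t\<in>{0<..<T} in lborel. good K t"
    using C1 C2 C3 C4 W fc td mo pressures incompressible
  proof eventually_elim
    case (elim t)
    show ?case
    proof
      assume t: "t \<in> {0<..<T}"
      have "weak_incompressible \<Omega> (\<Gamma> t)"
        using elim t by (intro weak_incompressible_diff[OF domain(1)]) (auto simp: velocity_fields_def)
      then show "good K t" using elim t unfolding good_def K_def by auto
    qed
  qed
  moreover have "K \<ge> 0" unfolding K_def by simp
  ultimately show ?thesis by blast
qed

lemma weak_time_deriv_u:
  assumes "0 < a" "a < b" "b < T"
  shows "weak_time_deriv a b {0<..<T} \<Omega> u z"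
proof -
  note d1 = time_deriv_weak[OF domain classes(1) derivs(1) assms]
  note d2 = time_deriv_weak[OF domain classes(2) derivs(2) assms]
  have L: "bounded_linear (\<lambda>x :: real ^ 'd. (x, 0 :: real ^ 'd ^ 'd))" "bounded_linear (\<lambda>y :: real ^ 'd ^ 'd. (0 :: real ^ 'd, sqrt \<kappa> *\<^sub>R y))"
    by (intro bounded_linear_Pair bounded_linear_ident bounded_linear_zero bounded_linear_scaleR_right)+
  from weak_time_deriv_add[OF weak_time_deriv_linear[OF L(1) weak_time_deriv_diff[OF d1(1) d2(1)]] weak_time_deriv_linear[OF L(2) weak_time_deriv_diff[OF d1(2) d2(2)]]]
  show ?thesis unfolding u_def[abs_def] z_def[abs_def] by simp
qed

text \<open>The time derivatives are integrable on compact subintervals of the open time interval only, so the exceptional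
  null sets of an exhaustion are united.\<close>

lemma ftc_exists:
  "\<exists>N\<in>null_sets lborel. \<forall>s t. 0 < s \<and> s < t \<and> t < T \<and> s \<notin> N \<and> t \<notin> N \<longrightarrow>
     (AE x in S. u t x - u s x = (LINT \<tau>:{s..t}|lborel. z \<tau> x))"
proof -
  let ?a = "\<lambda>n::nat. T / (real n + 3)"
  have "\<exists>N\<in>null_sets lborel. \<forall>s t. ?a n < s \<and> s < t \<and> t < T - ?a n \<and> s \<notin> N \<and> t \<notin> N \<longrightarrow>
     (AE x in S. u t x - u s x = (LINT \<tau>:{s..t}|lborel. z \<tau> x))" for n
  proof -
    have "2 * T / (real n + 3) < T" using constants(5) by (simp add: field_simps add_pos_nonneg)
    then have ab: "0 < ?a n" "?a n < T - ?a n" "T - ?a n < T" using constants(5) by auto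
    note w = weak_time_deriv_u[OF ab, unfolded weak_time_deriv_def]
    show ?thesis
      by (rule space_time_FTC[OF domain(1) ab(2), of "{0<..<T}"]) (use w ab in auto)
  qed
  then have "\<forall>n. \<exists>N. N \<in> null_sets lborel \<and> (\<forall>s t. ?a n < s \<and> s < t \<and> t < T - ?a n \<and> s \<notin> N \<and> t \<notin> N \<longrightarrow>
     (AE x in S. u t x - u s x = (LINT \<tau>:{s..t}|lborel. z \<tau> x)))"
    by blast
  from choice[OF this] obtain N where N0: "\<forall>n. N n \<in> null_sets lborel \<and> (\<forall>s t. ?a n < s \<and> s < t \<and> t < T - ?a n \<and> s \<notin> N n \<and> t \<notin> N n \<longrightarrow>
     (AE x in S. u t x - u s x = (LINT \<tau>:{s..t}|lborel. z \<tau> x)))" ..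
  have N: "N n \<in> null_sets lborel"
    "?a n < s \<Longrightarrow> s < t \<Longrightarrow> t < T - ?a n \<Longrightarrow> s \<notin> N n \<Longrightarrow> t \<notin> N n \<Longrightarrow>
     (AE x in S. u t x - u s x = (LINT \<tau>:{s..t}|lborel. z \<tau> x))" for n s t
    using N0[rule_format, of n] by auto
  show ?thesis
  proof (intro bexI[of _ "\<Union>n. N n"] allI impI)
    show "(\<Union>n. N n) \<in> null_sets lborel" by (intro null_sets_UN N(1))
    fix s t assume st: "0 < s \<and> s < t \<and> t < T \<and> s \<notin> (\<Union>n. N n) \<and> t \<notin> (\<Union>n. N n)"
    then obtain n :: nat where "?a n < s" "t < T - ?a n" using interval_exhaustion[of s t T] constants(5) by auto
    then show "AE x in S. u t x - u s x = (LINT \<tau>:{s..t}|lborel. z \<tau> x)" using st by (intro N(2)[of n]) auto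
  qed
qed

lemma good_difference:
  assumes "good K t"
  shows "Lp_mem 2 S (\<phi> t)" "Lp_mem 2 S (\<Gamma> t)" "velocity_fields S (\<phi> t) (\<Gamma> t)"
    "Lp_seminorm 2 S (\<phi> t) \<le> 4 * K" "Lp_seminorm 2 S (\<Gamma> t) \<le> 4 * K"
    "Lp_mem 2 S (\<lambda>x. wt1 t x - wt2 t x)" "Lp_mem 2 S (\<lambda>x. Gt1 t x - Gt2 t x)"
proof -
  note g = assms[unfolded good_def]
  show m: "Lp_mem 2 S (\<phi> t)" "Lp_mem 2 S (\<Gamma> t)" "velocity_fields S (\<phi> t) (\<Gamma> t)"
    "Lp_mem 2 S (\<lambda>x. wt1 t x - wt2 t x)" "Lp_mem 2 S (\<lambda>x. Gt1 t x - Gt2 t x)"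
    using g unfolding velocity_fields_def by (auto intro!: Lp_mem_diff(1))
  have b: "Lp_seminorm 2 S (w1 t) \<le> K" "Lp_seminorm 2 S (w2 t) \<le> K" "Lp_seminorm 2 S (H1 t) \<le> K" "Lp_seminorm 2 S (H2 t) \<le> K"
    using g by auto
  have "Lp_seminorm 2 S (\<phi> t) \<le> 2 * (Lp_seminorm 2 S (w1 t) + Lp_seminorm 2 S (w2 t))"
    using g unfolding velocity_fields_def by (intro Lp_mem_diff(2)) auto
  also have "\<dots> \<le> 2 * (K + K)" by (intro mult_left_mono add_mono b) simp
  finally show "Lp_seminorm 2 S (\<phi> t) \<le> 4 * K" by simp
  have "Lp_seminorm 2 S (\<Gamma> t) \<le> 2 * (Lp_seminorm 2 S (H1 t) + Lp_seminorm 2 S (H2 t))"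
    using g unfolding velocity_fields_def by (intro Lp_mem_diff(2)) auto
  also have "\<dots> \<le> 2 * (K + K)" by (intro mult_left_mono add_mono b) simp
  finally show "Lp_seminorm 2 S (\<Gamma> t) \<le> 4 * K" by simp
qed

lemma good_energy:
  assumes "good K t"
  shows "Lp_mem 2 S (u t)" "Lp_mem 2 S (z t)"
    "E t = (Lp_seminorm 2 S (\<phi> t))\<^sup>2 + \<kappa> * (Lp_seminorm 2 S (\<Gamma> t))\<^sup>2"
    "E t \<le> (1 + \<kappa>) * (4 * K)\<^sup>2" "Lp_seminorm 2 S (u t) \<le> sqrt ((1 + \<kappa>) * (4 * K)\<^sup>2)"
    "Lp_seminorm 2 S (z t) \<le> Lp_seminorm 2 S (\<lambda>x. wt1 t x - wt2 t x) + sqrt \<kappa> * Lp_seminorm 2 S (\<lambda>x. Gt1 t x - Gt2 t x)"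
proof -
  note d = good_difference[OF assms]
  have k: "(sqrt \<kappa>)\<^sup>2 = \<kappa>" using \<kappa>_pos by simp
  show "Lp_mem 2 S (u t)" "Lp_mem 2 S (z t)"
    unfolding u_def[abs_def] z_def[abs_def] by (intro Lp_mem_2_Pair(1) d)+
  show E: "E t = (Lp_seminorm 2 S (\<phi> t))\<^sup>2 + \<kappa> * (Lp_seminorm 2 S (\<Gamma> t))\<^sup>2"
    unfolding E_def u_def[abs_def] Lp_mem_2_Pair(2)[OF d(1,2)] k ..
  have "(Lp_seminorm 2 S (\<phi> t))\<^sup>2 \<le> (4 * K)\<^sup>2" "(Lp_seminorm 2 S (\<Gamma> t))\<^sup>2 \<le> (4 * K)\<^sup>2"
    by (intro power_mono d Lp_seminorm_nonneg)+
  then have "E t \<le> (4 * K)\<^sup>2 + \<kappa> * (4 * K)\<^sup>2" unfolding E using \<kappa>_pos by (intro add_mono mult_left_mono) auto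
  then show E2: "E t \<le> (1 + \<kappa>) * (4 * K)\<^sup>2" by (simp only: distrib_right mult_1)
  then show "Lp_seminorm 2 S (u t) \<le> sqrt ((1 + \<kappa>) * (4 * K)\<^sup>2)" unfolding E_def by (rule real_le_rsqrt)
  have "(Lp_seminorm 2 S (z t))\<^sup>2 = (Lp_seminorm 2 S (\<lambda>x. wt1 t x - wt2 t x))\<^sup>2 + (sqrt \<kappa> * Lp_seminorm 2 S (\<lambda>x. Gt1 t x - Gt2 t x))\<^sup>2"
    unfolding z_def[abs_def] Lp_mem_2_Pair(2)[OF d(6,7)] by (simp add: power_mult_distrib)
  also have "\<dots> \<le> (Lp_seminorm 2 S (\<lambda>x. wt1 t x - wt2 t x) + sqrt \<kappa> * Lp_seminorm 2 S (\<lambda>x. Gt1 t x - Gt2 t x))\<^sup>2"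
    unfolding power2_sum using \<kappa>_pos by (simp add: Lp_seminorm_nonneg)
  finally show "Lp_seminorm 2 S (z t) \<le> Lp_seminorm 2 S (\<lambda>x. wt1 t x - wt2 t x) + sqrt \<kappa> * Lp_seminorm 2 S (\<lambda>x. Gt1 t x - Gt2 t x)"
    by (rule power2_le_imp_le) (use \<kappa>_pos in \<open>simp add: Lp_seminorm_nonneg\<close>)
qed

lemma inner_u_z:
  assumes "good K t" "good K s"
  shows "(\<integral>x. z s x \<bullet> u t x \<partial>S) = (\<integral>x. (wt1 s x - wt2 s x) \<bullet> \<phi> t x \<partial>S) + \<kappa> * (\<integral>x. (Gt1 s x - Gt2 s x) \<bullet> \<Gamma> t x \<partial>S)"
    and "(\<integral>x. u s x \<bullet> u t x \<partial>S) = (\<integral>x. \<phi> s x \<bullet> \<phi> t x \<partial>S) + \<kappa> * (\<integral>x. \<Gamma> s x \<bullet> \<Gamma> t x \<partial>S)"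
proof -
  note d = good_difference[OF assms(1)] and e = good_difference[OF assms(2)]
  have k: "(sqrt \<kappa>)\<^sup>2 = \<kappa>" using \<kappa>_pos by simp
  show "(\<integral>x. z s x \<bullet> u t x \<partial>S) = (\<integral>x. (wt1 s x - wt2 s x) \<bullet> \<phi> t x \<partial>S) + \<kappa> * (\<integral>x. (Gt1 s x - Gt2 s x) \<bullet> \<Gamma> t x \<partial>S)"
    unfolding u_def z_def integral_inner_Pair[OF e(6) d(1) e(7) d(2)] k ..
  show "(\<integral>x. u s x \<bullet> u t x \<partial>S) = (\<integral>x. \<phi> s x \<bullet> \<phi> t x \<partial>S) + \<kappa> * (\<integral>x. \<Gamma> s x \<bullet> \<Gamma> t x \<partial>S)"
    unfolding u_def integral_inner_Pair[OF e(1) d(1) e(2) d(2)] k ..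
qed

text \<open>The Gronwall coefficient; $1 + 1/\kappa$ compares $\|\phi\|^2 + \|\nabla\phi\|^2$ with the energy.\<close>

definition "\<alpha> t = 16 * (1 + 1 / \<kappa>) * (Lp_seminorm 6 S (w1 t) + Lp_seminorm 3 S (H2 t))"

lemma \<alpha>_nonneg: "0 \<le> \<alpha> t"
  unfolding \<alpha>_def using \<kappa>_pos by (intro mult_nonneg_nonneg add_nonneg_nonneg Lp_seminorm_nonneg) auto

lemma energy_rate:
  assumes g: "good K t"
  shows "(\<integral>x. z t x \<bullet> u t x \<partial>S) \<le> \<alpha> t * E t"
proof -
  let ?a = "(Lp_seminorm 2 S (\<phi> t))\<^sup>2" and ?b = "(Lp_seminorm 2 S (\<Gamma> t))\<^sup>2" and ?w = "Lp_seminorm 6 S (w1 t) + Lp_seminorm 3 S (H2 t)"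
  have "(\<integral>x. z t x \<bullet> u t x \<partial>S) \<le> 16 * ?w * (?a + ?b)"
    unfolding inner_u_z(1)[OF g g] \<kappa>_def
    by (rule difference_energy_bound[OF dim domain, where \<nu>=\<nu> and f=f and ?p1.0="p1 t" and ?p2.0="p2 t"]) (use g constants in \<open>auto simp: good_def\<close>)
  also have "\<dots> \<le> 16 * ?w * ((1 + 1 / \<kappa>) * E t)"
  proof (rule mult_left_mono)
    have "(1 + 1 / \<kappa>) * E t = ?a + ?b + (?a / \<kappa> + \<kappa> * ?b)"
      unfolding good_energy(3)[OF g] using \<kappa>_pos by (simp add: field_simps)
    moreover have "0 \<le> ?a / \<kappa> + \<kappa> * ?b" using \<kappa>_pos by simp
    ultimately show "?a + ?b \<le> (1 + 1 / \<kappa>) * E t" by linarith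
  qed (simp add: Lp_seminorm_nonneg)
  also have "\<dots> = \<alpha> t * E t" unfolding \<alpha>_def by (simp only: mult.assoc mult.commute mult.left_commute)
  finally show ?thesis .
qed

text \<open>An integrable bound for the action of \<open>z\<close> at time \<open>t\<close> on a difference frozen at another time, up to the cube of the
  gradient of the frozen field.  The cubes in \<open>R\<close> are integrable because the gradients lie in $L^3$ of space-time.\<close>

definition "R K t = K * (Lp_seminorm 6 S (w1 t) + Lp_seminorm 6 S (w2 t)) * (4 * sqrt ((4 * K)\<^sup>2 + (4 * K)\<^sup>2))
   + \<nu> * (2 * (K + K) * (4 * K)) + (Cs * \<delta>)\<^sup>2 * (Lp_seminorm 3 S (H1 t) ^ 3 + Lp_seminorm 3 S (H2 t) ^ 3)"

lemma test_rate:
  assumes g: "good K \<tau>" "good K t" and K: "0 \<le> K"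
    and m: "weak_momentum \<nu> Cs \<delta> \<mu> \<Omega> f (w1 \<tau>) (H1 \<tau>) (wt1 \<tau>) (Gt1 \<tau>) (p1 \<tau>) (\<phi> t) (\<Gamma> t)"
      "weak_momentum \<nu> Cs \<delta> \<mu> \<Omega> f (w2 \<tau>) (H2 \<tau>) (wt2 \<tau>) (Gt2 \<tau>) (p2 \<tau>) (\<phi> t) (\<Gamma> t)"
  shows "(\<integral>x. z \<tau> x \<bullet> u t x \<partial>S) \<le> R K \<tau> + 2 * (Cs * \<delta>)\<^sup>2 * Lp_seminorm 3 S (\<Gamma> t) ^ 3"
proof -
  note d = good_difference[OF g(2)] and gd = g(1)[unfolded good_def] g(2)[unfolded good_def]
  have lad: "Lp_seminorm 3 S (\<phi> t) \<le> 4 * sqrt ((4 * K)\<^sup>2 + (4 * K)\<^sup>2)"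
  proof -
    have "Lp_seminorm 3 S (\<phi> t) \<le> 4 * sqrt ((Lp_seminorm 2 S (\<phi> t))\<^sup>2 + (Lp_seminorm 2 S (\<Gamma> t))\<^sup>2)"
      by (rule Ladyzhenskaya[OF dim domain]) (use gd in auto)
    also have "\<dots> \<le> 4 * sqrt ((4 * K)\<^sup>2 + (4 * K)\<^sup>2)"
      by (intro mult_left_mono real_sqrt_le_mono add_mono power_mono d Lp_seminorm_nonneg) auto
    finally show ?thesis .
  qed
  have "(\<integral>x. z \<tau> x \<bullet> u t x \<partial>S)
     \<le> (Lp_seminorm 2 S (H1 \<tau>) * Lp_seminorm 6 S (w1 \<tau>) + Lp_seminorm 2 S (H2 \<tau>) * Lp_seminorm 6 S (w2 \<tau>)) * Lp_seminorm 3 S (\<phi> t)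
       + \<nu> * (2 * (Lp_seminorm 2 S (H1 \<tau>) + Lp_seminorm 2 S (H2 \<tau>)) * Lp_seminorm 2 S (\<Gamma> t))
       + (Cs * \<delta>)\<^sup>2 * (Lp_seminorm 3 S (H1 \<tau>) ^ 3 + Lp_seminorm 3 S (H2 \<tau>) ^ 3 + 2 * Lp_seminorm 3 S (\<Gamma> t) ^ 3)"
    unfolding inner_u_z(1)[OF g(2,1)] \<kappa>_def
    by (rule difference_functional_bound[OF domain(1), where f=f and ?p1.0="p1 \<tau>" and ?p2.0="p2 \<tau>"]) (use gd d(3) constants m in auto)
  also have "\<dots> \<le> (K * Lp_seminorm 6 S (w1 \<tau>) + K * Lp_seminorm 6 S (w2 \<tau>)) * (4 * sqrt ((4 * K)\<^sup>2 + (4 * K)\<^sup>2))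
       + \<nu> * (2 * (K + K) * (4 * K))
       + (Cs * \<delta>)\<^sup>2 * (Lp_seminorm 3 S (H1 \<tau>) ^ 3 + Lp_seminorm 3 S (H2 \<tau>) ^ 3 + 2 * Lp_seminorm 3 S (\<Gamma> t) ^ 3)"
    using gd K constants by (intro add_mono mult_mono lad d(5) order_refl add_nonneg_nonneg mult_nonneg_nonneg Lp_seminorm_nonneg) auto
  also have "\<dots> = R K \<tau> + 2 * (Cs * \<delta>)\<^sup>2 * Lp_seminorm 3 S (\<Gamma> t) ^ 3"
    unfolding R_def by (simp only: distrib_left distrib_right mult.assoc mult.left_commute[of "(Cs * \<delta>)\<^sup>2" 2] add.assoc)
  finally show ?thesis .
qed

lemma norms_integrable:
  "set_integrable lborel {0<..<T} (\<lambda>t. Lp_seminorm 6 S (w1 t))" "set_integrable lborel {0<..<T} (\<lambda>t. Lp_seminorm 6 S (w2 t))"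
  "set_integrable lborel {0<..<T} (\<lambda>t. Lp_seminorm 3 S (H2 t))"
proof -
  have m: "{0<..<T} \<in> sets lborel" by simp
  have fin: "finite_measure (restrict_space lborel {0<..<T})" by (rule finite_measure_restrict_lborel[OF m bounded_subset[OF bounded_closed_interval[of 0 T]]]) auto
  have *: "set_integrable lborel {0<..<T} (\<lambda>t. Lp_seminorm q S (g t))" if "in_Lr_Lq 2 q {0<..<T} \<Omega> g" for q and g :: "real \<Rightarrow> real ^ 'd \<Rightarrow> 'e::euclidean_space"
  proof -
    have "Lp_mem 2 (restrict_space lborel {0<..<T}) (\<lambda>t. Lp_seminorm q S (g t))" using that unfolding in_Lr_Lq_iff[OF m \<Omega>_sets] by simp
    then have "Lp_mem 1 (restrict_space lborel {0<..<T}) (\<lambda>t. Lp_seminorm q S (g t))" by (rule Lp_mem_mono[OF fin]) auto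
    then show ?thesis unfolding Lp_mem_def integral_restrict_lborel_self(2)[OF m, symmetric] by (simp add: abs_of_nonneg[OF Lp_seminorm_nonneg])
  qed
  show "set_integrable lborel {0<..<T} (\<lambda>t. Lp_seminorm 6 S (w1 t))" "set_integrable lborel {0<..<T} (\<lambda>t. Lp_seminorm 6 S (w2 t))"
    "set_integrable lborel {0<..<T} (\<lambda>t. Lp_seminorm 3 S (H2 t))"
    using classes unfolding velocity_class_def by (auto intro: *)
qed

lemma \<alpha>_integrable: "set_integrable lborel {0<..<T} \<alpha>"
  unfolding \<alpha>_def by (intro set_integrable_mult_right set_integral_add(1) norms_integrable)

lemma R_integrable: "set_integrable lborel {0<..<T} (R K)"
proof -
  have c: "set_integrable lborel {0<..<T} (\<lambda>t. c :: real)" for c unfolding set_integrable_def by (cases "0 \<le> T") auto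
  show ?thesis unfolding R_def
    by (intro set_integrable_mult_right set_integrable_mult_left set_integral_add(1) norms_integrable cubes c)
qed

end

text \<open>One null set \<open>N\<close> outside of which all times are good and \<open>u\<close> is absolutely continuous.\<close>

locale two_solutions_good = two_solutions +
  fixes K :: real and N :: "real set"
  assumes K: "0 \<le> K" and N: "N \<in> null_sets lborel"
    and good: "\<And>t. 0 < t \<Longrightarrow> t < T \<Longrightarrow> t \<notin> N \<Longrightarrow> good K t"
    and ftc: "\<And>s t. 0 < s \<Longrightarrow> s < t \<Longrightarrow> t < T \<Longrightarrow> s \<notin> N \<Longrightarrow> t \<notin> N \<Longrightarrow>
      AE x in S. u t x - u s x = (LINT \<tau>:{s..t}|lborel. z \<tau> x)"
begin

lemma z_norm_integrable:
  assumes ab: "0 < a" "a < b" "b < T"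
  shows "set_integrable lborel {a..b} (\<lambda>\<tau>. Lp_seminorm 2 S (z \<tau>))"
proof -
  let ?T = "restrict_space lborel {a..b}"
  have m: "{a..b} \<in> sets lborel" by simp
  let ?w = "\<lambda>t. Lp_seminorm 2 S (\<lambda>x. wt1 t x - wt2 t x)" and ?G = "\<lambda>t. Lp_seminorm 2 S (\<lambda>x. Gt1 t x - Gt2 t x)"
  have zm: "(\<lambda>(t, x). z t x) \<in> borel_measurable (?T \<Otimes>\<^sub>M S)"
    using weak_time_deriv_u[OF ab] unfolding weak_time_deriv_def by (blast dest: borel_measurable_integrable)
  have "in_Lr_Lq 1 2 {a..b} \<Omega> (\<lambda>t x. wt1 t x - wt2 t x)" "in_Lr_Lq 1 2 {a..b} \<Omega> (\<lambda>t x. Gt1 t x - Gt2 t x)"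
    using derivs ab unfolding has_time_deriv_def by (auto intro!: in_Lr_Lq_diff[OF m \<Omega>_sets])
  note i = this[THEN L1_L2_integrable[OF m \<Omega>_sets]]
  have "integrable ?T (\<lambda>\<tau>. Lp_seminorm 2 S (z \<tau>))"
  proof (rule Bochner_Integration.integrable_bound)
    show "integrable ?T (\<lambda>t. ?w t + sqrt \<kappa> * ?G t)"
      using i by (intro Bochner_Integration.integrable_add integrable_mult_right)
    show "(\<lambda>\<tau>. Lp_seminorm 2 S (z \<tau>)) \<in> borel_measurable ?T" by (rule Lp_seminorm_measurable[OF m \<Omega>_sets zm])
    have "AE t\<in>{a..b} in lborel. norm (Lp_seminorm 2 S (z t)) \<le> norm (?w t + sqrt \<kappa> * ?G t)"
      using null_set_AE[OF N]
    proof eventually_elim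
      case (elim t)
      show ?case
      proof
        assume "t \<in> {a..b}"
        then have "good K t" using elim ab by (intro good) auto
        from good_energy(6)[OF this] show "norm (Lp_seminorm 2 S (z t)) \<le> norm (?w t + sqrt \<kappa> * ?G t)"
          using Lp_seminorm_nonneg[of 2 S "z t"] by simp
      qed
    qed
    then show "AE t in ?T. norm (Lp_seminorm 2 S (z t)) \<le> norm (?w t + sqrt \<kappa> * ?G t)" unfolding AE_restrict_iff[OF m] .
  qed
  then show ?thesis unfolding integral_restrict_lborel_self(2)[OF m] .
qed

lemma energy_growth:
  assumes st: "0 < s" "s < t" "t < T" "s \<notin> N" "t \<notin> N"
  shows "E t \<le> E s + (LINT \<tau>:{s..t}|lborel. (2 * \<alpha> \<tau>) * E \<tau>)"
proof -
  \<comment> \<open>a compact interval that contains \<open>{s..t}\<close> in its interior\<close>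
  define a b where "a = s / 2" and "b = (t + T) / 2"
  have ab: "0 < a" "a < s" "a < b" "t < b" "b < T" unfolding a_def b_def using st by auto
  let ?T = "restrict_space lborel {a..b}"
  have m: "{a..b} \<in> sets lborel" by simp
  have gd: "good K r" if "a < r" "r < b" "r \<notin> N" for r using that ab by (intro good) auto
  note w = weak_time_deriv_u[OF ab(1,3,5), unfolded weak_time_deriv_def]
  have um: "(\<lambda>(t, x). u t x) \<in> borel_measurable (?T \<Otimes>\<^sub>M S)" using w by (blast dest: borel_measurable_integrable)
  have zi: "integrable (?T \<Otimes>\<^sub>M S) (\<lambda>(t, x). z t x)" using w by blast
  note e = energy_inequality[OF finite_S N, of a b u "sqrt ((1 + \<kappa>) * (4 * K)\<^sup>2)" z s t, OF good_energy(1)[OF gd] good_energy(5)[OF gd] um zi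
      good_energy(2)[OF gd] z_norm_integrable[OF ab(1,3,5)] ftc ab(2) st(2) ab(4) st(4,5)]
  have e1: "set_integrable lborel {a..b} (\<lambda>\<tau>. \<integral>x. z \<tau> x \<bullet> u \<tau> x \<partial>S)"
    and e2: "E t \<le> E s + 2 * (LINT \<tau>:{s..t}|lborel. \<integral>x. z \<tau> x \<bullet> u \<tau> x \<partial>S)"
    using e ab unfolding E_def by auto
  have i1: "set_integrable lborel {s..t} (\<lambda>\<tau>. \<integral>x. z \<tau> x \<bullet> u \<tau> x \<partial>S)"
    by (rule set_integrable_subset[OF e1]) (use ab in auto)
  have i2: "set_integrable lborel {s..t} (\<lambda>\<tau>. \<alpha> \<tau> * E \<tau>)"
  proof -
    have "integrable ?T (\<lambda>\<tau>. \<alpha> \<tau> * E \<tau>)"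
    proof (rule Bochner_Integration.integrable_bound)
      have "set_integrable lborel {a..b} \<alpha>" by (rule set_integrable_subset[OF \<alpha>_integrable]) (use ab in auto)
      then have i\<alpha>: "integrable ?T \<alpha>" unfolding integral_restrict_lborel_self(2)[OF m] .
      then show "integrable ?T (\<lambda>\<tau>. \<alpha> \<tau> * ((1 + \<kappa>) * (4 * K)\<^sup>2))" by (rule integrable_mult_left)
      have "(\<lambda>\<tau>. E \<tau>) \<in> borel_measurable ?T"
        unfolding E_def using Lp_seminorm_measurable[OF m \<Omega>_sets um] by measurable
      then show "(\<lambda>\<tau>. \<alpha> \<tau> * E \<tau>) \<in> borel_measurable ?T"
        using i\<alpha> by (intro borel_measurable_times) auto
      have "AE \<tau>\<in>{a..b} in lborel. norm (\<alpha> \<tau> * E \<tau>) \<le> norm (\<alpha> \<tau> * ((1 + \<kappa>) * (4 * K)\<^sup>2))"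
        using null_set_AE[OF N]
      proof eventually_elim
        case (elim \<tau>)
        show ?case
        proof
          assume "\<tau> \<in> {a..b}"
          then have "good K \<tau>" using elim ab by (intro good) auto
          note ge = good_energy(4)[OF this]
          have "0 \<le> E \<tau>" unfolding E_def by simp
          with ge show "norm (\<alpha> \<tau> * E \<tau>) \<le> norm (\<alpha> \<tau> * ((1 + \<kappa>) * (4 * K)\<^sup>2))"
            unfolding norm_mult[of "\<alpha> \<tau>"] by (intro mult_left_mono) auto
        qed
      qed
      then show "AE \<tau> in ?T. norm (\<alpha> \<tau> * E \<tau>) \<le> norm (\<alpha> \<tau> * ((1 + \<kappa>) * (4 * K)\<^sup>2))" unfolding AE_restrict_iff[OF m] .
    qed
    then have "set_integrable lborel {a..b} (\<lambda>\<tau>. \<alpha> \<tau> * E \<tau>)" unfolding integral_restrict_lborel_self(2)[OF m] .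
    then show ?thesis by (rule set_integrable_subset) (use ab in auto)
  qed
  have "(LINT \<tau>:{s..t}|lborel. \<integral>x. z \<tau> x \<bullet> u \<tau> x \<partial>S) \<le> (LINT \<tau>:{s..t}|lborel. \<alpha> \<tau> * E \<tau>)"
  proof (rule set_integral_mono_AE[OF i1 i2])
    show "AE \<tau>\<in>{s..t} in lborel. (\<integral>x. z \<tau> x \<bullet> u \<tau> x \<partial>S) \<le> \<alpha> \<tau> * E \<tau>"
      using null_set_AE[OF N] by eventually_elim (use st in \<open>auto intro!: energy_rate good\<close>)
  qed
  then have "E t \<le> E s + 2 * (LINT \<tau>:{s..t}|lborel. \<alpha> \<tau> * E \<tau>)" using e2 by linarith
  then show ?thesis by (simp add: mult.assoc)
qed

text \<open>The common initial value controls the velocities only; it says nothing about their gradients.\<close>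

lemma initial_difference_small:
  assumes \<epsilon>: "0 < \<epsilon>"
  shows "\<exists>\<eta>>0. \<exists>N'\<in>null_sets lborel. \<forall>s. 0 < s \<and> s < \<eta> \<and> s < T \<and> s \<notin> N \<and> s \<notin> N' \<longrightarrow> Lp_seminorm 2 S (\<phi> s) \<le> 4 * \<epsilon>"
proof -
  obtain \<eta>1 where \<eta>1: "\<eta>1 > 0" "AE t\<in>{0<..<\<eta>1} in lborel. Lp_norm 2 \<Omega> (\<lambda>x. w1 t x - w0 x) < \<epsilon>" using initial(1)[OF \<epsilon>] by blast
  obtain \<eta>2 where \<eta>2: "\<eta>2 > 0" "AE t\<in>{0<..<\<eta>2} in lborel. Lp_norm 2 \<Omega> (\<lambda>x. w2 t x - w0 x) < \<epsilon>" using initial(2)[OF \<epsilon>] by blast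
  have "AE t in lborel. (t \<in> {0<..<\<eta>1} \<longrightarrow> Lp_seminorm 2 S (\<lambda>x. w1 t x - w0 x) < \<epsilon>) \<and> (t \<in> {0<..<\<eta>2} \<longrightarrow> Lp_seminorm 2 S (\<lambda>x. w2 t x - w0 x) < \<epsilon>)"
    using \<eta>1(2) \<eta>2(2) unfolding Lp_norm_eq[OF \<Omega>_sets] by eventually_elim blast
  then obtain N' where N': "N' \<in> null_sets lborel" "\<And>t. t \<notin> N' \<Longrightarrow> (t \<in> {0<..<\<eta>1} \<longrightarrow> Lp_seminorm 2 S (\<lambda>x. w1 t x - w0 x) < \<epsilon>) \<and> (t \<in> {0<..<\<eta>2} \<longrightarrow> Lp_seminorm 2 S (\<lambda>x. w2 t x - w0 x) < \<epsilon>)"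
    by (rule AE_E3) auto
  show ?thesis
  proof (intro exI[of _ "min \<eta>1 \<eta>2"] conjI bexI[OF _ N'(1)] allI impI)
    show "0 < min \<eta>1 \<eta>2" using \<eta>1 \<eta>2 by simp
    fix s assume s: "0 < s \<and> s < min \<eta>1 \<eta>2 \<and> s < T \<and> s \<notin> N \<and> s \<notin> N'"
    then have g: "good K s" by (intro good) auto
    have m: "Lp_mem 2 S (w1 s)" "Lp_mem 2 S (w2 s)" "Lp_mem 2 S w0"
      using g initial_mem unfolding good_def velocity_fields_def in_Lp_iff[OF \<Omega>_sets] by auto
    have "Lp_seminorm 2 S (\<lambda>x. (w1 s x - w0 x) - (w2 s x - w0 x)) \<le> 2 * (Lp_seminorm 2 S (\<lambda>x. w1 s x - w0 x) + Lp_seminorm 2 S (\<lambda>x. w2 s x - w0 x))"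
      by (intro Lp_mem_diff m) auto
    moreover have "Lp_seminorm 2 S (\<lambda>x. w1 s x - w0 x) < \<epsilon>" "Lp_seminorm 2 S (\<lambda>x. w2 s x - w0 x) < \<epsilon>" using N'(2)[of s] s by auto
    ultimately show "Lp_seminorm 2 S (\<phi> s) \<le> 4 * \<epsilon>" by simp
  qed
qed

text \<open>Near the initial time \<open>u\<close> tends to zero weakly: the velocities tend to zero in norm, and in the
  pairing of the gradients \<open>\<Gamma> t\<close> may be replaced by the gradient of a test function \<open>\<Phi> n\<close>, whose derivatives
  are moved off \<open>\<Gamma> s\<close>.  The error of the replacement is controlled by the uniform bound \<open>K\<close>.\<close>

lemma weakly_vanishing_start:
  assumes t: "0 < t" "t < T" "t \<notin> N" and \<epsilon>: "0 < \<epsilon>"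
  shows "\<exists>s. 0 < s \<and> s < t \<and> s \<notin> N \<and> \<bar>\<integral>x. u s x \<bullet> u t x \<partial>S\<bar> \<le> \<epsilon>"
proof -
  have gt: "good K t" using t by (rule good)
  note d = good_difference[OF gt]
  have W: "W0 3 \<Omega> (\<phi> t) (\<Gamma> t)" using gt unfolding good_def by simp
  \<comment> \<open>\<open>\<epsilon>1\<close> is the accuracy of the approximation of \<open>\<Gamma> t\<close>; it has to be fixed first, as \<open>\<epsilon>2\<close>, the size of \<open>\<phi> s\<close>,
    depends through \<open>C\<close> on the approximating test function\<close>
  define \<epsilon>1 where "\<epsilon>1 = \<epsilon> / (2 * (1 + 4 * K * \<kappa>))"
  have den1: "0 < 1 + 4 * K * \<kappa>" using K \<kappa>_pos by (simp add: add_pos_nonneg)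
  have \<epsilon>1: "0 < \<epsilon>1" unfolding \<epsilon>1_def using \<epsilon> den1 by simp
  obtain \<Phi> where \<Phi>0: "\<And>n. test_function \<Omega> (\<Phi> n)"
    "(\<lambda>n. Lp_seminorm 3 S (\<lambda>x. \<Phi> n x - \<phi> t x)) \<longlonglongrightarrow> 0"
    "(\<lambda>n. Lp_seminorm 2 S (\<lambda>x. \<Phi> n x - \<phi> t x)) \<longlonglongrightarrow> 0"
    "(\<lambda>n. Lp_seminorm 2 S (\<lambda>x. gradient_matrix (\<Phi> n) x - \<Gamma> t x)) \<longlonglongrightarrow> 0"
    using W0_approximation[OF domain W] by blast
  note \<Phi> = \<Phi>0(1,4)
  have "\<forall>\<^sub>F n in sequentially. Lp_seminorm 2 S (\<lambda>x. gradient_matrix (\<Phi> n) x - \<Gamma> t x) < \<epsilon>1"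
    using order_tendstoD(2)[OF \<Phi>(2) \<epsilon>1] .
  then obtain n where n: "Lp_seminorm 2 S (\<lambda>x. gradient_matrix (\<Phi> n) x - \<Gamma> t x) < \<epsilon>1"
    unfolding eventually_sequentially by blast
  obtain C where C: "C \<ge> 0" "\<And>u G. has_weak_gradient \<Omega> u G \<Longrightarrow> Lp_mem 2 S u \<Longrightarrow> Lp_mem 2 S G \<Longrightarrow>
     \<bar>\<integral>x. G x \<bullet> gradient_matrix (\<Phi> n) x \<partial>S\<bar> \<le> C * Lp_seminorm 2 S u"
    using gradient_pairing_bound[OF domain \<Phi>(1)[of n]] by blast
  define \<epsilon>2 where "\<epsilon>2 = \<epsilon> / (2 * (1 + 16 * K + 4 * \<kappa> * C))"
  have den2: "0 < 1 + 16 * K + 4 * \<kappa> * C" using K \<kappa>_pos C(1) by (simp add: add_pos_nonneg)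
  have \<epsilon>2: "0 < \<epsilon>2" unfolding \<epsilon>2_def using \<epsilon> den2 by simp
  obtain \<eta> N' where \<eta>: "\<eta> > 0" "N' \<in> null_sets lborel"
    "\<And>s. 0 < s \<Longrightarrow> s < \<eta> \<Longrightarrow> s < T \<Longrightarrow> s \<notin> N \<Longrightarrow> s \<notin> N' \<Longrightarrow> Lp_seminorm 2 S (\<phi> s) \<le> 4 * \<epsilon>2"
    using initial_difference_small[OF \<epsilon>2] by blast
  obtain s where s: "0 < s" "s < min \<eta> t" "s \<notin> N \<union> N'"
    using null_set_avoids[OF null_sets.Un[OF N \<eta>(2)], of 0 "min \<eta> t"] \<eta>(1) t by auto
  have gs: "good K s" using s t by (intro good) auto
  note e = good_difference[OF gs]
  have \<phi>s: "Lp_seminorm 2 S (\<phi> s) \<le> 4 * \<epsilon>2" using s t by (intro \<eta>(3)) auto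
  have gm: "Lp_mem 2 S (gradient_matrix (\<Phi> n))" by (rule Lp_mem_test_function(3)[OF domain \<Phi>(1)]) simp
  have dm: "Lp_mem 2 S (\<lambda>x. gradient_matrix (\<Phi> n) x - \<Gamma> t x)" by (intro Lp_mem_diff(1) gm d) simp
  have "\<bar>\<integral>x. \<phi> s x \<bullet> \<phi> t x \<partial>S\<bar> \<le> Lp_seminorm 2 S (\<phi> s) * Lp_seminorm 2 S (\<phi> t)" by (rule L2_inner_bound(2)[OF e(1) d(1)])
  also have "\<dots> \<le> (4 * \<epsilon>2) * (4 * K)" by (intro mult_mono \<phi>s d(4) Lp_seminorm_nonneg) (use \<epsilon>2 in simp)
  finally have 1: "\<bar>\<integral>x. \<phi> s x \<bullet> \<phi> t x \<partial>S\<bar> \<le> 16 * K * \<epsilon>2" by (simp add: ac_simps)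
  have "(\<integral>x. \<Gamma> s x \<bullet> \<Gamma> t x \<partial>S) = (\<integral>x. \<Gamma> s x \<bullet> gradient_matrix (\<Phi> n) x - \<Gamma> s x \<bullet> (gradient_matrix (\<Phi> n) x - \<Gamma> t x) \<partial>S)"
    by (intro Bochner_Integration.integral_cong) (auto simp: inner_diff_right)
  also have "\<dots> = (\<integral>x. \<Gamma> s x \<bullet> gradient_matrix (\<Phi> n) x \<partial>S) - (\<integral>x. \<Gamma> s x \<bullet> (gradient_matrix (\<Phi> n) x - \<Gamma> t x) \<partial>S)"
    by (rule Bochner_Integration.integral_diff[OF L2_inner_bound(1)[OF e(2) gm] L2_inner_bound(1)[OF e(2) dm]])
  finally have split: "(\<integral>x. \<Gamma> s x \<bullet> \<Gamma> t x \<partial>S) = (\<integral>x. \<Gamma> s x \<bullet> gradient_matrix (\<Phi> n) x \<partial>S) - (\<integral>x. \<Gamma> s x \<bullet> (gradient_matrix (\<Phi> n) x - \<Gamma> t x) \<partial>S)" .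
  have "\<bar>\<integral>x. \<Gamma> s x \<bullet> gradient_matrix (\<Phi> n) x \<partial>S\<bar> \<le> C * Lp_seminorm 2 S (\<phi> s)"
    using gs unfolding good_def W0_def by (intro C(2) e) simp
  also have "\<dots> \<le> C * (4 * \<epsilon>2)" by (intro mult_left_mono \<phi>s C(1))
  finally have 2: "\<bar>\<integral>x. \<Gamma> s x \<bullet> gradient_matrix (\<Phi> n) x \<partial>S\<bar> \<le> C * (4 * \<epsilon>2)" .
  have "\<bar>\<integral>x. \<Gamma> s x \<bullet> (gradient_matrix (\<Phi> n) x - \<Gamma> t x) \<partial>S\<bar> \<le> Lp_seminorm 2 S (\<Gamma> s) * Lp_seminorm 2 S (\<lambda>x. gradient_matrix (\<Phi> n) x - \<Gamma> t x)"
    by (rule L2_inner_bound(2)[OF e(2) dm])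
  also have "\<dots> \<le> (4 * K) * \<epsilon>1" by (intro mult_mono e(5) less_imp_le[OF n] Lp_seminorm_nonneg) (use K in simp)
  finally have 3: "\<bar>\<integral>x. \<Gamma> s x \<bullet> (gradient_matrix (\<Phi> n) x - \<Gamma> t x) \<partial>S\<bar> \<le> 4 * K * \<epsilon>1" .
  have "\<bar>\<integral>x. \<Gamma> s x \<bullet> \<Gamma> t x \<partial>S\<bar> \<le> C * (4 * \<epsilon>2) + 4 * K * \<epsilon>1" using split 2 3 by linarith
  then have "\<kappa> * \<bar>\<integral>x. \<Gamma> s x \<bullet> \<Gamma> t x \<partial>S\<bar> \<le> \<kappa> * (C * (4 * \<epsilon>2) + 4 * K * \<epsilon>1)" using \<kappa>_pos by (intro mult_left_mono) auto
  then have 4: "\<bar>\<kappa> * (\<integral>x. \<Gamma> s x \<bullet> \<Gamma> t x \<partial>S)\<bar> \<le> 4 * \<kappa> * C * \<epsilon>2 + 4 * K * \<kappa> * \<epsilon>1" using \<kappa>_pos by (simp add: abs_mult algebra_simps)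
  have half: "d * (\<epsilon> / (2 * d)) = \<epsilon> / 2" if "0 < d" for d :: real using that by simp
  have "(1 + 16 * K + 4 * \<kappa> * C) * \<epsilon>2 = \<epsilon> / 2" unfolding \<epsilon>2_def by (rule half[OF den2])
  then have 5: "16 * K * \<epsilon>2 + 4 * \<kappa> * C * \<epsilon>2 \<le> \<epsilon> / 2" using \<epsilon>2 by (simp add: distrib_right)
  have "(1 + 4 * K * \<kappa>) * \<epsilon>1 = \<epsilon> / 2" unfolding \<epsilon>1_def by (rule half[OF den1])
  then have 6: "4 * K * \<kappa> * \<epsilon>1 \<le> \<epsilon> / 2" using \<epsilon>1 by (simp add: distrib_right)
  have "\<bar>\<integral>x. u s x \<bullet> u t x \<partial>S\<bar> \<le> \<epsilon>" unfolding inner_u_z(2)[OF gt gs] using 1 4 5 6 by linarith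
  then show ?thesis using s by (intro exI[of _ s]) auto
qed

text \<open>The energy at \<open>t\<close> is the pairing of \<open>u t\<close> with itself.  Going back in time with the second factor frozen,
  \<open>u s\<close> contributes nothing in the limit \<open>s \<longlonglongrightarrow> 0\<close>, and the change of the pairing is controlled by the
  equations tested with the frozen difference.\<close>

lemma energy_endpoint:
  assumes t: "0 < t" "t < T" "t \<notin> N"
  shows "E t \<le> (LINT \<tau>:{0<..<t}|lborel. R K \<tau>) + t * (2 * (Cs * \<delta>)\<^sup>2 * Lp_seminorm 3 S (\<Gamma> t) ^ 3)"
proof -
  let ?m = "2 * (Cs * \<delta>)\<^sup>2 * Lp_seminorm 3 S (\<Gamma> t) ^ 3"
  have m0: "0 \<le> ?m" by (simp add: Lp_seminorm_nonneg)
  have R0: "0 \<le> R K \<tau>" for \<tau>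
    unfolding R_def using K constants by (intro add_nonneg_nonneg mult_nonneg_nonneg zero_le_power Lp_seminorm_nonneg) auto
  have gt: "good K t" using t by (rule good)
  have W: "W0 3 \<Omega> (\<phi> t) (\<Gamma> t)" using gt unfolding good_def by simp
  have vc: "velocity_class T \<Omega> (\<lambda>_. \<phi> t) (\<lambda>_. \<Gamma> t)"
    by (rule velocity_class_const[OF domain W good_difference(3)[OF gt]])
  have "E t \<le> ((LINT \<tau>:{0<..<t}|lborel. R K \<tau>) + t * ?m) + \<epsilon>" if \<epsilon>: "0 < \<epsilon>" for \<epsilon>
  proof -
    obtain s where s: "0 < s" "s < t" "s \<notin> N" "\<bar>\<integral>x. u s x \<bullet> u t x \<partial>S\<bar> \<le> \<epsilon>"
      using weakly_vanishing_start[OF t \<epsilon>] by blast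
    define a b where "a = s / 2" and "b = (t + T) / 2"
    have ab: "0 < a" "a < s" "a < b" "t < b" "b < T" unfolding a_def b_def using s t by auto
    have gs: "good K s" using s t by (intro good) auto
    have gd: "good K r" if "a < r" "r < b" "r \<notin> N" for r using that ab by (intro good) auto
    have zi: "integrable (restrict_space lborel {a..b} \<Otimes>\<^sub>M S) (\<lambda>(t, x). z t x)"
      using weak_time_deriv_u[OF ab(1,3,5)] unfolding weak_time_deriv_def by blast
    note pr = energy_pairing[OF finite_S N zi good_energy(2)[OF gd] z_norm_integrable[OF ab(1,3,5)] ab(2) s(2) ab(4)
        ftc[OF s(1,2) t(2) s(3) t(3)] good_energy(1)[OF gs] good_energy(1)[OF gt] good_energy(1)[OF gt]]
    have p1: "set_integrable lborel {s..t} (\<lambda>\<tau>. \<integral>x. z \<tau> x \<bullet> u t x \<partial>S)"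
      and p2: "(\<integral>x. (u t x - u s x) \<bullet> u t x \<partial>S) = (LINT \<tau>:{s..t}|lborel. \<integral>x. z \<tau> x \<bullet> u t x \<partial>S)"
      using pr by auto
    have mi: "set_integrable lborel {s..t} (\<lambda>\<tau>. ?m)" by (rule borel_integrable_atLeastAtMost') simp
    have Ri: "set_integrable lborel {s..t} (R K)" by (rule set_integrable_subset[OF R_integrable]) (use s t in auto)
    have "(LINT \<tau>:{s..t}|lborel. \<integral>x. z \<tau> x \<bullet> u t x \<partial>S) \<le> (LINT \<tau>:{s..t}|lborel. R K \<tau> + ?m)"
    proof (rule set_integral_mono_AE[OF p1 set_integral_add(1)[OF Ri mi]])
      show "AE \<tau>\<in>{s..t} in lborel. (\<integral>x. z \<tau> x \<bullet> u t x \<partial>S) \<le> R K \<tau> + ?m"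
        using momentum(1)[OF vc] momentum(2)[OF vc] null_set_AE[OF N]
      proof eventually_elim
        case (elim \<tau>)
        show ?case
        proof
          assume "\<tau> \<in> {s..t}"
          then have \<tau>: "\<tau> \<in> {0<..<T}" using s t by auto
          then have "good K \<tau>" using elim by (intro good) auto
          then show "(\<integral>x. z \<tau> x \<bullet> u t x \<partial>S) \<le> R K \<tau> + ?m"
            using elim \<tau> by (intro test_rate gt K) auto
        qed
      qed
    qed
    also have "\<dots> = (LINT \<tau>:{s..t}|lborel. R K \<tau>) + (LINT \<tau>:{s..t}|lborel. ?m)" by (rule set_integral_add(2)[OF Ri mi])
    also have "(LINT \<tau>:{s..t}|lborel. ?m) = (t - s) * ?m" unfolding set_lebesgue_integral_def using s by simp
    also have "(t - s) * ?m \<le> t * ?m" using s m0 by (intro mult_right_mono) auto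
    also have "(LINT \<tau>:{s..t}|lborel. R K \<tau>) \<le> (LINT \<tau>:{0<..<t}|lborel. R K \<tau>)"
      unfolding set_lebesgue_integral_def
    proof (rule integral_mono_AE)
      show "integrable lborel (\<lambda>\<tau>. indicator {s..t} \<tau> *\<^sub>R R K \<tau>)" using Ri unfolding set_integrable_def .
      have "set_integrable lborel {0<..<t} (R K)" by (rule set_integrable_subset[OF R_integrable]) (use t in auto)
      then show "integrable lborel (\<lambda>\<tau>. indicator {0<..<t} \<tau> *\<^sub>R R K \<tau>)" unfolding set_integrable_def .
      show "AE \<tau> in lborel. indicator {s..t} \<tau> *\<^sub>R R K \<tau> \<le> indicator {0<..<t} \<tau> *\<^sub>R R K \<tau>"
        using AE_lborel_singleton[of t]
        by eventually_elim (use s R0 in \<open>auto simp: indicator_def\<close>)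
    qed
    finally have bd: "(LINT \<tau>:{s..t}|lborel. \<integral>x. z \<tau> x \<bullet> u t x \<partial>S) \<le> (LINT \<tau>:{0<..<t}|lborel. R K \<tau>) + t * ?m" by simp
    have "E t = (\<integral>x. u t x \<bullet> u t x \<partial>S)" unfolding E_def Lp_seminorm_2 power2_norm_eq_inner ..
    also have "\<dots> = (\<integral>x. (u t x - u s x) \<bullet> u t x + u s x \<bullet> u t x \<partial>S)"
      by (intro Bochner_Integration.integral_cong) (auto simp: inner_diff_left)
    also have "\<dots> = (\<integral>x. (u t x - u s x) \<bullet> u t x \<partial>S) + (\<integral>x. u s x \<bullet> u t x \<partial>S)"
    proof (rule Bochner_Integration.integral_add)
      show "integrable S (\<lambda>x. (u t x - u s x) \<bullet> u t x)"
        by (intro L2_inner_bound(1) Lp_mem_diff(1) good_energy(1)[OF gt] good_energy(1)[OF gs]) simp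
      show "integrable S (\<lambda>x. u s x \<bullet> u t x)" by (rule L2_inner_bound(1)[OF good_energy(1)[OF gs] good_energy(1)[OF gt]])
    qed
    also have "\<dots> \<le> ((LINT \<tau>:{0<..<t}|lborel. R K \<tau>) + t * ?m) + \<epsilon>" using p2 bd s(4) by linarith
    finally show ?thesis .
  qed
  then show ?thesis by (rule field_le_epsilon)
qed

text \<open>The energy may be large at some small times, since the cube of the gradient at \<open>t\<close> enters the previous
  bound.  But this cube is integrable in time, so \<open>t\<close> times it is small at suitable times.\<close>

lemma energy_small_somewhere:
  assumes \<epsilon>: "0 < \<epsilon>" and h: "0 < h"
  shows "\<exists>t. 0 < t \<and> t < h \<and> t < T \<and> t \<notin> N \<and> E t < \<epsilon>"
proof -
  \<comment> \<open>\<open>64 = 4 ^ 3\<close>, with \<open>4\<close> from the quasi-triangle inequality and from \<open>a + b \<le> 2 * max a b\<close>\<close>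
  let ?c = "2 * (Cs * \<delta>)\<^sup>2" and ?M = "\<lambda>t. 64 * (Lp_seminorm 3 S (H1 t) ^ 3 + Lp_seminorm 3 S (H2 t) ^ 3)"
  define g where "g t = R K t + ?c * ?M t" for t
  have R0: "0 \<le> R K \<tau>" for \<tau>
    unfolding R_def using K constants by (intro add_nonneg_nonneg mult_nonneg_nonneg zero_le_power Lp_seminorm_nonneg) auto
  have M0: "0 \<le> ?c * ?M t" for t by (intro mult_nonneg_nonneg add_nonneg_nonneg zero_le_power Lp_seminorm_nonneg) (use constants in auto)
  have Mi: "set_integrable lborel {0<..<T} (\<lambda>t. ?c * ?M t)" by (intro set_integrable_mult_right set_integral_add(1) cubes)
  have gi: "set_integrable lborel {0<..<T} g" unfolding g_def by (intro set_integral_add(1) R_integrable Mi)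
  have g0: "0 \<le> g t" for t unfolding g_def using R0 M0 by (rule add_nonneg_nonneg)
  obtain t where t: "0 < t" "t < h" "t < T" "t \<notin> N" "(LINT \<tau>:{0<..<t}|lborel. g \<tau>) + t * g t < \<epsilon>"
    using vanishing_times[OF constants(5) gi g0 N \<epsilon> h] by blast
  have gt: "good K t" using t by (intro good)
  have "Lp_seminorm 3 S (\<Gamma> t) ^ 3 \<le> ?M t"
  proof -
    let ?a = "Lp_seminorm 3 S (H1 t)" and ?b = "Lp_seminorm 3 S (H2 t)"
    define c where "c = max ?a ?b"
    have "Lp_seminorm 3 S (\<Gamma> t) \<le> 2 * (?a + ?b)"
      using gt unfolding good_def velocity_fields_def by (intro Lp_mem_diff(2)) auto
    also have "\<dots> \<le> 4 * c" unfolding c_def by simp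
    finally have "Lp_seminorm 3 S (\<Gamma> t) ^ 3 \<le> (4 * c) ^ 3" by (intro power_mono Lp_seminorm_nonneg)
    also have "\<dots> = 64 * c ^ 3" by (simp add: power_mult_distrib)
    also have "c ^ 3 \<le> ?a ^ 3 + ?b ^ 3"
      unfolding c_def by (cases "?a \<le> ?b") (simp_all add: max_def Lp_seminorm_nonneg)
    finally show ?thesis by simp
  qed
  then have "?c * Lp_seminorm 3 S (\<Gamma> t) ^ 3 \<le> ?c * ?M t" by (rule mult_left_mono) simp
  then have "?c * Lp_seminorm 3 S (\<Gamma> t) ^ 3 \<le> g t" unfolding g_def using R0[of t] by linarith
  then have 1: "t * (?c * Lp_seminorm 3 S (\<Gamma> t) ^ 3) \<le> t * g t" using t(1) by (intro mult_left_mono) auto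
  have 2: "(LINT \<tau>:{0<..<t}|lborel. R K \<tau>) \<le> (LINT \<tau>:{0<..<t}|lborel. g \<tau>)"
  proof (rule set_integral_mono)
    show "set_integrable lborel {0<..<t} (R K)" by (rule set_integrable_subset[OF R_integrable]) (use t in auto)
    show "set_integrable lborel {0<..<t} g" by (rule set_integrable_subset[OF gi]) (use t in auto)
    show "R K \<tau> \<le> g \<tau>" for \<tau> unfolding g_def using M0[of \<tau>] by linarith
  qed
  have "E t < \<epsilon>" using energy_endpoint[OF t(1,3,4)] 1 2 t(5) by linarith
  then show ?thesis using t by blast
qed

lemma energy_zero:
  assumes t: "0 < t" "t < T" "t \<notin> N"
  shows "E t = 0"
proof (rule integral_Gronwall_zero[OF constants(5) N, of "\<lambda>t. 2 * \<alpha> t" E "(1 + \<kappa>) * (4 * K)\<^sup>2"])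
  show "set_integrable lborel {0<..<T} (\<lambda>t. 2 * \<alpha> t)" by (intro set_integrable_mult_right \<alpha>_integrable)
  show "0 \<le> 2 * \<alpha> t" for t using \<alpha>_nonneg[of t] by simp
  show "0 \<le> E t" for t unfolding E_def by simp
qed (use t good_energy(4)[OF good] energy_growth energy_small_somewhere in auto)

lemma solutions_agree:
  assumes t: "0 < t" "t < T" "t \<notin> N"
  shows "AE x\<in>\<Omega> in lborel. w1 t x = w2 t x"
proof -
  have g: "good K t" using t by (rule good)
  have "0 \<le> \<kappa> * (Lp_seminorm 2 S (\<Gamma> t))\<^sup>2" using \<kappa>_pos by simp
  then have "(Lp_seminorm 2 S (\<phi> t))\<^sup>2 \<le> 0" using energy_zero[OF t] unfolding good_energy(3)[OF g] by linarith
  then have "Lp_seminorm 2 S (\<phi> t) = 0" by simp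
  then have "AE x in S. \<phi> t x = 0" by (intro Lp_seminorm_eq_0[OF _ good_difference(1)[OF g]]) auto
  then show ?thesis unfolding AE_restrict_iff[OF \<Omega>_sets] by simp
qed

end

lemma (in two_solutions) uniqueness:
  "AE t\<in>{0<..<T} in lborel. AE x\<in>\<Omega> in lborel. w1 t x = w2 t x"
proof -
  obtain K where K: "K \<ge> 0" "AE t\<in>{0<..<T} in lborel. good K t" using good_AE by blast
  obtain N1 where N1: "N1 \<in> null_sets lborel" "\<And>t. t \<notin> N1 \<Longrightarrow> t \<in> {0<..<T} \<longrightarrow> good K t"
    using K(2) by (rule AE_E3) auto
  obtain N2 where N2: "N2 \<in> null_sets lborel" "\<And>s t. 0 < s \<and> s < t \<and> t < T \<and> s \<notin> N2 \<and> t \<notin> N2 \<Longrightarrow>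
     (AE x in S. u t x - u s x = (LINT \<tau>:{s..t}|lborel. z \<tau> x))" using ftc_exists by blast
  interpret two_solutions_good \<Omega> \<nu> Cs \<delta> \<mu> T f w0 w1 w2 wt1 wt2 H1 H2 Gt1 Gt2 p1 p2 K "N1 \<union> N2"
    by unfold_locales (use K(1) N1 N2 in auto)
  show ?thesis using null_set_AE[OF N] by eventually_elim (auto intro: solutions_agree)
qed

theorem theorem4p4:
  fixes \<Omega> :: "(real ^ 'd) set"
    and \<nu> Cs \<delta> \<mu> T :: real
    and f w0 :: "real ^ 'd \<Rightarrow> real ^ 'd"
    and w1 w2 :: "real \<Rightarrow> real ^ 'd \<Rightarrow> real ^ 'd"
    and G1 G2 :: "real \<Rightarrow> real ^ 'd \<Rightarrow> real ^ 'd ^ 'd"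
  assumes "CARD('d) = 2 \<or> CARD('d) = 3"
    and "flow_domain \<Omega>"
    and "\<nu> > 0" and "Cs > 0" and "\<delta> > 0" and "\<mu> > 0" and "T > 0"
    and "body_force \<Omega> f"
    and "strong_solution \<nu> Cs \<delta> \<mu> \<Omega> T f w0 w1"
    and "strong_solution \<nu> Cs \<delta> \<mu> \<Omega> T f w0 w2"
    and "has_spatial_gradient {0<..<T} \<Omega> w1 G1" and "in_Lr_Lq 3 3 {0<..<T} \<Omega> G1"
    and "has_spatial_gradient {0<..<T} \<Omega> w2 G2" and "in_Lr_Lq 3 3 {0<..<T} \<Omega> G2"
  shows "AE t\<in>{0<..<T} in lborel. AE x\<in>\<Omega> in lborel. w1 t x = w2 t x"
proof -
  have \<Omega>: "open \<Omega>" "bounded \<Omega>" using assms(2) unfolding flow_domain_def by auto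
  have w0: "in_Lp 2 \<Omega> w0" using assms(9) unfolding strong_solution_def W0_def by blast
  have ini: "\<forall>\<epsilon>>0. \<exists>\<eta>>0. AE t\<in>{0<..<\<eta>} in lborel. Lp_norm 2 \<Omega> (\<lambda>x. w1 t x - w0 x) < \<epsilon>"
    "\<forall>\<epsilon>>0. \<exists>\<eta>>0. AE t\<in>{0<..<\<eta>} in lborel. Lp_norm 2 \<Omega> (\<lambda>x. w2 t x - w0 x) < \<epsilon>"
    using assms(9,10) unfolding strong_solution_def by blast+
  obtain H1 wt1 Gt1 and p1 :: "real \<Rightarrow> real ^ 'd \<Rightarrow> real" where s1: "velocity_class T \<Omega> w1 H1" "has_time_deriv T \<Omega> w1 wt1 Gt1"
    "AE t\<in>{0<..<T} in lborel. p1 t \<in> pressure_space \<Omega>" "AE t\<in>{0<..<T} in lborel. weak_incompressible \<Omega> (H1 t)"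
    "\<And>v H. velocity_class T \<Omega> v H \<Longrightarrow> AE t\<in>{0<..<T} in lborel.
        weak_momentum \<nu> Cs \<delta> \<mu> \<Omega> f (w1 t) (H1 t) (wt1 t) (Gt1 t) (p1 t) (v t) (H t)"
    using assms(9) unfolding strong_solution_def by blast
  obtain H2 wt2 Gt2 and p2 :: "real \<Rightarrow> real ^ 'd \<Rightarrow> real" where s2: "velocity_class T \<Omega> w2 H2" "has_time_deriv T \<Omega> w2 wt2 Gt2"
    "AE t\<in>{0<..<T} in lborel. p2 t \<in> pressure_space \<Omega>" "AE t\<in>{0<..<T} in lborel. weak_incompressible \<Omega> (H2 t)"
    "\<And>v H. velocity_class T \<Omega> v H \<Longrightarrow> AE t\<in>{0<..<T} in lborel.
        weak_momentum \<nu> Cs \<delta> \<mu> \<Omega> f (w2 t) (H2 t) (wt2 t) (Gt2 t) (p2 t) (v t) (H t)"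
    using assms(10) unfolding strong_solution_def by blast
  interpret two_solutions \<Omega> \<nu> Cs \<delta> \<mu> T f w0 w1 w2 wt1 wt2 H1 H2 Gt1 Gt2 p1 p2
  proof
    show "set_integrable lborel {0<..<T} (\<lambda>t. Lp_seminorm 3 (restrict_space lborel \<Omega>) (H1 t) ^ 3)"
      by (rule gradient_cube_integrable[OF \<Omega>(1) s1(1) assms(11,12)])
    show "set_integrable lborel {0<..<T} (\<lambda>t. Lp_seminorm 3 (restrict_space lborel \<Omega>) (H2 t) ^ 3)"
      by (rule gradient_cube_integrable[OF \<Omega>(1) s2(1) assms(13,14)])
  qed (use assms(1,3-7) \<Omega> w0 ini s1 s2 in blast)+
  show ?thesis by (rule uniqueness)
qed

end
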